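(* With the notation of the context, assume $k\neq \sqrt{1-M^2}\,\frac{n\pi}{d}$ for all $n\in\mathbb{N}$. There exists a (large) constant $\tilde L>0$ such that for all $L\ge\tilde L$ the operator $\mathcal{A}^L: V\to V'$, $V=H^1(\Omega_b)$, is an isomorphism. Moreover, there are positive constants $C_1,C_2$, depending on $k$ and $M$, such that for all $L\ge\tilde L$ $$\|p^{h}_b-p^{L}_b\|_{H^1(\Omega_b)}\leq C_1 \Big(e^{-C_2 \int^{L}_{0}\tilde{\sigma}(x^{+}+s)\,ds}+e^{-C_2 \int^{L}_{0}\tilde{\sigma}(x^{-}-s)\,ds}\Big)\|p^{h}_b\|_{H^{1}(\Omega_b)},$$ where $\tilde\sigma(x_1)=\min\{1,\sigma(x_1)/\omega\}$.
   Context: Let $d>0$, $\Omega=\mathbb{R}\times(0,d)$, $0\le M<1$, $k>0$, $\omega>0$, $x^-<x^+$, $\Omega_b=\{x\in\Omega: x^-<x_1<x^+\}$, $\Sigma_\pm=\{x\in\Omega: x_1=x^\pm\}$. The geometry and $\sigma,\omega$ are fixed. Let $f\in L^2(\Omega)$ with compact support $\Omega_f\subset\Omega_b$, and let $\dot W^h=\sum_{i=1}^N|K_i|^{-1/2}\xi_i1_{K_i}\in L^2(\Omega)$ be the discretized white noise, where $\{K_i\}$ is a triangulation of $\Omega_f$ and $\xi_i=|K_i|^{-1/2}\int_{K_i}dW$ are i.i.d. standard normal; the statement holds for each realization of $\dot W^h$, with $\tilde L,C_1,C_2$ not depending on the realization. Let $\sigma\in C^1(\mathbb{R})$ be real-valued,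 $\sigma=0$ on $[x^-,x^+]$, $\sigma>0$ outside, and $\alpha(x_1)=\frac{-i\omega}{-i\omega+\sigma(x_1)}$. Let $\phi_0=\frac1{\sqrt d}$, $\phi_n(x_2)=\sqrt{\tfrac2d}\cos\frac{n\pi x_2}{d}$ ($n\ge1$), $K_0=\frac{kd}{\pi\sqrt{1-M^2}}$, $N_0=\lfloor K_0\rfloor$, and $$\beta^\pm_n=\frac{-kM\pm\sqrt{k^2-\frac{n^2\pi^2}{d^2}(1-M^2)}}{1-M^2}\ (n\le N_0),\qquad \beta^\pm_n=\frac{-kM\pm i\sqrt{\frac{n^2\pi^2}{d^2}(1-M^2)-k^2}}{1-M^2}\ (n> N_0).$$ For $L>0$ set $$\nu^{\pm}_n=\beta^\pm_n\mp\frac{\beta^+_n-\beta^-_n}{1-e^{-i(\beta^+_n-\beta^-_n)\int_0^L\frac{ds}{\alpha(x^\pm\pm s)}}}.$$ The Dirichlet-to-Neumann operators $T_\pm,T^L_\pm:H^{1/2}(\Sigma_\pm)\to H^{-1/2}(\Sigma_\pm)$ are $$T_\pm\psi=\mp\sum_{n\ge0}i\beta^\pm_n(\psi,\phi_n)_{L^2(\Sigma_\pm)}\phi_n,\qquad T^L_\pm\psi=\mp\sum_{n\ge0}i\nu^\pm_n(\psi,\phi_n)_{L^2(\Sigma_\pm)}\phi_n .$$ With $\mathcal{M}=\mathrm{diag}(1-M^2,1)$ and $\langle\cdot,\cdot\rangle_{\Sigma_\pm}$ the $H^{-1/2}$–$H^{1/2}$ duality, define on $V=H^1(\Omega_b)$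 $$a_{\Omega_b}(p,q)=\int_{\Omega_b}(\mathcal M\nabla p)\cdot\nabla\bar q\,dx-k^2\int_{\Omega_b}p\bar q\,dx-2ikM\int_{\Omega_b}\partial_{x_1}p\,\bar q\,dx+(1-M^2)\big(\langle T_+p,q\rangle_{\Sigma_+}+\langle T_-p,q\rangle_{\Sigma_-}\big),$$ and $a^L_{\Omega_b}$ by the same formula with $T^L_\pm$ in place of $T_\pm$. Operators $\mathcal A,\mathcal A^L\in\mathcal L(V,V')$ are given by $\langle\mathcal Ap,q\rangle=a_{\Omega_b}(p,q)$, $\langle\mathcal A^Lp,q\rangle=a^L_{\Omega_b}(p,q)$. Finally $p^h_b,p^L_b\in V$ are the solutions of $a_{\Omega_b}(p^h_b,q)=-\int_{\Omega_b}(f+\dot W^h)\bar q\,dx$ and $a^L_{\Omega_b}(p^L_b,q)=-\int_{\Omega_b}(f+\dot W^h)\bar q\,dx$ for all $q\in V$. (These are the weak forms of $(1-M^2)\partial_{x_1}^2u+\partial_{x_2}^2u+2ikM\partial_{x_1}u+k^2u=f+\dot W^h$ in $\Omega_b$, $\partial_{x_2}u=0$ on $\partial\Omega\cap\partial\Omega_b$, with $\partial_{\mathbf n}u=-T_\pm u$, respectively $-T^L_\pm u$, on $\Sigma_\pm$.) *)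

theory Defs
  imports "HOL-Probability.Probability"
begin

section \<open>Lebesgue and Sobolev spaces\<close>

text \<open>Elements of function spaces are represented by functions on the whole type, of which only the
  values on the domain matter; functions that agree almost everywhere on the domain are not
  identified, so the norms below are seminorms whose null functions vanish almost everywhere.\<close>

definition L2 :: "'a::euclidean_space set \<Rightarrow> ('a \<Rightarrow> complex) set" where
  "L2 S = {u \<in> borel_measurable (lebesgue_on S). integrable (lebesgue_on S) (\<lambda>x. (cmod (u x))\<^sup>2)}"

definition L2_inner :: "'a::euclidean_space set \<Rightarrow> ('a \<Rightarrow> complex) \<Rightarrow> ('a \<Rightarrow> complex) \<Rightarrow> complex" where
  "L2_inner S u v = (LINT x|lebesgue_on S. u x * cnj (v x))"

definition L2_norm :: "'a::euclidean_space set \<Rightarrow> ('a \<Rightarrow> complex) \<Rightarrow> real" where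
  "L2_norm S u = sqrt (LINT x|lebesgue_on S. (cmod (u x))\<^sup>2)"

text \<open>\<open>smooth\<close> is \<open>C\<^sup>\<infinity>\<close> on the plane; \<open>D i j\<close> is the partial derivative of order \<open>i\<close> in the first and
  \<open>j\<close> in the second variable.\<close>

definition smooth :: "(real \<times> real \<Rightarrow> 'b::real_normed_vector) \<Rightarrow> bool" where
  "smooth u \<longleftrightarrow> (\<exists>D :: nat \<Rightarrow> nat \<Rightarrow> real \<times> real \<Rightarrow> 'b. D 0 0 = u \<and>
     (\<forall>i j x. (D i j has_derivative
        (\<lambda>h. fst h *\<^sub>R D (Suc i) j x + snd h *\<^sub>R D i (Suc j) x)) (at x)))"

definition test_function :: "(real \<times> real) set \<Rightarrow> (real \<times> real \<Rightarrow> real) \<Rightarrow> bool" where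
  "test_function S \<phi> \<longleftrightarrow>
     smooth \<phi> \<and> compact (closure {x. \<phi> x \<noteq> 0}) \<and> closure {x. \<phi> x \<noteq> 0} \<subseteq> S"

definition is_weak_deriv ::
  "(real \<times> real) set \<Rightarrow> real \<times> real \<Rightarrow> (real \<times> real \<Rightarrow> complex) \<Rightarrow> (real \<times> real \<Rightarrow> complex) \<Rightarrow> bool" where
  "is_weak_deriv S e u g \<longleftrightarrow> (\<forall>\<phi>. test_function S \<phi> \<longrightarrow>
     (LINT x|lebesgue_on S. u x * of_real (frechet_derivative \<phi> (at x) e)) =
     - (LINT x|lebesgue_on S. g x * of_real (\<phi> x)))"

definition H1 :: "(real \<times> real) set \<Rightarrow> (real \<times> real \<Rightarrow> complex) set" where
  "H1 S = {u \<in> L2 S. \<forall>e \<in> {(1, 0), (0, 1)}. \<exists>g \<in> L2 S. is_weak_deriv S e u g}"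

text \<open>Determined up to a null set for \<open>u\<close> in \<open>H1 S\<close>, \<open>S\<close> open.\<close>

definition weak_deriv ::
  "(real \<times> real) set \<Rightarrow> real \<times> real \<Rightarrow> (real \<times> real \<Rightarrow> complex) \<Rightarrow> real \<times> real \<Rightarrow> complex" where
  "weak_deriv S e u = (SOME g. g \<in> L2 S \<and> is_weak_deriv S e u g)"

definition H1_norm :: "(real \<times> real) set \<Rightarrow> (real \<times> real \<Rightarrow> complex) \<Rightarrow> real" where
  "H1_norm S u = sqrt ((L2_norm S u)\<^sup>2 + (L2_norm S (weak_deriv S (1, 0) u))\<^sup>2
                                       + (L2_norm S (weak_deriv S (0, 1) u))\<^sup>2)"

text \<open>Support of a function on \<open>S\<close> defined up to null sets: the complement of the largest open
  set on which it vanishes almost everywhere.\<close>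

definition ess_support :: "'a::euclidean_space set \<Rightarrow> ('a \<Rightarrow> complex) \<Rightarrow> 'a set" where
  "ess_support S f =
     {x. \<forall>U. open U \<and> x \<in> U \<longrightarrow> \<not> (AE y in lebesgue_on (U \<inter> S). f y = 0)}"


section \<open>Dual spaces and isomorphisms\<close>

text \<open>The dual of a space \<open>X\<close> of functions with seminorm \<open>nX\<close>. Sesquilinear forms are antilinear in
  the second argument, so the dual consists of bounded antilinear functionals.\<close>

definition antidual :: "('x \<Rightarrow> complex) set \<Rightarrow> (('x \<Rightarrow> complex) \<Rightarrow> real) \<Rightarrow> (('x \<Rightarrow> complex) \<Rightarrow> complex) set" where
  "antidual X nX = {l \<in> extensional X.
     (\<forall>p\<in>X. \<forall>q\<in>X. l (\<lambda>x. p x + q x) = l p + l q) \<and>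
     (\<forall>c. \<forall>p\<in>X. l (\<lambda>x. c * p x) = cnj c * l p) \<and>
     (\<exists>C. \<forall>p\<in>X. cmod (l p) \<le> C * nX p)}"

definition dual_norm :: "('x \<Rightarrow> complex) set \<Rightarrow> (('x \<Rightarrow> complex) \<Rightarrow> real) \<Rightarrow> (('x \<Rightarrow> complex) \<Rightarrow> complex) \<Rightarrow> real" where
  "dual_norm X nX l = (SUP q\<in>{q\<in>X. nX q \<le> 1}. cmod (l q))"

text \<open>Bounded linear bijections with bounded inverse, from \<open>X\<close> modulo null functions onto its dual;
  injectivity is contained in the last conjunct.\<close>

definition isomorphism_onto_dual ::
  "('x \<Rightarrow> complex) set \<Rightarrow> (('x \<Rightarrow> complex) \<Rightarrow> real) \<Rightarrow> (('x \<Rightarrow> complex) \<Rightarrow> ('x \<Rightarrow> complex) \<Rightarrow> complex) \<Rightarrow> bool" where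
  "isomorphism_onto_dual X nX A \<longleftrightarrow>
     (\<forall>p\<in>X. A p \<in> antidual X nX) \<and>
     (\<forall>p\<in>X. \<forall>p'\<in>X. \<forall>q\<in>X. A (\<lambda>x. p x + p' x) q = A p q + A p' q) \<and>
     (\<forall>c. \<forall>p\<in>X. \<forall>q\<in>X. A (\<lambda>x. c * p x) q = c * A p q) \<and>
     (\<exists>C. \<forall>p\<in>X. dual_norm X nX (A p) \<le> C * nX p) \<and>
     (\<forall>l\<in>antidual X nX. \<exists>p\<in>X. A p = l) \<and>
     (\<exists>C. \<forall>p\<in>X. nX p \<le> C * dual_norm X nX (A p))"


section \<open>The waveguide and traces on its cross sections\<close>

definition Omega :: "real \<Rightarrow> (real \<times> real) set" where
  "Omega d = UNIV \<times> {0<..<d}"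

definition Omega_b :: "real \<Rightarrow> real \<Rightarrow> real \<Rightarrow> (real \<times> real) set" where
  "Omega_b d xm xp = {x \<in> Omega d. xm < fst x \<and> fst x < xp}"

text \<open>Functions on the cross section at \<open>x\<^sub>1 = s\<close>, with \<open>s = xm\<close> or \<open>s = xp\<close>, are functions of \<open>x\<^sub>2\<close>.
  The trace is the continuous extension of the restriction map from functions smooth up to
  the boundary.\<close>

definition is_edge_trace ::
  "real \<Rightarrow> real \<Rightarrow> real \<Rightarrow> real \<Rightarrow> (real \<times> real \<Rightarrow> complex) \<Rightarrow> (real \<Rightarrow> complex) \<Rightarrow> bool" where
  "is_edge_trace d xm xp s p g \<longleftrightarrow> g \<in> L2 {0<..<d} \<and>
     (\<exists>u :: nat \<Rightarrow> real \<times> real \<Rightarrow> complex. (\<forall>n. smooth (u n)) \<and>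
        (\<lambda>n. H1_norm (Omega_b d xm xp) (\<lambda>x. u n x - p x)) \<longlonglongrightarrow> 0 \<and>
        (\<lambda>n. L2_norm {0<..<d} (\<lambda>y. u n (s, y) - g y)) \<longlonglongrightarrow> 0)"

definition edge_trace :: "real \<Rightarrow> real \<Rightarrow> real \<Rightarrow> real \<Rightarrow> (real \<times> real \<Rightarrow> complex) \<Rightarrow> real \<Rightarrow> complex" where
  "edge_trace d xm xp s p = (SOME g. is_edge_trace d xm xp s p g)"

text \<open>The space \<open>H\<^sup>1\<^sup>/\<^sup>2\<close> of a cross section, as the trace space of \<open>H\<^sup>1\<close> with the quotient norm.\<close>

definition Hhalf :: "real \<Rightarrow> real \<Rightarrow> real \<Rightarrow> real \<Rightarrow> (real \<Rightarrow> complex) set" where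
  "Hhalf d xm xp s = {g. \<exists>p \<in> H1 (Omega_b d xm xp). is_edge_trace d xm xp s p g}"

definition Hhalf_norm :: "real \<Rightarrow> real \<Rightarrow> real \<Rightarrow> real \<Rightarrow> (real \<Rightarrow> complex) \<Rightarrow> real" where
  "Hhalf_norm d xm xp s g =
     (INF p \<in> {p \<in> H1 (Omega_b d xm xp). is_edge_trace d xm xp s p g}. H1_norm (Omega_b d xm xp) p)"


section \<open>Dirichlet-to-Neumann operators\<close>

text \<open>Throughout, \<open>sg = 1\<close> and \<open>sg = -1\<close> select the upper and the lower sign in formulas with
  \<open>\<plusminus>\<close> or \<open>\<mp>\<close>.\<close>

definition phi :: "real \<Rightarrow> nat \<Rightarrow> real \<Rightarrow> complex" where
  "phi d n y = of_real (if n = 0 then 1 / sqrt d else sqrt (2 / d) * cos (real n * pi * y / d))"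

definition N0 :: "real \<Rightarrow> real \<Rightarrow> real \<Rightarrow> int" where
  "N0 d M k = \<lfloor>k * d / (pi * sqrt (1 - M\<^sup>2))\<rfloor>"

definition beta :: "real \<Rightarrow> real \<Rightarrow> real \<Rightarrow> real \<Rightarrow> nat \<Rightarrow> complex" where
  "beta d M k sg n =
     (if int n \<le> N0 d M k
      then (- of_real (k * M) + of_real sg * of_real (sqrt (k\<^sup>2 - (real n)\<^sup>2 * pi\<^sup>2 / d\<^sup>2 * (1 - M\<^sup>2))))
             / of_real (1 - M\<^sup>2)
      else (- of_real (k * M) + of_real sg * \<i> * of_real (sqrt ((real n)\<^sup>2 * pi\<^sup>2 / d\<^sup>2 * (1 - M\<^sup>2) - k\<^sup>2)))
             / of_real (1 - M\<^sup>2))"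

definition pml_alpha :: "real \<Rightarrow> (real \<Rightarrow> real) \<Rightarrow> real \<Rightarrow> complex" where
  "pml_alpha \<omega> \<sigma> x = (- \<i> * of_real \<omega>) / (- \<i> * of_real \<omega> + of_real (\<sigma> x))"

text \<open>Here \<open>x0\<close> is \<open>xp\<close> for \<open>sg = 1\<close> and \<open>xm\<close> for \<open>sg = -1\<close>.\<close>

definition nu ::
  "real \<Rightarrow> real \<Rightarrow> real \<Rightarrow> real \<Rightarrow> (real \<Rightarrow> real) \<Rightarrow> real \<Rightarrow> real \<Rightarrow> real \<Rightarrow> nat \<Rightarrow> complex" where
  "nu d M k \<omega> \<sigma> L sg x0 n =
     (let \<delta> = beta d M k 1 n - beta d M k (-1) n
      in beta d M k sg n - of_real sg * (\<delta> /
           (1 - exp (- \<i> * \<delta> * integral {0..L} (\<lambda>s. 1 / pml_alpha \<omega> \<sigma> (x0 + sg * s))))))"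

text \<open>The operator \<open>\<psi> \<mapsto> \<Sum>n. c n (\<psi>, phi n) phi n\<close> from \<open>H\<^sup>1\<^sup>/\<^sup>2\<close> to its dual, the series converging in the
  dual norm. A square integrable \<open>\<chi>\<close> is identified with the functional \<open>g \<mapsto> L2_inner _ \<chi> g\<close>, so that
  the duality pairing \<open>\<langle>l, g\<rangle>\<close> is \<open>l g\<close>.\<close>

definition modal_operator ::
  "real \<Rightarrow> real \<Rightarrow> real \<Rightarrow> real \<Rightarrow> (nat \<Rightarrow> complex) \<Rightarrow> (real \<Rightarrow> complex) \<Rightarrow> (real \<Rightarrow> complex) \<Rightarrow> complex" where
  "modal_operator d xm xp s c \<psi> =
     (THE l. l \<in> antidual (Hhalf d xm xp s) (Hhalf_norm d xm xp s) \<and>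
        (\<lambda>N. dual_norm (Hhalf d xm xp s) (Hhalf_norm d xm xp s)
           (\<lambda>g. l g - (\<Sum>n<N. c n * L2_inner {0<..<d} \<psi> (phi d n) * L2_inner {0<..<d} (phi d n) g)))
        \<longlonglongrightarrow> 0)"

definition DtN ::
  "real \<Rightarrow> real \<Rightarrow> real \<Rightarrow> real \<Rightarrow> real \<Rightarrow> real \<Rightarrow> (real \<Rightarrow> complex) \<Rightarrow> (real \<Rightarrow> complex) \<Rightarrow> complex" where
  "DtN d M k xm xp sg =
     (let x0 = (if sg = 1 then xp else xm)
      in modal_operator d xm xp x0 (\<lambda>n. - of_real sg * (\<i> * beta d M k sg n)))"

definition DtN_pml ::
  "real \<Rightarrow> real \<Rightarrow> real \<Rightarrow> real \<Rightarrow> real \<Rightarrow> real \<Rightarrow> (real \<Rightarrow> real) \<Rightarrow> real \<Rightarrow> real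
     \<Rightarrow> (real \<Rightarrow> complex) \<Rightarrow> (real \<Rightarrow> complex) \<Rightarrow> complex" where
  "DtN_pml d M k xm xp \<omega> \<sigma> L sg =
     (let x0 = (if sg = 1 then xp else xm)
      in modal_operator d xm xp x0 (\<lambda>n. - of_real sg * (\<i> * nu d M k \<omega> \<sigma> L sg x0 n)))"


section \<open>Sesquilinear forms and operators\<close>

definition waveguide_form ::
  "real \<Rightarrow> real \<Rightarrow> real \<Rightarrow> real \<Rightarrow> real
     \<Rightarrow> ((real \<Rightarrow> complex) \<Rightarrow> (real \<Rightarrow> complex) \<Rightarrow> complex)
     \<Rightarrow> ((real \<Rightarrow> complex) \<Rightarrow> (real \<Rightarrow> complex) \<Rightarrow> complex)
     \<Rightarrow> (real \<times> real \<Rightarrow> complex) \<Rightarrow> (real \<times> real \<Rightarrow> complex) \<Rightarrow> complex" where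
  "waveguide_form d M k xm xp Tp Tm p q =
     (let \<Omega> = Omega_b d xm xp;
          D1 = weak_deriv \<Omega> (1, 0);
          D2 = weak_deriv \<Omega> (0, 1)
      in (LINT x|lebesgue_on \<Omega>. of_real (1 - M\<^sup>2) * D1 p x * cnj (D1 q x) + D2 p x * cnj (D2 q x))
         - of_real (k\<^sup>2) * (LINT x|lebesgue_on \<Omega>. p x * cnj (q x))
         - 2 * \<i> * of_real (k * M) * (LINT x|lebesgue_on \<Omega>. D1 p x * cnj (q x))
         + of_real (1 - M\<^sup>2) * (Tp (edge_trace d xm xp xp p) (edge_trace d xm xp xp q)
                              + Tm (edge_trace d xm xp xm p) (edge_trace d xm xp xm q)))"

definition a_form ::
  "real \<Rightarrow> real \<Rightarrow> real \<Rightarrow> real \<Rightarrow> real \<Rightarrow> (real \<times> real \<Rightarrow> complex) \<Rightarrow> (real \<times> real \<Rightarrow> complex) \<Rightarrow> complex" where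
  "a_form d M k xm xp =
     waveguide_form d M k xm xp (DtN d M k xm xp 1) (DtN d M k xm xp (-1))"

definition aL_form ::
  "real \<Rightarrow> real \<Rightarrow> real \<Rightarrow> real \<Rightarrow> real \<Rightarrow> real \<Rightarrow> (real \<Rightarrow> real) \<Rightarrow> real
     \<Rightarrow> (real \<times> real \<Rightarrow> complex) \<Rightarrow> (real \<times> real \<Rightarrow> complex) \<Rightarrow> complex" where
  "aL_form d M k xm xp \<omega> \<sigma> L =
     waveguide_form d M k xm xp (DtN_pml d M k xm xp \<omega> \<sigma> L 1) (DtN_pml d M k xm xp \<omega> \<sigma> L (-1))"

definition AL_operator ::
  "real \<Rightarrow> real \<Rightarrow> real \<Rightarrow> real \<Rightarrow> real \<Rightarrow> real \<Rightarrow> (real \<Rightarrow> real) \<Rightarrow> real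
     \<Rightarrow> (real \<times> real \<Rightarrow> complex) \<Rightarrow> (real \<times> real \<Rightarrow> complex) \<Rightarrow> complex" where
  "AL_operator d M k xm xp \<omega> \<sigma> L p =
     restrict (aL_form d M k xm xp \<omega> \<sigma> L p) (H1 (Omega_b d xm xp))"

definition weak_solution ::
  "(real \<times> real) set \<Rightarrow> ((real \<times> real \<Rightarrow> complex) \<Rightarrow> (real \<times> real \<Rightarrow> complex) \<Rightarrow> complex)
     \<Rightarrow> (real \<times> real \<Rightarrow> complex) \<Rightarrow> (real \<times> real \<Rightarrow> complex) \<Rightarrow> bool" where
  "weak_solution S a F p \<longleftrightarrow>
     p \<in> H1 S \<and> (\<forall>q \<in> H1 S. a p q = - (LINT x|lebesgue_on S. F x * cnj (q x)))"

definition sigma_tilde :: "real \<Rightarrow> (real \<Rightarrow> real) \<Rightarrow> real \<Rightarrow> real" where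
  "sigma_tilde \<omega> \<sigma> x = min 1 (\<sigma> x / \<omega>)"


section \<open>Discretized white noise\<close>

text \<open>White noise on \<open>S\<close>, with \<open>W A\<close> the integral of \<open>dW\<close> over \<open>A\<close>: the centred Gaussian process indexed by
  measurable sets of finite measure with covariance \<open>E (W A * W B) = |A \<inter> B|\<close>. The finite-dimensional
  laws are prescribed through their characteristic functions.\<close>

definition white_noise :: "'w measure \<Rightarrow> (real \<times> real) set \<Rightarrow> ((real \<times> real) set \<Rightarrow> 'w \<Rightarrow> real) \<Rightarrow> bool" where
  "white_noise P S W \<longleftrightarrow> prob_space P \<and>
     (\<forall>A. A \<in> lmeasurable \<and> A \<subseteq> S \<longrightarrow> W A \<in> borel_measurable P) \<and>
     (\<forall>\<A> c. finite \<A> \<and> (\<forall>A\<in>\<A>. A \<in> lmeasurable \<and> A \<subseteq> S) \<longrightarrow>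
        char (distr P borel (\<lambda>w. \<Sum>A\<in>\<A>. c A * W A w)) 1 =
        of_real (exp (- (\<Sum>A\<in>\<A>. \<Sum>B\<in>\<A>. c A * c B * measure lebesgue (A \<inter> B)) / 2)))"

definition mesh_of :: "(real \<times> real) set \<Rightarrow> (real \<times> real) set set \<Rightarrow> bool" where
  "mesh_of S \<T> \<longleftrightarrow> triangulation \<T> \<and> (\<forall>K\<in>\<T>. 2 simplex K) \<and> \<Union>\<T> = S"

definition noise_coeff :: "((real \<times> real) set \<Rightarrow> 'w \<Rightarrow> real) \<Rightarrow> (real \<times> real) set \<Rightarrow> 'w \<Rightarrow> real" where
  "noise_coeff W K w = measure lebesgue K powr (-1/2) * W K w"

definition discretized_noise ::
  "((real \<times> real) set \<Rightarrow> 'w \<Rightarrow> real) \<Rightarrow> (real \<times> real) set set \<Rightarrow> 'w \<Rightarrow> real \<times> real \<Rightarrow> complex" where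
  "discretized_noise W \<T> w x =
     of_real (\<Sum>K\<in>\<T>. measure lebesgue K powr (-1/2) * noise_coeff W K w * indicator K x)"

end

theory Submission
  imports Defs
begin

text \<open>The cosine modes of the cross section diagonalise the problem: on the \<open>n\<close>-th mode the form becomes that
  of a one-dimensional problem, in which the gauge factor \<open>exp (- \<i> k M x / (1 - M\<^sup>2))\<close> removes the
  convective term and shifts \<open>\<beta>\<^sub>n\<close> to \<open>\<plusminus> \<mu>\<^sub>n\<close>. Both the exact and the truncated boundary conditions then
  have the impedance \<open>- \<i> \<mu>\<^sub>n (1 + E\<^sub>n) / (1 - E\<^sub>n)\<close>, where \<open>E\<^sub>n\<close> is the reflection coefficient of the layer
  and \<open>E\<^sub>n = 0\<close> for the exact one. Since \<open>k\<close> is no cutoff frequency, \<open>|\<mu>\<^sub>n|\<close> is bounded below, and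
  \<open>|E\<^sub>n| \<le> exp (- C\<^sub>2 \<integral> \<sigma>)\<close> with \<open>\<sigma>\<close> truncated as in the statement, both for the finitely many
  propagating modes, damped by \<open>\<sigma>\<close>, and for the evanescent ones, damped by the length of the layer.

  It remains to bound the inverse uniformly over all reflection coefficients of modulus at most \<open>r < 1\<close>. The form is
  coercive on the evanescent modes because the impedances have positive real part there; on the propagating modes
  it is coercive up to finitely many Fourier coefficients. Each of these is controlled by testing with the explicit
  solution of a two-point boundary value problem whose determinant \<open>1 - E E' exp (2 \<i> \<mu>\<^sub>n (x\<^sup>+ - x\<^sup>-))\<close> is at least
  \<open>1 - r\<^sup>2\<close>; the same solutions turn a Lax--Milgram solution of the coercive perturbation into a solution of
  the problem itself. The error solves the truncated problem with the difference of the boundary terms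
  as data, and this difference is of size \<open>|\<mu>\<^sub>n| |E\<^sub>n|\<close>.\<close>

section \<open>Seminormed Hilbert spaces of functions\<close>

text \<open>A compactness argument would bound the inverse for each L separately; the constants must
  serve all L at once, so every bound is explicit and depends on the layers only through r. It holds
  for each r < 1, so layers of any positive thickness could serve as the threshold; thickness 1 is
  taken.

  Cosine series in both variables fit H^1 functions without boundary conditions: the differentiated
  series is a sine series, sines vanish on the sides, and hence a weak derivative has exactly the
  termwise differentiated expansion. Density of trigonometric polynomials and uniqueness of weak
  derivatives both come from this.

  The form is not Hermitian, so a Fourier coefficient has a representer in each argument: the right
  one bounds the coefficient of a solution, the left one corrects the Lax--Milgram solution.

  Spaces consist of functions, not of classes, and weak derivatives and traces are arbitrary
  choices. Identities between them hold up to null functions and are therefore stated through inner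
  products, norms and Fourier coefficients.\<close>

locale semi_inner_space =
  fixes V :: "('x \<Rightarrow> complex) set" and ip :: "('x \<Rightarrow> complex) \<Rightarrow> ('x \<Rightarrow> complex) \<Rightarrow> complex"
  assumes zero_mem: "(\<lambda>x. 0) \<in> V"
    and add_mem: "\<And>p q. p \<in> V \<Longrightarrow> q \<in> V \<Longrightarrow> (\<lambda>x. p x + q x) \<in> V"
    and scale_mem: "\<And>c p. p \<in> V \<Longrightarrow> (\<lambda>x. c * p x) \<in> V"
    and ip_add_left: "\<And>p q r. p \<in> V \<Longrightarrow> q \<in> V \<Longrightarrow> r \<in> V \<Longrightarrow> ip (\<lambda>x. p x + q x) r = ip p r + ip q r"
    and ip_scale_left: "\<And>c p r. p \<in> V \<Longrightarrow> r \<in> V \<Longrightarrow> ip (\<lambda>x. c * p x) r = c * ip p r"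
    and ip_cnj: "\<And>p q. p \<in> V \<Longrightarrow> q \<in> V \<Longrightarrow> cnj (ip p q) = ip q p"
    and ip_pos: "\<And>p. p \<in> V \<Longrightarrow> 0 \<le> Re (ip p p)"
begin

definition nrm :: "('x \<Rightarrow> complex) \<Rightarrow> real" where "nrm p = sqrt (Re (ip p p))"

lemma diff_mem: "p \<in> V \<Longrightarrow> q \<in> V \<Longrightarrow> (\<lambda>x. p x - q x) \<in> V"
  using add_mem[OF _ scale_mem[of q "-1"], of p] by simp

lemma sum_mem: "finite I \<Longrightarrow> (\<And>i. i \<in> I \<Longrightarrow> f i \<in> V) \<Longrightarrow> (\<lambda>x. \<Sum>i\<in>I. f i x) \<in> V"
  by (induction I rule: finite_induct) (auto intro: zero_mem add_mem)

lemma ip_add_right: "p \<in> V \<Longrightarrow> q \<in> V \<Longrightarrow> r \<in> V \<Longrightarrow> ip r (\<lambda>x. p x + q x) = ip r p + ip r q"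
  using ip_add_left[of p q r] by (metis add_mem complex_cnj_add ip_cnj)

lemma ip_scale_right: "p \<in> V \<Longrightarrow> r \<in> V \<Longrightarrow> ip r (\<lambda>x. c * p x) = cnj c * ip r p"
  using ip_scale_left[of p r c] by (metis complex_cnj_mult ip_cnj scale_mem)

lemma ip_diff_left: "p \<in> V \<Longrightarrow> q \<in> V \<Longrightarrow> r \<in> V \<Longrightarrow> ip (\<lambda>x. p x - q x) r = ip p r - ip q r"
  using ip_add_left[of p "\<lambda>x. -1 * q x" r] ip_scale_left[of q r "-1"] scale_mem[of q "-1"] by simp

lemma ip_diff_right: "p \<in> V \<Longrightarrow> q \<in> V \<Longrightarrow> r \<in> V \<Longrightarrow> ip r (\<lambda>x. p x - q x) = ip r p - ip r q"
  using ip_add_right[of p "\<lambda>x. -1 * q x" r] ip_scale_right[of q r "-1"] scale_mem[of q "-1"] by simp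

lemma ip_zero_left: "r \<in> V \<Longrightarrow> ip (\<lambda>x. 0) r = 0"
  using ip_scale_left[OF zero_mem, of r 0] by simp

lemma ip_sum_left: "finite I \<Longrightarrow> (\<And>i. i \<in> I \<Longrightarrow> f i \<in> V) \<Longrightarrow> r \<in> V
    \<Longrightarrow> ip (\<lambda>x. \<Sum>i\<in>I. f i x) r = (\<Sum>i\<in>I. ip (f i) r)"
  by (induction I rule: finite_induct) (auto simp: ip_zero_left ip_add_left sum_mem)

lemma ip_sum_right: "finite I \<Longrightarrow> (\<And>i. i \<in> I \<Longrightarrow> f i \<in> V) \<Longrightarrow> r \<in> V
    \<Longrightarrow> ip r (\<lambda>x. \<Sum>i\<in>I. f i x) = (\<Sum>i\<in>I. ip r (f i))"
  by (subst ip_cnj[symmetric]) (auto simp: ip_sum_left sum_mem ip_cnj)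

lemma ip_self: "p \<in> V \<Longrightarrow> ip p p = of_real ((nrm p)\<^sup>2)"
proof -
  assume p: "p \<in> V"
  have "Im (ip p p) = 0" using arg_cong[OF ip_cnj[OF p p], of Im] by simp
  then show ?thesis using ip_pos[OF p] by (simp add: nrm_def complex_eq_iff)
qed

lemma nrm_nonneg: "p \<in> V \<Longrightarrow> 0 \<le> nrm p"
  by (simp add: nrm_def ip_pos)

lemma nrm_square: "p \<in> V \<Longrightarrow> (nrm p)\<^sup>2 = Re (ip p p)"
  by (simp add: nrm_def ip_pos)

lemma nrm_scale: "p \<in> V \<Longrightarrow> nrm (\<lambda>x. c * p x) = cmod c * nrm p"
proof -
  assume p: "p \<in> V"
  have "ip (\<lambda>x. c * p x) (\<lambda>x. c * p x) = (c * cnj c) * ip p p"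
    using p by (simp add: ip_scale_left ip_scale_right scale_mem)
  also have "\<dots> = of_real ((cmod c * nrm p)\<^sup>2)"
    by (simp add: ip_self[OF p] complex_mult_cnj cmod_power2 power_mult_distrib)
  finally have "(nrm (\<lambda>x. c * p x))\<^sup>2 = (cmod c * nrm p)\<^sup>2"
    using nrm_square[OF scale_mem[OF p]] by simp
  then show ?thesis by (simp add: nrm_nonneg p scale_mem)
qed

lemma nrm_minus_commute: "p \<in> V \<Longrightarrow> q \<in> V \<Longrightarrow> nrm (\<lambda>x. p x - q x) = nrm (\<lambda>x. q x - p x)"
  using nrm_scale[OF diff_mem, of q p "-1"] by simp

lemma nrm_add_square:
  assumes "p \<in> V" "q \<in> V"
  shows "(nrm (\<lambda>x. p x + q x))\<^sup>2 = (nrm p)\<^sup>2 + 2 * Re (ip p q) + (nrm q)\<^sup>2"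
proof -
  have "Re (ip q p) = Re (ip p q)" using arg_cong[OF ip_cnj[OF assms], of Re] by simp
  then show ?thesis using assms
    by (simp add: nrm_square add_mem ip_add_left ip_add_right)
qed

lemma nrm_diff_square:
  assumes "p \<in> V" "q \<in> V"
  shows "(nrm (\<lambda>x. p x - q x))\<^sup>2 = (nrm p)\<^sup>2 - 2 * Re (ip p q) + (nrm q)\<^sup>2"
proof -
  have "Re (ip q p) = Re (ip p q)" using arg_cong[OF ip_cnj[OF assms], of Re] by simp
  then show ?thesis using assms
    by (simp add: nrm_square diff_mem ip_diff_left ip_diff_right)
qed

lemma Cauchy_Schwarz:
  assumes p: "p \<in> V" and q: "q \<in> V"
  shows "cmod (ip p q) \<le> nrm p * nrm q"
proof -
  define b where "b = ip p q"
  define a where "a = (nrm p)\<^sup>2" 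
  define c where "c = (nrm q)\<^sup>2"
  have key: "0 \<le> a - 2 * t * (cmod b)\<^sup>2 + t\<^sup>2 * (cmod b)\<^sup>2 * c" for t :: real
  proof -
    let ?s = "of_real t * b"
    have "0 \<le> (nrm (\<lambda>x. p x - ?s * q x))\<^sup>2" by simp
    also have "\<dots> = a - 2 * Re (ip p (\<lambda>x. ?s * q x)) + (nrm (\<lambda>x. ?s * q x))\<^sup>2"
      unfolding a_def using nrm_diff_square[OF p scale_mem[OF q]] .
    also have "ip p (\<lambda>x. ?s * q x) = of_real t * (b * cnj b)"
      using ip_scale_right[OF q p, of ?s] by (simp add: b_def)
    also have "\<dots> = of_real (t * (cmod b)\<^sup>2)" by (simp add: complex_mult_cnj cmod_power2)
    also have "nrm (\<lambda>x. ?s * q x) = \<bar>t\<bar> * cmod b * nrm q"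
      using nrm_scale[OF q, of ?s] by (simp add: norm_mult)
    finally show ?thesis by (simp add: c_def power_mult_distrib mult.assoc)
  qed
  have a: "a \<ge> 0" and c: "c \<ge> 0" by (auto simp: a_def c_def)
  have "(cmod b)\<^sup>2 \<le> a * c"
  \<comment> \<open>For a null q the bound \<open>key\<close> is affine in t, so its slope must
    vanish; otherwise t = 1/c minimises it.\<close>
  proof (cases "c = 0")
    case True
    have "(cmod b)\<^sup>2 = 0"
    proof (rule ccontr)
      assume nz: "(cmod b)\<^sup>2 \<noteq> 0"
      have "0 \<le> a - 2 * ((a + 1) / (cmod b)\<^sup>2) * (cmod b)\<^sup>2"
        using key[of "(a + 1) / (cmod b)\<^sup>2"] True by simp
      then show False using nz a by simp
    qed
    then show ?thesis using True by simp
  next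
    case False
    then have cp: "c > 0" using c by simp
    have "0 \<le> a - 2 * (1/c) * (cmod b)\<^sup>2 + (1/c)\<^sup>2 * (cmod b)\<^sup>2 * c" by (rule key)
    also have "\<dots> = a - (cmod b)\<^sup>2 / c" using cp by (simp add: field_simps power2_eq_square)
    finally show ?thesis using cp by (simp add: field_simps)
  qed
  also have "\<dots> = (nrm p * nrm q)\<^sup>2" by (simp add: a_def c_def power_mult_distrib)
  finally show ?thesis
    unfolding b_def by (rule power2_le_imp_le) (simp add: nrm_nonneg p q)
qed

lemma nrm_triangle:
  assumes p: "p \<in> V" and q: "q \<in> V"
  shows "nrm (\<lambda>x. p x + q x) \<le> nrm p + nrm q"
proof -
  have "Re (ip p q) \<le> nrm p * nrm q"
    using Cauchy_Schwarz[OF p q] complex_Re_le_cmod order_trans by blast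
  then have "(nrm (\<lambda>x. p x + q x))\<^sup>2 \<le> (nrm p + nrm q)\<^sup>2"
    by (simp add: nrm_add_square[OF p q] power2_sum)
  then show ?thesis by (rule power2_le_imp_le) (simp add: nrm_nonneg p q)
qed

lemma nrm_triangle_diff:
  assumes p: "p \<in> V" and q: "q \<in> V" and r: "r \<in> V"
  shows "nrm (\<lambda>x. p x - r x) \<le> nrm (\<lambda>x. p x - q x) + nrm (\<lambda>x. q x - r x)"
  using nrm_triangle[OF diff_mem[OF p q] diff_mem[OF q r]] by simp

lemma nrm_triangle_sub:
  assumes p: "p \<in> V" and q: "q \<in> V"
  shows "nrm p \<le> nrm (\<lambda>x. p x - q x) + nrm q"
  using nrm_triangle[OF diff_mem[OF p q] q] by simp

lemma nrm_tendsto: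
  assumes "\<And>n. u n \<in> V" "p \<in> V" "(\<lambda>n. nrm (\<lambda>x. u n x - p x)) \<longlonglongrightarrow> 0"
  shows "(\<lambda>n. nrm (u n)) \<longlonglongrightarrow> nrm p"
proof (rule LIM_zero_cancel, rule tendsto_rabs_zero_cancel, rule tendsto_sandwich[OF _ _ tendsto_const assms(3)])
  show "\<forall>\<^sub>F n in sequentially. \<bar>nrm (u n) - nrm p\<bar> \<le> nrm (\<lambda>x. u n x - p x)"
  proof (rule always_eventually, rule allI)
    fix n
    have "nrm p \<le> nrm (\<lambda>x. p x - u n x) + nrm (u n)" by (rule nrm_triangle_sub) (use assms in auto)
    moreover have "nrm (u n) \<le> nrm (\<lambda>x. u n x - p x) + nrm p" by (rule nrm_triangle_sub) (use assms in auto)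
    ultimately show "\<bar>nrm (u n) - nrm p\<bar> \<le> nrm (\<lambda>x. u n x - p x)"
      using nrm_minus_commute[of p "u n"] assms by auto
  qed
qed auto

lemma ip_tendsto_left:
  assumes "\<And>n. u n \<in> V" "p \<in> V" "(\<lambda>n. nrm (\<lambda>x. u n x - p x)) \<longlonglongrightarrow> 0" "q \<in> V"
  shows "(\<lambda>n. ip (u n) q) \<longlonglongrightarrow> ip p q"
proof (rule LIM_zero_cancel, rule tendsto_norm_zero_cancel, rule tendsto_sandwich[OF _ _ tendsto_const])
  show "(\<lambda>n. nrm (\<lambda>x. u n x - p x) * nrm q) \<longlonglongrightarrow> 0"
    using tendsto_mult_left_zero[OF assms(3)] .
  show "\<forall>\<^sub>F n in sequentially. cmod (ip (u n) q - ip p q) \<le> nrm (\<lambda>x. u n x - p x) * nrm q"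
    using Cauchy_Schwarz[OF diff_mem[OF assms(1,2)] assms(4)] assms by (simp add: ip_diff_left)
qed auto

text \<open>The functionals of \<open>antidual\<close>, without the condition on extensionality.\<close>

definition bounded_antilinear :: "(('x \<Rightarrow> complex) \<Rightarrow> complex) \<Rightarrow> bool" where
  "bounded_antilinear l \<longleftrightarrow>
     (\<forall>p\<in>V. \<forall>q\<in>V. l (\<lambda>x. p x + q x) = l p + l q) \<and>
     (\<forall>c. \<forall>p\<in>V. l (\<lambda>x. c * p x) = cnj c * l p) \<and>
     (\<exists>C. \<forall>p\<in>V. cmod (l p) \<le> C * nrm p)"

lemma bounded_antilinearD:
  assumes "bounded_antilinear l"
  shows "p \<in> V \<Longrightarrow> q \<in> V \<Longrightarrow> l (\<lambda>x. p x + q x) = l p + l q"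
    and "p \<in> V \<Longrightarrow> l (\<lambda>x. c * p x) = cnj c * l p"
    and "p \<in> V \<Longrightarrow> q \<in> V \<Longrightarrow> l (\<lambda>x. p x - q x) = l p - l q"
    and "\<exists>C\<ge>0. \<forall>p\<in>V. cmod (l p) \<le> C * nrm p"
proof -
  show add: "l (\<lambda>x. p x + q x) = l p + l q" if "p \<in> V" "q \<in> V" for p q
    using assms that by (auto simp: bounded_antilinear_def)
  show scale: "l (\<lambda>x. c * p x) = cnj c * l p" if "p \<in> V" for p c
    using assms that by (auto simp: bounded_antilinear_def)
  show "l (\<lambda>x. p x - q x) = l p - l q" if "p \<in> V" "q \<in> V"
    using add[of p "\<lambda>x. -1 * q x"] scale[of q "-1"] that scale_mem[of q "-1"] by simp
  obtain C where "\<forall>p\<in>V. cmod (l p) \<le> C * nrm p" using assms by (auto simp: bounded_antilinear_def)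
  then have "\<forall>p\<in>V. cmod (l p) \<le> max C 0 * nrm p"
    by (meson max.cobounded1 mult_right_mono nrm_nonneg order_trans)
  then show "\<exists>C\<ge>0. \<forall>p\<in>V. cmod (l p) \<le> C * nrm p" by (meson max.cobounded2)
qed

end

section \<open>Riesz representation and the Lax--Milgram theorem\<close>

locale complete_semi_inner_space = semi_inner_space +
  assumes complete: "\<And>u :: nat \<Rightarrow> 'a \<Rightarrow> complex. (\<And>n. u n \<in> V) \<Longrightarrow>
      (\<And>e. e > 0 \<Longrightarrow> \<exists>N. \<forall>m\<ge>N. \<forall>n\<ge>N. sqrt (Re (ip (\<lambda>x. u m x - u n x) (\<lambda>x. u m x - u n x))) < e) \<Longrightarrow>
      \<exists>p\<in>V. (\<lambda>n. sqrt (Re (ip (\<lambda>x. u n x - p x) (\<lambda>x. u n x - p x)))) \<longlonglongrightarrow> 0"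
begin

lemma complete':
  assumes "\<And>n. u n \<in> V" "\<And>e. e > 0 \<Longrightarrow> \<exists>N. \<forall>m\<ge>N. \<forall>n\<ge>N. nrm (\<lambda>x. u m x - u n x) < e"
  obtains p where "p \<in> V" "(\<lambda>n. nrm (\<lambda>x. u n x - p x)) \<longlonglongrightarrow> 0"
  using complete[of u] assms unfolding nrm_def by blast

text \<open>The representer minimises \<open>(nrm p)\<^sup>2 - 2 * Re (l p)\<close>; minimising sequences are Cauchy by the
  parallelogram law.\<close>

theorem Riesz:
  assumes l: "bounded_antilinear l"
  obtains r where "r \<in> V" "\<And>q. q \<in> V \<Longrightarrow> l q = ip r q"
proof -
  note ladd = bounded_antilinearD(1)[OF l] and lscale = bounded_antilinearD(2)[OF l]
  obtain C where C: "C \<ge> 0" "\<And>p. p \<in> V \<Longrightarrow> cmod (l p) \<le> C * nrm p"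
    using bounded_antilinearD(4)[OF l] by auto
  define J where "J p = (nrm p)\<^sup>2 - 2 * Re (l p)" for p
  \<comment> \<open>Completing the square: \<open>J p\<close> is at least (nrm p - C)^2 -
    C^2.\<close>
  have Jlow: "- C\<^sup>2 \<le> J p" if "p \<in> V" for p
  proof -
    have "Re (l p) \<le> C * nrm p" using C(2)[OF that] complex_Re_le_cmod order_trans by blast
    moreover have "0 \<le> (nrm p - C)\<^sup>2" by simp
    ultimately show ?thesis unfolding J_def power2_diff by (simp add: algebra_simps)
  qed
  define I where "I = Inf (J ` V)"
  have ne: "J ` V \<noteq> {}" using zero_mem by blast
  have bd: "bdd_below (J ` V)" using Jlow by (auto simp: bdd_below_def)
  have I: "I \<le> J p" if "p \<in> V" for p unfolding I_def using bd that by (simp add: cINF_lower)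
  have "\<exists>p\<in>V. J p < I + 1 / real (Suc k)" for k
    using cInf_lessD[OF ne, of "I + 1 / real (Suc k)"] unfolding I_def by auto
  then obtain u where u: "\<And>k. u k \<in> V" "\<And>k. J (u k) < I + 1 / real (Suc k)" by metis
  \<comment> \<open>Parallelogram law: J at the midpoint is at least I, which leaves only the
    excesses of p and q over I to bound their distance.\<close>
  have par: "(nrm (\<lambda>x. p x - q x))\<^sup>2 \<le> 2 * (J p - I) + 2 * (J q - I)" if pq: "p \<in> V" "q \<in> V" for p q
  proof -
    let ?m = "\<lambda>x. (1/2) * (p x + q x)"
    have m: "?m \<in> V" using scale_mem[OF add_mem[OF pq], of "1/2"] by simp
    have "nrm ?m = 1/2 * nrm (\<lambda>x. p x + q x)" using nrm_scale[OF add_mem[OF pq], of "1/2"] by simp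
    then have "4 * (nrm ?m)\<^sup>2 = 4 * (1/2 * nrm (\<lambda>x. p x + q x))\<^sup>2" by (simp only:)
    then have "4 * (nrm ?m)\<^sup>2 = (nrm (\<lambda>x. p x + q x))\<^sup>2" by (simp add: power2_eq_square)
    moreover have "l ?m = 1/2 * (l p + l q)"
      using lscale[OF add_mem[OF pq], of "1/2"] ladd[OF pq] by simp
    then have "Re (l ?m) = Re (1/2 * (l p + l q))" by (simp only:)
    then have "4 * Re (l ?m) = 2 * Re (l p) + 2 * Re (l q)" by simp
    ultimately show ?thesis using I[OF m] nrm_add_square[OF pq] nrm_diff_square[OF pq]
      unfolding J_def by (simp add: algebra_simps)
  qed
  have "\<exists>N. \<forall>m\<ge>N. \<forall>n\<ge>N. nrm (\<lambda>x. u m x - u n x) < e" if e: "e > 0" for e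
  proof -
    obtain N :: nat where N: "4 / e\<^sup>2 < real (Suc N)" using reals_Archimedean2 by (meson less_Suc_eq of_nat_less_iff order_less_trans lessI)
    have "nrm (\<lambda>x. u m x - u n x) < e" if "m \<ge> N" "n \<ge> N" for m n
    proof -
      have b: "1 / real (Suc j) \<le> 1 / real (Suc N)" if "j \<ge> N" for j using that by (simp add: frac_le)
      have "(nrm (\<lambda>x. u m x - u n x))\<^sup>2 \<le> 2 * (J (u m) - I) + 2 * (J (u n) - I)" using par u by blast
      also have "\<dots> < 4 / real (Suc N)" using u(2)[of m] u(2)[of n] b[OF that(1)] b[OF that(2)] by simp
      also have "\<dots> < e\<^sup>2" using N e by (simp add: field_simps)
      finally show ?thesis using e by (simp add: power2_less_imp_less)
    qed
    then show ?thesis by blast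
  qed
  then obtain r where r: "r \<in> V" "(\<lambda>n. nrm (\<lambda>x. u n x - r x)) \<longlonglongrightarrow> 0"
    by (rule complete'[of u, OF u(1)])
  have "(\<lambda>k. Re (l (u k))) \<longlonglongrightarrow> Re (l r)"
  proof (rule tendsto_Re, rule LIM_zero_cancel, rule tendsto_norm_zero_cancel,
      rule tendsto_sandwich[OF _ _ tendsto_const])
    show "(\<lambda>n. C * nrm (\<lambda>x. u n x - r x)) \<longlonglongrightarrow> 0" using tendsto_mult_right_zero[OF r(2)] .
    show "\<forall>\<^sub>F n in sequentially. cmod (l (u n) - l r) \<le> C * nrm (\<lambda>x. u n x - r x)"
      using C(2)[OF diff_mem[OF u(1) r(1)]] bounded_antilinearD(3)[OF l u(1) r(1)] by simp
  qed auto
  then have "(\<lambda>k. J (u k)) \<longlonglongrightarrow> J r"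
    unfolding J_def using nrm_tendsto[OF u(1) r] by (intro tendsto_diff tendsto_power tendsto_mult_left)
  moreover have "(\<lambda>k. I + 1 / real (Suc k)) \<longlonglongrightarrow> I + 0"
    by (intro tendsto_intros LIMSEQ_Suc[OF lim_1_over_n])
  ultimately have "J r \<le> I + 0"
    by (rule LIMSEQ_le) (use u(2) less_imp_le in blast)
  then have Jr: "J r \<le> J p" if "p \<in> V" for p using I[OF that] by simp
  have re: "Re (ip r q) = Re (l q)" if q: "q \<in> V" for q
  proof -
    define b where "b = Re (ip r q) - Re (l q)"
    have "0 \<le> t\<^sup>2 * (nrm q)\<^sup>2 + 2 * t * b" for t :: real
    proof -
      have tq: "(\<lambda>x. of_real t * q x) \<in> V" using scale_mem[OF q] .
      have "J r \<le> J (\<lambda>x. r x + of_real t * q x)" using Jr[OF add_mem[OF r(1) tq]] .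
      moreover have "Re (ip r (\<lambda>x. of_real t * q x)) = t * Re (ip r q)"
        using ip_scale_right[OF q r(1), of "of_real t"] by simp
      moreover have "(nrm (\<lambda>x. of_real t * q x))\<^sup>2 = t\<^sup>2 * (nrm q)\<^sup>2"
        using nrm_scale[OF q, of "of_real t"] by (simp add: power_mult_distrib)
      moreover have "Re (l (\<lambda>x. r x + of_real t * q x)) = Re (l r) + t * Re (l q)"
        using ladd[OF r(1) tq] lscale[OF q, of "of_real t"] by simp
      ultimately show ?thesis unfolding J_def b_def using nrm_add_square[OF r(1) tq]
        by (simp add: algebra_simps)
    qed
    \<comment> \<open>The quadratic in t has its minimum at - b / (nrm q)^2; the added 1 also covers
      a null q.\<close>
    from this[of "- b / ((nrm q)\<^sup>2 + 1)"]
    have "0 \<le> b\<^sup>2 * (nrm q)\<^sup>2 / ((nrm q)\<^sup>2 + 1)\<^sup>2 - 2 * b\<^sup>2 / ((nrm q)\<^sup>2 + 1)"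
      by (simp add: power_divide power2_eq_square)
    moreover have "b\<^sup>2 * (nrm q)\<^sup>2 / ((nrm q)\<^sup>2 + 1)\<^sup>2 \<le> b\<^sup>2 / ((nrm q)\<^sup>2 + 1)"
    proof -
      have p: "(nrm q)\<^sup>2 + 1 > 0" by (simp add: add_nonneg_pos)
      have "b\<^sup>2 * (nrm q)\<^sup>2 / ((nrm q)\<^sup>2 + 1)\<^sup>2 = b\<^sup>2 / ((nrm q)\<^sup>2 + 1) * ((nrm q)\<^sup>2 / ((nrm q)\<^sup>2 + 1))"
        by (simp add: power2_eq_square)
      also have "\<dots> \<le> b\<^sup>2 / ((nrm q)\<^sup>2 + 1) * 1"
        by (intro mult_left_mono) (use p in \<open>auto simp: divide_le_eq\<close>)
      finally show ?thesis by simp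
    qed
    ultimately have "b\<^sup>2 / ((nrm q)\<^sup>2 + 1) \<le> 0" by simp
    then have "b\<^sup>2 \<le> 0" by (simp add: divide_le_0_iff add_nonneg_pos not_le)
      (smt (verit, best) zero_le_power2)
    then show ?thesis by (simp add: b_def)
  qed
  have "l q = ip r q" if q: "q \<in> V" for q
  proof (rule complex_eqI)
    show "Re (l q) = Re (ip r q)" using re[OF q] by simp
    \<comment> \<open>Replacing q by \<i> q turns real parts into imaginary parts, since both sides
      are antilinear in q.\<close>
    have "Re (ip r (\<lambda>x. \<i> * q x)) = Re (l (\<lambda>x. \<i> * q x))" by (rule re[OF scale_mem[OF q]])
    then show "Im (l q) = Im (ip r q)" by (simp add: ip_scale_right[OF q r(1)] lscale[OF q])
  qed
  with r(1) that show ?thesis by blast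
qed

text \<open>Richardson iteration \<open>p \<mapsto> p + \<rho> r\<close>, where \<open>r\<close> represents the residual.\<close>

theorem Lax_Milgram:
  assumes t: "\<And>p. p \<in> V \<Longrightarrow> bounded_antilinear (t p)"
    and tadd: "\<And>p p' q. p \<in> V \<Longrightarrow> p' \<in> V \<Longrightarrow> q \<in> V \<Longrightarrow> t (\<lambda>x. p x + p' x) q = t p q + t p' q"
    and tscale: "\<And>c p q. p \<in> V \<Longrightarrow> q \<in> V \<Longrightarrow> t (\<lambda>x. c * p x) q = c * t p q"
    and tbound: "\<And>p q. p \<in> V \<Longrightarrow> q \<in> V \<Longrightarrow> cmod (t p q) \<le> B * nrm p * nrm q"
    and coercive: "\<And>p. p \<in> V \<Longrightarrow> c * (nrm p)\<^sup>2 \<le> Re (t p p)" and c: "c > 0"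
    and l: "bounded_antilinear l"
  obtains p where "p \<in> V" "\<And>q. q \<in> V \<Longrightarrow> t p q = l q"
proof -
  \<comment> \<open>The maximum with 2 c forces c < A even when the given bound B is small, so that
    \<theta> below is the root of a positive number.\<close>
  define A where "A = max B (2 * c)"
  have A: "A > 0" "c < A" using c by (auto simp: A_def)
  have tb: "cmod (t p q) \<le> A * nrm p * nrm q" if "p \<in> V" "q \<in> V" for p q
  proof -
    have "B * nrm p * nrm q \<le> A * nrm p * nrm q"
      unfolding A_def using that by (intro mult_right_mono) (auto simp: nrm_nonneg)
    then show ?thesis using tbound[OF that] by linarith
  qed
  \<comment> \<open>This \<rho> minimises 1 - 2 \<rho> c + \<rho>^2 A^2; the minimum 1 - (c/A)^2 is
    the square of \<theta>.\<close>
  define \<rho> where "\<rho> = c / A\<^sup>2"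
  have \<rho>: "\<rho> > 0" using c A by (simp add: \<rho>_def)
  have "\<exists>r\<in>V. \<forall>q\<in>V. l q - t p q = ip r q" if p: "p \<in> V" for p
  proof -
    have "bounded_antilinear (\<lambda>q. l q - t p q)"
      unfolding bounded_antilinear_def
    proof (intro conjI ballI allI)
      fix q q' assume q: "q \<in> V" "q' \<in> V"
      show "l (\<lambda>x. q x + q' x) - t p (\<lambda>x. q x + q' x) = l q - t p q + (l q' - t p q')"
        using bounded_antilinearD(1)[OF l q] bounded_antilinearD(1)[OF t[OF p] q] by simp
    next
      fix a q assume q: "q \<in> V"
      show "l (\<lambda>x. a * q x) - t p (\<lambda>x. a * q x) = cnj a * (l q - t p q)"
        using bounded_antilinearD(2)[OF l q] bounded_antilinearD(2)[OF t[OF p] q]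
        by (simp add: algebra_simps)
    next
      obtain C where C: "\<forall>q\<in>V. cmod (l q) \<le> C * nrm q" using bounded_antilinearD(4)[OF l] by auto
      have "cmod (l q - t p q) \<le> (C + A * nrm p) * nrm q" if "q \<in> V" for q
        using C that tb[OF p that] norm_triangle_ineq4[of "l q" "t p q"] by (simp add: algebra_simps) force
      then show "\<exists>C. \<forall>q\<in>V. cmod (l q - t p q) \<le> C * nrm q" by blast
    qed
    from Riesz[OF this] show ?thesis by metis
  qed
  then obtain R where R: "\<And>p. p \<in> V \<Longrightarrow> R p \<in> V" "\<And>p q. p \<in> V \<Longrightarrow> q \<in> V \<Longrightarrow> l q - t p q = ip (R p) q"
    by metis
  define u where "u = rec_nat (\<lambda>x. 0) (\<lambda>_ p x. p x + of_real \<rho> * R p x)"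
  have u0: "u 0 = (\<lambda>x. 0)" and uS: "u (Suc n) = (\<lambda>x. u n x + of_real \<rho> * R (u n) x)" for n
    by (simp_all add: u_def)
  have uV: "u n \<in> V" for n
    by (induction n) (auto simp: u0 uS zero_mem intro!: add_mem scale_mem R)
  define r where "r n = R (u n)" for n
  have rV: "r n \<in> V" for n using R(1) uV by (simp add: r_def)
  have rip: "ip (r n) q = l q - t (u n) q" if "q \<in> V" for n q
    using R(2)[OF uV that] by (simp add: r_def)
  have rS: "ip (r (Suc n)) q = ip (r n) q - of_real \<rho> * t (r n) q" if q: "q \<in> V" for n q
    using q uV rV unfolding rip[OF q] uS r_def[symmetric]
    by (simp add: tadd tscale scale_mem)
  define \<theta> where "\<theta> = sqrt (1 - (c / A)\<^sup>2)"
  have ca: "0 < c / A" "c / A < 1" using A c by auto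
  have "(c / A)\<^sup>2 < 1" using ca by (simp add: power_less_one_iff abs_square_less_1)
  then have \<theta>: "0 \<le> \<theta>" "\<theta> < 1" "\<theta>\<^sup>2 = 1 - (c / A)\<^sup>2" using ca by (auto simp: \<theta>_def)
  \<comment> \<open>The next residual represents the same functional as \<open>r n\<close> minus
    \<rho> times the representer w of \<open>t (r n)\<close>. Representers are fixed only up to null
    functions, so the two are compared through \<open>ip\<close>.\<close>
  have contr: "nrm (r (Suc n)) \<le> \<theta> * nrm (r n)" for n
  proof -
    let ?a = "r n" and ?b = "r (Suc n)"
    obtain w where w: "w \<in> V" "\<And>q. q \<in> V \<Longrightarrow> t ?a q = ip w q" using Riesz[OF t[OF rV[of n]]] by metis
    have wa: "nrm w \<le> A * nrm ?a"
    proof (cases "nrm w = 0")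
      case False
      have "(nrm w)\<^sup>2 = Re (t ?a w)" using w by (simp add: nrm_square)
      also have "\<dots> \<le> A * nrm ?a * nrm w" using tb[OF rV w(1)] complex_Re_le_cmod order_trans by blast
      finally show ?thesis using False nrm_nonneg[OF w(1)] by (simp add: power2_eq_square)
    qed (use A nrm_nonneg[OF rV] in simp)
    let ?d = "\<lambda>x. ?a x - of_real \<rho> * w x"
    have dV: "?d \<in> V" by (intro diff_mem scale_mem rV w)
    have bd: "ip ?b q = ip ?d q" if "q \<in> V" for q
      using that rS[OF that] w rV by (simp add: ip_diff_left scale_mem ip_scale_left)
    have "(nrm ?b)\<^sup>2 \<le> nrm ?d * nrm ?b"
      using bd[OF rV[of "Suc n"]] Cauchy_Schwarz[OF dV rV[of "Suc n"]] complex_Re_le_cmod[of "ip ?b ?b"]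
      by (simp add: nrm_square rV)
    then have "nrm ?b \<le> nrm ?d"
      using nrm_nonneg[OF rV[of "Suc n"]] nrm_nonneg[OF dV]
      by (cases "nrm ?b = 0") (auto simp: power2_eq_square)
    moreover have "nrm ?d \<le> \<theta> * nrm ?a"
    proof (rule power2_le_imp_le)
      have "Re (ip ?a w) = Re (t ?a ?a)" using arg_cong[OF ip_cnj[OF rV w(1), of n], of Re] w(2)[OF rV[of n]] by simp
      then have "Re (ip ?a (\<lambda>x. of_real \<rho> * w x)) = \<rho> * Re (t ?a ?a)"
        using ip_scale_right[OF w(1) rV, of n "of_real \<rho>"] by simp
      then have "(nrm ?d)\<^sup>2 = (nrm ?a)\<^sup>2 - 2 * \<rho> * Re (t ?a ?a) + \<rho>\<^sup>2 * (nrm w)\<^sup>2"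
        using nrm_diff_square[OF rV scale_mem[OF w(1)], of n "of_real \<rho>"] nrm_scale[OF w(1), of "of_real \<rho>"]
        by (simp add: power_mult_distrib)
      also have "\<dots> \<le> (nrm ?a)\<^sup>2 - 2 * \<rho> * (c * (nrm ?a)\<^sup>2) + \<rho>\<^sup>2 * (A * nrm ?a)\<^sup>2"
        using coercive[OF rV, of n] \<rho> wa nrm_nonneg[OF w(1)]
        by (intro add_mono diff_mono mult_left_mono power_mono) (auto simp: nrm_nonneg rV)
      also have "\<dots> = (\<theta> * nrm ?a)\<^sup>2"
        using A unfolding power_mult_distrib \<theta>(3) \<rho>_def
        by (simp add: field_simps power2_eq_square)
      finally show "(nrm ?d)\<^sup>2 \<le> (\<theta> * nrm ?a)\<^sup>2" .
    qed (use \<theta> nrm_nonneg[OF rV] in simp)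
    ultimately show ?thesis by linarith
  qed
  have geo: "nrm (r n) \<le> \<theta> ^ n * nrm (r 0)" for n
  proof (induction n)
    case (Suc n)
    have "nrm (r (Suc n)) \<le> \<theta> * (\<theta> ^ n * nrm (r 0))"
      using contr[of n] mult_left_mono[OF Suc \<theta>(1)] by linarith
    then show ?case by simp
  qed simp
  have inc: "nrm (\<lambda>x. u (n + k) x - u n x) \<le> \<rho> * nrm (r 0) * (\<Sum>i<k. \<theta> ^ (n + i))" for n k
  proof (induction k)
    case 0
    then show ?case using ip_zero_left[OF zero_mem] by (simp add: nrm_def)
  next
    case (Suc k)
    have "nrm (\<lambda>x. u (n + Suc k) x - u n x) \<le> nrm (\<lambda>x. u (n + Suc k) x - u (n + k) x) + nrm (\<lambda>x. u (n + k) x - u n x)"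
      by (rule nrm_triangle_diff) (rule uV)+
    also have "nrm (\<lambda>x. u (n + Suc k) x - u (n + k) x) = \<rho> * nrm (r (n + k))"
      using nrm_scale[OF rV, of "of_real \<rho>" "n + k"] \<rho> by (simp add: uS r_def)
    also have "\<dots> \<le> \<rho> * (\<theta> ^ (n + k) * nrm (r 0))" using geo[of "n + k"] \<rho> by simp
    finally show ?case using Suc by (simp add: algebra_simps)
  qed
  have cau: "nrm (\<lambda>x. u (n + k) x - u n x) \<le> \<rho> * nrm (r 0) / (1 - \<theta>) * \<theta> ^ n" for n k
  proof -
    have "(\<Sum>i<k. \<theta> ^ (n + i)) = \<theta> ^ n * (\<Sum>i<k. \<theta> ^ i)" by (simp add: power_add sum_distrib_left)
    also have "\<dots> \<le> \<theta> ^ n * (1 / (1 - \<theta>))"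
      using \<theta> by (intro mult_left_mono) (auto simp: sum_gp_strict intro!: divide_right_mono)
    finally have "\<rho> * nrm (r 0) * (\<Sum>i<k. \<theta> ^ (n + i)) \<le> \<rho> * nrm (r 0) * (\<theta> ^ n * (1 / (1 - \<theta>)))"
      using \<rho> nrm_nonneg[OF rV] by (intro mult_left_mono) auto
    then show ?thesis using inc[of n k] by (simp add: field_simps)
  qed
  have lim0: "(\<lambda>n. K * \<theta> ^ n) \<longlonglongrightarrow> 0" for K :: real
    using tendsto_mult_right_zero[OF LIMSEQ_realpow_zero[OF \<theta>(1,2)]] .
  have "\<exists>N. \<forall>m\<ge>N. \<forall>n\<ge>N. nrm (\<lambda>x. u m x - u n x) < e" if e: "e > 0" for e
  proof -
    obtain N where N: "\<And>n. n \<ge> N \<Longrightarrow> \<rho> * nrm (r 0) / (1 - \<theta>) * \<theta> ^ n < e"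
      using order_tendstoD(2)[OF lim0 e] unfolding eventually_sequentially by blast
    have "nrm (\<lambda>x. u m x - u n x) < e" if "n \<ge> N" "m \<ge> n" for m n
      using cau[of n "m - n"] N[OF that(1)] that by simp
    then show ?thesis using nrm_minus_commute[OF uV uV] by (metis nat_le_linear)
  qed
  then obtain p where p: "p \<in> V" "(\<lambda>n. nrm (\<lambda>x. u n x - p x)) \<longlonglongrightarrow> 0"
    by (rule complete'[of u, OF uV])
  have "t p q = l q" if q: "q \<in> V" for q
  proof -
    have "(\<lambda>n. t (u n) q) \<longlonglongrightarrow> t p q"
    proof (rule LIM_zero_cancel, rule tendsto_norm_zero_cancel, rule tendsto_sandwich[OF _ _ tendsto_const])
      show "(\<lambda>n. A * nrm q * nrm (\<lambda>x. u n x - p x)) \<longlonglongrightarrow> 0" using tendsto_mult_right_zero[OF p(2)] .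
      have "t (u n) q - t p q = t (\<lambda>x. u n x - p x) q" for n
        using tadd[OF uV scale_mem[OF p(1)] q, of n "-1"] tscale[OF p(1) q, of "-1"] by simp
      then show "\<forall>\<^sub>F n in sequentially. cmod (t (u n) q - t p q) \<le> A * nrm q * nrm (\<lambda>x. u n x - p x)"
        using tb[OF diff_mem[OF uV p(1)] q] by (simp add: mult_ac)
    qed auto
    moreover have "(\<lambda>n. l q - t (u n) q) \<longlonglongrightarrow> 0"
    proof (rule tendsto_norm_zero_cancel, rule tendsto_sandwich[OF _ _ tendsto_const])
      show "(\<lambda>n. nrm (r 0) * nrm q * \<theta> ^ n) \<longlonglongrightarrow> 0" by (rule lim0)
      have "cmod (l q - t (u n) q) \<le> \<theta> ^ n * nrm (r 0) * nrm q" for n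
        using Cauchy_Schwarz[OF rV q, of n] rip[OF q, of n] mult_right_mono[OF geo[of n] nrm_nonneg[OF q]] by simp
      then show "\<forall>\<^sub>F n in sequentially. cmod (l q - t (u n) q) \<le> nrm (r 0) * nrm q * \<theta> ^ n"
        by (simp add: mult_ac)
    qed auto
    then have "(\<lambda>n. l q - (l q - t (u n) q)) \<longlonglongrightarrow> l q - 0" by (intro tendsto_diff tendsto_const)
    then have "(\<lambda>n. t (u n) q) \<longlonglongrightarrow> l q" by simp
    ultimately show ?thesis using LIMSEQ_unique by blast
  qed
  with p(1) that show ?thesis by blast
qed

end

section \<open>Bessel's inequality and orthonormal expansions\<close>

context semi_inner_space
begin

lemma ip_orthonormal_sum:
  assumes "finite I" "\<And>i. i \<in> I \<Longrightarrow> e i \<in> V" "\<And>i j. i \<in> I \<Longrightarrow> j \<in> I \<Longrightarrow> ip (e i) (e j) = (if i = j then 1 else 0)"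
  shows "ip (\<lambda>x. \<Sum>i\<in>I. a i * e i x) (\<lambda>x. \<Sum>i\<in>I. b i * e i x) = (\<Sum>i\<in>I. a i * cnj (b i))"
proof -
  have "ip (\<lambda>x. \<Sum>i\<in>I. a i * e i x) (\<lambda>x. \<Sum>i\<in>I. b i * e i x)
      = (\<Sum>i\<in>I. \<Sum>j\<in>I. a i * (cnj (b j) * ip (e i) (e j)))"
    using assms(1,2) by (simp add: ip_sum_left ip_sum_right scale_mem sum_mem ip_scale_left ip_scale_right sum_distrib_left)
  also have "\<dots> = (\<Sum>i\<in>I. \<Sum>j\<in>I. if i = j then a i * cnj (b j) else 0)"
    using assms(3) by (intro sum.cong) auto
  finally show ?thesis using assms(1) by simp
qed

lemma nrm_orthonormal_sum:
  assumes "finite I" "\<And>i. i \<in> I \<Longrightarrow> e i \<in> V" "\<And>i j. i \<in> I \<Longrightarrow> j \<in> I \<Longrightarrow> ip (e i) (e j) = (if i = j then 1 else 0)"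
  shows "(nrm (\<lambda>x. \<Sum>i\<in>I. a i * e i x))\<^sup>2 = (\<Sum>i\<in>I. (cmod (a i))\<^sup>2)"
proof -
  have "(\<lambda>x. \<Sum>i\<in>I. a i * e i x) \<in> V" using assms(1,2) by (intro sum_mem scale_mem)
  then have "(nrm (\<lambda>x. \<Sum>i\<in>I. a i * e i x))\<^sup>2 = Re (\<Sum>i\<in>I. a i * cnj (a i))"
    by (simp add: nrm_square ip_orthonormal_sum[OF assms])
  also have "\<dots> = (\<Sum>i\<in>I. (cmod (a i))\<^sup>2)" by (simp add: complex_mult_cnj cmod_power2)
  finally show ?thesis .
qed

lemma Bessel:
  assumes I: "finite I" "\<And>i. i \<in> I \<Longrightarrow> e i \<in> V" "\<And>i j. i \<in> I \<Longrightarrow> j \<in> I \<Longrightarrow> ip (e i) (e j) = (if i = j then 1 else 0)"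
    and f: "f \<in> V"
  shows "(\<Sum>i\<in>I. (cmod (ip f (e i)))\<^sup>2) \<le> (nrm f)\<^sup>2"
proof -
  let ?s = "\<lambda>x. \<Sum>i\<in>I. ip f (e i) * e i x"
  have s: "?s \<in> V" using I by (intro sum_mem scale_mem)
  have "ip f ?s = (\<Sum>i\<in>I. cnj (ip f (e i)) * ip f (e i))"
    using I f by (simp add: ip_sum_right scale_mem ip_scale_right)
  then have "Re (ip f ?s) = (\<Sum>i\<in>I. (cmod (ip f (e i)))\<^sup>2)"
    by (simp add: cmod_power2 power2_eq_square[of "Re _"] power2_eq_square[of "Im _"])
  moreover have "0 \<le> (nrm (\<lambda>x. f x - ?s x))\<^sup>2" by simp
  ultimately show ?thesis using nrm_diff_square[OF f s] nrm_orthonormal_sum[OF I] by simp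
qed

end

context complete_semi_inner_space
begin

text \<open>Bessel's inequality bounds the sums of squared coefficients, hence the partial sums are
  Cauchy; their limit g has the coefficients of f, so totality makes g - f null. Summing along an
  exhaustion \<open>F\<close> by finite sets lets the index set consist of pairs.\<close>

theorem orthonormal_expansion:
  fixes F :: "nat \<Rightarrow> 'i set"
  assumes e: "\<And>i. e i \<in> V" "\<And>i j. ip (e i) (e j) = (if i = j then 1 else 0)"
    and F: "\<And>n. finite (F n)" "incseq F" "\<And>i. \<exists>n. i \<in> F n"
    and total: "\<And>g. g \<in> V \<Longrightarrow> (\<And>i. ip g (e i) = 0) \<Longrightarrow> nrm g = 0"
    and f: "f \<in> V"
  shows "(\<lambda>n. nrm (\<lambda>x. (\<Sum>i\<in>F n. ip f (e i) * e i x) - f x)) \<longlonglongrightarrow> 0"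
proof -
  define s where "s n = (\<lambda>x. \<Sum>i\<in>F n. ip f (e i) * e i x)" for n
  have sV: "s n \<in> V" for n unfolding s_def using F e by (intro sum_mem scale_mem) auto
  define b where "b n = (\<Sum>i\<in>F n. (cmod (ip f (e i)))\<^sup>2)" for n
  have diff: "(nrm (\<lambda>x. s m x - s n x))\<^sup>2 = b m - b n" if "n \<le> m" for m n
  proof -
    have sub: "F n \<subseteq> F m" using F(2) that by (auto simp: incseq_def)
    have "(\<lambda>x. s m x - s n x) = (\<lambda>x. \<Sum>i\<in>F m - F n. ip f (e i) * e i x)"
      unfolding s_def using sum_diff[OF F(1) sub] by metis
    then have "(nrm (\<lambda>x. s m x - s n x))\<^sup>2 = (\<Sum>i\<in>F m - F n. (cmod (ip f (e i)))\<^sup>2)"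
      using nrm_orthonormal_sum[of "F m - F n" e] F e by simp
    then show ?thesis unfolding b_def using sum_diff[OF F(1) sub] by metis
  qed
  have "b n \<le> (nrm f)\<^sup>2" for n unfolding b_def using Bessel[OF F(1) _ _ f] e by simp
  moreover have "b n \<le> b m" if "n \<le> m" for n m using diff[OF that] by (metis diff_ge_0_iff_ge zero_le_power2)
  then have "incseq b" by (simp add: incseq_def)
  ultimately have "Cauchy b"
    by (metis incseq_convergent LIMSEQ_imp_Cauchy)
  have "\<exists>N. \<forall>m\<ge>N. \<forall>n\<ge>N. nrm (\<lambda>x. s m x - s n x) < e" if "e > 0" for e
  proof -
    have "e\<^sup>2 > 0" using that by simp
    then obtain N where N: "\<And>m n. m \<ge> N \<Longrightarrow> n \<ge> N \<Longrightarrow> \<bar>b m - b n\<bar> < e\<^sup>2"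
      using \<open>Cauchy b\<close> by (metis CauchyD real_norm_def)
    have *: "nrm (\<lambda>x. s m x - s n x) < e" if "n \<ge> N" "n \<le> m" for m n
    proof (rule power2_less_imp_less)
      show "(nrm (\<lambda>x. s m x - s n x))\<^sup>2 < e\<^sup>2" using diff[OF that(2)] N[of m n] that by simp
    qed (use \<open>e > 0\<close> in simp)
    show ?thesis
    proof (intro exI allI impI)
      fix m n assume "m \<ge> N" "n \<ge> N"
      then show "nrm (\<lambda>x. s m x - s n x) < e"
        using *[of n m] *[of m n] nrm_minus_commute[OF sV sV, of m n] by (cases "n \<le> m") auto
    qed
  qed
  then obtain g where g: "g \<in> V" "(\<lambda>n. nrm (\<lambda>x. s n x - g x)) \<longlonglongrightarrow> 0"
    by (rule complete'[of s, OF sV])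
  have "ip (\<lambda>x. g x - f x) (e i) = 0" for i
  proof -
    have "(\<lambda>n. ip (s n) (e i)) \<longlonglongrightarrow> ip g (e i)" by (rule ip_tendsto_left[OF sV g e(1)])
    moreover obtain k where k: "i \<in> F k" using F(3) by blast
    have "ip (s n) (e i) = ip f (e i)" if "n \<ge> k" for n
    proof -
      have i: "i \<in> F n" using that F(2) k by (auto simp: incseq_def)
      have "ip (s n) (e i) = (\<Sum>j\<in>F n. ip f (e j) * ip (e j) (e i))"
        unfolding s_def using F e by (simp add: ip_sum_left scale_mem ip_scale_left del: e(2))
      also have "\<dots> = (\<Sum>j\<in>F n. if j = i then ip f (e j) else 0)" using e(2) by (intro sum.cong) auto
      finally show ?thesis using i F(1) by simp
    qed
    then have "(\<lambda>n. ip (s n) (e i)) \<longlonglongrightarrow> ip f (e i)"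
      by (intro tendsto_eventually) (auto simp: eventually_sequentially)
    ultimately have "ip g (e i) = ip f (e i)" using LIMSEQ_unique by blast
    then show ?thesis using g f e by (simp add: ip_diff_left)
  qed
  then have gf: "nrm (\<lambda>x. g x - f x) = 0" using total[OF diff_mem[OF g(1) f]] by blast
  show ?thesis
  proof (rule tendsto_sandwich[OF _ _ tendsto_const g(2)])
    show "\<forall>\<^sub>F n in sequentially. 0 \<le> nrm (\<lambda>x. (\<Sum>i\<in>F n. ip f (e i) * e i x) - f x)"
      using nrm_nonneg[OF diff_mem[OF sV f]] by (simp add: s_def)
    show "\<forall>\<^sub>F n in sequentially. nrm (\<lambda>x. (\<Sum>i\<in>F n. ip f (e i) * e i x) - f x) \<le> nrm (\<lambda>x. s n x - g x)"
      using nrm_triangle_diff[OF sV g(1) f] gf by (simp add: s_def)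
  qed
qed

end

section \<open>Completeness of the Lebesgue spaces\<close>

lemma L2_iff:
  "u \<in> L2 S \<longleftrightarrow> u \<in> borel_measurable (lebesgue_on S) \<and> integrable (lebesgue_on S) (\<lambda>x. (cmod (u x))\<^sup>2)"
  by (simp add: L2_def)

lemma L2_D: 
  assumes "u \<in> L2 S" shows "u \<in> borel_measurable (lebesgue_on S)" "integrable (lebesgue_on S) (\<lambda>x. (cmod (u x))\<^sup>2)"
  using assms by (auto simp: L2_iff)

lemma L2_mult_integrable:
  assumes u: "u \<in> L2 S" and v: "v \<in> L2 S"
  shows "integrable (lebesgue_on S) (\<lambda>x. u x * v x)"
proof (rule Bochner_Integration.integrable_bound)
  show "integrable (lebesgue_on S) (\<lambda>x. (cmod (u x))\<^sup>2 + (cmod (v x))\<^sup>2)"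
    by (intro Bochner_Integration.integrable_add L2_D u v)
  show "(\<lambda>x. u x * v x) \<in> borel_measurable (lebesgue_on S)"
    by (intro borel_measurable_times L2_D u v)
  show "AE x in lebesgue_on S. norm (u x * v x) \<le> norm ((cmod (u x))\<^sup>2 + (cmod (v x))\<^sup>2)"
  proof (rule AE_I2)
    fix x
    have "2 * cmod (u x) * cmod (v x) \<le> (cmod (u x))\<^sup>2 + (cmod (v x))\<^sup>2"
      using sum_squares_bound by blast
    moreover have "0 \<le> cmod (u x) * cmod (v x)" by simp
    ultimately have "cmod (u x) * cmod (v x) \<le> (cmod (u x))\<^sup>2 + (cmod (v x))\<^sup>2" by linarith
    then show "norm (u x * v x) \<le> norm ((cmod (u x))\<^sup>2 + (cmod (v x))\<^sup>2)"
      by (simp add: norm_mult)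
  qed
qed

lemma L2_cnj: "u \<in> L2 S \<Longrightarrow> (\<lambda>x. cnj (u x)) \<in> L2 S"
  unfolding L2_iff using borel_measurable_continuous_on[OF continuous_on_cnj[OF continuous_on_id]] by auto

lemma L2_inner_integrable:
  assumes "u \<in> L2 S" "v \<in> L2 S"
  shows "integrable (lebesgue_on S) (\<lambda>x. u x * cnj (v x))"
  using L2_mult_integrable[OF assms(1) L2_cnj[OF assms(2)]] .

lemma L2_add:
  assumes u: "u \<in> L2 S" and v: "v \<in> L2 S"
  shows "(\<lambda>x. u x + v x) \<in> L2 S"
  unfolding L2_iff
proof (rule conjI, rule_tac [2] Bochner_Integration.integrable_bound)
  show m: "(\<lambda>x. u x + v x) \<in> borel_measurable (lebesgue_on S)"
    by (intro borel_measurable_add L2_D u v)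
  show "integrable (lebesgue_on S) (\<lambda>x. 2 * (cmod (u x))\<^sup>2 + 2 * (cmod (v x))\<^sup>2)"
    by (intro Bochner_Integration.integrable_add integrable_mult_right L2_D u v)
  show "(\<lambda>x. (cmod (u x + v x))\<^sup>2) \<in> borel_measurable (lebesgue_on S)" using m by measurable
  show "AE x in lebesgue_on S. norm ((cmod (u x + v x))\<^sup>2) \<le> norm (2 * (cmod (u x))\<^sup>2 + 2 * (cmod (v x))\<^sup>2)"
  proof (rule AE_I2)
    fix x
    have "(cmod (u x + v x))\<^sup>2 \<le> (cmod (u x) + cmod (v x))\<^sup>2"
      by (intro power_mono norm_triangle_ineq) auto
    also have "\<dots> \<le> 2 * (cmod (u x))\<^sup>2 + 2 * (cmod (v x))\<^sup>2"
      using sum_squares_bound[of "cmod (u x)" "cmod (v x)"] by (simp add: power2_sum)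
    finally show "norm ((cmod (u x + v x))\<^sup>2) \<le> norm (2 * (cmod (u x))\<^sup>2 + 2 * (cmod (v x))\<^sup>2)" by simp
  qed
qed

lemma L2_scale: "u \<in> L2 S \<Longrightarrow> (\<lambda>x. c * u x) \<in> L2 S"
  unfolding L2_iff by (auto simp: norm_mult power_mult_distrib)

lemma L2_norm_nonneg: "0 \<le> L2_norm S u"
  by (simp add: L2_norm_def integral_nonneg_AE)

lemma L2_inner_self: "L2_inner S p p = of_real ((L2_norm S p)\<^sup>2)"
proof -
  have "L2_inner S p p = of_real (LINT x|lebesgue_on S. (cmod (p x))\<^sup>2)"
    unfolding L2_inner_def by (subst integral_complex_of_real[symmetric]) (simp add: complex_mult_cnj cmod_power2)
  then show ?thesis by (simp add: L2_norm_def integral_nonneg_AE)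
qed

lemma semi_inner_space_L2: "semi_inner_space (L2 S) (L2_inner S)"
proof
  fix p q r :: "'a \<Rightarrow> complex" and c
  show "(\<lambda>x. 0) \<in> L2 S" by (simp add: L2_iff)
  show "(\<lambda>x. p x + q x) \<in> L2 S" if "p \<in> L2 S" "q \<in> L2 S" using L2_add that by blast
  show "(\<lambda>x. c * p x) \<in> L2 S" if "p \<in> L2 S" using L2_scale that by blast
  show "L2_inner S (\<lambda>x. p x + q x) r = L2_inner S p r + L2_inner S q r"
    if "p \<in> L2 S" "q \<in> L2 S" "r \<in> L2 S"
    unfolding L2_inner_def distrib_right
    by (intro Bochner_Integration.integral_add L2_inner_integrable that)
  show "L2_inner S (\<lambda>x. c * p x) r = c * L2_inner S p r"
    if "p \<in> L2 S" "r \<in> L2 S"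
    by (simp add: L2_inner_def mult.assoc)
  show "cnj (L2_inner S p q) = L2_inner S q p"
    if "p \<in> L2 S" "q \<in> L2 S"
    unfolding L2_inner_def Bochner_Integration.integral_cnj[symmetric] by (simp add: mult.commute)
  show "0 \<le> Re (L2_inner S p p)" if "p \<in> L2 S"
    by (simp add: L2_inner_self)
qed

lemma nrm_L2: "semi_inner_space.nrm (L2_inner S) = L2_norm S"
  by (rule ext) (simp add: semi_inner_space.nrm_def[OF semi_inner_space_L2] L2_inner_self L2_norm_nonneg)

interpretation L2: semi_inner_space "L2 S" "L2_inner S"
  rewrites "semi_inner_space.nrm (L2_inner S) = L2_norm S"
  by (rule semi_inner_space_L2 nrm_L2)+

lemma L2_norm_eq_0_iff:
  assumes "u \<in> L2 S"
  shows "L2_norm S u = 0 \<longleftrightarrow> (AE x in lebesgue_on S. u x = 0)"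
  using integral_nonneg_eq_0_iff_AE[OF L2_D(2)[OF assms]] by (simp add: L2_norm_def)

lemma bounded_in_L2:
  assumes S: "S \<in> lmeasurable" and m: "u \<in> borel_measurable (lebesgue_on S)"
    and b: "\<And>x. x \<in> S \<Longrightarrow> cmod (u x) \<le> B"
  shows "u \<in> L2 S"
proof -
  have "integrable (lebesgue_on S) (\<lambda>x. (cmod (u x))\<^sup>2)"
  proof (rule Bochner_Integration.integrable_bound)
    show "integrable (lebesgue_on S) (\<lambda>x. B\<^sup>2)"
      using S by (intro finite_measure.integrable_const finite_measure_lebesgue_on)
    show "AE x in lebesgue_on S. norm ((cmod (u x))\<^sup>2) \<le> norm (B\<^sup>2)"
      using b by (auto intro!: AE_I2 power_mono simp: space_restrict_space)
  qed (use m in measurable)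
  then show ?thesis using m by (simp add: L2_iff)
qed

lemma L2_integrable:
  assumes S: "S \<in> lmeasurable" and u: "u \<in> L2 S"
  shows "integrable (lebesgue_on S) u"
proof -
  have "(\<lambda>x. 1) \<in> L2 S" using bounded_in_L2[OF S, of "\<lambda>x. 1" 1] by simp
  from L2_mult_integrable[OF u this] show ?thesis by simp
qed

lemma L1_le_L2:
  assumes S: "S \<in> lmeasurable" and u: "u \<in> L2 S"
  shows "(LINT x|lebesgue_on S. cmod (u x)) \<le> L2_norm S u * L2_norm S (\<lambda>x. 1)"
proof -
  have 1: "(\<lambda>x. 1) \<in> L2 S" using bounded_in_L2[OF S, of "\<lambda>x. 1" 1] by simp
  have a: "(\<lambda>x. of_real (cmod (u x))) \<in> L2 S"
    using u by (auto simp: L2_iff)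
  have "L2_inner S (\<lambda>x. of_real (cmod (u x))) (\<lambda>x. 1) = of_real (LINT x|lebesgue_on S. cmod (u x))"
    unfolding L2_inner_def by (subst integral_complex_of_real[symmetric]) simp
  with L2.Cauchy_Schwarz[OF a 1] have "\<bar>LINT x|lebesgue_on S. cmod (u x)\<bar> \<le> L2_norm S (\<lambda>x. of_real (cmod (u x))) * L2_norm S (\<lambda>x. 1)"
    by simp
  then show ?thesis by (simp add: L2_norm_def)
qed

text \<open>On a set of finite measure an L2-Cauchy sequence is Cauchy in L1, so a subsequence
  converges almost everywhere. Fatou's lemma along it bounds u n - p by the Cauchy estimate, which
  gives both membership of p and convergence of the whole sequence.\<close>

theorem complete_L2:
  assumes S: "S \<in> lmeasurable"
  shows "complete_semi_inner_space (L2 S) (L2_inner S)"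
proof (intro complete_semi_inner_space.intro semi_inner_space_L2, unfold_locales)
  fix u :: "nat \<Rightarrow> 'a \<Rightarrow> complex"
  assume u: "\<And>n. u n \<in> L2 S"
  have n: "sqrt (Re (L2_inner S p p)) = L2_norm S p" for p by (simp add: L2_inner_self L2_norm_nonneg)
  assume "\<And>e. e > 0 \<Longrightarrow> \<exists>N. \<forall>m\<ge>N. \<forall>n\<ge>N. sqrt (Re (L2_inner S (\<lambda>x. u m x - u n x) (\<lambda>x. u m x - u n x))) < e"
  then have C: "\<And>e. e > 0 \<Longrightarrow> \<exists>N. \<forall>m\<ge>N. \<forall>n\<ge>N. L2_norm S (\<lambda>x. u m x - u n x) < e"
    by (simp add: n)
  \<comment> \<open>The 1 keeps the divisor positive when S is a null set.\<close>
  let ?c = "L2_norm S (\<lambda>x. 1) + 1"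
  have c: "?c > 0" using L2_norm_nonneg[of S "\<lambda>x. 1"] by linarith
  have "\<exists>N. \<forall>m\<ge>N. \<forall>n\<ge>N. LINT x|lebesgue_on S. cmod (u m x - u n x) < e" if e: "e > 0" for e
  proof -
    obtain N where N: "\<forall>m\<ge>N. \<forall>n\<ge>N. L2_norm S (\<lambda>x. u m x - u n x) < e / ?c"
      using C[of "e / ?c"] e c by auto
    have "LINT x|lebesgue_on S. cmod (u m x - u n x) < e" if "m \<ge> N" "n \<ge> N" for m n
    proof -
      have "(LINT x|lebesgue_on S. cmod (u m x - u n x)) \<le> L2_norm S (\<lambda>x. u m x - u n x) * L2_norm S (\<lambda>x. 1)"
        by (rule L1_le_L2[OF S L2.diff_mem[OF u u]])
      also have "\<dots> \<le> L2_norm S (\<lambda>x. u m x - u n x) * ?c"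
        by (intro mult_left_mono L2_norm_nonneg) auto
      also have "\<dots> < e" using N that c by (simp add: field_simps)
      finally show ?thesis .
    qed
    then show ?thesis by blast
  qed
  then obtain r where r: "strict_mono r" "AE x in lebesgue_on S. Cauchy (\<lambda>i. u (r i) x)"
    using cauchy_L1_AE_cauchy_subseq[of "lebesgue_on S" u] L2_integrable[OF S u] by blast
  define p where "p x = lim (\<lambda>i. u (r i) x)" for x
  have lim: "AE x in lebesgue_on S. (\<lambda>i. u (r i) x) \<longlonglongrightarrow> p x"
    using r(2) by eventually_elim (simp add: p_def Cauchy_convergent_iff convergent_LIMSEQ_iff)
  have um: "u n \<in> borel_measurable (lebesgue_on S)" for n using L2_D(1)[OF u] .
  have pm: "p \<in> borel_measurable (lebesgue_on S)"
    unfolding p_def by (rule borel_measurable_lim_metric) (rule um)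
  have fatou: "integrable (lebesgue_on S) (\<lambda>x. (cmod (u n x - p x))\<^sup>2) \<and>
      (LINT x|lebesgue_on S. (cmod (u n x - p x))\<^sup>2) \<le> e\<^sup>2"
    if N: "\<forall>m\<ge>N. \<forall>n\<ge>N. L2_norm S (\<lambda>x. u m x - u n x) < e" and n: "n \<ge> N" for n N e
  proof -
    have e: "e > 0" using N n L2_norm_nonneg by (meson le_less_trans)
    have d: "L2_norm S (\<lambda>x. u n x - u m x) < e" if "m \<ge> N" for m using N n that by auto
    have "(\<integral>\<^sup>+x. ennreal ((cmod (u n x - p x))\<^sup>2) \<partial>lebesgue_on S)
      = (\<integral>\<^sup>+x. liminf (\<lambda>i. ennreal ((cmod (u n x - u (r i) x))\<^sup>2)) \<partial>lebesgue_on S)"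
    proof (rule nn_integral_cong_AE)
      show "AE x in lebesgue_on S. ennreal ((cmod (u n x - p x))\<^sup>2) = liminf (\<lambda>i. ennreal ((cmod (u n x - u (r i) x))\<^sup>2))"
        using lim
      proof eventually_elim
        case (elim x)
        then have "(\<lambda>i. ennreal ((cmod (u n x - u (r i) x))\<^sup>2)) \<longlonglongrightarrow> ennreal ((cmod (u n x - p x))\<^sup>2)"
          by (intro tendsto_ennrealI tendsto_power tendsto_norm tendsto_diff tendsto_const)
        from lim_imp_Liminf[OF _ this] show ?case by simp
      qed
    qed
    also have "\<dots> \<le> liminf (\<lambda>i. \<integral>\<^sup>+x. ennreal ((cmod (u n x - u (r i) x))\<^sup>2) \<partial>lebesgue_on S)"
      using um by (intro nn_integral_liminf) measurable
    also have "\<dots> \<le> ennreal (e\<^sup>2)"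
    proof (rule Liminf_le)
      show "\<forall>\<^sub>F i in sequentially. (\<integral>\<^sup>+x. ennreal ((cmod (u n x - u (r i) x))\<^sup>2) \<partial>lebesgue_on S) \<le> ennreal (e\<^sup>2)"
        unfolding eventually_sequentially
      proof (intro exI allI impI)
        fix i assume "i \<ge> N"
        then have "r i \<ge> N" using seq_suble[OF r(1), of i] by linarith
        have "(\<integral>\<^sup>+x. ennreal ((cmod (u n x - u (r i) x))\<^sup>2) \<partial>lebesgue_on S)
          = ennreal (LINT x|lebesgue_on S. (cmod (u n x - u (r i) x))\<^sup>2)"
          by (rule nn_integral_eq_integral) (use L2_D(2)[OF L2.diff_mem[OF u u]] in auto)
        also have "(LINT x|lebesgue_on S. (cmod (u n x - u (r i) x))\<^sup>2) = (L2_norm S (\<lambda>x. u n x - u (r i) x))\<^sup>2"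
          unfolding L2_norm_def by (subst real_sqrt_pow2) (auto intro!: integral_nonneg_AE)
        also have "\<dots> \<le> e\<^sup>2" using d[OF \<open>r i \<ge> N\<close>] by (intro power_mono L2_norm_nonneg) auto
        finally show "(\<integral>\<^sup>+x. ennreal ((cmod (u n x - u (r i) x))\<^sup>2) \<partial>lebesgue_on S) \<le> ennreal (e\<^sup>2)"
          by (simp add: ennreal_leI)
      qed
    qed simp
    finally have f: "(\<integral>\<^sup>+x. ennreal ((cmod (u n x - p x))\<^sup>2) \<partial>lebesgue_on S) \<le> ennreal (e\<^sup>2)" .
    have i: "integrable (lebesgue_on S) (\<lambda>x. (cmod (u n x - p x))\<^sup>2)"
    proof (rule integrableI_bounded)
      show "(\<integral>\<^sup>+x. ennreal (norm ((cmod (u n x - p x))\<^sup>2)) \<partial>lebesgue_on S) < \<infinity>"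
        using f by (simp add: le_less_trans)
    qed (use um pm in measurable)
    moreover have "ennreal (LINT x|lebesgue_on S. (cmod (u n x - p x))\<^sup>2) \<le> ennreal (e\<^sup>2)"
      using f nn_integral_eq_integral[OF i] by simp
    ultimately show ?thesis by (simp add: ennreal_le_iff)
  qed
  obtain N1 where N1: "\<forall>m\<ge>N1. \<forall>n\<ge>N1. L2_norm S (\<lambda>x. u m x - u n x) < 1" using C[of 1] by auto
  have "(\<lambda>x. u N1 x - p x) \<in> L2 S"
    using fatou[OF N1, of N1] um pm by (simp add: L2_iff)
  from L2.diff_mem[OF u[of N1] this] have p: "p \<in> L2 S" by simp
  have "(\<lambda>n. L2_norm S (\<lambda>x. u n x - p x)) \<longlonglongrightarrow> 0"
  proof (rule LIMSEQ_I)
    fix e :: real assume e: "e > 0"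
    obtain N where N: "\<forall>m\<ge>N. \<forall>n\<ge>N. L2_norm S (\<lambda>x. u m x - u n x) < e/2" using C[of "e/2"] e by auto
    have b: "L2_norm S (\<lambda>x. u n x - p x) \<le> e/2" if "n \<ge> N" for n
      using fatou[OF N that] e unfolding L2_norm_def by (intro real_le_lsqrt) auto
    have "norm (L2_norm S (\<lambda>x. u n x - p x) - 0) < e" if "n \<ge> N" for n
      using e L2_norm_nonneg[of S "\<lambda>x. u n x - p x"] b[OF that] by simp
    then show "\<exists>no. \<forall>n\<ge>no. norm (L2_norm S (\<lambda>x. u n x - p x) - 0) < e" by blast
  qed
  with p show "\<exists>p\<in>L2 S. (\<lambda>n. sqrt (Re (L2_inner S (\<lambda>x. u n x - p x) (\<lambda>x. u n x - p x)))) \<longlonglongrightarrow> 0"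
    by (auto simp: n)
qed

lemma Omega_b_eq_box: "Omega_b d xm xp = box (xm, 0) (xp, d)"
  by (auto simp: Omega_b_def Omega_def box_def Basis_prod_def)

lemma lmeasurable_Omega_b: "Omega_b d xm xp \<in> lmeasurable"
  by (simp add: Omega_b_eq_box)

lemmas L2_complete = complete_semi_inner_space.complete'[OF complete_L2, unfolded nrm_L2]

lemmas L2_orthonormal_expansion = complete_semi_inner_space.orthonormal_expansion[OF complete_L2, unfolded nrm_L2]

section \<open>Smooth functions\<close>

definition smooth1 :: "(real \<Rightarrow> 'b::real_normed_vector) \<Rightarrow> bool" where
  "smooth1 f \<longleftrightarrow> (\<exists>D :: nat \<Rightarrow> real \<Rightarrow> 'b. D 0 = f \<and> (\<forall>i x. (D i has_vector_derivative D (Suc i) x) (at x)))"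

text \<open>A class of functions closed under differentiation contains only smooth ones: iterating
  the choice of a derivative produces the sequence \<open>D\<close>. Closure properties then require
  only first derivatives.\<close>

lemma smooth1_coinduct:
  assumes "P f" and step: "\<And>g. P g \<Longrightarrow> \<exists>g'. P g' \<and> (\<forall>x. (g has_vector_derivative g' x) (at x))"
  shows "smooth1 f"
proof -
  have "\<exists>D. D 0 = f \<and> (\<forall>n. P (D n) \<and> (\<forall>x. (D n has_vector_derivative D (Suc n) x) (at x)))"
  proof -
    define N where "N g = (SOME g'. P g' \<and> (\<forall>x. (g has_vector_derivative g' x) (at x)))" for g
    have N: "P (N g) \<and> (\<forall>x. (g has_vector_derivative N g x) (at x))" if "P g" for g
      unfolding N_def by (rule someI_ex[OF step[OF that]])
    define D where "D n = (N ^^ n) f" for n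
    have "P (D n)" for n by (induction n) (auto simp: D_def assms(1) N)
    then show ?thesis using N by (intro exI[of _ D]) (auto simp: D_def)
  qed
  then show ?thesis unfolding smooth1_def by blast
qed

lemma smooth1_deriv:
  assumes "smooth1 f"
  obtains f' where "smooth1 f'" "\<And>x. (f has_vector_derivative f' x) (at x)"
proof -
  obtain D where D: "D 0 = f" "\<And>i x. (D i has_vector_derivative D (Suc i) x) (at x)"
    using assms by (auto simp: smooth1_def)
  have "smooth1 (D 1)" unfolding smooth1_def
    by (rule exI[of _ "\<lambda>i. D (Suc i)"]) (use D in auto)
  then show ?thesis using that[of "D 1"] D(2)[of 0] D(1) by simp
qed

lemma smooth1_antideriv:
  assumes "\<And>x. (f has_vector_derivative f' x) (at x)" "smooth1 f'"
  shows "smooth1 f"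
proof (rule smooth1_coinduct[where P = "\<lambda>g. g = f \<or> smooth1 g"])
  fix g assume "g = f \<or> smooth1 g"
  then show "\<exists>g'. (g' = f \<or> smooth1 g') \<and> (\<forall>x. (g has_vector_derivative g' x) (at x))"
    using assms smooth1_deriv[of g] by metis
qed simp

lemma smooth1_continuous: "smooth1 f \<Longrightarrow> continuous_on S f"
  by (metis smooth1_deriv continuous_at_imp_continuous_on has_vector_derivative_continuous)

lemma smooth1_const [simp]: "smooth1 (\<lambda>x. c)"
  by (rule smooth1_coinduct[where P = "\<lambda>g. \<exists>c. g = (\<lambda>x. c)"]) (auto intro!: exI[of _ "\<lambda>x. 0"])

lemma smooth1_add:
  assumes "smooth1 f" "smooth1 g" shows "smooth1 (\<lambda>x. f x + g x)"
proof (rule smooth1_coinduct[where P = "\<lambda>h. \<exists>f g. smooth1 f \<and> smooth1 g \<and> h = (\<lambda>x. f x + g x)"])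
  fix h :: "real \<Rightarrow> 'a" assume "\<exists>f g. smooth1 f \<and> smooth1 g \<and> h = (\<lambda>x. f x + g x)"
  then obtain f g where *: "smooth1 f" "smooth1 g" "h = (\<lambda>x. f x + g x)" by blast
  obtain f' where f: "smooth1 f'" "\<And>x. (f has_vector_derivative f' x) (at x)" using smooth1_deriv[OF *(1)] by blast
  obtain g' where g: "smooth1 g'" "\<And>x. (g has_vector_derivative g' x) (at x)" using smooth1_deriv[OF *(2)] by blast
  show "\<exists>h'. (\<exists>f g. smooth1 f \<and> smooth1 g \<and> h' = (\<lambda>x. f x + g x)) \<and> (\<forall>x. (h has_vector_derivative h' x) (at x))"
    using f g *(3) by (intro exI[of _ "\<lambda>x. f' x + g' x"]) (auto intro!: derivative_intros)
qed (use assms in blast)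

text \<open>By the Leibniz rule products alone are not closed under differentiation; finite sums of
  products are, and can serve as the coinduction class.\<close>

inductive product_sum :: "(real \<Rightarrow> 'a::real_normed_algebra) \<Rightarrow> bool" where
  product: "smooth1 f \<Longrightarrow> smooth1 g \<Longrightarrow> product_sum (\<lambda>x. f x * g x)"
| sum: "product_sum u \<Longrightarrow> product_sum v \<Longrightarrow> product_sum (\<lambda>x. u x + v x)"

lemma smooth1_mult:
  fixes f g :: "real \<Rightarrow> 'a::real_normed_algebra"
  assumes "smooth1 f" "smooth1 g" shows "smooth1 (\<lambda>x. f x * g x)"
proof (rule smooth1_coinduct[where P = product_sum])
  show "product_sum (\<lambda>x. f x * g x)" by (intro product assms)
  fix h :: "real \<Rightarrow> 'a" assume "product_sum h"
  then show "\<exists>h'. product_sum h' \<and> (\<forall>x. (h has_vector_derivative h' x) (at x))"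
  proof induction
    case (product f g)
    obtain f' where f: "smooth1 f'" "\<And>x. (f has_vector_derivative f' x) (at x)" using smooth1_deriv[OF product(1)] by blast
    obtain g' where g: "smooth1 g'" "\<And>x. (g has_vector_derivative g' x) (at x)" using smooth1_deriv[OF product(2)] by blast
    show ?case
      by (rule exI[of _ "\<lambda>x. f x * g' x + f' x * g x"])
        (use f g product in \<open>auto intro!: product_sum.intros derivative_intros\<close>)
  next
    case (sum u v)
    then obtain u' v' where "product_sum u'" "\<forall>x. (u has_vector_derivative u' x) (at x)"
      "product_sum v'" "\<forall>x. (v has_vector_derivative v' x) (at x)" by blast
    then show ?case
      by (intro exI[of _ "\<lambda>x. u' x + v' x"]) (auto intro!: product_sum.intros derivative_intros)
  qed
qed

lemma smooth1_sum: "(\<And>i. i \<in> I \<Longrightarrow> smooth1 (f i)) \<Longrightarrow> smooth1 (\<lambda>x. \<Sum>i\<in>I. f i x)"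
  by (induction I rule: infinite_finite_induct) (auto intro: smooth1_add)

lemma smooth1_linear:
  assumes "bounded_linear T" "smooth1 f" shows "smooth1 (\<lambda>x. T (f x))"
proof (rule smooth1_coinduct[where P = "\<lambda>h. \<exists>f. smooth1 f \<and> h = (\<lambda>x. T (f x))"])
  fix h assume "\<exists>f. smooth1 f \<and> h = (\<lambda>x. T (f x))"
  then obtain f where *: "smooth1 f" "h = (\<lambda>x. T (f x))" by blast
  obtain f' where f: "smooth1 f'" "\<And>x. (f has_vector_derivative f' x) (at x)" using smooth1_deriv[OF *(1)] by blast
  show "\<exists>h'. (\<exists>f. smooth1 f \<and> h' = (\<lambda>x. T (f x))) \<and> (\<forall>x. (h has_vector_derivative h' x) (at x))"
    using f *(2) bounded_linear.has_vector_derivative[OF assms(1)] by (intro exI[of _ "\<lambda>x. T (f' x)"]) auto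
qed (use assms in blast)

lemma smooth1_of_real: "smooth1 f \<Longrightarrow> smooth1 (\<lambda>x. of_real (f x) :: complex)"
  by (rule smooth1_linear[OF bounded_linear_of_real])

lemma smooth1_cnj: "smooth1 f \<Longrightarrow> smooth1 (\<lambda>x. cnj (f x))"
  by (rule smooth1_linear[OF bounded_linear_cnj])

lemma smooth1_affine:
  assumes "smooth1 f" shows "smooth1 (\<lambda>x. f (a * x + b))"
proof (rule smooth1_coinduct[where P = "\<lambda>h. \<exists>f c. smooth1 f \<and> h = (\<lambda>x. c *\<^sub>R f (a * x + b))"])
  fix h :: "real \<Rightarrow> 'a" assume "\<exists>f c. smooth1 f \<and> h = (\<lambda>x. c *\<^sub>R f (a * x + b))"
  then obtain f c where *: "smooth1 f" "h = (\<lambda>x. c *\<^sub>R f (a * x + b))" by blast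
  obtain f' where f: "smooth1 f'" "\<And>x. (f has_vector_derivative f' x) (at x)" using smooth1_deriv[OF *(1)] by blast
  have "((\<lambda>x. c *\<^sub>R f (a * x + b)) has_vector_derivative c *\<^sub>R (a *\<^sub>R f' (a * x + b))) (at x)" for x
  proof (intro bounded_linear.has_vector_derivative[OF bounded_linear_scaleR_right])
    have "((\<lambda>x. a * x + b) has_vector_derivative a) (at x)" by (auto intro!: derivative_eq_intros)
    from vector_diff_chain_at[OF this f(2)] show "((\<lambda>x. f (a * x + b)) has_vector_derivative a *\<^sub>R f' (a * x + b)) (at x)"
      by (simp add: o_def)
  qed
  then show "\<exists>h'. (\<exists>f c. smooth1 f \<and> h' = (\<lambda>x. c *\<^sub>R f (a * x + b))) \<and> (\<forall>x. (h has_vector_derivative h' x) (at x))"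
    using f * by (intro exI[of _ "\<lambda>x. (c * a) *\<^sub>R f' (a * x + b)"]) auto
qed (use assms in \<open>auto intro!: exI[of _ f] exI[of _ 1]\<close>)

lemma smooth1_exp: "smooth1 (\<lambda>x. exp (c * of_real x) :: complex)"
proof (rule smooth1_coinduct[where P = "\<lambda>h. \<exists>b. h = (\<lambda>x. b * exp (c * of_real x))"])
  fix h :: "real \<Rightarrow> complex" assume "\<exists>b. h = (\<lambda>x. b * exp (c * of_real x))"
  then obtain b where h: "h = (\<lambda>x. b * exp (c * of_real x))" by blast
  have "(h has_vector_derivative (b * c) * exp (c * of_real x)) (at x)" for x
  proof -
    have "((\<lambda>z. b * exp (c * z)) has_field_derivative (b * c) * exp (c * of_real x)) (at (of_real x))"
      by (auto intro!: derivative_eq_intros)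
    from has_vector_derivative_real_field[OF this] show ?thesis by (simp add: h)
  qed
  then show "\<exists>h'. (\<exists>b. h' = (\<lambda>x. b * exp (c * of_real x))) \<and> (\<forall>x. (h has_vector_derivative h' x) (at x))"
    by (intro exI[of _ "\<lambda>x. (b * c) * exp (c * of_real x)"]) auto
qed (auto intro: exI[of _ 1])

lemma smooth1_cos: "smooth1 (\<lambda>x::real. cos (a * x + b))" and smooth1_sin: "smooth1 (\<lambda>x::real. sin (a * x + b))"
proof -
  have "smooth1 (\<lambda>x. Re (exp (\<i> * of_real x)))" "smooth1 (\<lambda>x. Im (exp (\<i> * of_real x)))"
    by (intro smooth1_linear[OF bounded_linear_Re] smooth1_linear[OF bounded_linear_Im] smooth1_exp)+
  then have "smooth1 (\<lambda>x::real. cos x)" "smooth1 (\<lambda>x::real. sin x)" by (simp_all add: Re_exp Im_exp)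
  then show "smooth1 (\<lambda>x::real. cos (a * x + b))" "smooth1 (\<lambda>x::real. sin (a * x + b))"
    using smooth1_affine by blast+
qed

section \<open>Smooth cutoffs\<close>

definition flat :: "real poly \<Rightarrow> real \<Rightarrow> real" where
  "flat p x = (if x > 0 then poly p (inverse x) * exp (- inverse x) else 0)"

lemma flat_limit: "((\<lambda>x. poly p (inverse x) * exp (- inverse x)) \<longlongrightarrow> 0) (at_right (0::real))"
proof -
  have "((\<lambda>y. poly p y * exp (- y)) \<longlongrightarrow> 0) at_top"
  proof -
    have "((\<lambda>y. poly q y / exp y) \<longlongrightarrow> 0) at_top" for q :: "real poly"
    proof -
      have "((\<lambda>y. \<Sum>i\<le>degree q. coeff q i * (y ^ i / exp y)) \<longlongrightarrow> (\<Sum>i\<le>degree q. coeff q i * 0)) at_top"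
        by (intro tendsto_sum tendsto_mult_left tendsto_power_div_exp_0)
      then show ?thesis by (simp add: poly_altdef sum_divide_distrib)
    qed
    then show ?thesis by (simp add: exp_minus divide_inverse)
  qed
  then show ?thesis
    by (rule filterlim_compose[of _ _ at_top]) (rule filterlim_inverse_at_top_right)
qed

text \<open>The functions p(1/x) exp(-1/x), extended by 0 to x \<le> 0, are closed under
  differentiation. The polynomial 1 gives the classical function that is flat at 0.\<close>

lemma smooth1_flat: "smooth1 (flat p)"
proof (rule smooth1_coinduct[where P = "\<lambda>h. \<exists>p. h = flat p"])
  fix h assume "\<exists>p. h = flat p"
  then obtain p where h: "h = flat p" by blast
  \<comment> \<open>In y = 1/x the derivative of p(y) exp(-y) with respect to x is y^2 (p(y) -
    p'(y)) exp(-y).\<close>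
  define q where "q = [:0, 0, 1:] * (p - pderiv p)"
  have "(flat p has_real_derivative flat q x) (at x)" for x
  proof -
    consider "x > 0" | "x < 0" | "x = 0" by linarith
    then show ?thesis
    proof cases
      case 1
      have "((\<lambda>x. poly p (inverse x) * exp (- inverse x)) has_real_derivative flat q x) (at x)"
        using 1 by (auto intro!: derivative_eq_intros simp: flat_def q_def algebra_simps power2_eq_square)
      then show ?thesis
      proof (rule DERIV_cong_ev[OF refl _ refl, THEN iffD1, rotated])
        show "\<forall>\<^sub>F y in nhds x. poly p (inverse y) * exp (- inverse y) = flat p y"
          using eventually_nhds_in_open[of "{0<..}" x] 1 by (auto simp: flat_def elim!: eventually_mono)
      qed
    next
      case 2
      have "((\<lambda>x. 0) has_real_derivative flat q x) (at x)" using 2 by (simp add: flat_def)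
      then show ?thesis
      proof (rule DERIV_cong_ev[OF refl _ refl, THEN iffD1, rotated])
        show "\<forall>\<^sub>F y in nhds x. 0 = flat p y"
          using eventually_nhds_in_open[of "{..<0}" x] 2 by (auto simp: flat_def elim!: eventually_mono)
      qed
    next
      case 3
      \<comment> \<open>The difference quotient at 0 is of the same form, with p multiplied by the
        variable.\<close>
      have "((\<lambda>y. flat p y / y) \<longlongrightarrow> 0) (at_right 0)"
      proof (rule Lim_transform_eventually[OF flat_limit[of "pCons 0 p"]])
        show "\<forall>\<^sub>F y in at_right 0. poly (pCons 0 p) (inverse y) * exp (- inverse y) = flat p y / y"
          by (auto simp: eventually_at_right_field flat_def field_simps intro!: exI[of _ 1])
      qed
      moreover have "((\<lambda>y. flat p y / y) \<longlongrightarrow> 0) (at_left 0)"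
      proof (rule Lim_transform_eventually[OF tendsto_const[of 0]])
        show "\<forall>\<^sub>F y in at_left 0. 0 = flat p y / y"
          by (auto simp: eventually_at_left_field flat_def intro!: exI[of _ "-1"])
      qed
      ultimately have "((\<lambda>y. flat p y / y) \<longlongrightarrow> 0) (at 0)" by (simp add: filterlim_split_at)
      then show ?thesis unfolding 3 has_field_derivative_iff by (simp add: flat_def)
    qed
  qed
  then show "\<exists>h'. (\<exists>p. h' = flat p) \<and> (\<forall>x. (h has_vector_derivative h' x) (at x))"
    by (auto simp: h has_real_derivative_iff_has_vector_derivative)
qed auto

text \<open>The bound on \<open>x * h' x\<close> is the scale-invariant one: for h rescaled by N the
  derivative grows like N, but times the distance to the edge it stays bounded. h is the normalised
  integral of a bump supported in [1, 2].\<close>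

lemma smooth_step:
  "\<exists>(h :: real \<Rightarrow> real) h' C. smooth1 h \<and> (\<forall>x. (h has_vector_derivative h' x) (at x)) \<and>
    (\<forall>x. \<bar>h x\<bar> \<le> 1) \<and> (\<forall>x\<le>1. h x = 0) \<and> (\<forall>x\<ge>2. h x = 1) \<and> (\<forall>x\<ge>2. h' x = 0) \<and>
    (\<forall>x. \<bar>x * h' x\<bar> \<le> C) \<and> C \<ge> 0"
proof -
  define b where "b x = flat 1 (x - 1) * flat 1 (2 - x)" for x
  have b: "smooth1 b" unfolding b_def
    using smooth1_mult[OF smooth1_affine[OF smooth1_flat, of 1 1 "-1"] smooth1_affine[OF smooth1_flat, of 1 "-1" 2]]
    by simp
  have bc: "continuous_on S b" for S by (rule smooth1_continuous[OF b])
  have fl: "0 \<le> flat 1 x" "flat 1 x \<le> 1" for x by (auto simp: flat_def)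
  have b0: "0 \<le> b x" "b x \<le> 1" for x using fl by (auto simp: b_def mult_le_one)
  have bz: "b x = 0" if "x \<le> 1 \<or> x \<ge> 2" for x using that by (auto simp: b_def flat_def)
  define B where "B = integral {0..2} b"
  have bi: "b integrable_on {u..v}" for u v by (rule integrable_continuous_real[OF bc])
  have B: "B > 0"
  proof -
    have "0 \<le> B" unfolding B_def by (rule integral_nonneg[OF bi]) (use b0 in auto)
    moreover have "B \<noteq> 0"
    proof
      assume "B = 0"
      then have "(b has_integral 0) (cbox 0 2)" using bi[of 0 2] unfolding B_def by (simp add: has_integral_integral)
      from has_integral_0_cbox_imp_0[OF bc _ this, of "3/2"] b0 have "b (3/2) = 0" by (auto simp: box_real)
      then show False by (simp add: b_def flat_def)
    qed
    ultimately show ?thesis by linarith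
  qed
  define h where "h x = integral {0..x} b / B" for x
  have h0: "h x = 0" if "x \<le> 1" for x
  proof -
    have "integral {0..x} b = integral {0..x} (\<lambda>x. 0)" by (rule integral_cong) (use that bz in auto)
    then show ?thesis by (simp add: h_def)
  qed
  have h2: "h x = 1" if "x \<ge> 2" for x
  proof -
    have "integral {0..2} b + integral {2..x} b = integral {0..x} b"
      by (rule Henstock_Kurzweil_Integration.integral_combine[OF _ _ bi]) (use that in auto)
    moreover have "integral {2..x} b = integral {2..x} (\<lambda>x. 0)" by (rule integral_cong) (use bz in auto)
    ultimately show ?thesis using B by (simp add: h_def B_def)
  qed
  \<comment> \<open>The fundamental theorem is applied on [0, x + 1], so the points below 1, where h
    is locally 0, are treated apart.\<close>
  have hd: "(h has_vector_derivative b x / B) (at x)" for x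
  proof (cases "x < 1")
    case True
    have "((\<lambda>x. 0) has_vector_derivative b x / B) (at x)" using True bz by simp
    then show ?thesis
    proof (rule has_vector_derivative_transform_within_open[of _ _ _ "{..<1}"])
    qed (use True h0 in auto)
  next
    case False
    have "((\<lambda>u. integral {0..u} b) has_vector_derivative b x) (at x within {0..x+1})"
      by (rule integral_has_vector_derivative[OF bc]) (use False in auto)
    then have "((\<lambda>u. integral {0..u} b) has_vector_derivative b x) (at x)"
      using False by (subst (asm) at_within_interior) auto
    from has_vector_derivative_divide[OF this, of B] show ?thesis by (simp add: h_def[abs_def])
  qed
  have sb: "smooth1 (\<lambda>x. b x / B)" using smooth1_mult[OF b smooth1_const[of "1/B"]] by simp
  have "\<bar>h x\<bar> \<le> 1" for x
  proof (cases "x \<le> 2")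
    case True
    have "0 \<le> integral {0..x} b" by (rule integral_nonneg[OF bi]) (use b0 in auto)
    moreover have "integral {0..x} b \<le> B" unfolding B_def
      by (rule integral_subset_le) (use True bi b0 in auto)
    ultimately show ?thesis using B by (simp add: h_def)
  qed (use h2 in auto)
  moreover have "\<bar>x * (b x / B)\<bar> \<le> 2 / B" for x
  proof (cases "1 < x \<and> x < 2")
    case True
    then have "\<bar>x * b x\<bar> \<le> 2 * 1" unfolding abs_mult using b0 by (intro mult_mono) auto
    then show ?thesis using B by (simp add: abs_mult divide_right_mono)
  qed (use bz B in auto)
  ultimately show ?thesis
    using smooth1_antideriv[OF hd sb] sb hd h0 h2 bz B
    by (intro exI[of _ h] exI[of _ "\<lambda>x. b x / B"] exI[of _ "2 / B"]) auto
qed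

text \<open>Cutting a off near both ends leaves bounded functions, but the derivatives of the
  cutoffs have size N. If a vanishes at the ends, |a| is at most K times the distance to an end, and
  this compensates the growth since \<open>x * h' x\<close> is bounded.\<close>

lemma cutoff_sequence:
  fixes a a' :: "real \<Rightarrow> real"
  assumes a: "smooth1 a" "smooth1 a'" "\<And>x. (a has_vector_derivative a' x) (at x)" and lr: "l < r"
  obtains A A' :: "nat \<Rightarrow> real \<Rightarrow> real" and C where
    "\<And>k. smooth1 (A k)" "\<And>k x. (A k has_vector_derivative A' k x) (at x)"
    "\<And>k. \<exists>\<delta>>0. \<forall>x. A k x \<noteq> 0 \<longrightarrow> l + \<delta> \<le> x \<and> x \<le> r - \<delta>"
    "\<And>x. x \<in> {l<..<r} \<Longrightarrow> (\<lambda>k. A k x) \<longlonglongrightarrow> a x" "\<And>k x. x \<in> {l<..<r} \<Longrightarrow> \<bar>A k x\<bar> \<le> C"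
    "\<And>x. x \<in> {l<..<r} \<Longrightarrow> (\<lambda>k. A' k x) \<longlonglongrightarrow> a' x"
    "a l = 0 \<Longrightarrow> a r = 0 \<Longrightarrow> \<forall>k. \<forall>x\<in>{l<..<r}. \<bar>A' k x\<bar> \<le> C"
proof -
  obtain h h' C0 where H: "smooth1 h \<and> (\<forall>x::real. (h has_vector_derivative h' x) (at x)) \<and>
    (\<forall>x. \<bar>h x :: real\<bar> \<le> 1) \<and> (\<forall>x\<le>1. h x = 0) \<and> (\<forall>x\<ge>2. h x = 1) \<and> (\<forall>x\<ge>2. h' x = 0) \<and>
    (\<forall>x. \<bar>x * h' x\<bar> \<le> C0) \<and> C0 \<ge> 0" using smooth_step by blast
  then have h: "smooth1 h" "smooth1 h" "\<And>x. (h has_vector_derivative h' x) (at x)"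
    "\<And>x. \<bar>h x\<bar> \<le> 1" "\<And>x. x \<le> 1 \<Longrightarrow> h x = 0" "\<And>x. x \<ge> 2 \<Longrightarrow> h x = 1"
    "\<And>x. x \<ge> 2 \<Longrightarrow> h' x = 0" "\<And>x::real. \<bar>x * h' x\<bar> \<le> C0" "C0 \<ge> 0" by auto
  define N where "N k = real (Suc k)" for k
  have N: "N k > 0" for k by (simp add: N_def)
  define L where "L k x = h (N k * (x - l))" for k x
  define R where "R k x = h (N k * (r - x))" for k x
  define L' where "L' k x = N k * h' (N k * (x - l))" for k x
  define R' where "R' k x = - N k * h' (N k * (r - x))" for k x
  have L: "(L k has_vector_derivative L' k x) (at x)" for k x
  proof -
    have "((\<lambda>x. N k * (x - l)) has_vector_derivative N k) (at x)" by (auto intro!: derivative_eq_intros)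
    from vector_diff_chain_at[OF this h(3)] show ?thesis by (simp add: o_def L_def[abs_def] L'_def)
  qed
  have R: "(R k has_vector_derivative R' k x) (at x)" for k x
  proof -
    have "((\<lambda>x. N k * (r - x)) has_vector_derivative - N k) (at x)" by (auto intro!: derivative_eq_intros)
    from vector_diff_chain_at[OF this h(3)] show ?thesis by (simp add: o_def R_def[abs_def] R'_def)
  qed
  have Ls: "smooth1 (L k)" for k using smooth1_affine[OF h(1), of "N k" "- N k * l"] by (simp add: L_def[abs_def] algebra_simps)
  have Rs: "smooth1 (R k)" for k using smooth1_affine[OF h(1), of "- N k" "N k * r"] by (simp add: R_def[abs_def] algebra_simps)
  define A where "A k x = a x * (L k x * R k x)" for k x
  define A' where "A' k x = a x * (L k x * R' k x + L' k x * R k x) + a' x * (L k x * R k x)" for k x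
  have b: "\<exists>K. \<forall>x\<in>{l..r}. \<bar>f x\<bar> \<le> K" if "smooth1 f" for f :: "real \<Rightarrow> real"
  proof -
    have "bounded (f ` {l..r})"
      by (intro compact_imp_bounded compact_continuous_image smooth1_continuous[OF that] compact_Icc)
    then show ?thesis by (simp add: bounded_iff)
  qed
  obtain Ka where Ka: "\<And>x. x \<in> {l..r} \<Longrightarrow> \<bar>a x\<bar> \<le> Ka" using b[OF a(1)] by blast
  obtain K where K: "\<And>x. x \<in> {l..r} \<Longrightarrow> \<bar>a' x\<bar> \<le> K" using b[OF a(2)] by blast
  have K0: "K \<ge> 0" using K[of l] lr by simp
  have lip: "\<bar>a x - a y\<bar> \<le> K * \<bar>x - y\<bar>" if "x \<in> {l..r}" "y \<in> {l..r}" for x y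
  proof -
    have "norm (a x - a y) \<le> K * norm (x - y)"
      by (rule field_differentiable_bound[of "{l..r}"])
        (use a(3) K that in \<open>auto simp: has_real_derivative_iff_has_vector_derivative intro: has_vector_derivative_at_within\<close>)
    then show ?thesis by simp
  qed
  have ev: "\<forall>\<^sub>F k in sequentially. N k * t \<ge> 2 \<and> N k * s \<ge> 2" if "t > 0" "s > 0" for t s
  proof -
    have lim: "filterlim (\<lambda>k. N k * t) at_top sequentially" if "t > 0" for t
      unfolding N_def using that
      by (intro filterlim_at_top_mult_tendsto_pos[OF tendsto_const] filterlim_compose[OF filterlim_real_sequentially filterlim_Suc])
    show ?thesis using lim[OF that(1)] lim[OF that(2)] unfolding filterlim_at_top by (auto intro: eventually_conj)
  qed
  show ?thesis
  \<comment> \<open>\<open>Ka\<close> bounds the functions; in the derivatives each of the two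
    cutoffs contributes \<open>K * C0\<close> and the derivative of a contributes
    \<open>K\<close>.\<close>
  proof (rule that[of A A' "max Ka (K * C0 + K * C0 + K)"])
    show "smooth1 (A k)" for k unfolding A_def by (intro smooth1_mult a Ls Rs)
    show "(A k has_vector_derivative A' k x) (at x)" for k x
      unfolding A_def A'_def by (intro has_vector_derivative_mult a(3) L R)
    show "\<exists>\<delta>>0. \<forall>x. A k x \<noteq> 0 \<longrightarrow> l + \<delta> \<le> x \<and> x \<le> r - \<delta>" for k
    proof (intro exI[of _ "1 / N k"] conjI allI impI)
      show "1 / N k > 0" using N by simp
      fix x assume "A k x \<noteq> 0"
      then have "L k x \<noteq> 0" "R k x \<noteq> 0" by (auto simp: A_def)
      then have "N k * (x - l) > 1" "N k * (r - x) > 1"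
        using h(5)[of "N k * (x - l)"] h(5)[of "N k * (r - x)"] unfolding L_def R_def by (metis not_le)+
      then show "l + 1 / N k \<le> x" "x \<le> r - 1 / N k" using N[of k] by (auto simp: field_simps)
    qed
    show "(\<lambda>k. A k x) \<longlonglongrightarrow> a x" if "x \<in> {l<..<r}" for x
    proof (rule tendsto_eventually)
      show "\<forall>\<^sub>F k in sequentially. A k x = a x"
        by (rule eventually_mono[OF ev[of "x - l" "r - x"]]) (use that in \<open>auto simp: A_def L_def R_def h\<close>)
    qed
    show "(\<lambda>k. A' k x) \<longlonglongrightarrow> a' x" if "x \<in> {l<..<r}" for x
    proof (rule tendsto_eventually)
      show "\<forall>\<^sub>F k in sequentially. A' k x = a' x"
        by (rule eventually_mono[OF ev[of "x - l" "r - x"]]) (use that in \<open>auto simp: A'_def L_def R_def L'_def R'_def h\<close>)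
    qed
    have LR: "\<bar>L k x\<bar> \<le> 1" "\<bar>R k x\<bar> \<le> 1" "\<bar>L k x * R k x\<bar> \<le> 1" for k x
      using h(4) by (auto simp: L_def R_def abs_mult mult_le_one)
    show "\<bar>A k x\<bar> \<le> max Ka (K * C0 + K * C0 + K)" if "x \<in> {l<..<r}" for k x
    proof -
      have "\<bar>A k x\<bar> \<le> Ka * 1" unfolding A_def abs_mult[of "a x"]
        by (rule mult_mono) (use Ka[of x] that LR in auto)
      then show ?thesis by simp
    qed
    show "\<forall>k. \<forall>x\<in>{l<..<r}. \<bar>A' k x\<bar> \<le> max Ka (K * C0 + K * C0 + K)" if z: "a l = 0" "a r = 0"
    proof (intro allI ballI)
      fix k x assume x: "x \<in> {l<..<r}"
      have "\<bar>a x * R' k x\<bar> \<le> K * C0"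
      proof -
        have "\<bar>a x * R' k x\<bar> \<le> K * \<bar>x - r\<bar> * \<bar>R' k x\<bar>"
          unfolding abs_mult using lip[of x r] z x by (intro mult_right_mono) auto
        also have "\<dots> = K * \<bar>(N k * (r - x)) * h' (N k * (r - x))\<bar>"
          using N[of k] x by (simp add: R'_def abs_mult)
        also have "\<dots> \<le> K * C0" using h(8) K0 by (intro mult_left_mono) auto
        finally show ?thesis .
      qed
      moreover have "\<bar>a x * L' k x\<bar> \<le> K * C0"
      proof -
        have "\<bar>a x * L' k x\<bar> \<le> K * \<bar>x - l\<bar> * \<bar>L' k x\<bar>"
          unfolding abs_mult using lip[of x l] z x by (intro mult_right_mono) auto
        also have "\<dots> = K * \<bar>(N k * (x - l)) * h' (N k * (x - l))\<bar>"
          using N[of k] x by (simp add: L'_def abs_mult)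
        also have "\<dots> \<le> K * C0" using h(8) K0 by (intro mult_left_mono) auto
        finally show ?thesis .
      qed
      moreover have "\<bar>L k x * (a x * R' k x)\<bar> \<le> 1 * \<bar>a x * R' k x\<bar>"
        unfolding abs_mult[of "L k x"] by (rule mult_right_mono) (use LR in auto)
      moreover have "\<bar>(a x * L' k x) * R k x\<bar> \<le> \<bar>a x * L' k x\<bar> * 1"
        unfolding abs_mult[of _ "R k x"] by (rule mult_left_mono) (use LR in auto)
      moreover have "\<bar>a' x * (L k x * R k x)\<bar> \<le> K * 1" unfolding abs_mult[of "a' x"]
        by (rule mult_mono) (use K[of x] x K0 LR in auto)
      moreover have "A' k x = L k x * (a x * R' k x) + (a x * L' k x) * R k x + a' x * (L k x * R k x)"
        by (simp add: A'_def algebra_simps)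
      ultimately have "\<bar>A' k x\<bar> \<le> K * C0 + K * C0 + K" by linarith
      then show "\<bar>A' k x\<bar> \<le> max Ka (K * C0 + K * C0 + K)" by simp
    qed
  qed
qed

section \<open>Smooth functions of two variables\<close>

lemma smooth_tensor:
  fixes f g :: "real \<Rightarrow> 'b::real_normed_field"
  assumes "smooth1 f" "smooth1 g"
  shows "smooth (\<lambda>p. f (fst p) * g (snd p))"
proof -
  obtain F where F: "F 0 = f" "\<And>i x. (F i has_vector_derivative F (Suc i) x) (at x)"
    using assms(1) by (auto simp: smooth1_def)
  obtain G where G: "G 0 = g" "\<And>i x. (G i has_vector_derivative G (Suc i) x) (at x)"
    using assms(2) by (auto simp: smooth1_def)
  have "((\<lambda>p. F i (fst p) * G j (snd p)) has_derivative
        (\<lambda>h. fst h *\<^sub>R (F (Suc i) (fst x) * G j (snd x)) + snd h *\<^sub>R (F i (fst x) * G (Suc j) (snd x)))) (at x)"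
    for i j and x :: "real \<times> real"
  proof -
    have "((\<lambda>p. F i (fst p)) has_derivative (\<lambda>h. fst h *\<^sub>R F (Suc i) (fst x))) (at x)"
      by (rule has_derivative_compose[OF has_derivative_fst[OF has_derivative_ident] F(2)[unfolded has_vector_derivative_def]])
    moreover have "((\<lambda>p. G j (snd p)) has_derivative (\<lambda>h. snd h *\<^sub>R G (Suc j) (snd x))) (at x)"
      by (rule has_derivative_compose[OF has_derivative_snd[OF has_derivative_ident] G(2)[unfolded has_vector_derivative_def]])
    ultimately show ?thesis
      by (rule has_derivative_eq_rhs[OF has_derivative_mult]) (simp add: algebra_simps fun_eq_iff)
  qed
  then show ?thesis unfolding smooth_def
    by (intro exI[of _ "\<lambda>i j p. F i (fst p) * G j (snd p)"]) (auto simp: F G)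
qed

lemma smooth_partials:
  assumes "smooth u"
  obtains ux uy where "smooth ux" "smooth uy"
    "\<And>x. (u has_derivative (\<lambda>h. fst h *\<^sub>R ux x + snd h *\<^sub>R uy x)) (at x)"
proof -
  obtain D where D: "D 0 0 = u" "\<And>i j x. (D i j has_derivative (\<lambda>h. fst h *\<^sub>R D (Suc i) j x + snd h *\<^sub>R D i (Suc j) x)) (at x)"
    using assms by (auto simp: smooth_def)
  have 1: "smooth (D 1 0)" unfolding smooth_def by (rule exI[of _ "\<lambda>i. D (Suc i)"]) (use D in auto)
  have 2: "smooth (D 0 1)" unfolding smooth_def by (rule exI[of _ "\<lambda>i j. D i (Suc j)"]) (use D in auto)
  show ?thesis by (rule that[OF 1 2]) (use D(2)[of 0 0] D(1) in simp)
qed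

lemma smooth_continuous: "smooth u \<Longrightarrow> continuous_on S u"
  by (rule smooth_partials) (auto intro!: continuous_at_imp_continuous_on has_derivative_continuous)

lemma smooth_add:
  assumes "smooth u" "smooth v" shows "smooth (\<lambda>x. u x + v x)"
proof -
  obtain D where D: "D 0 0 = u" "\<And>i j x. (D i j has_derivative (\<lambda>h. fst h *\<^sub>R D (Suc i) j x + snd h *\<^sub>R D i (Suc j) x)) (at x)"
    using assms by (auto simp: smooth_def)
  obtain E where E: "E 0 0 = v" "\<And>i j x. (E i j has_derivative (\<lambda>h. fst h *\<^sub>R E (Suc i) j x + snd h *\<^sub>R E i (Suc j) x)) (at x)"
    using assms by (auto simp: smooth_def)
  show ?thesis unfolding smooth_def
    apply (intro exI[of _ "\<lambda>i j x. D i j x + E i j x"] conjI allI)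
    using D(1) E(1) apply auto[1]
    by (rule has_derivative_eq_rhs[OF has_derivative_add[OF D(2) E(2)]]) (auto simp: algebra_simps)
qed

lemma smooth_zero: "smooth (\<lambda>x. 0)"
  unfolding smooth_def by (rule exI[of _ "\<lambda>i j x. 0"]) auto

lemma smooth_sum: "(\<And>i. i \<in> I \<Longrightarrow> smooth (f i)) \<Longrightarrow> smooth (\<lambda>x. \<Sum>i\<in>I. f i x)"
  by (induction I rule: infinite_finite_induct) (auto intro: smooth_add smooth_zero)

lemma smooth1_derivative:
  assumes "smooth1 f" "\<And>x. (f has_vector_derivative f' x) (at x)"
  shows "smooth1 f'"
proof -
  obtain g where g: "smooth1 g" "\<And>x. (f has_vector_derivative g x) (at x)" using smooth1_deriv[OF assms(1)] by blast
  have "f' = g" using vector_derivative_unique_at[OF assms(2) g(2)] by blast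
  then show ?thesis using g by simp
qed

lemma continuous_on_UNIV_measurable:
  fixes g :: "'a::euclidean_space \<Rightarrow> 'b::euclidean_space"
  assumes "continuous_on UNIV g" shows "g \<in> borel_measurable (lebesgue_on S)"
proof -
  have "g \<in> borel_measurable lborel" using borel_measurable_continuous_onI[OF assms] by simp
  then show ?thesis by (intro measurable_restrict_space1 measurable_completion)
qed

section \<open>Weak derivatives on the rectangle\<close>

locale guide =
  fixes d xm xp :: real
  assumes d_pos: "0 < d" and xm_less_xp: "xm < xp"
begin

abbreviation \<Omega> :: "(real \<times> real) set" where "\<Omega> \<equiv> Omega_b d xm xp"

lemma Omega_subset_cbox: "\<Omega> \<subseteq> cbox (xm, 0) (xp, d)"
  using box_subset_cbox by (simp add: Omega_b_eq_box)

lemma mem_Omega: "p \<in> \<Omega> \<longleftrightarrow> xm < fst p \<and> fst p < xp \<and> 0 < snd p \<and> snd p < d"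
  by (cases p) (auto simp: Omega_b_def Omega_def)

lemma sets_Omega: "\<Omega> \<in> sets lebesgue"
  using lmeasurable_Omega_b by (simp add: fmeasurableD)

lemma continuous_bounded_Omega:
  fixes g :: "real \<times> real \<Rightarrow> 'b::real_normed_vector"
  assumes "continuous_on UNIV g"
  shows "\<exists>B\<ge>0. \<forall>x\<in>\<Omega>. norm (g x) \<le> B"
proof -
  have "bounded (g ` cbox (xm, 0) (xp, d))"
    by (intro compact_imp_bounded compact_continuous_image continuous_on_subset[OF assms] compact_cbox) auto
  then obtain B where "\<forall>x\<in>cbox (xm, 0) (xp, d). norm (g x) \<le> B" by (auto simp: bounded_iff)
  then have "\<forall>x\<in>\<Omega>. norm (g x) \<le> max B 0" using Omega_subset_cbox by (meson max.coboundedI1 subset_iff)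
  then show ?thesis by (meson max.cobounded2)
qed

lemma continuous_in_L2: "continuous_on UNIV g \<Longrightarrow> g \<in> L2 \<Omega>"
  using continuous_bounded_Omega[of g] bounded_in_L2[OF lmeasurable_Omega_b continuous_on_UNIV_measurable] by blast

lemma LINT_Omega:
  fixes g :: "real \<times> real \<Rightarrow> complex"
  assumes g: "continuous_on UNIV g"
  shows "(LINT x|lebesgue_on \<Omega>. g x) = integral {xm..xp} (\<lambda>x. integral {0..d} (\<lambda>y. g (x, y)))"
    and "(LINT x|lebesgue_on \<Omega>. g x) = integral {0..d} (\<lambda>y. integral {xm..xp} (\<lambda>x. g (x, y)))"
proof -
  have "(LINT x|lebesgue_on \<Omega>. g x) = integral \<Omega> g"
    by (rule lebesgue_integral_eq_integral[OF L2_integrable[OF lmeasurable_Omega_b continuous_in_L2[OF g]] sets_Omega])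
  also have "\<dots> = integral (cbox (xm, 0) (xp, d)) g"
    by (simp add: Omega_b_eq_box integral_open_interval)
  finally have 0: "(LINT x|lebesgue_on \<Omega>. g x) = integral (cbox (xm, 0) (xp, d)) g" .
  have gc: "continuous_on (cbox (xm, 0) (xp, d)) g" by (rule continuous_on_subset[OF g]) simp
  show 1: "(LINT x|lebesgue_on \<Omega>. g x) = integral {xm..xp} (\<lambda>x. integral {0..d} (\<lambda>y. g (x, y)))"
    using 0 integral_prod_continuous[OF gc] by simp
  show "(LINT x|lebesgue_on \<Omega>. g x) = integral {0..d} (\<lambda>y. integral {xm..xp} (\<lambda>x. g (x, y)))"
    using 1 integral_swap_continuous[of xm 0 xp d "\<lambda>x y. g (x, y)"] gc by simp
qed

lemma LINT_Omega_tensor: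
  fixes f g :: "real \<Rightarrow> complex"
  assumes "continuous_on UNIV f" "continuous_on UNIV g"
  shows "(LINT x|lebesgue_on \<Omega>. f (fst x) * g (snd x)) = integral {xm..xp} f * integral {0..d} g"
proof -
  have "continuous_on UNIV (\<lambda>x. f (fst x) * g (snd x))"
    by (intro continuous_intros continuous_on_compose2[OF assms(1)] continuous_on_compose2[OF assms(2)]) auto
  from LINT_Omega(1)[OF this] show ?thesis by simp
qed

text \<open>Total differentiability with named partial derivatives, so that product, tensor and sum
  rules compute them explicitly.\<close>

definition partial :: "(real \<times> real \<Rightarrow> 'b::real_normed_vector) \<Rightarrow> (real \<times> real \<Rightarrow> 'b) \<Rightarrow> (real \<times> real \<Rightarrow> 'b) \<Rightarrow> bool" where
  "partial u ux uy \<longleftrightarrow> (\<forall>x. (u has_derivative (\<lambda>h. fst h *\<^sub>R ux x + snd h *\<^sub>R uy x)) (at x))"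

lemma partialD: "partial u ux uy \<Longrightarrow> (u has_derivative (\<lambda>h. fst h *\<^sub>R ux x + snd h *\<^sub>R uy x)) (at x)"
  unfolding partial_def by blast

lemma partial_slice:
  assumes "partial u ux uy"
  shows "((\<lambda>x. u (x, y)) has_vector_derivative ux (x, y)) (at x within S)"
    and "((\<lambda>y. u (x, y)) has_vector_derivative uy (x, y)) (at y within T)"
proof -
  have u: "(u has_derivative (\<lambda>h. fst h *\<^sub>R ux (x, y) + snd h *\<^sub>R uy (x, y))) (at (x, y))"
    using assms by (simp add: partial_def)
  have "((\<lambda>x. (x, y)) has_derivative (\<lambda>h. (h, 0))) (at x within S)" by (auto intro!: derivative_eq_intros)
  from has_derivative_compose[OF this u] show "((\<lambda>x. u (x, y)) has_vector_derivative ux (x, y)) (at x within S)"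
    by (simp add: has_vector_derivative_def)
  have "((\<lambda>y. (x, y)) has_derivative (\<lambda>h. (0, h))) (at y within T)" by (auto intro!: derivative_eq_intros)
  from has_derivative_compose[OF this u] show "((\<lambda>y. u (x, y)) has_vector_derivative uy (x, y)) (at y within T)"
    by (simp add: has_vector_derivative_def)
qed

lemma partial_continuous: "partial u ux uy \<Longrightarrow> continuous_on S u"
  unfolding partial_def by (meson has_derivative_continuous continuous_at_imp_continuous_on)

lemma partial_frechet:
  assumes "partial u ux uy"
  shows "frechet_derivative u (at x) (1, 0) = ux x" "frechet_derivative u (at x) (0, 1) = uy x"
  using frechet_derivative_at[of u _ x] assms unfolding partial_def
  by (metis (no_types, lifting) fst_conv snd_conv scaleR_one scaleR_zero_left add.right_neutral add_0)+

lemma smooth_partial: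
  assumes "smooth u" obtains ux uy where "smooth ux" "smooth uy" "partial u ux uy"
proof (rule smooth_partials[OF assms])
  fix ux uy
  assume u: "smooth ux" "smooth uy" and *: "\<And>x. (u has_derivative (\<lambda>h. fst h *\<^sub>R ux x + snd h *\<^sub>R uy x)) (at x)"
  have "partial u ux uy" unfolding partial_def using * by blast
  with u show thesis by (rule that)
qed

lemma partial_mult:
  fixes u v :: "real \<times> real \<Rightarrow> 'b::real_normed_field"
  assumes "partial u ux uy" "partial v vx vy"
  shows "partial (\<lambda>x. u x * v x) (\<lambda>x. u x * vx x + ux x * v x) (\<lambda>x. u x * vy x + uy x * v x)"
  unfolding partial_def
proof
  fix x
  show "((\<lambda>x. u x * v x) has_derivative
      (\<lambda>h. fst h *\<^sub>R (u x * vx x + ux x * v x) + snd h *\<^sub>R (u x * vy x + uy x * v x))) (at x)"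
    by (rule has_derivative_eq_rhs[OF has_derivative_mult[OF assms[THEN partialD]]]) (auto simp: algebra_simps fun_eq_iff)
qed

lemma partial_of_real:
  assumes "partial u ux uy"
  shows "partial (\<lambda>x. of_real (u x) :: complex) (\<lambda>x. of_real (ux x)) (\<lambda>x. of_real (uy x))"
  unfolding partial_def
proof
  fix x
  show "((\<lambda>x. of_real (u x) :: complex) has_derivative (\<lambda>h. fst h *\<^sub>R of_real (ux x) + snd h *\<^sub>R of_real (uy x))) (at x)"
    by (rule has_derivative_eq_rhs[OF has_derivative_of_real[OF partialD[OF assms]]]) (auto simp: scaleR_conv_of_real fun_eq_iff)
qed

lemma partial_tensor:
  fixes f g :: "real \<Rightarrow> 'b::real_normed_field"
  assumes "\<And>x. (f has_vector_derivative f' x) (at x)" "\<And>x. (g has_vector_derivative g' x) (at x)"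
  shows "partial (\<lambda>p. f (fst p) * g (snd p)) (\<lambda>p. f' (fst p) * g (snd p)) (\<lambda>p. f (fst p) * g' (snd p))"
  unfolding partial_def
proof
  fix x :: "real \<times> real"
  have "((\<lambda>p. f (fst p)) has_derivative (\<lambda>h. fst h *\<^sub>R f' (fst x))) (at x)"
    by (rule has_derivative_compose[OF has_derivative_fst[OF has_derivative_ident] assms(1)[unfolded has_vector_derivative_def]])
  moreover have "((\<lambda>p. g (snd p)) has_derivative (\<lambda>h. snd h *\<^sub>R g' (snd x))) (at x)"
    by (rule has_derivative_compose[OF has_derivative_snd[OF has_derivative_ident] assms(2)[unfolded has_vector_derivative_def]])
  ultimately show "((\<lambda>p. f (fst p) * g (snd p)) has_derivative
      (\<lambda>h. fst h *\<^sub>R (f' (fst x) * g (snd x)) + snd h *\<^sub>R (f (fst x) * g' (snd x)))) (at x)"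
    by (rule has_derivative_eq_rhs[OF has_derivative_mult]) (simp add: algebra_simps fun_eq_iff)
qed

lemma partial_sum:
  assumes "\<And>i. i \<in> I \<Longrightarrow> partial (u i) (ux i) (uy i)"
  shows "partial (\<lambda>x. \<Sum>i\<in>I. u i x) (\<lambda>x. \<Sum>i\<in>I. ux i x) (\<lambda>x. \<Sum>i\<in>I. uy i x)"
  unfolding partial_def
proof
  fix x
  show "((\<lambda>x. \<Sum>i\<in>I. u i x) has_derivative (\<lambda>h. fst h *\<^sub>R (\<Sum>i\<in>I. ux i x) + snd h *\<^sub>R (\<Sum>i\<in>I. uy i x))) (at x)"
    by (rule has_derivative_eq_rhs[OF has_derivative_sum[OF partialD[OF assms]]]) (auto simp: scaleR_sum_right sum.distrib fun_eq_iff)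
qed

lemma LINT_partial_x:
  fixes u :: "real \<times> real \<Rightarrow> complex"
  assumes u: "partial u ux uy" and c: "continuous_on UNIV ux"
  shows "(LINT p|lebesgue_on \<Omega>. ux p) = integral {0..d} (\<lambda>y. u (xp, y) - u (xm, y))"
proof -
  have "integral {xm..xp} (\<lambda>x. ux (x, y)) = u (xp, y) - u (xm, y)" for y
    by (rule integral_unique, rule fundamental_theorem_of_calculus)
      (use xm_less_xp partial_slice(1)[OF u] in auto)
  then show ?thesis using LINT_Omega(2)[OF c] by simp
qed

lemma LINT_partial_y:
  fixes u :: "real \<times> real \<Rightarrow> complex"
  assumes u: "partial u ux uy" and c: "continuous_on UNIV uy"
  shows "(LINT p|lebesgue_on \<Omega>. uy p) = integral {xm..xp} (\<lambda>x. u (x, d) - u (x, 0))"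
proof -
  have "integral {0..d} (\<lambda>y. uy (x, y)) = u (x, d) - u (x, 0)" for x
    by (rule integral_unique, rule fundamental_theorem_of_calculus)
      (use d_pos partial_slice(2)[OF u] in auto)
  then show ?thesis using LINT_Omega(1)[OF c] by simp
qed

lemma test_function_zero:
  assumes "test_function \<Omega> \<phi>" "x \<notin> \<Omega>" shows "\<phi> x = 0"
  using assms closure_subset unfolding test_function_def by (metis (mono_tags, lifting) mem_Collect_eq subsetD)

text \<open>Fubini and the one-dimensional fundamental theorem; the product with a test function
  vanishes on the four sides.\<close>

lemma weak_deriv_classical:
  assumes u: "partial u ux uy" "continuous_on UNIV ux" "continuous_on UNIV uy"
  shows "is_weak_deriv \<Omega> (1, 0) u ux" "is_weak_deriv \<Omega> (0, 1) u uy"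
proof -
  have *: "(LINT x|lebesgue_on \<Omega>. u x * of_real (frechet_derivative \<phi> (at x) (1, 0))) = - (LINT x|lebesgue_on \<Omega>. ux x * of_real (\<phi> x)) \<and>
      (LINT x|lebesgue_on \<Omega>. u x * of_real (frechet_derivative \<phi> (at x) (0, 1))) = - (LINT x|lebesgue_on \<Omega>. uy x * of_real (\<phi> x))"
    if t: "test_function \<Omega> \<phi>" for \<phi>
  proof -
    have "smooth \<phi>" using t by (simp add: test_function_def)
    then obtain \<phi>x \<phi>y where \<phi>: "smooth \<phi>x" "smooth \<phi>y" "partial \<phi> \<phi>x \<phi>y" by (rule smooth_partial)
    have c: "continuous_on UNIV \<phi>x" "continuous_on UNIV \<phi>y" "continuous_on UNIV \<phi>" "continuous_on UNIV u"
      using \<phi> u by (auto intro: smooth_continuous partial_continuous)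
    note P = partial_mult[OF u(1) partial_of_real[OF \<phi>(3)]]
    have z: "\<phi> (xp, y) = 0" "\<phi> (xm, y) = 0" "\<phi> (x, d) = 0" "\<phi> (x, 0) = 0" for x y
      by (auto intro!: test_function_zero[OF t] simp: mem_Omega)
    have i: "integrable (lebesgue_on \<Omega>) g" if "continuous_on UNIV g" for g :: "real \<times> real \<Rightarrow> complex"
      by (rule L2_integrable[OF lmeasurable_Omega_b continuous_in_L2[OF that]])
    have "(LINT x|lebesgue_on \<Omega>. u x * of_real (\<phi>x x) + ux x * of_real (\<phi> x)) = 0"
      by (subst LINT_partial_x[OF P]) (auto simp: z intro!: continuous_intros c u)
    then have 1: "(LINT x|lebesgue_on \<Omega>. u x * of_real (\<phi>x x)) = - (LINT x|lebesgue_on \<Omega>. ux x * of_real (\<phi> x))"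
      by (subst (asm) Bochner_Integration.integral_add) (auto intro!: i continuous_intros c u simp: eq_neg_iff_add_eq_0)
    have "(LINT x|lebesgue_on \<Omega>. u x * of_real (\<phi>y x) + uy x * of_real (\<phi> x)) = 0"
      by (subst LINT_partial_y[OF P]) (auto simp: z intro!: continuous_intros c u)
    then have 2: "(LINT x|lebesgue_on \<Omega>. u x * of_real (\<phi>y x)) = - (LINT x|lebesgue_on \<Omega>. uy x * of_real (\<phi> x))"
      by (subst (asm) Bochner_Integration.integral_add) (auto intro!: i continuous_intros c u simp: eq_neg_iff_add_eq_0)
    show ?thesis using 1 2 by (simp add: partial_frechet[OF \<phi>(3)])
  qed
  show "is_weak_deriv \<Omega> (1, 0) u ux" "is_weak_deriv \<Omega> (0, 1) u uy"
    unfolding is_weak_deriv_def using * by blast+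
qed

lemma partial_in_H1:
  assumes u: "partial u ux uy" "continuous_on UNIV ux" "continuous_on UNIV uy"
  shows "u \<in> H1 \<Omega>"
  unfolding H1_def using weak_deriv_classical[OF u] continuous_in_L2 partial_continuous[OF u(1)] u(2,3) by auto

lemma smooth_in_H1: "smooth u \<Longrightarrow> u \<in> H1 \<Omega>"
  by (erule smooth_partial) (rule partial_in_H1, assumption, (erule smooth_continuous)+)

text \<open>The limit passage shared by the cutoffs and the Stone--Weierstrass approximations:
  bounded pointwise convergence against an L2 function on a bounded domain.\<close>

lemma dominated_pairing:
  fixes s :: "nat \<Rightarrow> real \<times> real \<Rightarrow> real"
  assumes u: "u \<in> L2 \<Omega>" and s: "\<And>k. continuous_on UNIV (s k)" "continuous_on UNIV t"
    and b: "\<And>k x. x \<in> \<Omega> \<Longrightarrow> \<bar>s k x\<bar> \<le> C" and l: "\<And>x. x \<in> \<Omega> \<Longrightarrow> (\<lambda>k. s k x) \<longlonglongrightarrow> t x"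
  shows "(\<lambda>k. LINT x|lebesgue_on \<Omega>. u x * of_real (s k x)) \<longlonglongrightarrow> (LINT x|lebesgue_on \<Omega>. u x * of_real (t x))"
proof (rule integral_dominated_convergence)
  show "(\<lambda>x. u x * of_real (t x)) \<in> borel_measurable (lebesgue_on \<Omega>)"
    by (intro borel_measurable_times L2_D(1)[OF u] continuous_on_UNIV_measurable continuous_intros s)
  show "(\<lambda>x. u x * of_real (s k x)) \<in> borel_measurable (lebesgue_on \<Omega>)" for k
    by (intro borel_measurable_times L2_D(1)[OF u] continuous_on_UNIV_measurable continuous_intros s)
  show "integrable (lebesgue_on \<Omega>) (\<lambda>x. C * cmod (u x))"
    by (intro integrable_mult_right integrable_norm L2_integrable[OF lmeasurable_Omega_b u])
  show "AE x in lebesgue_on \<Omega>. (\<lambda>k. u x * of_real (s k x)) \<longlonglongrightarrow> u x * of_real (t x)"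
    by (rule AE_I2) (use l in \<open>auto intro!: tendsto_intros simp: space_restrict_space\<close>)
  show "AE x in lebesgue_on \<Omega>. norm (u x * of_real (s k x)) \<le> C * cmod (u x)" for k
    by (rule AE_I2) (use b in \<open>auto intro!: mult_right_mono simp: space_restrict_space norm_mult mult.commute[of "cmod _"]\<close>)
qed

text \<open>Boundary values of the factor that is differentiated suffice, because a cutoff near a side where
  that factor vanishes has bounded effect on its derivative.\<close>

lemma weak_deriv_pairing:
  assumes u: "u \<in> L2 \<Omega>" and g: "g \<in> L2 \<Omega>"
    and a: "smooth1 a" "\<And>x. (a has_vector_derivative a' x) (at x)"
    and b: "smooth1 b" "\<And>x. (b has_vector_derivative b' x) (at x)"
  shows "is_weak_deriv \<Omega> (1, 0) u g \<Longrightarrow> a xm = 0 \<Longrightarrow> a xp = 0 \<Longrightarrow>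
      (LINT x|lebesgue_on \<Omega>. u x * of_real (a' (fst x) * b (snd x))) = - (LINT x|lebesgue_on \<Omega>. g x * of_real (a (fst x) * b (snd x)))"
    and "is_weak_deriv \<Omega> (0, 1) u g \<Longrightarrow> b 0 = 0 \<Longrightarrow> b d = 0 \<Longrightarrow>
      (LINT x|lebesgue_on \<Omega>. u x * of_real (a (fst x) * b' (snd x))) = - (LINT x|lebesgue_on \<Omega>. g x * of_real (a (fst x) * b (snd x)))"
proof -
  note a' = smooth1_derivative[OF a] and b' = smooth1_derivative[OF b]
  obtain A A' C where A: "\<And>k. smooth1 (A k)" "\<And>k x. (A k has_vector_derivative A' k x) (at x)"
    "\<And>k. \<exists>\<delta>>0. \<forall>x. A k x \<noteq> 0 \<longrightarrow> xm + \<delta> \<le> x \<and> x \<le> xp - \<delta>"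
    "\<And>x. x \<in> {xm<..<xp} \<Longrightarrow> (\<lambda>k. A k x) \<longlonglongrightarrow> a x" "\<And>k x. x \<in> {xm<..<xp} \<Longrightarrow> \<bar>A k x\<bar> \<le> C"
    "\<And>x. x \<in> {xm<..<xp} \<Longrightarrow> (\<lambda>k. A' k x) \<longlonglongrightarrow> a' x"
    "a xm = 0 \<Longrightarrow> a xp = 0 \<Longrightarrow> \<forall>k. \<forall>x\<in>{xm<..<xp}. \<bar>A' k x\<bar> \<le> C"
    using cutoff_sequence[OF a(1) a' a(2) xm_less_xp] by blast
  obtain B B' E where B: "\<And>k. smooth1 (B k)" "\<And>k x. (B k has_vector_derivative B' k x) (at x)"
    "\<And>k. \<exists>\<delta>>0. \<forall>x. B k x \<noteq> 0 \<longrightarrow> 0 + \<delta> \<le> x \<and> x \<le> d - \<delta>"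
    "\<And>x. x \<in> {0<..<d} \<Longrightarrow> (\<lambda>k. B k x) \<longlonglongrightarrow> b x" "\<And>k x. x \<in> {0<..<d} \<Longrightarrow> \<bar>B k x\<bar> \<le> E"
    "\<And>x. x \<in> {0<..<d} \<Longrightarrow> (\<lambda>k. B' k x) \<longlonglongrightarrow> b' x"
    "b 0 = 0 \<Longrightarrow> b d = 0 \<Longrightarrow> \<forall>k. \<forall>x\<in>{0<..<d}. \<bar>B' k x\<bar> \<le> E"
    using cutoff_sequence[OF b(1) b' b(2) d_pos] by blast
  define \<phi> where "\<phi> k = (\<lambda>p. A k (fst p) * B k (snd p))" for k
  \<comment> \<open>Each factor vanishes within a positive distance of its ends, so the product is
    supported in a smaller closed box.\<close>
  have test: "test_function \<Omega> (\<phi> k)" for k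
  proof -
    obtain \<delta> where \<delta>: "\<delta> > 0" "\<forall>x. A k x \<noteq> 0 \<longrightarrow> xm + \<delta> \<le> x \<and> x \<le> xp - \<delta>" using A(3) by blast
    obtain \<eta> where \<eta>: "\<eta> > 0" "\<forall>x. B k x \<noteq> 0 \<longrightarrow> 0 + \<eta> \<le> x \<and> x \<le> d - \<eta>" using B(3) by blast
    let ?K = "cbox (xm + \<delta>, \<eta>) (xp - \<delta>, d - \<eta>)"
    have "{x. \<phi> k x \<noteq> 0} \<subseteq> ?K" using \<delta> \<eta> by (auto simp: \<phi>_def cbox_Pair_eq)
    then have s: "closure {x. \<phi> k x \<noteq> 0} \<subseteq> ?K" by (intro closure_minimal) auto
    moreover have "?K \<subseteq> \<Omega>" using \<delta>(1) \<eta>(1) by (auto simp: mem_Omega)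
    moreover have "compact (closure {x. \<phi> k x \<noteq> 0})"
      using s by (meson bounded_cbox bounded_subset closed_closure compact_eq_bounded_closed)
    ultimately show ?thesis unfolding test_function_def
      by (auto simp: \<phi>_def intro!: smooth_tensor A B)
  qed
  note P = partial_tensor[OF A(2) B(2)]
  have fr: "frechet_derivative (\<phi> k) (at x) (1, 0) = A' k (fst x) * B k (snd x)"
    "frechet_derivative (\<phi> k) (at x) (0, 1) = A k (fst x) * B' k (snd x)" for k x
    using partial_frechet[OF P[of k]] by (simp_all add: \<phi>_def)
  have c: "continuous_on UNIV (\<lambda>x. f (fst x) * h (snd x))" if "smooth1 f" "smooth1 h" for f h :: "real \<Rightarrow> real"
    using that by (intro continuous_intros continuous_on_compose2[OF smooth1_continuous[of f UNIV]] continuous_on_compose2[OF smooth1_continuous[of h UNIV]]) auto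
  have AS: "smooth1 (A' k)" "smooth1 (B' k)" for k using smooth1_derivative A B by blast+
  have mult_le: "\<bar>s * t\<bar> \<le> C * E" if "\<bar>s\<bar> \<le> C" "\<bar>t\<bar> \<le> E" for s t
    unfolding abs_mult by (rule mult_mono) (use that in auto)
  have l0: "(\<lambda>k. LINT x|lebesgue_on \<Omega>. g x * of_real (\<phi> k x)) \<longlonglongrightarrow> (LINT x|lebesgue_on \<Omega>. g x * of_real (a (fst x) * b (snd x)))"
    unfolding \<phi>_def
    by (rule dominated_pairing[OF g, where C = "C * E"]) (auto intro!: c a b A B mult_le tendsto_mult simp: mem_Omega)
  \<comment> \<open>Only the cutoff of the differentiated factor is ever differentiated; the other
    one enters through its bounded values.\<close>
  show "(LINT x|lebesgue_on \<Omega>. u x * of_real (a' (fst x) * b (snd x))) = - (LINT x|lebesgue_on \<Omega>. g x * of_real (a (fst x) * b (snd x)))"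
    if w: "is_weak_deriv \<Omega> (1, 0) u g" and z: "a xm = 0" "a xp = 0"
  proof (rule LIMSEQ_unique)
    show "(\<lambda>k. LINT x|lebesgue_on \<Omega>. u x * of_real (A' k (fst x) * B k (snd x))) \<longlonglongrightarrow> (LINT x|lebesgue_on \<Omega>. u x * of_real (a' (fst x) * b (snd x)))"
      by (rule dominated_pairing[OF u, where C = "C * E"])
        (use A(7)[OF z] in \<open>auto intro!: c a' b AS A B mult_le tendsto_mult simp: mem_Omega\<close>)
    have "(LINT x|lebesgue_on \<Omega>. u x * of_real (A' k (fst x) * B k (snd x))) = - (LINT x|lebesgue_on \<Omega>. g x * of_real (\<phi> k x))" for k
      using w[unfolded is_weak_deriv_def, rule_format, OF test[of k]] by (simp only: fr)
    then show "(\<lambda>k. LINT x|lebesgue_on \<Omega>. u x * of_real (A' k (fst x) * B k (snd x))) \<longlonglongrightarrow> - (LINT x|lebesgue_on \<Omega>. g x * of_real (a (fst x) * b (snd x)))"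
      using tendsto_minus[OF l0] by simp
  qed
  show "(LINT x|lebesgue_on \<Omega>. u x * of_real (a (fst x) * b' (snd x))) = - (LINT x|lebesgue_on \<Omega>. g x * of_real (a (fst x) * b (snd x)))"
    if w: "is_weak_deriv \<Omega> (0, 1) u g" and z: "b 0 = 0" "b d = 0"
  proof (rule LIMSEQ_unique)
    show "(\<lambda>k. LINT x|lebesgue_on \<Omega>. u x * of_real (A k (fst x) * B' k (snd x))) \<longlonglongrightarrow> (LINT x|lebesgue_on \<Omega>. u x * of_real (a (fst x) * b' (snd x)))"
      by (rule dominated_pairing[OF u, where C = "C * E"])
        (use B(7)[OF z] in \<open>auto intro!: c a b' AS A B mult_le tendsto_mult simp: mem_Omega\<close>)
    have "(LINT x|lebesgue_on \<Omega>. u x * of_real (A k (fst x) * B' k (snd x))) = - (LINT x|lebesgue_on \<Omega>. g x * of_real (\<phi> k x))" for k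
      using w[unfolded is_weak_deriv_def, rule_format, OF test[of k]] by (simp only: fr)
    then show "(\<lambda>k. LINT x|lebesgue_on \<Omega>. u x * of_real (A k (fst x) * B' k (snd x))) \<longlonglongrightarrow> - (LINT x|lebesgue_on \<Omega>. g x * of_real (a (fst x) * b (snd x)))"
      using tendsto_minus[OF l0] by simp
  qed
qed

end

section \<open>Cosine series\<close>

context guide
begin

abbreviation len :: real where "len \<equiv> xp - xm"

definition cx :: "nat \<Rightarrow> real \<Rightarrow> real" where "cx m x = cos (real m * pi * (x - xm) / len)"
definition sx :: "nat \<Rightarrow> real \<Rightarrow> real" where "sx m x = sin (real m * pi * (x - xm) / len)"
definition cy :: "nat \<Rightarrow> real \<Rightarrow> real" where "cy n y = cos (real n * pi * y / d)"
definition sy :: "nat \<Rightarrow> real \<Rightarrow> real" where "sy n y = sin (real n * pi * y / d)"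

definition kx :: "nat \<Rightarrow> real" where "kx m = real m * pi / len"
definition ky :: "nat \<Rightarrow> real" where "ky n = real n * pi / d"

lemma len_pos: "len > 0" using xm_less_xp by simp

lemma cx_alt: "cx m x = cos (kx m * x + - (kx m * xm))" and sx_alt: "sx m x = sin (kx m * x + - (kx m * xm))"
  and cy_alt: "cy n x = cos (ky n * x + 0)" and sy_alt: "sy n x = sin (ky n * x + 0)"
  by (simp_all add: cx_def sx_def cy_def sy_def kx_def ky_def right_diff_distrib diff_divide_distrib)

lemma smooth1_trig [simp]: "smooth1 (cx m)" "smooth1 (sx m)" "smooth1 (cy n)" "smooth1 (sy n)"
  unfolding cx_alt[abs_def] sx_alt[abs_def] cy_alt[abs_def] sy_alt[abs_def] by (rule smooth1_cos smooth1_sin)+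

lemma trig_deriv:
  "(cx m has_vector_derivative - kx m * sx m x) (at x)" "(sx m has_vector_derivative kx m * cx m x) (at x)"
  "(cy n has_vector_derivative - ky n * sy n x) (at x)" "(sy n has_vector_derivative ky n * cy n x) (at x)"
  unfolding cx_alt[abs_def] sx_alt[abs_def] cy_alt[abs_def] sy_alt[abs_def] has_real_derivative_iff_has_vector_derivative[symmetric]
  by (auto intro!: derivative_eq_intros)

lemma trig_boundary: "sx m xm = 0" "sx m xp = 0" "sy n 0 = 0" "sy n d = 0"
  using len_pos d_pos by (auto simp: sx_def sy_def sin_times_pi_eq_0)

lemma trig_cont: "continuous_on S (cx m)" "continuous_on S (sx m)" "continuous_on S (cy n)" "continuous_on S (sy n)"
  by (simp_all add: smooth1_continuous)

lemma cont_pair: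
  assumes "\<And>S. continuous_on S f" "\<And>S. continuous_on S g"
  shows "continuous_on UNIV (\<lambda>p::real\<times>real. of_real (f (fst p) * g (snd p)) :: complex)"
  by (intro continuous_intros continuous_on_compose2[OF assms(1)[of UNIV]] continuous_on_compose2[OF assms(2)[of UNIV]]) auto

lemma kx_pos: "m > 0 \<Longrightarrow> kx m > 0" and ky_pos: "n > 0 \<Longrightarrow> ky n > 0"
  using len_pos d_pos by (auto simp: kx_def ky_def)

lemma integral_cx: "(cx m has_integral (if m = 0 then len else 0)) {xm..xp}"
proof (cases "m = 0")
  case True
  then have "cx m = (\<lambda>x. 1)" by (simp add: cx_def[abs_def])
  then show ?thesis using True has_integral_const_real[of "1::real" xm xp] len_pos by simp
next
  case False
  then have k: "kx m > 0" using kx_pos by simp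
  have "((\<lambda>x. sx m x / kx m) has_vector_derivative cx m x) (at x within {xm..xp})" for x
    using has_vector_derivative_at_within[OF has_vector_derivative_divide[OF trig_deriv(2)[of m x], of "kx m"]] k by simp
  from fundamental_theorem_of_calculus[OF _ this] show ?thesis using False len_pos by (auto simp: trig_boundary)
qed

lemma integral_cy: "(cy n has_integral (if n = 0 then d else 0)) {0..d}"
proof (cases "n = 0")
  case True
  then have "cy n = (\<lambda>x. 1)" by (simp add: cy_def[abs_def])
  then show ?thesis using True has_integral_const_real[of "1::real" 0 d] d_pos by simp
next
  case False
  then have k: "ky n > 0" using ky_pos by simp
  have "((\<lambda>x. sy n x / ky n) has_vector_derivative cy n x) (at x within {0..d})" for x
    using has_vector_derivative_at_within[OF has_vector_derivative_divide[OF trig_deriv(4)[of n x], of "ky n"]] k by simp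
  from fundamental_theorem_of_calculus[OF _ this] show ?thesis using False d_pos by (auto simp: trig_boundary)
qed

text \<open>The conditional index is |m - m'|, which truncated subtraction does not give directly;
  it may be used because cosine is even.\<close>

lemma trig_product:
  "cx m x * cx m' x = (cx (m + m') x + cx (if m' \<le> m then m - m' else m' - m) x) / 2"
  "sx m x * sx m' x = (cx (if m' \<le> m then m - m' else m' - m) x - cx (m + m') x) / 2"
  "cy n y * cy n' y = (cy (n + n') y + cy (if n' \<le> n then n - n' else n' - n) y) / 2"
  "sy n y * sy n' y = (cy (if n' \<le> n then n - n' else n' - n) y - cy (n + n') y) / 2"
proof -
  define u where "u = pi * (x - xm) / len"
  define v where "v = pi * y / d"
  have x: "cx m x = cos (real m * u)" "sx m x = sin (real m * u)" for m by (simp_all add: cx_def sx_def u_def mult.assoc)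
  have y: "cy m y = cos (real m * v)" "sy m y = sin (real m * v)" for m by (simp_all add: cy_def sy_def v_def mult.assoc)
  have c: "cos (real (if n \<le> m then m - n else n - m) * t) = cos (real m * t - real n * t)" for m n :: nat and t :: real
    using cos_minus[of "real m * t - real n * t"] by (auto simp: of_nat_diff left_diff_distrib)
  show "cx m x * cx m' x = (cx (m + m') x + cx (if m' \<le> m then m - m' else m' - m) x) / 2"
    "sx m x * sx m' x = (cx (if m' \<le> m then m - m' else m' - m) x - cx (m + m') x) / 2"
    unfolding x c by (simp_all add: distrib_right cos_add cos_diff)
  show "cy n y * cy n' y = (cy (n + n') y + cy (if n' \<le> n then n - n' else n' - n) y) / 2"
    "sy n y * sy n' y = (cy (if n' \<le> n then n - n' else n' - n) y - cy (n + n') y) / 2"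
    unfolding y c by (simp_all add: distrib_right cos_add cos_diff)
qed

definition nx :: "nat \<Rightarrow> real" where "nx m = (if m = 0 then 1 / sqrt len else sqrt (2 / len))"
definition ny :: "nat \<Rightarrow> real" where "ny n = (if n = 0 then 1 / sqrt d else sqrt (2 / d))"

lemma nx_pos: "nx m > 0" and ny_pos: "ny n > 0" using len_pos d_pos by (auto simp: nx_def ny_def)

lemma trig_orthonormal:
  "((\<lambda>x. nx m * cx m x * (nx m' * cx m' x)) has_integral (if m = m' then 1 else 0)) {xm..xp}"
  "((\<lambda>x. nx (Suc m) * sx (Suc m) x * (nx (Suc m') * sx (Suc m') x)) has_integral (if m = m' then 1 else 0)) {xm..xp}"
  "((\<lambda>y. ny n * cy n y * (ny n' * cy n' y)) has_integral (if n = n' then 1 else 0)) {0..d}"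
  "((\<lambda>y. ny (Suc n) * sy (Suc n) y * (ny (Suc n') * sy (Suc n') y)) has_integral (if n = n' then 1 else 0)) {0..d}"
proof -
  have "((\<lambda>x. nx m * nx m' * (cx m x * cx m' x)) has_integral
      nx m * nx m' * (((if m + m' = 0 then len else 0) + (if (if m' \<le> m then m - m' else m' - m) = 0 then len else 0)) / 2)) {xm..xp}"
    unfolding trig_product by (intro has_integral_mult_right has_integral_divide has_integral_add integral_cx)
  then show "((\<lambda>x. nx m * cx m x * (nx m' * cx m' x)) has_integral (if m = m' then 1 else 0)) {xm..xp}"
    by (rule has_integral_eq_rhs[OF has_integral_eq[rotated]]) (use len_pos in \<open>auto simp: nx_def field_simps split: if_splits\<close>)
  have "((\<lambda>x. nx (Suc m) * nx (Suc m') * (sx (Suc m) x * sx (Suc m') x)) has_integral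
      nx (Suc m) * nx (Suc m') * (((if (if Suc m' \<le> Suc m then Suc m - Suc m' else Suc m' - Suc m) = 0 then len else 0) - (if Suc m + Suc m' = 0 then len else 0)) / 2)) {xm..xp}"
    unfolding trig_product by (intro has_integral_mult_right has_integral_divide has_integral_diff integral_cx)
  then show "((\<lambda>x. nx (Suc m) * sx (Suc m) x * (nx (Suc m') * sx (Suc m') x)) has_integral (if m = m' then 1 else 0)) {xm..xp}"
    by (rule has_integral_eq_rhs[OF has_integral_eq[rotated]]) (use len_pos in \<open>auto simp: nx_def field_simps split: if_splits\<close>)
  have "((\<lambda>y. ny n * ny n' * (cy n y * cy n' y)) has_integral
      ny n * ny n' * (((if n + n' = 0 then d else 0) + (if (if n' \<le> n then n - n' else n' - n) = 0 then d else 0)) / 2)) {0..d}"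
    unfolding trig_product by (intro has_integral_mult_right has_integral_divide has_integral_add integral_cy)
  then show "((\<lambda>y. ny n * cy n y * (ny n' * cy n' y)) has_integral (if n = n' then 1 else 0)) {0..d}"
    by (rule has_integral_eq_rhs[OF has_integral_eq[rotated]]) (use d_pos in \<open>auto simp: ny_def field_simps split: if_splits\<close>)
  have "((\<lambda>y. ny (Suc n) * ny (Suc n') * (sy (Suc n) y * sy (Suc n') y)) has_integral
      ny (Suc n) * ny (Suc n') * (((if (if Suc n' \<le> Suc n then Suc n - Suc n' else Suc n' - Suc n) = 0 then d else 0) - (if Suc n + Suc n' = 0 then d else 0)) / 2)) {0..d}"
    unfolding trig_product by (intro has_integral_mult_right has_integral_divide has_integral_diff integral_cy)
  then show "((\<lambda>y. ny (Suc n) * sy (Suc n) y * (ny (Suc n') * sy (Suc n') y)) has_integral (if n = n' then 1 else 0)) {0..d}"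
    by (rule has_integral_eq_rhs[OF has_integral_eq[rotated]]) (use d_pos in \<open>auto simp: ny_def field_simps split: if_splits\<close>)
qed

lemma L2_times_bounded:
  assumes h: "h \<in> L2 \<Omega>" and g: "continuous_on UNIV g"
  shows "(\<lambda>x. h x * of_real (g x)) \<in> L2 \<Omega>"
proof -
  obtain B where B: "\<And>x. x \<in> \<Omega> \<Longrightarrow> \<bar>g x\<bar> \<le> B" using continuous_bounded_Omega[OF g] by auto
  have m: "(\<lambda>x. h x * of_real (g x)) \<in> borel_measurable (lebesgue_on \<Omega>)"
    by (intro borel_measurable_times L2_D(1)[OF h] continuous_on_UNIV_measurable continuous_intros g)
  have "integrable (lebesgue_on \<Omega>) (\<lambda>x. (cmod (h x * of_real (g x)))\<^sup>2)"
  proof (rule Bochner_Integration.integrable_bound)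
    show "integrable (lebesgue_on \<Omega>) (\<lambda>x. B\<^sup>2 * (cmod (h x))\<^sup>2)" by (intro integrable_mult_right L2_D h)
    show "(\<lambda>x. (cmod (h x * of_real (g x)))\<^sup>2) \<in> borel_measurable (lebesgue_on \<Omega>)" using m by measurable
    show "AE x in lebesgue_on \<Omega>. norm ((cmod (h x * of_real (g x)))\<^sup>2) \<le> norm (B\<^sup>2 * (cmod (h x))\<^sup>2)"
    proof (rule AE_I2)
      fix x assume "x \<in> space (lebesgue_on \<Omega>)"
      then have "(g x)\<^sup>2 \<le> B\<^sup>2" using B[of x] by (simp add: space_restrict_space abs_le_square_iff[symmetric] power2_le_iff_abs_le order_trans[OF abs_ge_zero])
      then show "norm ((cmod (h x * of_real (g x)))\<^sup>2) \<le> norm (B\<^sup>2 * (cmod (h x))\<^sup>2)"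
        using mult_right_mono[of "(g x)\<^sup>2" "B\<^sup>2" "(cmod (h x))\<^sup>2"] by (simp add: norm_mult power_mult_distrib mult.commute)
    qed
  qed
  with m show ?thesis by (simp add: L2_iff)
qed

section \<open>Totality of the double cosine and sine systems\<close>

definition cos_null :: "(real \<times> real \<Rightarrow> complex) \<Rightarrow> bool" where
  "cos_null h \<longleftrightarrow> h \<in> L2 \<Omega> \<and> (\<forall>m n. (LINT p|lebesgue_on \<Omega>. h p * of_real (cx m (fst p) * cy n (snd p))) = 0)"

lemma pair_integrable:
  assumes h: "h \<in> L2 \<Omega>" and g: "continuous_on UNIV g"
  shows "integrable (lebesgue_on \<Omega>) (\<lambda>p. h p * of_real (g p))"
  by (rule L2_integrable[OF lmeasurable_Omega_b L2_times_bounded[OF h g]])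

lemma cont_pair_real:
  assumes "\<And>S. continuous_on S f" "\<And>S. continuous_on S g"
  shows "continuous_on UNIV (\<lambda>p::real\<times>real. f (fst p) * g (snd p) :: real)"
  by (intro continuous_intros continuous_on_compose2[OF assms(1)[of UNIV]] continuous_on_compose2[OF assms(2)[of UNIV]]) auto

text \<open>The multipliers that preserve \<open>cos_null\<close> form a function ring containing the first
  nonconstant cosines, which separate the points of the closed rectangle.\<close>

lemma cos_null_pairing:
  assumes f: "cos_null f" and g: "continuous_on UNIV g"
  shows "(LINT p|lebesgue_on \<Omega>. f p * of_real (g p)) = 0"
proof -
  define R where "R g \<longleftrightarrow> continuous_on UNIV g \<and> (\<forall>h. cos_null h \<longrightarrow> cos_null (\<lambda>p. h p * of_real (g p)))" for g :: "real \<times> real \<Rightarrow> real"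
  have int: "integrable (lebesgue_on \<Omega>) (\<lambda>p. h p * of_real (cx m (fst p) * cy n (snd p)))" if "cos_null h" for h m n
    using that by (intro pair_integrable cont_pair_real trig_cont) (auto simp: cos_null_def)
  have Rx: "R (\<lambda>p. cx 1 (fst p))"
    unfolding R_def
  proof (intro conjI allI impI)
    show c: "continuous_on UNIV (\<lambda>p::real\<times>real. cx 1 (fst p))"
      by (rule continuous_on_compose2[OF trig_cont(1)[of UNIV]]) (auto intro: continuous_intros)
    fix h assume h: "cos_null h"
    have "(LINT p|lebesgue_on \<Omega>. h p * of_real (cx 1 (fst p)) * of_real (cx m (fst p) * cy n (snd p))) = 0" for m n
    proof -
      define j where "j = (if m \<le> 1 then 1 - m else m - 1)"
      have "h p * of_real (cx 1 (fst p)) * of_real (cx m (fst p) * cy n (snd p)) =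
          h p * of_real (cx (1 + m) (fst p) * cy n (snd p)) / 2 + h p * of_real (cx j (fst p) * cy n (snd p)) / 2" for p
      proof -
        have "h p * of_real (cx 1 (fst p)) * of_real (cx m (fst p) * cy n (snd p)) = h p * of_real ((cx 1 (fst p) * cx m (fst p)) * cy n (snd p))"
          by simp
        also have "\<dots> = h p * of_real ((cx (1 + m) (fst p) + cx j (fst p)) / 2 * cy n (snd p))" unfolding trig_product j_def ..
        finally show ?thesis by (simp add: algebra_simps add_divide_distrib)
      qed
      then show ?thesis using h int[OF h] by (simp add: cos_null_def)
    qed
    then show "cos_null (\<lambda>p. h p * of_real (cx 1 (fst p)))"
      using h L2_times_bounded[OF _ c] by (simp add: cos_null_def)
  qed
  have Ry: "R (\<lambda>p. cy 1 (snd p))"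
    unfolding R_def
  proof (intro conjI allI impI)
    show c: "continuous_on UNIV (\<lambda>p::real\<times>real. cy 1 (snd p))"
      by (rule continuous_on_compose2[OF trig_cont(3)[of UNIV]]) (auto intro: continuous_intros)
    fix h assume h: "cos_null h"
    have "(LINT p|lebesgue_on \<Omega>. h p * of_real (cy 1 (snd p)) * of_real (cx m (fst p) * cy n (snd p))) = 0" for m n
    proof -
      define j where "j = (if n \<le> 1 then 1 - n else n - 1)"
      have "h p * of_real (cy 1 (snd p)) * of_real (cx m (fst p) * cy n (snd p)) =
          h p * of_real (cx m (fst p) * cy (1 + n) (snd p)) / 2 + h p * of_real (cx m (fst p) * cy j (snd p)) / 2" for p
      proof -
        have "h p * of_real (cy 1 (snd p)) * of_real (cx m (fst p) * cy n (snd p)) = h p * of_real (cx m (fst p) * (cy 1 (snd p) * cy n (snd p)))"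
          by simp
        also have "\<dots> = h p * of_real (cx m (fst p) * ((cy (1 + n) (snd p) + cy j (snd p)) / 2))" unfolding trig_product j_def ..
        finally show ?thesis by (simp add: algebra_simps add_divide_distrib)
      qed
      then show ?thesis using h int[OF h] by (simp add: cos_null_def)
    qed
    then show "cos_null (\<lambda>p. h p * of_real (cy 1 (snd p)))"
      using h L2_times_bounded[OF _ c] by (simp add: cos_null_def)
  qed
  \<comment> \<open>Cosine is injective on [0, pi], the range of the scaled coordinates, so
    whichever coordinate differs is separated by its own first cosine.\<close>
  have sep: "\<exists>g. R g \<and> g x \<noteq> g y" if xy: "x \<in> cbox (xm, 0) (xp, d)" "y \<in> cbox (xm, 0) (xp, d)" "x \<noteq> y" for x y
  proof (cases "fst x = fst y")
    case True
    then have ne: "snd x \<noteq> snd y" using xy(3) by (simp add: prod_eq_iff)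
    have r: "0 \<le> snd x" "snd x \<le> d" "0 \<le> snd y" "snd y \<le> d" using xy by (cases x, cases y, auto)+
    have "pi * snd x / d \<noteq> pi * snd y / d" using ne d_pos by simp
    then have "cy 1 (snd x) \<noteq> cy 1 (snd y)"
      using cos_inj_pi[of "pi * snd x / d" "pi * snd y / d"] r d_pos by (auto simp: cy_def field_simps)
    then show ?thesis using Ry by blast
  next
    case False
    have r: "xm \<le> fst x" "fst x \<le> xp" "xm \<le> fst y" "fst y \<le> xp" using xy by (cases x, cases y, auto)+
    have "pi * (fst x - xm) / len \<noteq> pi * (fst y - xm) / len" using False len_pos by simp
    moreover have "0 \<le> pi * (t - xm) / len" "pi * (t - xm) / len \<le> pi" if "xm \<le> t" "t \<le> xp" for t
      using that len_pos by (auto simp: pos_divide_le_eq)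
    ultimately have "cx 1 (fst x) \<noteq> cx 1 (fst y)"
      using cos_inj_pi[of "pi * (fst x - xm) / len" "pi * (fst y - xm) / len"] r by (auto simp: cx_def)
    then show ?thesis using Rx by blast
  qed
  have "\<exists>h. R h \<and> (\<forall>x\<in>cbox (xm, 0) (xp, d). \<bar>g x - h x\<bar> < e)" if "e > 0" for e
  proof (rule Stone_Weierstrass_HOL[where P = R])
    show "R (\<lambda>x. c)" for c
    proof -
      have "cos_null (\<lambda>p. h p * of_real c)" if "cos_null h" for h
        using that L2_scale[of h \<Omega> "of_real c"] int[OF that] unfolding cos_null_def
        by (simp add: mult.commute[of _ "of_real c"] mult.assoc)
      then show ?thesis by (simp add: R_def)
    qed
    show "R (\<lambda>x. f x + g x)" if "R f \<and> R g" for f g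
    proof -
      have "cos_null (\<lambda>p. h p * of_real (f p + g p))" if h: "cos_null h" for h
      proof -
        have 1: "cos_null (\<lambda>p. h p * of_real (f p))" "cos_null (\<lambda>p. h p * of_real (g p))"
          using \<open>R f \<and> R g\<close> h by (auto simp: R_def)
        then show ?thesis using L2_add[of "\<lambda>p. h p * of_real (f p)" \<Omega> "\<lambda>p. h p * of_real (g p)"] int[OF 1(1)] int[OF 1(2)]
          unfolding cos_null_def by (simp add: algebra_simps)
      qed
      then show ?thesis using that by (auto simp: R_def intro!: continuous_intros)
    qed
    show "R (\<lambda>x. f x * g x)" if "R f \<and> R g" for f g
    proof -
      have "cos_null (\<lambda>p. h p * of_real (f p * g p))" if h: "cos_null h" for h
      proof -
        have "cos_null (\<lambda>p. h p * of_real (f p))" using \<open>R f \<and> R g\<close> h by (auto simp: R_def)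
        then have "cos_null (\<lambda>p. h p * of_real (f p) * of_real (g p))" using \<open>R f \<and> R g\<close> unfolding R_def by blast
        then show ?thesis by (simp add: mult.assoc)
      qed
      then show ?thesis using that by (auto simp: R_def intro!: continuous_intros)
    qed
    show "continuous_on (cbox (xm, 0) (xp, d)) f" if "R f" for f
      using that continuous_on_subset unfolding R_def by blast
    show "continuous_on (cbox (xm, 0) (xp, d)) g" using g continuous_on_subset by blast
  qed (use sep that in \<open>auto intro: compact_cbox\<close>)
  then have "\<exists>h. R h \<and> (\<forall>x\<in>cbox (xm, 0) (xp, d). \<bar>g x - h x\<bar> < inverse (real (Suc k)))" for k by simp
  then obtain h where h: "\<And>k. R (h k)" "\<And>k x. x \<in> cbox (xm, 0) (xp, d) \<Longrightarrow> \<bar>g x - h k x\<bar> < inverse (real (Suc k))"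
    by metis
  have fL: "f \<in> L2 \<Omega>" using f by (simp add: cos_null_def)
  obtain B where B: "\<And>x. x \<in> \<Omega> \<Longrightarrow> \<bar>g x\<bar> \<le> B" using continuous_bounded_Omega[OF g] by auto
  have hx: "\<bar>g x - h k x\<bar> < inverse (real (Suc k))" if "x \<in> \<Omega>" for x k using h(2) that Omega_subset_cbox by blast
  have "(\<lambda>k. LINT p|lebesgue_on \<Omega>. f p * of_real (h k p)) \<longlonglongrightarrow> (LINT p|lebesgue_on \<Omega>. f p * of_real (g p))"
  proof (rule dominated_pairing[OF fL])
    show "continuous_on UNIV (h k)" for k using h(1) by (simp add: R_def)
    show "\<bar>h k x\<bar> \<le> B + 1" if "x \<in> \<Omega>" for k x
    proof -
      have "inverse (real (Suc k)) \<le> 1" by (simp add: field_simps)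
      then show ?thesis using B[OF that] hx[OF that, of k] by linarith
    qed
    show "(\<lambda>k. h k x) \<longlonglongrightarrow> g x" if "x \<in> \<Omega>" for x
    proof (rule LIM_zero_cancel, rule tendsto_rabs_zero_cancel, rule tendsto_sandwich[OF _ _ tendsto_const LIMSEQ_inverse_real_of_nat])
      show "\<forall>\<^sub>F n in sequentially. \<bar>h n x - g x\<bar> \<le> inverse (real (Suc n))"
        using hx[OF that] by (auto simp: abs_minus_commute less_imp_le)
    qed auto
  qed (rule g)
  \<comment> \<open>Multiplication by \<open>h k\<close> preserves \<open>cos_null\<close>, and the
    coefficient at (0, 0) is the plain integral.\<close>
  moreover have "(LINT p|lebesgue_on \<Omega>. f p * of_real (h k p)) = 0" for k
  proof -
    have "cos_null (\<lambda>p. f p * of_real (h k p))" using h(1)[of k] f by (simp add: R_def)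
    then have "(LINT p|lebesgue_on \<Omega>. f p * of_real (h k p) * of_real (cx 0 (fst p) * cy 0 (snd p))) = 0"
      unfolding cos_null_def by blast
    then show ?thesis by (simp add: cx_def cy_def)
  qed
  ultimately have "(\<lambda>k. 0) \<longlonglongrightarrow> (LINT p|lebesgue_on \<Omega>. f p * of_real (g p))" by simp
  then show ?thesis by (simp add: LIMSEQ_const_iff)
qed

text \<open>Continuous functions approximate the indicator of a measurable set almost everywhere, so
  vanishing pairings pass from continuous functions to indicators; a function whose integral over
  every measurable subset is 0 vanishes almost everywhere.\<close>

lemma cos_null_AE:
  assumes f: "cos_null f" shows "AE p in lebesgue_on \<Omega>. f p = 0"
proof (rule sigma_finite_measure.density_zero)
  show "sigma_finite_measure (lebesgue_on \<Omega>)"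
    using finite_measure_lebesgue_on[OF lmeasurable_Omega_b] by (rule finite_measure.axioms)
  have fL: "f \<in> L2 \<Omega>" using f by (simp add: cos_null_def)
  show fi: "integrable (lebesgue_on \<Omega>) f" by (rule L2_integrable[OF lmeasurable_Omega_b fL])
  fix A assume A': "A \<in> sets (lebesgue_on \<Omega>)"
  then have A: "A \<in> sets lebesgue" "A \<subseteq> \<Omega>"
    using sets_Omega by (auto simp: sets_restrict_space_iff)
  note A'[measurable]
  have "(indicat_real A) \<in> borel_measurable (lebesgue_on UNIV)"
    using A(1) by (simp add: borel_measurable_indicator)
  then have "(indicat_real A) measurable_on UNIV"
    using measurable_on_iff_borel_measurable[of UNIV "indicat_real A"] by simp
  then obtain N g where N: "negligible N" "\<And>n. continuous_on UNIV (g n)" "\<And>x. x \<notin> N \<Longrightarrow> (\<lambda>n. g n x) \<longlonglongrightarrow> indicat_real A x"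
    by (auto simp: measurable_on_def)
  \<comment> \<open>Clipping to [0, 1] keeps the limit and provides the dominating function
    |f|.\<close>
  define h where "h n x = min 1 (max 0 (g n x))" for n x
  have hc: "continuous_on UNIV (h n)" for n unfolding h_def by (intro continuous_intros N)
  have "(\<lambda>n. LINT x|lebesgue_on \<Omega>. f x * of_real (h n x)) \<longlonglongrightarrow> (LINT x|lebesgue_on \<Omega>. f x * of_real (indicat_real A x))"
  proof (rule integral_dominated_convergence)
    show "(\<lambda>x. f x * of_real (indicat_real A x)) \<in> borel_measurable (lebesgue_on \<Omega>)"
      by (intro borel_measurable_times L2_D(1)[OF fL]) measurable
    show "(\<lambda>x. f x * of_real (h k x)) \<in> borel_measurable (lebesgue_on \<Omega>)" for k
      by (intro borel_measurable_times L2_D(1)[OF fL] continuous_on_UNIV_measurable continuous_intros hc)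
    show "integrable (lebesgue_on \<Omega>) (\<lambda>x. cmod (f x))" using fi by simp
    have "AE x in lebesgue. x \<notin> N" using N(1) by (simp add: negligible_iff_null_sets AE_not_in)
    then have "AE x in lebesgue_on \<Omega>. x \<notin> N" by (subst AE_restrict_space_iff) (auto simp: sets_Omega)
    then show "AE x in lebesgue_on \<Omega>. (\<lambda>k. f x * of_real (h k x)) \<longlonglongrightarrow> f x * of_real (indicat_real A x)"
    proof eventually_elim
      case (elim x)
      have "(\<lambda>k. h k x) \<longlonglongrightarrow> min 1 (max 0 (indicat_real A x))" unfolding h_def by (intro tendsto_intros N elim)
      also have "min 1 (max 0 (indicat_real A x)) = indicat_real A x" by (simp add: indicator_def)
      finally show ?case by (intro tendsto_intros)
    qed
    show "AE x in lebesgue_on \<Omega>. norm (f x * of_real (h k x)) \<le> cmod (f x)" for k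
      by (rule AE_I2) (auto simp: norm_mult h_def intro!: mult_left_le)
  qed
  moreover have "(LINT x|lebesgue_on \<Omega>. f x * of_real (h n x)) = 0" for n by (rule cos_null_pairing[OF f hc])
  ultimately have "(\<lambda>k. 0) \<longlonglongrightarrow> (LINT x|lebesgue_on \<Omega>. f x * of_real (indicat_real A x))" by simp
  then have "(LINT x|lebesgue_on \<Omega>. f x * of_real (indicat_real A x)) = 0" by (simp add: LIMSEQ_const_iff)
  then show "set_lebesgue_integral (lebesgue_on \<Omega>) A f = 0"
    by (simp add: set_lebesgue_integral_def scaleR_conv_of_real mult.commute)
qed

text \<open>The product of \<open>sx 1\<close> with a cosine is a combination of sines, so
  multiplication by \<open>sx 1\<close> turns vanishing sine coefficients into vanishing cosine
  coefficients. As \<open>sx 1\<close> is positive inside, nothing is lost by the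
  multiplication.\<close>

lemma sin_cos_null_AE:
  assumes f: "f \<in> L2 \<Omega>"
    and z: "\<And>m n. (LINT p|lebesgue_on \<Omega>. f p * of_real (sx (Suc m) (fst p) * cy n (snd p))) = 0"
  shows "AE p in lebesgue_on \<Omega>. f p = 0"
proof -
  have z': "(LINT p|lebesgue_on \<Omega>. f p * of_real (sx m (fst p) * cy n (snd p))) = 0" for m n
    by (cases m) (use z in \<open>auto simp: sx_def\<close>)
  have c: "continuous_on UNIV (\<lambda>p::real\<times>real. sx 1 (fst p))"
    by (rule continuous_on_compose2[OF trig_cont(2)[of UNIV]]) (auto intro: continuous_intros)
  have int: "integrable (lebesgue_on \<Omega>) (\<lambda>p. f p * of_real (sx m (fst p) * cy n (snd p)))" for m n
    by (intro pair_integrable cont_pair_real trig_cont f)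
  have "cos_null (\<lambda>p. f p * of_real (sx 1 (fst p)))"
    unfolding cos_null_def
  proof (intro conjI allI L2_times_bounded f c)
    fix m n
    \<comment> \<open>For m = 0 the second sine has index -1, that is, it equals -
      \<open>sx 1\<close>; truncated subtraction would yield \<open>sx 0\<close>.\<close>
    have s: "sx 1 x * cx m x = (sx (1 + m) x - (if m = 0 then - sx 1 x else sx (m - 1) x)) / 2" for x
    proof -
      define u where "u = pi * (x - xm) / len"
      have x: "cx m x = cos (real m * u)" "sx m x = sin (real m * u)" for m by (simp_all add: cx_def sx_def u_def mult.assoc)
      have "sin (real (m - 1) * u) = sin (real m * u - u)" if "m \<noteq> 0" using that by (simp add: of_nat_diff left_diff_distrib)
      moreover have "sin (real (1 + m) * u) = sin (u + real m * u)" by (simp add: distrib_right)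
      ultimately show ?thesis unfolding x by (auto simp: sin_add sin_diff)
    qed
    have eq: "f p * of_real (sx 1 (fst p)) * of_real (cx m (fst p) * cy n (snd p)) =
       f p * of_real (sx (1 + m) (fst p) * cy n (snd p)) / 2 - (if m = 0 then - 1 else 1) * (f p * of_real (sx (if m = 0 then 1 else m - 1) (fst p) * cy n (snd p)) / 2)" for p
    proof -
      have "f p * of_real (sx 1 (fst p)) * of_real (cx m (fst p) * cy n (snd p)) = f p * of_real ((sx 1 (fst p) * cx m (fst p)) * cy n (snd p))"
        by simp
      also have "\<dots> = f p * of_real ((sx (1 + m) (fst p) - (if m = 0 then - sx 1 (fst p) else sx (m - 1) (fst p))) / 2 * cy n (snd p))" unfolding s ..
      also have "\<dots> = f p * of_real (sx (1 + m) (fst p) * cy n (snd p)) / 2 - f p * of_real ((if m = 0 then - sx 1 (fst p) else sx (m - 1) (fst p)) * cy n (snd p)) / 2"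
        by (simp only: of_real_mult of_real_diff of_real_divide of_real_numeral) (simp only: diff_divide_distrib left_diff_distrib right_diff_distrib times_divide_eq_left times_divide_eq_right mult.assoc)
      also have "f p * of_real ((if m = 0 then - sx 1 (fst p) else sx (m - 1) (fst p)) * cy n (snd p)) / 2 =
          (if m = 0 then - 1 else 1) * (f p * of_real (sx (if m = 0 then 1 else m - 1) (fst p) * cy n (snd p)) / 2)" by simp
      finally show ?thesis .
    qed
    have "(LINT p|lebesgue_on \<Omega>. f p * of_real (sx (1 + m) (fst p) * cy n (snd p)) / 2 - (if m = 0 then - 1 else 1) * (f p * of_real (sx (if m = 0 then 1 else m - 1) (fst p) * cy n (snd p)) / 2)) = 0"
      by (subst Bochner_Integration.integral_diff) (auto simp: z' simp del: of_real_mult intro!: int integrable_divide integrable_mult_right)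
    then show "(LINT p|lebesgue_on \<Omega>. f p * of_real (sx 1 (fst p)) * of_real (cx m (fst p) * cy n (snd p))) = 0"
      by (simp only: eq)
  qed
  from cos_null_AE[OF this] show ?thesis
  proof (rule AE_mp, intro AE_I2 impI)
    fix p assume p: "p \<in> space (lebesgue_on \<Omega>)" "f p * of_real (sx 1 (fst p)) = 0"
    then have "0 < fst p - xm" "fst p - xm < len" by (auto simp: space_restrict_space mem_Omega)
    then have "0 < sx 1 (fst p)" unfolding sx_def using len_pos by (intro sin_gt_zero) (auto simp: field_simps)
    then show "f p = 0" using p by simp
  qed
qed

text \<open>The first sine in the second variable, positive inside, takes over the part of
  \<open>sx 1\<close>.\<close>

lemma cos_sin_null_AE:
  assumes f: "f \<in> L2 \<Omega>"
    and z: "\<And>m n. (LINT p|lebesgue_on \<Omega>. f p * of_real (cx m (fst p) * sy (Suc n) (snd p))) = 0"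
  shows "AE p in lebesgue_on \<Omega>. f p = 0"
proof -
  have z': "(LINT p|lebesgue_on \<Omega>. f p * of_real (cx m (fst p) * sy n (snd p))) = 0" for m n
    by (cases n) (use z in \<open>auto simp: sy_def\<close>)
  have c: "continuous_on UNIV (\<lambda>p::real\<times>real. sy 1 (snd p))"
    by (rule continuous_on_compose2[OF trig_cont(4)[of UNIV]]) (auto intro: continuous_intros)
  have int: "integrable (lebesgue_on \<Omega>) (\<lambda>p. f p * of_real (cx m (fst p) * sy n (snd p)))" for m n
    by (intro pair_integrable cont_pair_real trig_cont f)
  have "cos_null (\<lambda>p. f p * of_real (sy 1 (snd p)))"
    unfolding cos_null_def
  proof (intro conjI allI L2_times_bounded f c)
    fix m n
    have s: "sy 1 x * cy n x = (sy (1 + n) x - (if n = 0 then - sy 1 x else sy (n - 1) x)) / 2" for x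
    proof -
      define u where "u = pi * x / d"
      have x: "cy m x = cos (real m * u)" "sy m x = sin (real m * u)" for m by (simp_all add: cy_def sy_def u_def mult.assoc)
      have "sin (real (n - 1) * u) = sin (real n * u - u)" if "n \<noteq> 0" using that by (simp add: of_nat_diff left_diff_distrib)
      moreover have "sin (real (1 + n) * u) = sin (u + real n * u)" by (simp add: distrib_right)
      ultimately show ?thesis unfolding x by (auto simp: sin_add sin_diff)
    qed
    have eq: "f p * of_real (sy 1 (snd p)) * of_real (cx m (fst p) * cy n (snd p)) =
       f p * of_real (cx m (fst p) * sy (1 + n) (snd p)) / 2 - (if n = 0 then - 1 else 1) * (f p * of_real (cx m (fst p) * sy (if n = 0 then 1 else n - 1) (snd p)) / 2)" for p
    proof -
      have "f p * of_real (sy 1 (snd p)) * of_real (cx m (fst p) * cy n (snd p)) = f p * of_real (cx m (fst p) * (sy 1 (snd p) * cy n (snd p)))"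
        by simp
      also have "\<dots> = f p * of_real (cx m (fst p) * ((sy (1 + n) (snd p) - (if n = 0 then - sy 1 (snd p) else sy (n - 1) (snd p))) / 2))" unfolding s ..
      also have "\<dots> = f p * of_real (cx m (fst p) * sy (1 + n) (snd p)) / 2 - f p * of_real (cx m (fst p) * (if n = 0 then - sy 1 (snd p) else sy (n - 1) (snd p))) / 2"
        by (simp only: of_real_mult of_real_diff of_real_divide of_real_numeral) (simp only: diff_divide_distrib left_diff_distrib right_diff_distrib times_divide_eq_left times_divide_eq_right mult.assoc)
      also have "f p * of_real (cx m (fst p) * (if n = 0 then - sy 1 (snd p) else sy (n - 1) (snd p))) / 2 =
          (if n = 0 then - 1 else 1) * (f p * of_real (cx m (fst p) * sy (if n = 0 then 1 else n - 1) (snd p)) / 2)" by simp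
      finally show ?thesis .
    qed
    have "(LINT p|lebesgue_on \<Omega>. f p * of_real (cx m (fst p) * sy (1 + n) (snd p)) / 2 - (if n = 0 then - 1 else 1) * (f p * of_real (cx m (fst p) * sy (if n = 0 then 1 else n - 1) (snd p)) / 2)) = 0"
      by (subst Bochner_Integration.integral_diff) (auto simp: z' simp del: of_real_mult intro!: int integrable_divide integrable_mult_right)
    then show "(LINT p|lebesgue_on \<Omega>. f p * of_real (sy 1 (snd p)) * of_real (cx m (fst p) * cy n (snd p))) = 0"
      by (simp only: eq)
  qed
  from cos_null_AE[OF this] show ?thesis
  proof (rule AE_mp, intro AE_I2 impI)
    fix p assume p: "p \<in> space (lebesgue_on \<Omega>)" "f p * of_real (sy 1 (snd p)) = 0"
    then have "0 < snd p" "snd p < d" by (auto simp: space_restrict_space mem_Omega)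
    then have "0 < sy 1 (snd p)" unfolding sy_def using d_pos by (intro sin_gt_zero) (auto simp: field_simps)
    then show "f p = 0" using p by simp
  qed
qed

end

context semi_inner_space
begin

text \<open>Weights \<open>c i\<close> that may vanish admit the sine systems, whose members of
  index 0 are the zero function.\<close>

lemma nrm_orthogonal_sum:
  assumes "finite I" "\<And>i. i \<in> I \<Longrightarrow> e i \<in> V"
    "\<And>i j. i \<in> I \<Longrightarrow> j \<in> I \<Longrightarrow> ip (e i) (e j) = (if i = j then of_real (c i) else 0)"
  shows "(nrm (\<lambda>x. \<Sum>i\<in>I. a i * e i x))\<^sup>2 = (\<Sum>i\<in>I. c i * (cmod (a i))\<^sup>2)"
proof -
  have V: "(\<lambda>x. \<Sum>i\<in>I. a i * e i x) \<in> V" using assms(1,2) by (intro sum_mem scale_mem)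
  have "ip (\<lambda>x. \<Sum>i\<in>I. a i * e i x) (\<lambda>x. \<Sum>i\<in>I. a i * e i x)
      = (\<Sum>i\<in>I. \<Sum>j\<in>I. a i * (cnj (a j) * ip (e i) (e j)))"
    using assms(1,2) by (simp add: ip_sum_left ip_sum_right scale_mem sum_mem ip_scale_left ip_scale_right sum_distrib_left)
  also have "\<dots> = (\<Sum>i\<in>I. \<Sum>j\<in>I. if i = j then of_real (c i * (cmod (a i))\<^sup>2) else 0)"
    using assms(3) by (intro sum.cong) (auto simp: complex_mult_cnj cmod_power2 mult_ac)
  finally have "ip (\<lambda>x. \<Sum>i\<in>I. a i * e i x) (\<lambda>x. \<Sum>i\<in>I. a i * e i x) = of_real (\<Sum>i\<in>I. c i * (cmod (a i))\<^sup>2)"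
    using assms(1) by simp
  then show ?thesis using nrm_square[OF V] by simp
qed

lemma ip_cong_null:
  assumes "p \<in> V" "q \<in> V" "r \<in> V" "nrm (\<lambda>x. p x - q x) = 0"
  shows "ip p r = ip q r"
  using Cauchy_Schwarz[OF diff_mem[OF assms(1,2)] assms(3)] assms by (simp add: ip_diff_left)

lemma nrm_cong_null:
  assumes "p \<in> V" "q \<in> V" "nrm (\<lambda>x. p x - q x) = 0"
  shows "nrm p = nrm q"
  using nrm_triangle_sub[OF assms(1,2)] nrm_triangle_sub[OF assms(2,1)] assms(3) nrm_minus_commute[OF assms(1,2)] by simp

end

section \<open>Fourier expansion of functions and of their weak derivatives\<close>

context guide
begin

definition E :: "nat \<times> nat \<Rightarrow> real \<times> real \<Rightarrow> complex" where
  "E i p = of_real ((nx (fst i) * cx (fst i) (fst p)) * (ny (snd i) * cy (snd i) (snd p)))"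
definition Ex :: "nat \<times> nat \<Rightarrow> real \<times> real \<Rightarrow> complex" where
  "Ex i p = of_real ((nx (fst i) * sx (fst i) (fst p)) * (ny (snd i) * cy (snd i) (snd p)))"
definition Ey :: "nat \<times> nat \<Rightarrow> real \<times> real \<Rightarrow> complex" where
  "Ey i p = of_real ((nx (fst i) * cx (fst i) (fst p)) * (ny (snd i) * sy (snd i) (snd p)))"

lemma real_tensor_ip:
  assumes "\<And>S. continuous_on S a" "\<And>S. continuous_on S b" "\<And>S. continuous_on S a'" "\<And>S. continuous_on S b'"
    and "((\<lambda>x. a x * a' x) has_integral I) {xm..xp}" "((\<lambda>x. b x * b' x) has_integral J) {0..d}"
  shows "L2_inner \<Omega> (\<lambda>p. of_real (a (fst p) * b (snd p))) (\<lambda>p. of_real (a' (fst p) * b' (snd p))) = of_real (I * J)"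
proof -
  have 1: "continuous_on UNIV (\<lambda>x. of_real (a x * a' x) :: complex)" "continuous_on UNIV (\<lambda>x. of_real (b x * b' x) :: complex)"
    using assms by (auto intro!: continuous_intros)
  have "L2_inner \<Omega> (\<lambda>p. of_real (a (fst p) * b (snd p))) (\<lambda>p. of_real (a' (fst p) * b' (snd p)))
     = (LINT p|lebesgue_on \<Omega>. of_real (a (fst p) * a' (fst p)) * of_real (b (snd p) * b' (snd p)))"
    by (simp add: L2_inner_def mult_ac)
  also have "\<dots> = integral {xm..xp} (\<lambda>x. of_real (a x * a' x)) * integral {0..d} (\<lambda>x. of_real (b x * b' x))"
    by (rule LINT_Omega_tensor[OF 1])
  also have "integral {xm..xp} (\<lambda>x. of_real (a x * a' x)) = (of_real I :: complex)"
    using has_integral_of_real[OF assms(5)] by (rule integral_unique)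
  also have "integral {0..d} (\<lambda>x. of_real (b x * b' x)) = (of_real J :: complex)"
    using has_integral_of_real[OF assms(6)] by (rule integral_unique)
  finally show ?thesis by simp
qed

lemma cont_trig: "continuous_on S (\<lambda>x. nx m * cx m x)" "continuous_on S (\<lambda>x. nx m * sx m x)"
  "continuous_on S (\<lambda>y. ny n * cy n y)" "continuous_on S (\<lambda>y. ny n * sy n y)"
  by (intro continuous_intros trig_cont)+

lemma E_L2: "E i \<in> L2 \<Omega>" "Ex i \<in> L2 \<Omega>" "Ey i \<in> L2 \<Omega>"
  unfolding E_def[abs_def] Ex_def[abs_def] Ey_def[abs_def]
  by (intro continuous_in_L2 cont_pair cont_trig)+

lemma E_orthonormal: "L2_inner \<Omega> (E i) (E j) = (if i = j then 1 else 0)"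
proof -
  have "L2_inner \<Omega> (E i) (E j) = of_real ((if fst i = fst j then 1 else 0) * (if snd i = snd j then 1 else 0))"
    unfolding E_def[abs_def] by (intro real_tensor_ip cont_trig trig_orthonormal)
  then show ?thesis by (auto simp: prod_eq_iff)
qed

lemma sx_orthonormal:
  "((\<lambda>x. nx m * sx m x * (nx m' * sx m' x)) has_integral (if m = m' \<and> m \<noteq> 0 then 1 else 0)) {xm..xp}"
proof (cases "m = 0 \<or> m' = 0")
  case True
  then have "(\<lambda>x. nx m * sx m x * (nx m' * sx m' x)) = (\<lambda>x. 0)" by (auto simp: sx_def)
  then show ?thesis using True by auto
next
  case False
  then obtain j j' where "m = Suc j" "m' = Suc j'" by (metis not0_implies_Suc)
  then show ?thesis using trig_orthonormal(2)[of j j'] by simp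
qed

lemma sy_orthonormal:
  "((\<lambda>x. ny m * sy m x * (ny m' * sy m' x)) has_integral (if m = m' \<and> m \<noteq> 0 then 1 else 0)) {0..d}"
proof (cases "m = 0 \<or> m' = 0")
  case True
  then have "(\<lambda>x. ny m * sy m x * (ny m' * sy m' x)) = (\<lambda>x. 0)" by (auto simp: sy_def)
  then show ?thesis using True by auto
next
  case False
  then obtain j j' where "m = Suc j" "m' = Suc j'" by (metis not0_implies_Suc)
  then show ?thesis using trig_orthonormal(4)[of j j'] by simp
qed

lemma Ex_orthogonal: "L2_inner \<Omega> (Ex i) (Ex j) = (if i = j then of_real (if fst i = 0 then 0 else 1) else 0)"
proof -
  have "L2_inner \<Omega> (Ex i) (Ex j) = of_real ((if fst i = fst j \<and> fst i \<noteq> 0 then 1 else 0) * (if snd i = snd j then 1 else 0))"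
    unfolding Ex_def[abs_def] by (intro real_tensor_ip cont_trig trig_orthonormal sx_orthonormal)
  then show ?thesis by (auto simp: prod_eq_iff)
qed

lemma Ey_orthogonal: "L2_inner \<Omega> (Ey i) (Ey j) = (if i = j then of_real (if snd i = 0 then 0 else 1) else 0)"
proof -
  have "L2_inner \<Omega> (Ey i) (Ey j) = of_real ((if fst i = fst j then 1 else 0) * (if snd i = snd j \<and> snd i \<noteq> 0 then 1 else 0))"
    unfolding Ey_def[abs_def] by (intro real_tensor_ip cont_trig trig_orthonormal sy_orthonormal)
  then show ?thesis by (auto simp: prod_eq_iff)
qed

definition hat :: "(real \<times> real \<Rightarrow> complex) \<Rightarrow> nat \<times> nat \<Rightarrow> complex" where "hat u i = L2_inner \<Omega> u (E i)"

text \<open>Square truncations give all columns of the coefficient array the same length, so a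
  partial sum splits into modes with equally many terms.\<close>

definition Q :: "nat \<Rightarrow> (nat \<times> nat) set" where "Q N = {..N} \<times> {..N}"

lemma Q_finite: "finite (Q N)" and Q_mono: "incseq Q" and Q_exhaust: "\<exists>N. i \<in> Q N"
proof -
  show "finite (Q N)" by (simp add: Q_def)
  show "incseq Q" by (auto simp: incseq_def Q_def)
  show "\<exists>N. i \<in> Q N" by (rule exI[of _ "max (fst i) (snd i)"]) (auto simp: Q_def mem_Times_iff)
qed

definition trigpoly :: "(nat \<times> nat) set \<Rightarrow> (nat \<times> nat \<Rightarrow> complex) \<Rightarrow> real \<times> real \<Rightarrow> complex" where
  "trigpoly I a p = (\<Sum>i\<in>I. a i * E i p)"

lemma LINT_L2_inner: 
  "(LINT p|lebesgue_on \<Omega>. f p * of_real (g p)) = L2_inner \<Omega> f (\<lambda>p. of_real (g p))"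
  by (simp add: L2_inner_def)

lemma null_from_inner:
  assumes g: "g \<in> L2 \<Omega>"
  shows "(\<And>i. L2_inner \<Omega> g (E i) = 0) \<Longrightarrow> L2_norm \<Omega> g = 0"
    and "(\<And>m n. L2_inner \<Omega> g (Ex (Suc m, n)) = 0) \<Longrightarrow> L2_norm \<Omega> g = 0"
    and "(\<And>m n. L2_inner \<Omega> g (Ey (m, Suc n)) = 0) \<Longrightarrow> L2_norm \<Omega> g = 0"
proof -
  have sc: "(LINT p|lebesgue_on \<Omega>. g p * of_real (h p)) = 0"
    if "L2_inner \<Omega> g (\<lambda>p. of_real (c * h p)) = 0" "c \<noteq> 0" for c h
  proof -
    have "L2_inner \<Omega> g (\<lambda>p. of_real (c * h p)) = of_real c * (LINT p|lebesgue_on \<Omega>. g p * of_real (h p))"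
      by (simp add: L2_inner_def mult.left_commute)
    then show ?thesis using that by simp
  qed
  { assume z: "\<And>i. L2_inner \<Omega> g (E i) = 0"
    have "cos_null g" unfolding cos_null_def
    proof (intro conjI g allI)
      fix m n
      show "(LINT p|lebesgue_on \<Omega>. g p * of_real (cx m (fst p) * cy n (snd p))) = 0"
      proof (rule sc)
        show "L2_inner \<Omega> g (\<lambda>p. of_real ((nx m * ny n) * (cx m (fst p) * cy n (snd p)))) = 0"
          using z[of "(m, n)"] unfolding E_def[abs_def] by (simp add: mult_ac)
      qed (use nx_pos[of m] ny_pos[of n] in simp)
    qed
    then show "L2_norm \<Omega> g = 0" using cos_null_AE L2_norm_eq_0_iff[OF g] by blast }
  { assume z: "\<And>m n. L2_inner \<Omega> g (Ex (Suc m, n)) = 0"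
    have "(LINT p|lebesgue_on \<Omega>. g p * of_real (sx (Suc m) (fst p) * cy n (snd p))) = 0" for m n
    proof (rule sc)
      show "L2_inner \<Omega> g (\<lambda>p. of_real ((nx (Suc m) * ny n) * (sx (Suc m) (fst p) * cy n (snd p)))) = 0"
        using z[of "m" n] unfolding Ex_def[abs_def] by (simp add: mult_ac)
    qed (use nx_pos[of "Suc m"] ny_pos[of n] in simp)
    then show "L2_norm \<Omega> g = 0" using sin_cos_null_AE[OF g] L2_norm_eq_0_iff[OF g] by blast }
  { assume z: "\<And>m n. L2_inner \<Omega> g (Ey (m, Suc n)) = 0"
    have "(LINT p|lebesgue_on \<Omega>. g p * of_real (cx m (fst p) * sy (Suc n) (snd p))) = 0" for m n
    proof (rule sc)
      show "L2_inner \<Omega> g (\<lambda>p. of_real ((nx m * ny (Suc n)) * (cx m (fst p) * sy (Suc n) (snd p)))) = 0"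
        using z[of "m" n] unfolding Ey_def[abs_def] by (simp add: mult_ac)
    qed (use nx_pos[of "m"] ny_pos[of "Suc n"] in simp)
    then show "L2_norm \<Omega> g = 0" using cos_sin_null_AE[OF g] L2_norm_eq_0_iff[OF g] by blast }
qed

lemma expansion:
  assumes u: "u \<in> L2 \<Omega>"
  shows "(\<lambda>N. L2_norm \<Omega> (\<lambda>p. trigpoly (Q N) (hat u) p - u p)) \<longlonglongrightarrow> 0"
    and "(\<lambda>N. L2_norm \<Omega> (\<lambda>p. (\<Sum>i\<in>Q N. L2_inner \<Omega> u (Ex i) * Ex i p) - u p)) \<longlonglongrightarrow> 0"
    and "(\<lambda>N. L2_norm \<Omega> (\<lambda>p. (\<Sum>i\<in>Q N. L2_inner \<Omega> u (Ey i) * Ey i p) - u p)) \<longlonglongrightarrow> 0"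
proof -
  show "(\<lambda>N. L2_norm \<Omega> (\<lambda>p. trigpoly (Q N) (hat u) p - u p)) \<longlonglongrightarrow> 0"
    unfolding trigpoly_def hat_def
    by (rule L2_orthonormal_expansion[OF lmeasurable_Omega_b E_L2(1) E_orthonormal Q_finite Q_mono Q_exhaust null_from_inner(1) u])
  \<comment> \<open>Orthonormality holds once the zero members are dropped by shifting the index.
    {..<N} shifted covers 1 to N, so adding the zero terms back restores the sum over
    \<open>Q N\<close>.\<close>
  have "(\<lambda>N. L2_norm \<Omega> (\<lambda>p. (\<Sum>i\<in>{..<N}\<times>{..N}. L2_inner \<Omega> u (Ex (Suc (fst i), snd i)) * Ex (Suc (fst i), snd i) p) - u p)) \<longlonglongrightarrow> 0"
  proof (rule L2_orthonormal_expansion[OF lmeasurable_Omega_b _ _ _ _ _ _ u])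
    show "Ex (Suc (fst i), snd i) \<in> L2 \<Omega>" for i by (rule E_L2)
    show "L2_inner \<Omega> (Ex (Suc (fst i), snd i)) (Ex (Suc (fst j), snd j)) = (if i = j then 1 else 0)" for i j :: "nat \<times> nat"
      by (auto simp: Ex_orthogonal prod_eq_iff)
    show "finite ({..<N} \<times> {..N})" for N :: nat by simp
    show "incseq (\<lambda>N::nat. {..<N} \<times> {..N})" by (auto simp: incseq_def)
    show "\<exists>N. i \<in> {..<N} \<times> {..N}" for i :: "nat \<times> nat"
      by (rule exI[of _ "max (Suc (fst i)) (snd i)"]) (auto simp: mem_Times_iff)
    show "L2_norm \<Omega> g = 0" if "g \<in> L2 \<Omega>" "\<And>i. L2_inner \<Omega> g (Ex (Suc (fst i), snd i)) = 0" for g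
      using null_from_inner(2)[OF that(1)] that(2) by (metis fst_conv snd_conv)
  qed
  moreover have "(\<Sum>i\<in>{..<N}\<times>{..N}. L2_inner \<Omega> u (Ex (Suc (fst i), snd i)) * Ex (Suc (fst i), snd i) p) = (\<Sum>i\<in>Q N. L2_inner \<Omega> u (Ex i) * Ex i p)" for N p
  proof -
    have z: "Ex (0, n) p = 0" for n by (simp add: Ex_def sx_def)
    have "(\<Sum>i\<in>Q N. L2_inner \<Omega> u (Ex i) * Ex i p) = (\<Sum>m\<le>N. \<Sum>n\<le>N. L2_inner \<Omega> u (Ex (m, n)) * Ex (m, n) p)"
      by (simp add: Q_def sum.cartesian_product split_def)
    also have "\<dots> = (\<Sum>m<N. \<Sum>n\<le>N. L2_inner \<Omega> u (Ex (Suc m, n)) * Ex (Suc m, n) p)"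
      by (simp add: sum.atMost_shift z)
    finally show ?thesis by (simp add: sum.cartesian_product split_def)
  qed
  ultimately show "(\<lambda>N. L2_norm \<Omega> (\<lambda>p. (\<Sum>i\<in>Q N. L2_inner \<Omega> u (Ex i) * Ex i p) - u p)) \<longlonglongrightarrow> 0" by simp
  have "(\<lambda>N. L2_norm \<Omega> (\<lambda>p. (\<Sum>i\<in>{..N}\<times>{..<N}. L2_inner \<Omega> u (Ey (fst i, Suc (snd i))) * Ey (fst i, Suc (snd i)) p) - u p)) \<longlonglongrightarrow> 0"
  proof (rule L2_orthonormal_expansion[OF lmeasurable_Omega_b _ _ _ _ _ _ u])
    show "Ey (fst i, Suc (snd i)) \<in> L2 \<Omega>" for i by (rule E_L2)
    show "L2_inner \<Omega> (Ey (fst i, Suc (snd i))) (Ey (fst j, Suc (snd j))) = (if i = j then 1 else 0)" for i j :: "nat \<times> nat"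
      by (auto simp: Ey_orthogonal prod_eq_iff)
    show "finite ({..N} \<times> {..<N})" for N :: nat by simp
    show "incseq (\<lambda>N::nat. {..N} \<times> {..<N})" by (auto simp: incseq_def)
    show "\<exists>N. i \<in> {..N} \<times> {..<N}" for i :: "nat \<times> nat"
      by (rule exI[of _ "max (fst i) (Suc (snd i))"]) (auto simp: mem_Times_iff)
    show "L2_norm \<Omega> g = 0" if "g \<in> L2 \<Omega>" "\<And>i. L2_inner \<Omega> g (Ey (fst i, Suc (snd i))) = 0" for g
      using null_from_inner(3)[OF that(1)] that(2) by (metis fst_conv snd_conv)
  qed
  moreover have "(\<Sum>i\<in>{..N}\<times>{..<N}. L2_inner \<Omega> u (Ey (fst i, Suc (snd i))) * Ey (fst i, Suc (snd i)) p) = (\<Sum>i\<in>Q N. L2_inner \<Omega> u (Ey i) * Ey i p)" for N p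
  proof -
    have z: "Ey (m, 0) p = 0" for m by (simp add: Ey_def sy_def)
    have "(\<Sum>i\<in>Q N. L2_inner \<Omega> u (Ey i) * Ey i p) = (\<Sum>m\<le>N. \<Sum>n\<le>N. L2_inner \<Omega> u (Ey (m, n)) * Ey (m, n) p)"
      by (simp add: Q_def sum.cartesian_product split_def)
    also have "\<dots> = (\<Sum>m\<le>N. \<Sum>n<N. L2_inner \<Omega> u (Ey (m, Suc n)) * Ey (m, Suc n) p)"
      by (simp add: sum.atMost_shift[of _ N] z)
    finally show ?thesis by (simp add: sum.cartesian_product split_def)
  qed
  ultimately show "(\<lambda>N. L2_norm \<Omega> (\<lambda>p. (\<Sum>i\<in>Q N. L2_inner \<Omega> u (Ey i) * Ey i p) - u p)) \<longlonglongrightarrow> 0" by simp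
qed

text \<open>The sine in the differentiated direction vanishes at both ends, so
  \<open>weak_deriv_pairing\<close> applies and no boundary values of u enter. Sine coefficients of
  the weak derivative are thereby tied to cosine coefficients of u.\<close>

lemma weak_deriv_coeffs:
  assumes u: "u \<in> L2 \<Omega>" and g: "g \<in> L2 \<Omega>"
  shows "is_weak_deriv \<Omega> (1, 0) u g \<Longrightarrow> L2_inner \<Omega> g (Ex i) = - of_real (kx (fst i)) * hat u i"
    and "is_weak_deriv \<Omega> (0, 1) u g \<Longrightarrow> L2_inner \<Omega> g (Ey i) = - of_real (ky (snd i)) * hat u i"
proof -
  obtain m n where i: "i = (m, n)" by (cases i)
  have s: "smooth1 (\<lambda>x. nx m * cx m x)" "smooth1 (\<lambda>x. nx m * sx m x)" "smooth1 (\<lambda>x. ny n * cy n x)" "smooth1 (\<lambda>x. ny n * sy n x)"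
    by (intro smooth1_mult smooth1_const smooth1_trig)+
  have dd: "((\<lambda>x. nx m * cx m x) has_vector_derivative nx m * (- kx m * sx m x)) (at x)"
    "((\<lambda>x. nx m * sx m x) has_vector_derivative nx m * (kx m * cx m x)) (at x)"
    "((\<lambda>x. ny n * cy n x) has_vector_derivative ny n * (- ky n * sy n x)) (at x)"
    "((\<lambda>x. ny n * sy n x) has_vector_derivative ny n * (ky n * cy n x)) (at x)" for x
    by (intro has_vector_derivative_mult_right trig_deriv)+
  show "L2_inner \<Omega> g (Ex i) = - of_real (kx (fst i)) * hat u i" if w: "is_weak_deriv \<Omega> (1, 0) u g"
  proof -
    have "(LINT x|lebesgue_on \<Omega>. u x * of_real (nx m * (kx m * cx m (fst x)) * (ny n * cy n (snd x)))) =
        - (LINT x|lebesgue_on \<Omega>. g x * of_real (nx m * sx m (fst x) * (ny n * cy n (snd x))))"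
      by (rule weak_deriv_pairing(1)[OF u g s(2) dd(2) s(3) dd(3) w]) (simp_all add: trig_boundary)
    then have "(LINT x|lebesgue_on \<Omega>. g x * of_real (nx m * sx m (fst x) * (ny n * cy n (snd x)))) =
        - (LINT x|lebesgue_on \<Omega>. of_real (kx m) * (u x * of_real (nx m * cx m (fst x) * (ny n * cy n (snd x)))))"
      by (simp add: mult_ac)
    then show ?thesis by (simp add: i hat_def L2_inner_def Ex_def E_def)
  qed
  show "L2_inner \<Omega> g (Ey i) = - of_real (ky (snd i)) * hat u i" if w: "is_weak_deriv \<Omega> (0, 1) u g"
  proof -
    have "(LINT x|lebesgue_on \<Omega>. u x * of_real (nx m * cx m (fst x) * (ny n * (ky n * cy n (snd x))))) =
        - (LINT x|lebesgue_on \<Omega>. g x * of_real (nx m * cx m (fst x) * (ny n * sy n (snd x))))"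
      by (rule weak_deriv_pairing(2)[OF u g s(1) dd(1) s(4) dd(4) w]) (simp_all add: trig_boundary)
    then have "(LINT x|lebesgue_on \<Omega>. g x * of_real (nx m * cx m (fst x) * (ny n * sy n (snd x)))) =
        - (LINT x|lebesgue_on \<Omega>. of_real (ky n) * (u x * of_real (nx m * cx m (fst x) * (ny n * cy n (snd x)))))"
      by (simp add: mult_ac)
    then show ?thesis by (simp add: i hat_def L2_inner_def Ey_def E_def)
  qed
qed

text \<open>The sine coefficients of a weak derivative are determined by u, and the sine systems are
  total.\<close>

lemma weak_deriv_unique:
  assumes "u \<in> L2 \<Omega>" "g \<in> L2 \<Omega>" "h \<in> L2 \<Omega>" "e \<in> {(1, 0), (0, 1)}" "is_weak_deriv \<Omega> e u g" "is_weak_deriv \<Omega> e u h"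
  shows "L2_norm \<Omega> (\<lambda>x. g x - h x) = 0"
proof (cases "e = (1, 0)")
  case True
  show ?thesis
    by (rule null_from_inner(2)[OF L2.diff_mem[OF assms(2,3)]])
      (use assms True in \<open>simp add: L2.ip_diff_left E_L2 weak_deriv_coeffs(1)[of u]\<close>)
next
  case False
  then have "e = (0, 1)" using assms by auto
  then show ?thesis
    by (intro null_from_inner(3)[OF L2.diff_mem[OF assms(2,3)]])
      (use assms in \<open>simp add: L2.ip_diff_left E_L2 weak_deriv_coeffs(2)[of u]\<close>)
qed

section \<open>The Sobolev space as a Hilbert space\<close>

abbreviation D1 where "D1 u \<equiv> weak_deriv \<Omega> (1, 0) u"
abbreviation D2 where "D2 u \<equiv> weak_deriv \<Omega> (0, 1) u"

lemma H1D:
  assumes "u \<in> H1 \<Omega>"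
  shows "u \<in> L2 \<Omega>" "D1 u \<in> L2 \<Omega>" "D2 u \<in> L2 \<Omega>" "is_weak_deriv \<Omega> (1, 0) u (D1 u)" "is_weak_deriv \<Omega> (0, 1) u (D2 u)"
proof -
  show "u \<in> L2 \<Omega>" using assms by (simp add: H1_def)
  have "\<exists>g. g \<in> L2 \<Omega> \<and> is_weak_deriv \<Omega> (1, 0) u g" "\<exists>g. g \<in> L2 \<Omega> \<and> is_weak_deriv \<Omega> (0, 1) u g"
    using assms by (auto simp: H1_def)
  from this[THEN someI_ex] show "D1 u \<in> L2 \<Omega>" "D2 u \<in> L2 \<Omega>" "is_weak_deriv \<Omega> (1, 0) u (D1 u)" "is_weak_deriv \<Omega> (0, 1) u (D2 u)"
    by (auto simp: weak_deriv_def)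
qed

lemma H1I:
  assumes "u \<in> L2 \<Omega>" "g \<in> L2 \<Omega>" "h \<in> L2 \<Omega>" "is_weak_deriv \<Omega> (1, 0) u g" "is_weak_deriv \<Omega> (0, 1) u h"
  shows "u \<in> H1 \<Omega>" "L2_norm \<Omega> (\<lambda>x. D1 u x - g x) = 0" "L2_norm \<Omega> (\<lambda>x. D2 u x - h x) = 0"
proof -
  show u: "u \<in> H1 \<Omega>" using assms by (auto simp: H1_def)
  show "L2_norm \<Omega> (\<lambda>x. D1 u x - g x) = 0" "L2_norm \<Omega> (\<lambda>x. D2 u x - h x) = 0"
    using weak_deriv_unique[OF assms(1) H1D(2)[OF u] assms(2) _ H1D(4)[OF u] assms(4)]
      weak_deriv_unique[OF assms(1) H1D(3)[OF u] assms(3) _ H1D(5)[OF u] assms(5)] by auto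
qed

lemma test_function_continuous:
  assumes "test_function \<Omega> \<phi>" "e \<in> {(1, 0), (0, 1)}"
  shows "continuous_on UNIV \<phi>" "continuous_on UNIV (\<lambda>x. frechet_derivative \<phi> (at x) e)"
proof -
  have s: "smooth \<phi>" using assms(1) by (simp add: test_function_def)
  show "continuous_on UNIV \<phi>" by (rule smooth_continuous[OF s])
  obtain \<phi>x \<phi>y where \<phi>: "smooth \<phi>x" "smooth \<phi>y" "partial \<phi> \<phi>x \<phi>y" using s by (rule smooth_partial)
  have "(\<lambda>x. frechet_derivative \<phi> (at x) e) = \<phi>x \<or> (\<lambda>x. frechet_derivative \<phi> (at x) e) = \<phi>y"
    using assms(2) partial_frechet[OF \<phi>(3)] by auto
  then show "continuous_on UNIV (\<lambda>x. frechet_derivative \<phi> (at x) e)"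
    using smooth_continuous \<phi> by metis
qed

lemma is_weak_deriv_add:
  assumes "u \<in> L2 \<Omega>" "v \<in> L2 \<Omega>" "g \<in> L2 \<Omega>" "h \<in> L2 \<Omega>" "e \<in> {(1, 0), (0, 1)}" "is_weak_deriv \<Omega> e u g" "is_weak_deriv \<Omega> e v h"
  shows "is_weak_deriv \<Omega> e (\<lambda>x. u x + v x) (\<lambda>x. g x + h x)"
  unfolding is_weak_deriv_def
proof (intro allI impI)
  fix \<phi> assume t: "test_function \<Omega> \<phi>"
  note c = test_function_continuous[OF t assms(5)]
  show "(LINT x|lebesgue_on \<Omega>. (u x + v x) * of_real (frechet_derivative \<phi> (at x) e)) = - (LINT x|lebesgue_on \<Omega>. (g x + h x) * of_real (\<phi> x))"
    unfolding distrib_right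
    by (subst (1 2) Bochner_Integration.integral_add)
      (use assms t in \<open>auto intro!: pair_integrable c simp: is_weak_deriv_def\<close>)
qed

lemma is_weak_deriv_scale:
  "is_weak_deriv \<Omega> e u g \<Longrightarrow> is_weak_deriv \<Omega> e (\<lambda>x. c * u x) (\<lambda>x. c * g x)"
  unfolding is_weak_deriv_def by (simp add: mult.assoc)

lemma is_weak_deriv_limit:
  assumes u: "\<And>k. u k \<in> L2 \<Omega>" "v \<in> L2 \<Omega>" "(\<lambda>k. L2_norm \<Omega> (\<lambda>x. u k x - v x)) \<longlonglongrightarrow> 0"
    and g: "\<And>k. g k \<in> L2 \<Omega>" "h \<in> L2 \<Omega>" "(\<lambda>k. L2_norm \<Omega> (\<lambda>x. g k x - h x)) \<longlonglongrightarrow> 0"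
    and e: "e \<in> {(1, 0), (0, 1)}" and w: "\<And>k. is_weak_deriv \<Omega> e (u k) (g k)"
  shows "is_weak_deriv \<Omega> e v h"
  unfolding is_weak_deriv_def LINT_L2_inner
proof (intro allI impI)
  fix \<phi> assume t: "test_function \<Omega> \<phi>"
  have c: "(\<lambda>x. of_real (\<phi> x)) \<in> L2 \<Omega>" "(\<lambda>x. of_real (frechet_derivative \<phi> (at x) e)) \<in> L2 \<Omega>"
    using test_function_continuous[OF t e] by (auto intro!: continuous_in_L2 continuous_intros)
  have "(\<lambda>k. - L2_inner \<Omega> (g k) (\<lambda>x. of_real (\<phi> x))) \<longlonglongrightarrow> - L2_inner \<Omega> h (\<lambda>x. of_real (\<phi> x))"
    by (intro tendsto_minus L2.ip_tendsto_left g c)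
  moreover have "(\<lambda>k. L2_inner \<Omega> (u k) (\<lambda>x. of_real (frechet_derivative \<phi> (at x) e))) \<longlonglongrightarrow> L2_inner \<Omega> v (\<lambda>x. of_real (frechet_derivative \<phi> (at x) e))"
    by (intro L2.ip_tendsto_left u c)
  moreover have "L2_inner \<Omega> (u k) (\<lambda>x. of_real (frechet_derivative \<phi> (at x) e)) = - L2_inner \<Omega> (g k) (\<lambda>x. of_real (\<phi> x))" for k
    using w[of k] t unfolding is_weak_deriv_def LINT_L2_inner by blast
  ultimately show "L2_inner \<Omega> v (\<lambda>x. of_real (frechet_derivative \<phi> (at x) e)) = - L2_inner \<Omega> h (\<lambda>x. of_real (\<phi> x))"
    using LIMSEQ_unique by simp
qed

lemma H1_add:
  assumes u: "u \<in> H1 \<Omega>" and v: "v \<in> H1 \<Omega>"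
  shows "(\<lambda>x. u x + v x) \<in> H1 \<Omega>" "L2_norm \<Omega> (\<lambda>x. D1 (\<lambda>x. u x + v x) x - (D1 u x + D1 v x)) = 0"
    "L2_norm \<Omega> (\<lambda>x. D2 (\<lambda>x. u x + v x) x - (D2 u x + D2 v x)) = 0"
proof -
  have w: "is_weak_deriv \<Omega> (1, 0) (\<lambda>x. u x + v x) (\<lambda>x. D1 u x + D1 v x)"
    "is_weak_deriv \<Omega> (0, 1) (\<lambda>x. u x + v x) (\<lambda>x. D2 u x + D2 v x)"
    by (rule is_weak_deriv_add; (intro H1D u v)?; simp)+
  note * = H1I[OF L2_add[OF H1D(1)[OF u] H1D(1)[OF v]] L2_add[OF H1D(2)[OF u] H1D(2)[OF v]] L2_add[OF H1D(3)[OF u] H1D(3)[OF v]] w]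
  show "(\<lambda>x. u x + v x) \<in> H1 \<Omega>" "L2_norm \<Omega> (\<lambda>x. D1 (\<lambda>x. u x + v x) x - (D1 u x + D1 v x)) = 0"
    "L2_norm \<Omega> (\<lambda>x. D2 (\<lambda>x. u x + v x) x - (D2 u x + D2 v x)) = 0" by (rule *)+
qed

lemma H1_scale:
  assumes u: "u \<in> H1 \<Omega>"
  shows "(\<lambda>x. c * u x) \<in> H1 \<Omega>" "L2_norm \<Omega> (\<lambda>x. D1 (\<lambda>x. c * u x) x - c * D1 u x) = 0"
    "L2_norm \<Omega> (\<lambda>x. D2 (\<lambda>x. c * u x) x - c * D2 u x) = 0"
proof -
  note * = H1I[OF L2_scale[OF H1D(1)[OF u], of c] L2_scale[OF H1D(2)[OF u], of c] L2_scale[OF H1D(3)[OF u], of c]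
      is_weak_deriv_scale[OF H1D(4)[OF u]] is_weak_deriv_scale[OF H1D(5)[OF u]]]
  show "(\<lambda>x. c * u x) \<in> H1 \<Omega>" "L2_norm \<Omega> (\<lambda>x. D1 (\<lambda>x. c * u x) x - c * D1 u x) = 0"
    "L2_norm \<Omega> (\<lambda>x. D2 (\<lambda>x. c * u x) x - c * D2 u x) = 0" by (rule *)+
qed

text \<open>\<open>weak_deriv\<close> is an arbitrary choice among functions equal almost
  everywhere, so it is linear only up to null functions; inner products do not see the
  difference.\<close>

lemma D_add_inner:
  assumes u: "u \<in> H1 \<Omega>" and v: "v \<in> H1 \<Omega>" and w: "w \<in> L2 \<Omega>"
  shows "L2_inner \<Omega> (D1 (\<lambda>x. u x + v x)) w = L2_inner \<Omega> (D1 u) w + L2_inner \<Omega> (D1 v) w"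
    "L2_inner \<Omega> (D2 (\<lambda>x. u x + v x)) w = L2_inner \<Omega> (D2 u) w + L2_inner \<Omega> (D2 v) w"
  using L2.ip_cong_null[OF H1D(2)[OF H1_add(1)[OF u v]] L2_add[OF H1D(2)[OF u] H1D(2)[OF v]] w H1_add(2)[OF u v]]
    L2.ip_cong_null[OF H1D(3)[OF H1_add(1)[OF u v]] L2_add[OF H1D(3)[OF u] H1D(3)[OF v]] w H1_add(3)[OF u v]]
  by (simp_all add: L2.ip_add_left H1D u v w)

lemma D_scale_inner:
  assumes u: "u \<in> H1 \<Omega>" and w: "w \<in> L2 \<Omega>"
  shows "L2_inner \<Omega> (D1 (\<lambda>x. c * u x)) w = c * L2_inner \<Omega> (D1 u) w"
    "L2_inner \<Omega> (D2 (\<lambda>x. c * u x)) w = c * L2_inner \<Omega> (D2 u) w"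
  using L2.ip_cong_null[OF H1D(2)[OF H1_scale(1)[OF u]] L2_scale[OF H1D(2)[OF u]] w H1_scale(2)[OF u]]
    L2.ip_cong_null[OF H1D(3)[OF H1_scale(1)[OF u]] L2_scale[OF H1D(3)[OF u]] w H1_scale(3)[OF u]]
  by (simp_all add: L2.ip_scale_left H1D u w)

definition H1_inner :: "(real \<times> real \<Rightarrow> complex) \<Rightarrow> (real \<times> real \<Rightarrow> complex) \<Rightarrow> complex" where
  "H1_inner u v = L2_inner \<Omega> u v + L2_inner \<Omega> (D1 u) (D1 v) + L2_inner \<Omega> (D2 u) (D2 v)"

lemma H1_inner_self: "H1_inner u u = of_real ((H1_norm \<Omega> u)\<^sup>2)"
  by (simp add: H1_inner_def L2_inner_self H1_norm_def)

lemma H1_norm_square: "(H1_norm \<Omega> u)\<^sup>2 = (L2_norm \<Omega> u)\<^sup>2 + (L2_norm \<Omega> (D1 u))\<^sup>2 + (L2_norm \<Omega> (D2 u))\<^sup>2"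
  by (simp add: H1_norm_def)

lemma H1_norm_nonneg: "0 \<le> H1_norm \<Omega> u" by (simp add: H1_norm_def)

lemma semi_inner_space_H1: "semi_inner_space (H1 \<Omega>) H1_inner"
proof
  fix p q r :: "real \<times> real \<Rightarrow> complex" and c
  show "(\<lambda>x. 0) \<in> H1 \<Omega>" using smooth_in_H1[OF smooth_zero] .
  show "(\<lambda>x. p x + q x) \<in> H1 \<Omega>" if "p \<in> H1 \<Omega>" "q \<in> H1 \<Omega>" using H1_add that by blast
  show "(\<lambda>x. c * p x) \<in> H1 \<Omega>" if "p \<in> H1 \<Omega>" using H1_scale that by blast
  show "H1_inner (\<lambda>x. p x + q x) r = H1_inner p r + H1_inner q r" if "p \<in> H1 \<Omega>" "q \<in> H1 \<Omega>" "r \<in> H1 \<Omega>"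
    using that by (simp add: H1_inner_def D_add_inner H1D L2.ip_add_left)
  show "H1_inner (\<lambda>x. c * p x) r = c * H1_inner p r" if "p \<in> H1 \<Omega>" "r \<in> H1 \<Omega>"
    using that by (simp add: H1_inner_def D_scale_inner H1D L2.ip_scale_left algebra_simps)
  show "cnj (H1_inner p q) = H1_inner q p" if "p \<in> H1 \<Omega>" "q \<in> H1 \<Omega>"
    using that by (simp add: H1_inner_def H1D L2.ip_cnj)
  show "0 \<le> Re (H1_inner p p)" if "p \<in> H1 \<Omega>" by (simp add: H1_inner_self)
qed

lemma nrm_H1: "semi_inner_space.nrm H1_inner = H1_norm \<Omega>"
  by (rule ext) (simp add: semi_inner_space.nrm_def[OF semi_inner_space_H1] H1_inner_self H1_norm_nonneg)

lemma L2_norms_le_H1: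
  "L2_norm \<Omega> u \<le> H1_norm \<Omega> u" "L2_norm \<Omega> (D1 u) \<le> H1_norm \<Omega> u" "L2_norm \<Omega> (D2 u) \<le> H1_norm \<Omega> u"
  unfolding H1_norm_def by (auto intro!: real_le_rsqrt)

lemma H1_norm_le_sum: "H1_norm \<Omega> u \<le> L2_norm \<Omega> u + L2_norm \<Omega> (D1 u) + L2_norm \<Omega> (D2 u)"
proof -
  have "(L2_norm \<Omega> u)\<^sup>2 + (L2_norm \<Omega> (D1 u))\<^sup>2 + (L2_norm \<Omega> (D2 u))\<^sup>2 \<le> (L2_norm \<Omega> u + L2_norm \<Omega> (D1 u) + L2_norm \<Omega> (D2 u))\<^sup>2"
    by (simp add: power2_eq_square algebra_simps L2_norm_nonneg)
  then show ?thesis unfolding H1_norm_def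
    by (intro real_le_lsqrt) (auto intro!: add_nonneg_nonneg L2_norm_nonneg)
qed

lemma D_diff_norm:
  assumes u: "u \<in> H1 \<Omega>" and v: "v \<in> H1 \<Omega>"
  shows "L2_norm \<Omega> (D1 (\<lambda>x. u x - v x)) = L2_norm \<Omega> (\<lambda>x. D1 u x - D1 v x)"
    "L2_norm \<Omega> (D2 (\<lambda>x. u x - v x)) = L2_norm \<Omega> (\<lambda>x. D2 u x - D2 v x)"
proof -
  have w: "is_weak_deriv \<Omega> (1, 0) (\<lambda>x. u x + -1 * v x) (\<lambda>x. D1 u x + -1 * D1 v x)"
    "is_weak_deriv \<Omega> (0, 1) (\<lambda>x. u x + -1 * v x) (\<lambda>x. D2 u x + -1 * D2 v x)"
    by (rule is_weak_deriv_add; (intro L2_scale is_weak_deriv_scale H1D u v)?; simp)+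
  have L: "(\<lambda>x. u x + -1 * v x) \<in> L2 \<Omega>" "(\<lambda>x. D1 u x + -1 * D1 v x) \<in> L2 \<Omega>" "(\<lambda>x. D2 u x + -1 * D2 v x) \<in> L2 \<Omega>"
    by (intro L2_add L2_scale H1D u v)+
  note * = H1I[OF L w]
  show "L2_norm \<Omega> (D1 (\<lambda>x. u x - v x)) = L2_norm \<Omega> (\<lambda>x. D1 u x - D1 v x)"
    using L2.nrm_cong_null[OF H1D(2)[OF *(1)] L(2) *(2)] by simp
  show "L2_norm \<Omega> (D2 (\<lambda>x. u x - v x)) = L2_norm \<Omega> (\<lambda>x. D2 u x - D2 v x)"
    using L2.nrm_cong_null[OF H1D(3)[OF *(1)] L(3) *(3)] by simp
qed

text \<open>Weak differentiation is closed under L2 limits, so g and h are weak derivatives of v and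
  differ from the chosen ones by null functions. Completeness and density both reduce to
  this.\<close>

lemma H1_tendsto:
  assumes "\<And>k. u k \<in> H1 \<Omega>" "v \<in> L2 \<Omega>" "g \<in> L2 \<Omega>" "h \<in> L2 \<Omega>"
    "(\<lambda>k. L2_norm \<Omega> (\<lambda>x. u k x - v x)) \<longlonglongrightarrow> 0" "(\<lambda>k. L2_norm \<Omega> (\<lambda>x. D1 (u k) x - g x)) \<longlonglongrightarrow> 0"
    "(\<lambda>k. L2_norm \<Omega> (\<lambda>x. D2 (u k) x - h x)) \<longlonglongrightarrow> 0"
  shows "v \<in> H1 \<Omega>" "(\<lambda>k. H1_norm \<Omega> (\<lambda>x. u k x - v x)) \<longlonglongrightarrow> 0"
proof -
  have w: "is_weak_deriv \<Omega> (1, 0) v g" "is_weak_deriv \<Omega> (0, 1) v h"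
    by (rule is_weak_deriv_limit[of u v "\<lambda>k. D1 (u k)" g] is_weak_deriv_limit[of u v "\<lambda>k. D2 (u k)" h];
        (intro assms H1D)?; simp)+
  note * = H1I[OF assms(2-4) w]
  show v: "v \<in> H1 \<Omega>" by (rule *(1))
  have 1: "L2_norm \<Omega> (D1 (\<lambda>x. u k x - v x)) \<le> L2_norm \<Omega> (\<lambda>x. D1 (u k) x - g x)" for k
    using L2.nrm_triangle_diff[OF H1D(2)[OF assms(1)[of k]] assms(3) H1D(2)[OF v]] *(2)
      L2.nrm_minus_commute[OF assms(3) H1D(2)[OF v]] D_diff_norm(1)[OF assms(1)[of k] v] by simp
  have 2: "L2_norm \<Omega> (D2 (\<lambda>x. u k x - v x)) \<le> L2_norm \<Omega> (\<lambda>x. D2 (u k) x - h x)" for k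
    using L2.nrm_triangle_diff[OF H1D(3)[OF assms(1)[of k]] assms(4) H1D(3)[OF v]] *(3)
      L2.nrm_minus_commute[OF assms(4) H1D(3)[OF v]] D_diff_norm(2)[OF assms(1)[of k] v] by simp
  show "(\<lambda>k. H1_norm \<Omega> (\<lambda>x. u k x - v x)) \<longlonglongrightarrow> 0"
  proof (rule tendsto_sandwich[OF _ _ tendsto_const])
    show "(\<lambda>k. L2_norm \<Omega> (\<lambda>x. u k x - v x) + L2_norm \<Omega> (\<lambda>x. D1 (u k) x - g x) + L2_norm \<Omega> (\<lambda>x. D2 (u k) x - h x)) \<longlonglongrightarrow> 0"
      using tendsto_add[OF tendsto_add[OF assms(5,6)] assms(7)] by simp
    have "H1_norm \<Omega> (\<lambda>x. u k x - v x) \<le> L2_norm \<Omega> (\<lambda>x. u k x - v x) + L2_norm \<Omega> (\<lambda>x. D1 (u k) x - g x) + L2_norm \<Omega> (\<lambda>x. D2 (u k) x - h x)" for k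
      using H1_norm_le_sum[of "\<lambda>x. u k x - v x"] 1[of k] 2[of k] by linarith
    then show "\<forall>\<^sub>F k in sequentially. H1_norm \<Omega> (\<lambda>x. u k x - v x) \<le> L2_norm \<Omega> (\<lambda>x. u k x - v x) + L2_norm \<Omega> (\<lambda>x. D1 (u k) x - g x) + L2_norm \<Omega> (\<lambda>x. D2 (u k) x - h x)"
      by simp
  qed (simp add: H1_norm_nonneg)
qed

lemma complete_H1: "complete_semi_inner_space (H1 \<Omega>) H1_inner"
proof (intro complete_semi_inner_space.intro semi_inner_space_H1, unfold_locales)
  fix u :: "nat \<Rightarrow> real \<times> real \<Rightarrow> complex"
  assume u: "\<And>n. u n \<in> H1 \<Omega>"
  have n: "sqrt (Re (H1_inner p p)) = H1_norm \<Omega> p" for p by (simp add: H1_inner_self H1_norm_nonneg)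
  assume "\<And>e. e > 0 \<Longrightarrow> \<exists>N. \<forall>m\<ge>N. \<forall>n\<ge>N. sqrt (Re (H1_inner (\<lambda>x. u m x - u n x) (\<lambda>x. u m x - u n x))) < e"
  then have C: "\<And>e. e > 0 \<Longrightarrow> \<exists>N. \<forall>m\<ge>N. \<forall>n\<ge>N. H1_norm \<Omega> (\<lambda>x. u m x - u n x) < e"
    by (simp add: n)
  have le: "L2_norm \<Omega> (\<lambda>x. D1 (u m) x - D1 (u n) x) \<le> H1_norm \<Omega> (\<lambda>x. u m x - u n x)"
    "L2_norm \<Omega> (\<lambda>x. D2 (u m) x - D2 (u n) x) \<le> H1_norm \<Omega> (\<lambda>x. u m x - u n x)" for m n
    using L2_norms_le_H1[of "\<lambda>x. u m x - u n x"] D_diff_norm[OF u u, of m n] by simp_all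
  have C': "\<exists>N. \<forall>m\<ge>N. \<forall>n\<ge>N. f m n < e" if "\<And>m n. f m n \<le> H1_norm \<Omega> (\<lambda>x. u m x - u n x)" "e > 0" for f :: "nat \<Rightarrow> nat \<Rightarrow> real" and e
    using C[OF that(2)] that(1) by (meson le_less_trans)
  obtain v where v: "v \<in> L2 \<Omega>" "(\<lambda>n. L2_norm \<Omega> (\<lambda>x. u n x - v x)) \<longlonglongrightarrow> 0"
    by (rule L2_complete[OF lmeasurable_Omega_b, of u]) (rule H1D(1)[OF u], rule C'[OF L2_norms_le_H1(1)], simp, blast)
  obtain g where g: "g \<in> L2 \<Omega>" "(\<lambda>n. L2_norm \<Omega> (\<lambda>x. D1 (u n) x - g x)) \<longlonglongrightarrow> 0"
    by (rule L2_complete[OF lmeasurable_Omega_b, of "\<lambda>n. D1 (u n)"]) (rule H1D(2)[OF u], rule C'[OF le(1)], simp, blast)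
  obtain h where h: "h \<in> L2 \<Omega>" "(\<lambda>n. L2_norm \<Omega> (\<lambda>x. D2 (u n) x - h x)) \<longlonglongrightarrow> 0"
    by (rule L2_complete[OF lmeasurable_Omega_b, of "\<lambda>n. D2 (u n)"]) (rule H1D(3)[OF u], rule C'[OF le(2)], simp, blast)
  show "\<exists>p\<in>H1 \<Omega>. (\<lambda>n. sqrt (Re (H1_inner (\<lambda>x. u n x - p x) (\<lambda>x. u n x - p x)))) \<longlonglongrightarrow> 0"
    unfolding n using H1_tendsto[OF u v(1) g(1) h(1) v(2) g(2) h(2)] by blast
qed

interpretation H1: semi_inner_space "H1 \<Omega>" H1_inner
  rewrites "semi_inner_space.nrm H1_inner = H1_norm \<Omega>"
  by (rule semi_inner_space_H1 nrm_H1)+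

section \<open>Density of trigonometric polynomials\<close>

definition trigpoly_x :: "(nat \<times> nat) set \<Rightarrow> (nat \<times> nat \<Rightarrow> complex) \<Rightarrow> real \<times> real \<Rightarrow> complex" where
  "trigpoly_x I a p = (\<Sum>i\<in>I. (- of_real (kx (fst i)) * a i) * Ex i p)"
definition trigpoly_y :: "(nat \<times> nat) set \<Rightarrow> (nat \<times> nat \<Rightarrow> complex) \<Rightarrow> real \<times> real \<Rightarrow> complex" where
  "trigpoly_y I a p = (\<Sum>i\<in>I. (- of_real (ky (snd i)) * a i) * Ey i p)"

lemma partial_E: "partial (E i) (\<lambda>p. - of_real (kx (fst i)) * Ex i p) (\<lambda>p. - of_real (ky (snd i)) * Ey i p)"
proof -
  obtain m n where i: "i = (m, n)" by (cases i)
  have "partial (\<lambda>p. nx m * cx m (fst p) * (ny n * cy n (snd p)))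
      (\<lambda>p. nx m * (- kx m * sx m (fst p)) * (ny n * cy n (snd p))) (\<lambda>p. nx m * cx m (fst p) * (ny n * (- ky n * sy n (snd p))))"
    by (intro partial_tensor has_vector_derivative_mult_right trig_deriv)
  from partial_of_real[OF this] show ?thesis
    by (simp add: i E_def[abs_def] Ex_def[abs_def] Ey_def[abs_def] mult_ac)
qed

lemma partial_scale:
  assumes "partial u ux uy" shows "partial (\<lambda>x. c * u x) (\<lambda>x. c * ux x) (\<lambda>x. (c::complex) * uy x)"
  unfolding partial_def
proof
  fix x
  show "((\<lambda>x. c * u x) has_derivative (\<lambda>h. fst h *\<^sub>R (c * ux x) + snd h *\<^sub>R (c * uy x))) (at x)"
    by (rule has_derivative_eq_rhs[OF has_derivative_mult_right[OF partialD[OF assms]]]) (auto simp: algebra_simps fun_eq_iff)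
qed

lemma partial_trigpoly: "partial (trigpoly I a) (trigpoly_x I a) (trigpoly_y I a)"
proof -
  have "partial (\<lambda>p. \<Sum>i\<in>I. a i * E i p) (\<lambda>p. \<Sum>i\<in>I. a i * (- of_real (kx (fst i)) * Ex i p)) (\<lambda>p. \<Sum>i\<in>I. a i * (- of_real (ky (snd i)) * Ey i p))"
    by (intro partial_sum partial_scale partial_E)
  then show ?thesis by (simp add: trigpoly_def[abs_def] trigpoly_x_def[abs_def] trigpoly_y_def[abs_def] mult_ac)
qed

lemma smooth_trigpoly: "smooth (trigpoly I a)"
proof -
  have "smooth (\<lambda>p. a i * E i p)" for i
  proof -
    have "smooth (\<lambda>p. (a i * of_real (nx (fst i) * cx (fst i) (fst p))) * of_real (ny (snd i) * cy (snd i) (snd p)))"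
      by (intro smooth_tensor smooth1_mult smooth1_const smooth1_of_real smooth1_trig)
    then show ?thesis by (simp add: E_def mult.assoc)
  qed
  then show ?thesis unfolding trigpoly_def[abs_def] by (intro smooth_sum)
qed

lemma continuous_E: "continuous_on UNIV (E i)" "continuous_on UNIV (Ex i)" "continuous_on UNIV (Ey i)"
  unfolding E_def[abs_def] Ex_def[abs_def] Ey_def[abs_def] by (intro cont_pair cont_trig)+

lemma continuous_trigpoly: "continuous_on UNIV (trigpoly I a)" "continuous_on UNIV (trigpoly_x I a)" "continuous_on UNIV (trigpoly_y I a)"
  unfolding trigpoly_def[abs_def] trigpoly_x_def[abs_def] trigpoly_y_def[abs_def] by (intro continuous_intros continuous_E)+

lemma D_classical:
  assumes u: "partial u ux uy" "continuous_on UNIV ux" "continuous_on UNIV uy"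
  shows "u \<in> H1 \<Omega>" "L2_norm \<Omega> (\<lambda>x. D1 u x - ux x) = 0" "L2_norm \<Omega> (\<lambda>x. D2 u x - uy x) = 0"
  by (rule H1I[OF continuous_in_L2[OF partial_continuous[OF u(1)]] continuous_in_L2[OF u(2)] continuous_in_L2[OF u(3)] weak_deriv_classical[OF u]])+

lemma D_trigpoly:
  "trigpoly I a \<in> H1 \<Omega>" "L2_norm \<Omega> (\<lambda>x. D1 (trigpoly I a) x - trigpoly_x I a x) = 0" "L2_norm \<Omega> (\<lambda>x. D2 (trigpoly I a) x - trigpoly_y I a x) = 0"
  by (rule D_classical[OF partial_trigpoly continuous_trigpoly(2,3)])+

text \<open>By \<open>weak_deriv_coeffs\<close> the differentiated cosine sum is the partial sum of
  the sine expansion of the weak derivative, so the three L2 expansions combine to convergence in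
  H^1.\<close>

theorem trigpoly_dense:
  assumes u: "u \<in> H1 \<Omega>"
  shows "(\<lambda>N. H1_norm \<Omega> (\<lambda>p. trigpoly (Q N) (hat u) p - u p)) \<longlonglongrightarrow> 0"
proof (rule H1_tendsto(2)[OF D_trigpoly(1) H1D(1-3)[OF u]])
  show "(\<lambda>k. L2_norm \<Omega> (\<lambda>x. trigpoly (Q k) (hat u) x - u x)) \<longlonglongrightarrow> 0"
    by (rule expansion(1)[OF H1D(1)[OF u]])
  have x: "(\<Sum>i\<in>I. L2_inner \<Omega> (D1 u) (Ex i) * Ex i p) = trigpoly_x I (hat u) p" for I p
    unfolding trigpoly_x_def weak_deriv_coeffs(1)[OF H1D(1,2,4)[OF u]] ..
  have y: "(\<Sum>i\<in>I. L2_inner \<Omega> (D2 u) (Ey i) * Ey i p) = trigpoly_y I (hat u) p" for I p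
    unfolding trigpoly_y_def weak_deriv_coeffs(2)[OF H1D(1,3,5)[OF u]] ..
  have L: "trigpoly_x I a \<in> L2 \<Omega>" "trigpoly_y I a \<in> L2 \<Omega>" for I a by (intro continuous_in_L2 continuous_trigpoly)+
  show "(\<lambda>k. L2_norm \<Omega> (\<lambda>x. D1 (trigpoly (Q k) (hat u)) x - D1 u x)) \<longlonglongrightarrow> 0"
  proof (rule tendsto_sandwich[OF _ _ tendsto_const expansion(2)[OF H1D(2)[OF u], unfolded x]])
    show "\<forall>\<^sub>F n in sequentially. L2_norm \<Omega> (\<lambda>xa. D1 (trigpoly (Q n) (hat u)) xa - D1 u xa)
         \<le> L2_norm \<Omega> (\<lambda>p. trigpoly_x (Q n) (hat u) p - D1 u p)"
    proof (rule always_eventually, rule allI)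
      fix n
      show "L2_norm \<Omega> (\<lambda>xa. D1 (trigpoly (Q n) (hat u)) xa - D1 u xa) \<le> L2_norm \<Omega> (\<lambda>p. trigpoly_x (Q n) (hat u) p - D1 u p)"
        using L2.nrm_triangle_diff[OF H1D(2)[OF D_trigpoly(1)[of "Q n" "hat u"]] L(1)[of "Q n" "hat u"] H1D(2)[OF u]]
          D_trigpoly(2)[of "Q n" "hat u"] by simp
    qed
  qed (simp add: L2_norm_nonneg)
  show "(\<lambda>k. L2_norm \<Omega> (\<lambda>x. D2 (trigpoly (Q k) (hat u)) x - D2 u x)) \<longlonglongrightarrow> 0"
  proof (rule tendsto_sandwich[OF _ _ tendsto_const expansion(3)[OF H1D(3)[OF u], unfolded y]])
    show "\<forall>\<^sub>F n in sequentially. L2_norm \<Omega> (\<lambda>xa. D2 (trigpoly (Q n) (hat u)) xa - D2 u xa)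
         \<le> L2_norm \<Omega> (\<lambda>p. trigpoly_y (Q n) (hat u) p - D2 u p)"
    proof (rule always_eventually, rule allI)
      fix n
      show "L2_norm \<Omega> (\<lambda>xa. D2 (trigpoly (Q n) (hat u)) xa - D2 u xa) \<le> L2_norm \<Omega> (\<lambda>p. trigpoly_y (Q n) (hat u) p - D2 u p)"
        using L2.nrm_triangle_diff[OF H1D(3)[OF D_trigpoly(1)[of "Q n" "hat u"]] L(2)[of "Q n" "hat u"] H1D(3)[OF u]]
          D_trigpoly(3)[of "Q n" "hat u"] by simp
    qed
  qed (simp add: L2_norm_nonneg)
qed

lemma kxy_0: "kx 0 = 0" "ky 0 = 0" by (simp_all add: kx_def ky_def)

lemma trigpoly_norms:
  assumes I: "finite I"
  shows "(L2_norm \<Omega> (trigpoly I a))\<^sup>2 = (\<Sum>i\<in>I. (cmod (a i))\<^sup>2)"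
    "(L2_norm \<Omega> (D1 (trigpoly I a)))\<^sup>2 = (\<Sum>i\<in>I. (kx (fst i))\<^sup>2 * (cmod (a i))\<^sup>2)"
    "(L2_norm \<Omega> (D2 (trigpoly I a)))\<^sup>2 = (\<Sum>i\<in>I. (ky (snd i))\<^sup>2 * (cmod (a i))\<^sup>2)"
proof -
  have L: "trigpoly_x I a \<in> L2 \<Omega>" "trigpoly_y I a \<in> L2 \<Omega>" by (intro continuous_in_L2 continuous_trigpoly)+
  show "(L2_norm \<Omega> (trigpoly I a))\<^sup>2 = (\<Sum>i\<in>I. (cmod (a i))\<^sup>2)"
    using L2.nrm_orthogonal_sum[OF I E_L2(1), where c = "\<lambda>i. 1" and a = a] by (simp add: E_orthonormal trigpoly_def[abs_def])
  have "(L2_norm \<Omega> (trigpoly_x I a))\<^sup>2 = (\<Sum>i\<in>I. (if fst i = 0 then 0 else 1) * (cmod (- of_real (kx (fst i)) * a i))\<^sup>2)"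
    unfolding trigpoly_x_def[abs_def] by (rule L2.nrm_orthogonal_sum[OF I E_L2(2)]) (simp add: Ex_orthogonal)
  also have "\<dots> = (\<Sum>i\<in>I. (kx (fst i))\<^sup>2 * (cmod (a i))\<^sup>2)"
    by (intro sum.cong refl) (auto simp: norm_mult power_mult_distrib kxy_0)
  finally show "(L2_norm \<Omega> (D1 (trigpoly I a)))\<^sup>2 = (\<Sum>i\<in>I. (kx (fst i))\<^sup>2 * (cmod (a i))\<^sup>2)"
    using L2.nrm_cong_null[OF H1D(2)[OF D_trigpoly(1)] L(1) D_trigpoly(2)] by simp
  have "(L2_norm \<Omega> (trigpoly_y I a))\<^sup>2 = (\<Sum>i\<in>I. (if snd i = 0 then 0 else 1) * (cmod (- of_real (ky (snd i)) * a i))\<^sup>2)"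
    unfolding trigpoly_y_def[abs_def] by (rule L2.nrm_orthogonal_sum[OF I E_L2(3)]) (simp add: Ey_orthogonal)
  also have "\<dots> = (\<Sum>i\<in>I. (ky (snd i))\<^sup>2 * (cmod (a i))\<^sup>2)"
    by (intro sum.cong refl) (auto simp: norm_mult power_mult_distrib kxy_0)
  finally show "(L2_norm \<Omega> (D2 (trigpoly I a)))\<^sup>2 = (\<Sum>i\<in>I. (ky (snd i))\<^sup>2 * (cmod (a i))\<^sup>2)"
    using L2.nrm_cong_null[OF H1D(3)[OF D_trigpoly(1)] L(2) D_trigpoly(3)] by simp
qed

lemma H1_norm_trigpoly:
  "finite I \<Longrightarrow> (H1_norm \<Omega> (trigpoly I a))\<^sup>2 = (\<Sum>i\<in>I. (1 + (kx (fst i))\<^sup>2 + (ky (snd i))\<^sup>2) * (cmod (a i))\<^sup>2)"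
  by (simp add: H1_norm_square trigpoly_norms sum.distrib distrib_right)

end

section \<open>Traces\<close>

lemma smooth_diff:
  assumes "smooth u" "smooth v" shows "smooth (\<lambda>x. u x - v x)"
proof -
  obtain D where D: "D 0 0 = u" "\<And>i j x. (D i j has_derivative (\<lambda>h. fst h *\<^sub>R D (Suc i) j x + snd h *\<^sub>R D i (Suc j) x)) (at x)"
    using assms by (auto simp: smooth_def)
  obtain E where E: "E 0 0 = v" "\<And>i j x. (E i j has_derivative (\<lambda>h. fst h *\<^sub>R E (Suc i) j x + snd h *\<^sub>R E i (Suc j) x)) (at x)"
    using assms by (auto simp: smooth_def)
  show ?thesis unfolding smooth_def
    apply (intro exI[of _ "\<lambda>i j x. D i j x - E i j x"] conjI allI)
    using D(1) E(1) apply auto[1]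
    by (rule has_derivative_eq_rhs[OF has_derivative_diff[OF D(2) E(2)]]) (auto simp: algebra_simps)
qed

lemma smooth_cmult: "smooth u \<Longrightarrow> smooth (\<lambda>x. c * u x :: complex)"
proof -
  assume "smooth u"
  then obtain D where D: "D 0 0 = u" "\<And>i j x. (D i j has_derivative (\<lambda>h. fst h *\<^sub>R D (Suc i) j x + snd h *\<^sub>R D i (Suc j) x)) (at x)"
    by (auto simp: smooth_def)
  show ?thesis unfolding smooth_def
    apply (intro exI[of _ "\<lambda>i j x. c * D i j x"] conjI allI)
    using D(1) apply auto[1]
    by (rule has_derivative_eq_rhs[OF has_derivative_mult_right[OF D(2)]]) (auto simp: algebra_simps)
qed

lemma L2_norm_mono:
  assumes "u \<in> L2 S" "v \<in> L2 S" "\<And>x. x \<in> S \<Longrightarrow> cmod (u x) \<le> cmod (v x)"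
  shows "L2_norm S u \<le> L2_norm S v"
  unfolding L2_norm_def
  by (intro real_sqrt_le_mono integral_mono L2_D assms power_mono) (auto simp: space_restrict_space intro: assms)

context guide
begin

interpretation H1: semi_inner_space "H1 \<Omega>" H1_inner
  rewrites "semi_inner_space.nrm H1_inner = H1_norm \<Omega>"
  by (rule semi_inner_space_H1 nrm_H1)+

abbreviation J :: "real set" where "J \<equiv> {0<..<d}"

lemma continuous_in_L2_J: "continuous_on UNIV g \<Longrightarrow> g \<in> L2 J"
proof -
  assume g: "continuous_on UNIV g"
  have "bounded (g ` {0..d})"
    by (intro compact_imp_bounded compact_continuous_image continuous_on_subset[OF g]) auto
  then obtain B where "\<forall>x\<in>{0..d}. cmod (g x) \<le> B" by (auto simp: bounded_iff)
  then show ?thesis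
    by (intro bounded_in_L2[of _ _ B] continuous_on_UNIV_measurable g) auto
qed

lemma L2_inner_J:
  assumes "continuous_on UNIV f" "continuous_on UNIV g"
  shows "L2_inner J f g = integral {0..d} (\<lambda>y. f y * cnj (g y))"
proof -
  have "L2_inner J f g = integral J (\<lambda>y. f y * cnj (g y))"
    unfolding L2_inner_def by (rule lebesgue_integral_eq_integral[OF L2_inner_integrable]) (auto intro: continuous_in_L2_J assms)
  then show ?thesis by (simp add: integral_open_interval_real)
qed

lemma phi_eq: "phi d n y = of_real (ny n * cy n y)"
  by (simp add: phi_def ny_def cy_def)

lemma phi_L2: "phi d n \<in> L2 J" and phi_continuous: "continuous_on S (phi d n)"
proof -
  show c: "continuous_on S (phi d n)" for S
    unfolding phi_eq[abs_def] by (intro continuous_intros cont_trig)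
  show "phi d n \<in> L2 J" by (rule continuous_in_L2_J[OF c])
qed

lemma phi_orthonormal: "L2_inner J (phi d n) (phi d m) = (if n = m then 1 else 0)"
proof -
  have "L2_inner J (phi d n) (phi d m) = integral {0..d} (\<lambda>y. of_real (ny n * cy n y * (ny m * cy m y)))"
    by (subst L2_inner_J[OF phi_continuous phi_continuous]) (simp add: phi_eq)
  also have "\<dots> = of_real (if n = m then 1 else 0)"
    by (rule integral_unique[OF has_integral_of_real[OF trig_orthonormal(3)]])
  finally show ?thesis by simp
qed

lemma partial_cnj:
  assumes "partial u ux uy" shows "partial (\<lambda>x. cnj (u x)) (\<lambda>x. cnj (ux x)) (\<lambda>x. cnj (uy x))"
  unfolding partial_def
proof
  fix x
  show "((\<lambda>x. cnj (u x)) has_derivative (\<lambda>h. fst h *\<^sub>R cnj (ux x) + snd h *\<^sub>R cnj (uy x))) (at x)"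
    by (rule has_derivative_eq_rhs[OF has_derivative_cnj[OF partialD[OF assms]]]) (auto simp: fun_eq_iff)
qed

text \<open>Integrating \<open>\<partial>\<^sub>x (\<theta> |w|\<^sup>2)\<close> for an affine \<open>\<theta>\<close> that vanishes on the opposite side.\<close>

lemma edge_bound:
  assumes w: "smooth w" and s: "s \<in> {xm, xp}"
  shows "(L2_norm J (\<lambda>y. w (s, y)))\<^sup>2 \<le> (1 / len) * (L2_norm \<Omega> w)\<^sup>2 + 2 * L2_norm \<Omega> w * L2_norm \<Omega> (D1 w)"
proof -
  obtain wx wy where p: "smooth wx" "smooth wy" "partial w wx wy" using w by (rule smooth_partial)
  have c: "continuous_on S w" "continuous_on S wx" "continuous_on S wy" for S using p w smooth_continuous by auto
  define il where "il = 1 / len"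
  have il: "il > 0" using len_pos by (simp add: il_def)
  define b where "b = (if s = xp then xm else xp)"
  \<comment> \<open>\<theta> is 1 at s = xp and -1 at s = xm, and 0 on the opposite side, so that
    the difference of boundary values carries a plus sign for either s.\<close>
  define \<theta> where "\<theta> x = (x - b) / len" for x
  have \<theta>b: "\<bar>\<theta> x\<bar> \<le> 1" if "x \<in> {xm..xp}" for x
  proof -
    have "\<bar>x - b\<bar> \<le> len" using that by (auto simp: b_def)
    then show ?thesis using len_pos unfolding \<theta>_def abs_divide by simp
  qed
  have \<theta>v: "\<theta> xp * A - \<theta> xm * B = (if s = xp then A else B)" for A B :: real
  proof (cases "s = xp")
    case True
    then have "\<theta> xp = 1" "\<theta> xm = 0" using xm_less_xp by (simp_all add: \<theta>_def b_def)
    then show ?thesis using True by simp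
  next
    case False
    then have "\<theta> xp = 0" using xm_less_xp by (simp add: \<theta>_def b_def)
    moreover have "\<theta> xm = - (len / len)" using False unfolding \<theta>_def b_def by (simp only: if_False minus_divide_left minus_diff_eq)
    moreover have "len / len = 1" using xm_less_xp by (intro divide_self) auto
    ultimately show ?thesis using False by (simp only: if_False)
  qed
  have "((\<lambda>x. of_real (\<theta> x) :: complex) has_vector_derivative of_real il) (at x)" for x
  proof -
    have "(\<theta> has_real_derivative il) (at x)" unfolding \<theta>_def[abs_def] il_def using xm_less_xp by (auto intro!: derivative_eq_intros)
    then show ?thesis unfolding has_real_derivative_iff_has_vector_derivative
      by (rule bounded_linear.has_vector_derivative[OF bounded_linear_of_real])
  qed
  from partial_tensor[OF this has_vector_derivative_const[of 1]]
  have "partial (\<lambda>p. of_real (\<theta> (fst p)) :: complex) (\<lambda>p. of_real il) (\<lambda>p. 0)" by simp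
  from partial_mult[OF this partial_mult[OF p(3) partial_cnj[OF p(3)]]]
  have P: "partial (\<lambda>p. of_real (\<theta> (fst p)) * (w p * cnj (w p)))
     (\<lambda>p. of_real (\<theta> (fst p)) * (w p * cnj (wx p) + wx p * cnj (w p)) + of_real il * (w p * cnj (w p)))
     (\<lambda>p. of_real (\<theta> (fst p)) * (w p * cnj (wy p) + wy p * cnj (w p)) + 0 * (w p * cnj (w p)))" .
  have \<theta>c: "continuous_on UNIV (\<lambda>p::real\<times>real. \<theta> (fst p))" unfolding \<theta>_def using len_pos by (auto intro!: continuous_intros)
  have "(LINT p|lebesgue_on \<Omega>. of_real (\<theta> (fst p)) * (w p * cnj (wx p) + wx p * cnj (w p)) + of_real il * (w p * cnj (w p)))
      = integral {0..d} (\<lambda>y. of_real (\<theta> xp) * (w (xp, y) * cnj (w (xp, y))) - of_real (\<theta> xm) * (w (xm, y) * cnj (w (xm, y))))"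
    by (subst LINT_partial_x[OF P]) (auto intro!: continuous_intros c \<theta>c)
  also have "\<dots> = integral {0..d} (\<lambda>y. of_real ((cmod (w (s, y)))\<^sup>2))"
  proof (rule integral_cong)
    fix y
    have "of_real (\<theta> xp) * (w (xp, y) * cnj (w (xp, y))) - of_real (\<theta> xm) * (w (xm, y) * cnj (w (xm, y)))
      = (of_real (\<theta> xp * (cmod (w (xp, y)))\<^sup>2 - \<theta> xm * (cmod (w (xm, y)))\<^sup>2) :: complex)"
      by (simp add: complex_norm_square[symmetric] del: of_real_power)
    also have "\<dots> = of_real ((cmod (w (s, y)))\<^sup>2)" unfolding \<theta>v using s by auto
    finally show "of_real (\<theta> xp) * (w (xp, y) * cnj (w (xp, y))) - of_real (\<theta> xm) * (w (xm, y) * cnj (w (xm, y))) = of_real ((cmod (w (s, y)))\<^sup>2)" .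
  qed
  also have "\<dots> = L2_inner J (\<lambda>y. w (s, y)) (\<lambda>y. w (s, y))"
  proof -
    have cs: "continuous_on UNIV (\<lambda>y. w (s, y))" by (intro continuous_on_compose2[OF c(1)[of UNIV]] continuous_intros) auto
    show ?thesis unfolding L2_inner_J[OF cs cs] by (simp add: complex_norm_square del: of_real_power)
  qed
  also have "\<dots> = of_real ((L2_norm J (\<lambda>y. w (s, y)))\<^sup>2)" by (rule L2_inner_self)
  finally have eq: "(LINT p|lebesgue_on \<Omega>. of_real (\<theta> (fst p)) * (w p * cnj (wx p) + wx p * cnj (w p)) + of_real il * (w p * cnj (w p))) = of_real ((L2_norm J (\<lambda>y. w (s, y)))\<^sup>2)" .
  define v where "v p = of_real (\<theta> (fst p)) * w p" for p
  have vc: "continuous_on UNIV v" unfolding v_def by (intro continuous_intros \<theta>c c)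
  have L: "v \<in> L2 \<Omega>" "w \<in> L2 \<Omega>" "wx \<in> L2 \<Omega>" using vc c continuous_in_L2 by auto
  have "(LINT p|lebesgue_on \<Omega>. of_real (\<theta> (fst p)) * (w p * cnj (wx p) + wx p * cnj (w p)) + of_real il * (w p * cnj (w p)))
    = (LINT p|lebesgue_on \<Omega>. (v p * cnj (wx p) + wx p * cnj (v p)) + of_real il * (w p * cnj (w p)))"
    by (simp add: v_def algebra_simps)
  also have "\<dots> = (L2_inner \<Omega> v wx + L2_inner \<Omega> wx v) + of_real il * L2_inner \<Omega> w w"
    unfolding L2_inner_def
    by (subst Bochner_Integration.integral_add, (intro Bochner_Integration.integrable_add integrable_mult_right L2_inner_integrable L)+,
        subst Bochner_Integration.integral_add, (intro L2_inner_integrable L)+, simp)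
  finally have "of_real ((L2_norm J (\<lambda>y. w (s, y)))\<^sup>2) = L2_inner \<Omega> v wx + L2_inner \<Omega> wx v + of_real il * L2_inner \<Omega> w w"
    using eq by simp
  then have "cmod (of_real ((L2_norm J (\<lambda>y. w (s, y)))\<^sup>2)) \<le> cmod (L2_inner \<Omega> v wx) + cmod (L2_inner \<Omega> wx v) + cmod (of_real il * L2_inner \<Omega> w w)"
    by (metis norm_triangle_ineq norm_triangle_mono order_refl)
  also have "\<dots> \<le> L2_norm \<Omega> v * L2_norm \<Omega> wx + L2_norm \<Omega> wx * L2_norm \<Omega> v + il * (L2_norm \<Omega> w)\<^sup>2"
  proof -
    have "cmod (of_real il * L2_inner \<Omega> w w) = il * (L2_norm \<Omega> w)\<^sup>2"
      using il by (simp add: L2_inner_self norm_mult norm_power L2_norm_nonneg)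
    then show ?thesis using L2.Cauchy_Schwarz[OF L(1,3)] L2.Cauchy_Schwarz[OF L(3,1)] by linarith
  qed
  also have "L2_norm \<Omega> v * L2_norm \<Omega> wx + L2_norm \<Omega> wx * L2_norm \<Omega> v \<le> 2 * L2_norm \<Omega> w * L2_norm \<Omega> wx"
  proof -
    have "L2_norm \<Omega> v \<le> L2_norm \<Omega> w"
    proof (rule L2_norm_mono[OF L(1,2)])
      fix x assume "x \<in> \<Omega>"
      then have "\<bar>\<theta> (fst x)\<bar> \<le> 1" by (intro \<theta>b) (auto simp: mem_Omega)
      then show "cmod (v x) \<le> cmod (w x)" by (simp add: v_def norm_mult mult_left_le_one_le)
    qed
    then show ?thesis using mult_right_mono[of "L2_norm \<Omega> v" "L2_norm \<Omega> w" "L2_norm \<Omega> wx"] by (simp add: L2_norm_nonneg mult.commute)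
  qed
  also have "L2_norm \<Omega> wx = L2_norm \<Omega> (D1 w)"
    using L2.nrm_cong_null[OF H1D(2)[OF D_classical(1)] L(3) D_classical(2)] p(3) c by (metis)
  finally show ?thesis by (simp add: il_def norm_power L2_norm_nonneg add.commute)
qed

definition Ct :: real where "Ct = sqrt (1 / len + 2)"

lemma Ct_pos: "Ct > 0" using len_pos by (simp add: Ct_def add_pos_pos)

lemma edge_bound_H1:
  assumes w: "smooth w" and s: "s \<in> {xm, xp}"
  shows "L2_norm J (\<lambda>y. w (s, y)) \<le> Ct * H1_norm \<Omega> w"
proof (rule power2_le_imp_le)
  have "(L2_norm \<Omega> w)\<^sup>2 \<le> (H1_norm \<Omega> w)\<^sup>2" by (intro power_mono L2_norms_le_H1 L2_norm_nonneg)
  then have "(1 / len) * (L2_norm \<Omega> w)\<^sup>2 \<le> (1 / len) * (H1_norm \<Omega> w)\<^sup>2" using len_pos by (intro mult_left_mono) auto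
  moreover have "L2_norm \<Omega> w * L2_norm \<Omega> (D1 w) \<le> H1_norm \<Omega> w * H1_norm \<Omega> w"
    by (intro mult_mono L2_norms_le_H1 L2_norm_nonneg H1_norm_nonneg)
  ultimately have "(1 / len) * (L2_norm \<Omega> w)\<^sup>2 + 2 * L2_norm \<Omega> w * L2_norm \<Omega> (D1 w) \<le> (1 / len + 2) * (H1_norm \<Omega> w)\<^sup>2"
    by (simp add: distrib_right power2_eq_square[of "H1_norm \<Omega> w"])
  also have "\<dots> = (Ct * H1_norm \<Omega> w)\<^sup>2" using len_pos by (simp add: Ct_def power_mult_distrib)
  finally show "(L2_norm J (\<lambda>y. w (s, y)))\<^sup>2 \<le> (Ct * H1_norm \<Omega> w)\<^sup>2" using edge_bound[OF assms] by linarith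
qed (simp add: Ct_pos less_imp_le H1_norm_nonneg)

abbreviation is_trace where "is_trace s \<equiv> is_edge_trace d xm xp s"

lemma smooth_edge_L2: "smooth w \<Longrightarrow> (\<lambda>y. w (s, y)) \<in> L2 J"
  by (intro continuous_in_L2_J continuous_on_compose2[OF smooth_continuous[of w UNIV]] continuous_intros) auto

lemma is_trace_smooth: "smooth w \<Longrightarrow> is_trace s w (\<lambda>y. w (s, y))"
  unfolding is_edge_trace_def
proof (intro conjI smooth_edge_L2 exI[of _ "\<lambda>n. w"] allI)
  assume w: "smooth w"
  then have "H1_norm \<Omega> (\<lambda>x. w x - w x) = 0"
    using H1.nrm_scale[OF smooth_in_H1[OF w], of 0] by simp
  then show "(\<lambda>n::nat. H1_norm \<Omega> (\<lambda>x. w x - w x)) \<longlonglongrightarrow> 0" by simp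
  show "(\<lambda>n::nat. L2_norm J (\<lambda>y. w (s, y) - w (s, y))) \<longlonglongrightarrow> 0" by (simp add: L2_norm_def)
qed

text \<open>The trigonometric partial sums converge in H^1, and \<open>edge_bound_H1\<close> makes
  their restrictions to the side a Cauchy sequence.\<close>

lemma is_trace_exists:
  assumes u: "u \<in> H1 \<Omega>" and s: "s \<in> {xm, xp}"
  shows "\<exists>g. is_trace s u g"
proof -
  define a where "a N = trigpoly (Q N) (hat u)" for N
  have a: "smooth (a N)" "a N \<in> H1 \<Omega>" for N using smooth_trigpoly smooth_in_H1 by (auto simp: a_def)
  have lim: "(\<lambda>N. H1_norm \<Omega> (\<lambda>x. a N x - u x)) \<longlonglongrightarrow> 0" unfolding a_def by (rule trigpoly_dense[OF u])
  have C: "\<exists>N. \<forall>m\<ge>N. \<forall>n\<ge>N. L2_norm J (\<lambda>y. a m (s, y) - a n (s, y)) < e" if e: "e > 0" for e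
  proof -
    obtain N where N: "\<And>n. n \<ge> N \<Longrightarrow> H1_norm \<Omega> (\<lambda>x. a n x - u x) < e / (2 * Ct)"
      using order_tendstoD(2)[OF lim, of "e / (2 * Ct)"] e Ct_pos unfolding eventually_sequentially by auto
    have "L2_norm J (\<lambda>y. a m (s, y) - a n (s, y)) < e" if "m \<ge> N" "n \<ge> N" for m n
    proof -
      have "H1_norm \<Omega> (\<lambda>x. a m x - a n x) \<le> H1_norm \<Omega> (\<lambda>x. a m x - u x) + H1_norm \<Omega> (\<lambda>x. a n x - u x)"
        using H1.nrm_triangle_diff[OF a(2)[of m] u a(2)[of n]] H1.nrm_minus_commute[OF u a(2)[of n]] by simp
      also have "\<dots> < e / (2 * Ct) + e / (2 * Ct)" using N that by (intro add_strict_mono) auto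
      finally have "Ct * H1_norm \<Omega> (\<lambda>x. a m x - a n x) < e" using Ct_pos by (simp add: field_simps)
      then show ?thesis using edge_bound_H1[OF smooth_diff[OF a(1) a(1)] s, of m n] by linarith
    qed
    then show ?thesis by blast
  qed
  obtain g where "g \<in> L2 J" "(\<lambda>N. L2_norm J (\<lambda>y. a N (s, y) - g y)) \<longlonglongrightarrow> 0"
    by (rule L2_complete[OF lmeasurable_interval(2), of "\<lambda>N y. a N (s, y)"]) (rule smooth_edge_L2[OF a(1)], erule C, blast)
  then show ?thesis unfolding is_edge_trace_def using a(1) lim by blast
qed

text \<open>The approximating sequences of u and v are unrelated, so the edge bound is applied to
  their difference and passed to the limit. For u = v this shows that a trace is unique up to null
  functions.\<close>

lemma is_trace_diff_bound:
  assumes u: "u \<in> H1 \<Omega>" "is_trace s u g" and v: "v \<in> H1 \<Omega>" "is_trace s v h" and s: "s \<in> {xm, xp}"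
  shows "L2_norm J (\<lambda>y. g y - h y) \<le> Ct * H1_norm \<Omega> (\<lambda>x. u x - v x)"
proof -
  obtain a where a: "\<And>n. smooth (a n)" "(\<lambda>n. H1_norm \<Omega> (\<lambda>x. a n x - u x)) \<longlonglongrightarrow> 0" "(\<lambda>n. L2_norm J (\<lambda>y. a n (s, y) - g y)) \<longlonglongrightarrow> 0"
    and g: "g \<in> L2 J"
    using u(2) by (auto simp: is_edge_trace_def)
  obtain b where b: "\<And>n. smooth (b n)" "(\<lambda>n. H1_norm \<Omega> (\<lambda>x. b n x - v x)) \<longlonglongrightarrow> 0" "(\<lambda>n. L2_norm J (\<lambda>y. b n (s, y) - h y)) \<longlonglongrightarrow> 0"
    and h: "h \<in> L2 J"
    using v(2) by (auto simp: is_edge_trace_def)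
  let ?r = "\<lambda>n. L2_norm J (\<lambda>y. a n (s, y) - g y) + Ct * (H1_norm \<Omega> (\<lambda>x. a n x - u x) + H1_norm \<Omega> (\<lambda>x. u x - v x) + H1_norm \<Omega> (\<lambda>x. b n x - v x))
     + L2_norm J (\<lambda>y. b n (s, y) - h y)"
  have "?r \<longlonglongrightarrow> 0 + Ct * (0 + H1_norm \<Omega> (\<lambda>x. u x - v x) + 0) + 0"
    by (intro tendsto_add tendsto_mult_left tendsto_const a b)
  then have "?r \<longlonglongrightarrow> Ct * H1_norm \<Omega> (\<lambda>x. u x - v x)" by simp
  moreover have "L2_norm J (\<lambda>y. g y - h y) \<le> ?r n" for n
  proof -
    note aL = smooth_edge_L2[OF a(1)[of n], of s] and bL = smooth_edge_L2[OF b(1)[of n], of s]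
    note aH = smooth_in_H1[OF a(1)[of n]] and bH = smooth_in_H1[OF b(1)[of n]]
    have "L2_norm J (\<lambda>y. g y - h y) \<le> L2_norm J (\<lambda>y. g y - a n (s, y)) + L2_norm J (\<lambda>y. a n (s, y) - h y)"
      by (rule L2.nrm_triangle_diff[OF g aL h])
    also have "L2_norm J (\<lambda>y. a n (s, y) - h y) \<le> L2_norm J (\<lambda>y. a n (s, y) - b n (s, y)) + L2_norm J (\<lambda>y. b n (s, y) - h y)"
      by (rule L2.nrm_triangle_diff[OF aL bL h])
    also have "L2_norm J (\<lambda>y. a n (s, y) - b n (s, y)) \<le> Ct * H1_norm \<Omega> (\<lambda>x. a n x - b n x)"
      by (rule edge_bound_H1[OF smooth_diff[OF a(1) b(1)] s])
    also have "H1_norm \<Omega> (\<lambda>x. a n x - b n x) \<le> H1_norm \<Omega> (\<lambda>x. a n x - u x) + H1_norm \<Omega> (\<lambda>x. u x - v x) + H1_norm \<Omega> (\<lambda>x. b n x - v x)"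
      using H1.nrm_triangle_diff[OF aH u(1) bH] H1.nrm_triangle_diff[OF u(1) v(1) bH] H1.nrm_minus_commute[OF v(1) bH] by linarith
    finally show ?thesis using Ct_pos L2.nrm_minus_commute[OF g aL] by simp
  qed
  ultimately show ?thesis by (intro LIMSEQ_le_const) auto
qed

lemma is_trace_L2: "is_trace s u g \<Longrightarrow> g \<in> L2 J" by (simp add: is_edge_trace_def)

lemma is_trace_add:
  assumes "u \<in> H1 \<Omega>" "is_trace s u g" "v \<in> H1 \<Omega>" "is_trace s v h"
  shows "is_trace s (\<lambda>x. u x + v x) (\<lambda>y. g y + h y)"
proof -
  obtain a where a: "\<And>n. smooth (a n)" "(\<lambda>n. H1_norm \<Omega> (\<lambda>x. a n x - u x)) \<longlonglongrightarrow> 0" "(\<lambda>n. L2_norm J (\<lambda>y. a n (s, y) - g y)) \<longlonglongrightarrow> 0"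
    and g: "g \<in> L2 J"
    using assms(2) by (auto simp: is_edge_trace_def)
  obtain b where b: "\<And>n. smooth (b n)" "(\<lambda>n. H1_norm \<Omega> (\<lambda>x. b n x - v x)) \<longlonglongrightarrow> 0" "(\<lambda>n. L2_norm J (\<lambda>y. b n (s, y) - h y)) \<longlonglongrightarrow> 0"
    and h: "h \<in> L2 J"
    using assms(4) by (auto simp: is_edge_trace_def)
  show ?thesis unfolding is_edge_trace_def
  proof (intro conjI exI[of _ "\<lambda>n x. a n x + b n x"] allI)
    show "(\<lambda>y. g y + h y) \<in> L2 J" using g h by (rule L2_add)
    show "smooth (\<lambda>x. a n x + b n x)" for n by (intro smooth_add a b)
    have 1: "H1_norm \<Omega> (\<lambda>x. (a n x + b n x) - (u x + v x)) \<le> H1_norm \<Omega> (\<lambda>x. a n x - u x) + H1_norm \<Omega> (\<lambda>x. b n x - v x)" for n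
      using H1.nrm_triangle[OF H1.diff_mem[OF smooth_in_H1[OF a(1)] assms(1)] H1.diff_mem[OF smooth_in_H1[OF b(1)] assms(3)], of n n]
      by (simp add: algebra_simps)
    show "(\<lambda>n. H1_norm \<Omega> (\<lambda>x. a n x + b n x - (u x + v x))) \<longlonglongrightarrow> 0"
      by (rule tendsto_sandwich[OF _ _ tendsto_const tendsto_add_zero[OF a(2) b(2)]]) (use 1 in \<open>auto simp: H1_norm_nonneg\<close>)
    have 2: "L2_norm J (\<lambda>y. (a n (s, y) + b n (s, y)) - (g y + h y)) \<le> L2_norm J (\<lambda>y. a n (s, y) - g y) + L2_norm J (\<lambda>y. b n (s, y) - h y)" for n
      using L2.nrm_triangle[OF L2.diff_mem[OF smooth_edge_L2[OF a(1)] g] L2.diff_mem[OF smooth_edge_L2[OF b(1)] h], of n s n s]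
      by (simp add: algebra_simps)
    show "(\<lambda>n. L2_norm J (\<lambda>y. a n (s, y) + b n (s, y) - (g y + h y))) \<longlonglongrightarrow> 0"
      by (rule tendsto_sandwich[OF _ _ tendsto_const tendsto_add_zero[OF a(3) b(3)]]) (use 2 in \<open>auto simp: L2_norm_nonneg\<close>)
  qed
qed

lemma is_trace_scale:
  assumes "u \<in> H1 \<Omega>" "is_trace s u g"
  shows "is_trace s (\<lambda>x. c * u x) (\<lambda>y. c * g y)"
proof -
  obtain a where a: "\<And>n. smooth (a n)" "(\<lambda>n. H1_norm \<Omega> (\<lambda>x. a n x - u x)) \<longlonglongrightarrow> 0" "(\<lambda>n. L2_norm J (\<lambda>y. a n (s, y) - g y)) \<longlonglongrightarrow> 0"
    and g: "g \<in> L2 J"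
    using assms(2) by (auto simp: is_edge_trace_def)
  show ?thesis unfolding is_edge_trace_def
  proof (intro conjI exI[of _ "\<lambda>n x. c * a n x"] allI)
    show "(\<lambda>y. c * g y) \<in> L2 J" using g by (rule L2_scale)
    show "smooth (\<lambda>x. c * a n x)" for n by (intro smooth_cmult a)
    have 1: "H1_norm \<Omega> (\<lambda>x. c * a n x - c * u x) = cmod c * H1_norm \<Omega> (\<lambda>x. a n x - u x)" for n
      using H1.nrm_scale[OF H1.diff_mem[OF smooth_in_H1[OF a(1)] assms(1)], of c n] by (simp add: algebra_simps)
    show "(\<lambda>n. H1_norm \<Omega> (\<lambda>x. c * a n x - c * u x)) \<longlonglongrightarrow> 0"
      unfolding 1 using tendsto_mult_right_zero[OF a(2)] .
    have 2: "L2_norm J (\<lambda>y. c * a n (s, y) - c * g y) = cmod c * L2_norm J (\<lambda>y. a n (s, y) - g y)" for n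
      using L2.nrm_scale[OF L2.diff_mem[OF smooth_edge_L2[OF a(1)] g], of c n s] by (simp add: algebra_simps)
    show "(\<lambda>n. L2_norm J (\<lambda>y. c * a n (s, y) - c * g y)) \<longlonglongrightarrow> 0"
      unfolding 2 using tendsto_mult_right_zero[OF a(3)] .
  qed
qed

section \<open>Fourier coefficients of traces\<close>

definition gc :: "(real \<Rightarrow> complex) \<Rightarrow> nat \<Rightarrow> complex" where "gc g n = L2_inner J g (phi d n)"

text \<open>For u in H^1 these numbers do not depend on which trace \<open>edge_trace\<close> picks,
  since all traces of u have the same coefficients.\<close>

definition tc :: "real \<Rightarrow> (real \<times> real \<Rightarrow> complex) \<Rightarrow> nat \<Rightarrow> complex" where
  "tc s u n = gc (edge_trace d xm xp s u) n"

lemma edge_trace_is_trace: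
  assumes "u \<in> H1 \<Omega>" "s \<in> {xm, xp}" shows "is_trace s u (edge_trace d xm xp s u)"
  unfolding edge_trace_def using someI_ex[OF is_trace_exists[OF assms]] .

lemma gc_diff_bound:
  assumes "g \<in> L2 J" "h \<in> L2 J" shows "cmod (gc g n - gc h n) \<le> L2_norm J (\<lambda>y. g y - h y)"
proof -
  have "L2_norm J (phi d n) = 1" using L2_inner_self[of J "phi d n"] L2_norm_nonneg[of J "phi d n"]
    by (simp add: phi_orthonormal) (metis of_real_1 of_real_eq_iff of_real_power power2_eq_1_iff neg_0_le_iff_le not_one_le_zero)
  then show ?thesis
    using L2.Cauchy_Schwarz[OF L2.diff_mem[OF assms] phi_L2, of n] assms by (simp add: gc_def L2.ip_diff_left phi_L2)
qed

lemma is_trace_gc_diff: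
  assumes "u \<in> H1 \<Omega>" "is_trace s u g" "v \<in> H1 \<Omega>" "is_trace s v h" "s \<in> {xm, xp}"
  shows "cmod (gc g n - gc h n) \<le> Ct * H1_norm \<Omega> (\<lambda>x. u x - v x)"
  using gc_diff_bound[OF is_trace_L2[OF assms(2)] is_trace_L2[OF assms(4)], of n] is_trace_diff_bound[OF assms] by linarith

lemma H1_norm_diff_self: "u \<in> H1 \<Omega> \<Longrightarrow> H1_norm \<Omega> (\<lambda>x. u x - u x) = 0"
  using H1.nrm_scale[of u 0] by simp

lemma is_trace_gc:
  assumes "u \<in> H1 \<Omega>" "is_trace s u g" "s \<in> {xm, xp}" shows "gc g n = tc s u n"
  using is_trace_gc_diff[OF assms(1,2,1) edge_trace_is_trace[OF assms(1,3)] assms(3), of n] H1_norm_diff_self[OF assms(1)]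
  by (simp add: tc_def)

lemma tc_add: "u \<in> H1 \<Omega> \<Longrightarrow> v \<in> H1 \<Omega> \<Longrightarrow> s \<in> {xm, xp} \<Longrightarrow> tc s (\<lambda>x. u x + v x) n = tc s u n + tc s v n"
  using is_trace_gc[OF H1_add(1) is_trace_add[OF _ edge_trace_is_trace _ edge_trace_is_trace], of u v s n]
  by (simp add: gc_def tc_def L2.ip_add_left phi_L2 is_trace_L2[OF edge_trace_is_trace])

lemma tc_scale: "u \<in> H1 \<Omega> \<Longrightarrow> s \<in> {xm, xp} \<Longrightarrow> tc s (\<lambda>x. c * u x) n = c * tc s u n"
  using is_trace_gc[OF H1_scale(1) is_trace_scale[OF _ edge_trace_is_trace], of u s c n]
  by (simp add: gc_def tc_def L2.ip_scale_left phi_L2 is_trace_L2[OF edge_trace_is_trace])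

lemma tc_diff_bound:
  "u \<in> H1 \<Omega> \<Longrightarrow> v \<in> H1 \<Omega> \<Longrightarrow> s \<in> {xm, xp} \<Longrightarrow> cmod (tc s u n - tc s v n) \<le> Ct * H1_norm \<Omega> (\<lambda>x. u x - v x)"
  unfolding tc_def by (rule is_trace_gc_diff[OF _ edge_trace_is_trace _ edge_trace_is_trace])

lemma tc_tendsto:
  assumes "\<And>k. u k \<in> H1 \<Omega>" "v \<in> H1 \<Omega>" "s \<in> {xm, xp}" "(\<lambda>k. H1_norm \<Omega> (\<lambda>x. u k x - v x)) \<longlonglongrightarrow> 0"
  shows "(\<lambda>k. tc s (u k) n) \<longlonglongrightarrow> tc s v n"
proof (rule LIM_zero_cancel, rule tendsto_norm_zero_cancel, rule tendsto_sandwich[OF _ _ tendsto_const tendsto_mult_right_zero[OF assms(4), of Ct]])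
  show "\<forall>\<^sub>F k in sequentially. cmod (tc s (u k) n - tc s v n) \<le> Ct * H1_norm \<Omega> (\<lambda>x. u k x - v x)"
    using tc_diff_bound[OF assms(1-3)] by simp
qed simp

lemma tc_smooth: "smooth w \<Longrightarrow> s \<in> {xm, xp} \<Longrightarrow> tc s w n = gc (\<lambda>y. w (s, y)) n"
  using is_trace_gc[OF smooth_in_H1 is_trace_smooth] by simp

lemma gc_phi_sum:
  assumes "finite I" shows "gc (\<lambda>y. \<Sum>m\<in>I. c m * phi d m y) n = (if n \<in> I then c n else 0)"
proof -
  have "gc (\<lambda>y. \<Sum>m\<in>I. c m * phi d m y) n = (\<Sum>m\<in>I. c m * L2_inner J (phi d m) (phi d n))"
    unfolding gc_def L2.ip_sum_left[OF assms L2_scale[OF phi_L2] phi_L2] L2.ip_scale_left[OF phi_L2 phi_L2] ..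
  also have "\<dots> = (\<Sum>m\<in>I. if m = n then c n else 0)" by (intro sum.cong) (auto simp: phi_orthonormal)
  finally show ?thesis using assms by simp
qed

lemma E_phi: "E (m, n) (x, y) = of_real (nx m * cx m x) * phi d n y"
  by (simp add: E_def phi_eq)

lemma trigpoly_column:
  "trigpoly ({..N} \<times> K) a (x, y) = (\<Sum>n\<in>K. (\<Sum>m\<le>N. a (m, n) * of_real (nx m * cx m x)) * phi d n y)"
proof -
  have "trigpoly ({..N} \<times> K) a (x, y) = (\<Sum>m\<le>N. \<Sum>n\<in>K. a (m, n) * E (m, n) (x, y))"
    by (simp add: trigpoly_def sum.cartesian_product split_def)
  also have "\<dots> = (\<Sum>m\<le>N. \<Sum>n\<in>K. a (m, n) * (of_real (nx m * cx m x) * phi d n y))"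
    unfolding E_phi ..
  also have "\<dots> = (\<Sum>n\<in>K. \<Sum>m\<le>N. a (m, n) * (of_real (nx m * cx m x) * phi d n y))" by (rule sum.swap)
  finally show ?thesis by (simp add: sum_distrib_right mult.assoc)
qed

lemma tc_trigpoly:
  assumes "finite K" "s \<in> {xm, xp}"
  shows "tc s (trigpoly ({..N} \<times> K) a) n = (if n \<in> K then \<Sum>m\<le>N. a (m, n) * of_real (nx m * cx m s) else 0)"
  by (subst tc_smooth[OF smooth_trigpoly assms(2)]) (simp add: trigpoly_column gc_phi_sum[OF assms(1)])

definition Kt :: real where "Kt = 2 / len + 2"

lemma Kt_pos: "Kt > 0" using len_pos by (simp add: Kt_def add_pos_pos)

text \<open>On a single mode the derivative in the second variable has norm \<open>ky n\<close>
  times that of the function. The product of norms in the edge bound, multiplied by 1 +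
  \<open>ky n\<close>, is therefore absorbed by the squared H^1 norm; this is the H^{1/2} bound of
  the trace theorem, mode by mode.\<close>

lemma tc_column_bound:
  assumes s: "s \<in> {xm, xp}"
  shows "(1 + ky n) * (cmod (tc s (trigpoly ({..N} \<times> {n}) a) n))\<^sup>2 \<le> Kt * (H1_norm \<Omega> (trigpoly ({..N} \<times> {n}) a))\<^sup>2"
proof -
  define T where "T = trigpoly ({..N} \<times> {n}) a"
  define t where "t = (\<Sum>m\<le>N. a (m, n) * of_real (nx m * cx m s))"
  have k: "ky n \<ge> 0" using ky_pos[of n] kxy_0 by (cases "n = 0") auto
  have tcT: "tc s T n = t" using tc_trigpoly[OF _ s, of "{n}"] by (simp add: T_def t_def)
  have "(\<lambda>y. T (s, y)) = (\<lambda>y. t * phi d n y)" by (simp add: T_def trigpoly_column t_def)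
  then have "L2_inner J (\<lambda>y. T (s, y)) (\<lambda>y. T (s, y)) = t * cnj t"
    by (simp add: L2.ip_scale_left L2.ip_scale_right L2_scale phi_L2 phi_orthonormal)
  then have "(L2_norm J (\<lambda>y. T (s, y)))\<^sup>2 = (cmod t)\<^sup>2"
    by (metis L2_inner_self complex_norm_square of_real_eq_iff)
  then have eb: "(cmod t)\<^sup>2 \<le> (1 / len) * (L2_norm \<Omega> T)\<^sup>2 + 2 * L2_norm \<Omega> T * L2_norm \<Omega> (D1 T)"
    using edge_bound[OF smooth_trigpoly s, of "{..N} \<times> {n}" a] by (simp add: T_def)
  define A where "A = L2_norm \<Omega> T"
  define B where "B = L2_norm \<Omega> (D1 T)"
  have "(L2_norm \<Omega> (D2 T))\<^sup>2 = (ky n)\<^sup>2 * A\<^sup>2"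
  proof -
    have "(L2_norm \<Omega> (D2 T))\<^sup>2 = (\<Sum>i\<in>{..N} \<times> {n}. (ky (snd i))\<^sup>2 * (cmod (a i))\<^sup>2)"
      unfolding T_def by (rule trigpoly_norms) simp
    also have "\<dots> = (\<Sum>i\<in>{..N} \<times> {n}. (ky n)\<^sup>2 * (cmod (a i))\<^sup>2)" by (intro sum.cong) auto
    also have "\<dots> = (ky n)\<^sup>2 * A\<^sup>2" unfolding A_def T_def by (subst trigpoly_norms) (auto simp: sum_distrib_left)
    finally show ?thesis .
  qed
  then have H: "(H1_norm \<Omega> T)\<^sup>2 = (1 + (ky n)\<^sup>2) * A\<^sup>2 + B\<^sup>2" by (simp add: H1_norm_square A_def B_def distrib_right)
  have "(1 + ky n) * (cmod t)\<^sup>2 \<le> (1 + ky n) * ((1 / len) * A\<^sup>2 + 2 * A * B)"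
    using eb k by (intro mult_left_mono) (auto simp: A_def B_def)
  also have "\<dots> = (1 + ky n) * A\<^sup>2 * (1 / len) + 2 * ((1 + ky n) * A) * B" by (simp add: algebra_simps add_divide_distrib)
  \<comment> \<open>Arithmetic--geometric mean for the product of (1 + \<open>ky n\<close>) A and B;
    both 1 + \<open>ky n\<close> and its square are at most 2 (1 +
    \<open>(ky n)\<^sup>2\<close>).\<close>
  also have "\<dots> \<le> (2 * (1 + (ky n)\<^sup>2) * A\<^sup>2) * (1 / len) + (2 * (1 + (ky n)\<^sup>2) * A\<^sup>2 + B\<^sup>2)"
  proof (rule add_mono)
    have "0 \<le> (ky n - 1)\<^sup>2" by simp
    then have q: "2 * ky n \<le> 1 + (ky n)\<^sup>2" by (simp add: power2_diff)
    have "1 + k \<le> 2 * (1 + x)" if "2 * k \<le> 1 + x" "0 \<le> x" for k x :: real using that by simp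
    from this[OF q] have "1 + ky n \<le> 2 * (1 + (ky n)\<^sup>2)" by simp
    then show "(1 + ky n) * A\<^sup>2 * (1 / len) \<le> (2 * (1 + (ky n)\<^sup>2) * A\<^sup>2) * (1 / len)"
      using len_pos by (intro mult_right_mono) auto
    have "2 * ((1 + ky n) * A) * B \<le> ((1 + ky n) * A)\<^sup>2 + B\<^sup>2" by (rule sum_squares_bound)
    also have "((1 + ky n) * A)\<^sup>2 \<le> 2 * (1 + (ky n)\<^sup>2) * A\<^sup>2"
      unfolding power_mult_distrib using q by (intro mult_right_mono) (auto simp: power2_sum)
    finally show "2 * ((1 + ky n) * A) * B \<le> 2 * (1 + (ky n)\<^sup>2) * A\<^sup>2 + B\<^sup>2" by simp
  qed
  also have "\<dots> \<le> Kt * ((1 + (ky n)\<^sup>2) * A\<^sup>2 + B\<^sup>2)"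
    using len_pos by (simp add: Kt_def algebra_simps add_divide_distrib)
  finally show ?thesis using H tcT by (simp add: T_def)
qed

text \<open>Both sides split into modes: the trace coefficient of index n sees only the n-th column,
  and the squared H^1 norms of the columns add up.\<close>

lemma tc_bound_trigpoly:
  assumes s: "s \<in> {xm, xp}"
  shows "(\<Sum>n\<le>N. (1 + ky n) * (cmod (tc s (trigpoly (Q N) a) n))\<^sup>2) \<le> Kt * (H1_norm \<Omega> (trigpoly (Q N) a))\<^sup>2"
proof -
  have "(\<Sum>n\<le>N. (1 + ky n) * (cmod (tc s (trigpoly (Q N) a) n))\<^sup>2) = (\<Sum>n\<le>N. (1 + ky n) * (cmod (tc s (trigpoly ({..N} \<times> {n}) a) n))\<^sup>2)"
    by (intro sum.cong) (auto simp: Q_def tc_trigpoly[OF _ s])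
  also have "\<dots> \<le> (\<Sum>n\<le>N. Kt * (H1_norm \<Omega> (trigpoly ({..N} \<times> {n}) a))\<^sup>2)"
    by (intro sum_mono tc_column_bound s)
  also have "\<dots> = Kt * (H1_norm \<Omega> (trigpoly (Q N) a))\<^sup>2"
  proof -
    let ?f = "\<lambda>i. (1 + (kx (fst i))\<^sup>2 + (ky (snd i))\<^sup>2) * (cmod (a i))\<^sup>2"
    have "(\<Sum>i\<in>{..N} \<times> {n}. ?f i) = (\<Sum>m\<le>N. ?f (m, n))" for n
      unfolding sum.cartesian_product' by simp
    moreover have "(\<Sum>i\<in>Q N. ?f i) = (\<Sum>m\<le>N. \<Sum>n\<le>N. ?f (m, n))"
      unfolding Q_def sum.cartesian_product' ..
    moreover have "(\<Sum>m\<le>N. \<Sum>n\<le>N. ?f (m, n)) = (\<Sum>n\<le>N. \<Sum>m\<le>N. ?f (m, n))" by (rule sum.swap)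
    ultimately show ?thesis by (simp add: H1_norm_trigpoly Q_finite sum_distrib_left)
  qed
  finally show ?thesis .
qed

lemma tc_bound:
  assumes s: "s \<in> {xm, xp}" and u: "u \<in> H1 \<Omega>"
  shows "(\<Sum>n<N. (1 + ky n) * (cmod (tc s u n))\<^sup>2) \<le> Kt * (H1_norm \<Omega> u)\<^sup>2"
proof (rule LIMSEQ_le)
  note dense = trigpoly_dense[OF u]
  show "(\<lambda>k. \<Sum>n<N. (1 + ky n) * (cmod (tc s (trigpoly (Q k) (hat u)) n))\<^sup>2) \<longlonglongrightarrow> (\<Sum>n<N. (1 + ky n) * (cmod (tc s u n))\<^sup>2)"
    by (intro tendsto_sum tendsto_mult_left tendsto_power tendsto_norm tc_tendsto D_trigpoly u s dense)
  show "(\<lambda>k. Kt * (H1_norm \<Omega> (trigpoly (Q k) (hat u)))\<^sup>2) \<longlonglongrightarrow> Kt * (H1_norm \<Omega> u)\<^sup>2"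
    by (intro tendsto_mult_left tendsto_power H1.nrm_tendsto D_trigpoly u dense)
  show "\<exists>M. \<forall>k\<ge>M. (\<Sum>n<N. (1 + ky n) * (cmod (tc s (trigpoly (Q k) (hat u)) n))\<^sup>2) \<le> Kt * (H1_norm \<Omega> (trigpoly (Q k) (hat u)))\<^sup>2"
  proof (intro exI allI impI)
    fix k assume "N \<le> k"
    have "ky n \<ge> 0" for n using ky_pos[of n] kxy_0 by (cases "n = 0") auto
    then have "(\<Sum>n<N. (1 + ky n) * (cmod (tc s (trigpoly (Q k) (hat u)) n))\<^sup>2) \<le> (\<Sum>n\<le>k. (1 + ky n) * (cmod (tc s (trigpoly (Q k) (hat u)) n))\<^sup>2)"
      using \<open>N \<le> k\<close> by (intro sum_mono2) auto
    also have "\<dots> \<le> Kt * (H1_norm \<Omega> (trigpoly (Q k) (hat u)))\<^sup>2" by (rule tc_bound_trigpoly[OF s])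
    finally show "(\<Sum>n<N. (1 + ky n) * (cmod (tc s (trigpoly (Q k) (hat u)) n))\<^sup>2) \<le> Kt * (H1_norm \<Omega> (trigpoly (Q k) (hat u)))\<^sup>2" .
  qed
qed

end

section \<open>Modal operators\<close>

lemma dual_norm_le:
  assumes z: "z \<in> X" "nX z \<le> 1" and b: "\<And>q. q \<in> X \<Longrightarrow> cmod (l q) \<le> C * nX q" and C: "C \<ge> 0"
  shows "dual_norm X nX l \<le> C"
  unfolding dual_norm_def
proof (rule cSUP_least)
  fix q assume "q \<in> {q \<in> X. nX q \<le> 1}"
  then have "cmod (l q) \<le> C * nX q" "nX q \<le> 1" using b by auto
  then show "cmod (l q) \<le> C" using C by (meson mult_left_le order_trans)
qed (use z in auto)

text \<open>The bound b makes the supremum one of a bounded set, so that every value lies below it.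
  For the norm, scaling asks only for \<le>, which is what an infimum over extensions gives
  directly.\<close>

lemma dual_norm_ge:
  assumes b: "\<And>q. q \<in> X \<Longrightarrow> cmod (l q) \<le> C * nX q"
    and scale: "\<And>c q. q \<in> X \<Longrightarrow> c \<noteq> 0 \<Longrightarrow> (\<lambda>x. c * q x) \<in> X \<and> cmod (l (\<lambda>x. c * q x)) = cmod c * cmod (l q) \<and> nX (\<lambda>x. c * q x) \<le> cmod c * nX q"
    and n: "\<And>q. q \<in> X \<Longrightarrow> 0 \<le> nX q" and q: "q \<in> X"
  shows "cmod (l q) \<le> dual_norm X nX l * nX q"
proof (cases "nX q = 0")
  case True
  then show ?thesis using b[OF q] by simp
next
  case False
  then have p: "nX q > 0" using n[OF q] by simp
  let ?c = "of_real (1 / nX q) :: complex"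
  have s: "(\<lambda>x. ?c * q x) \<in> X" "cmod (l (\<lambda>x. ?c * q x)) = cmod (l q) / nX q" "nX (\<lambda>x. ?c * q x) \<le> 1"
    using scale[OF q, of ?c] p by (auto simp: norm_divide)
  have "bdd_above ((\<lambda>q. cmod (l q)) ` {q \<in> X. nX q \<le> 1})"
  proof (rule bdd_aboveI2)
    fix q assume "q \<in> {q \<in> X. nX q \<le> 1}"
    then have q: "q \<in> X" "nX q \<le> 1" by auto
    have "C * nX q \<le> \<bar>C\<bar> * nX q" using n[OF q(1)] by (intro mult_right_mono) auto
    also have "\<dots> \<le> \<bar>C\<bar>" using q n[OF q(1)] by (simp add: mult_left_le)
    finally show "cmod (l q) \<le> \<bar>C\<bar>" using b[OF q(1)] by linarith
  qed
  then have "cmod (l (\<lambda>x. ?c * q x)) \<le> dual_norm X nX l"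
    unfolding dual_norm_def using s by (intro cSUP_upper) auto
  then have "cmod (l q) / nX q \<le> dual_norm X nX l" unfolding s(2) .
  then show ?thesis using p by (simp add: divide_le_eq)
qed

lemma sum_weighted_Cauchy_Schwarz:
  fixes a b :: "nat \<Rightarrow> complex" and w :: "nat \<Rightarrow> real"
  assumes w: "\<And>n. w n > 0" and c: "\<And>n. cmod (c n) \<le> \<kappa> * w n" and k: "\<kappa> \<ge> 0"
  shows "(\<Sum>n\<in>I. cmod (c n * a n * cnj (b n))) \<le> \<kappa> * sqrt (\<Sum>n\<in>I. w n * (cmod (a n))\<^sup>2) * sqrt (\<Sum>n\<in>I. w n * (cmod (b n))\<^sup>2)"
proof -
  have "(\<Sum>n\<in>I. cmod (c n * a n * cnj (b n))) \<le> (\<Sum>n\<in>I. \<kappa> * ((sqrt (w n) * cmod (a n)) * (sqrt (w n) * cmod (b n))))"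
  proof (rule sum_mono)
    fix n
    have "cmod (c n * a n * cnj (b n)) = cmod (c n) * (cmod (a n) * cmod (b n))" by (simp add: norm_mult mult.assoc)
    also have "\<dots> \<le> (\<kappa> * w n) * (cmod (a n) * cmod (b n))" by (rule mult_right_mono[OF c]) simp
    also have "\<dots> = \<kappa> * ((sqrt (w n) * cmod (a n)) * (sqrt (w n) * cmod (b n)))"
    proof -
      have r: "sqrt (w n) * sqrt (w n) = w n" using w[of n] by simp
      have "\<kappa> * ((sqrt (w n) * cmod (a n)) * (sqrt (w n) * cmod (b n))) = \<kappa> * (sqrt (w n) * sqrt (w n)) * (cmod (a n) * cmod (b n))"
        by (simp only: mult_ac)
      from this[unfolded r] show ?thesis by (rule sym)
    qed
    finally show "cmod (c n * a n * cnj (b n)) \<le> \<kappa> * ((sqrt (w n) * cmod (a n)) * (sqrt (w n) * cmod (b n)))" .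
  qed
  also have "\<dots> = \<kappa> * (\<Sum>n\<in>I. \<bar>sqrt (w n) * cmod (a n)\<bar> * \<bar>sqrt (w n) * cmod (b n)\<bar>)"
    using w by (simp add: sum_distrib_left abs_mult less_imp_le)
  also have "\<dots> \<le> \<kappa> * (L2_set (\<lambda>n. sqrt (w n) * cmod (a n)) I * L2_set (\<lambda>n. sqrt (w n) * cmod (b n)) I)"
    using k by (intro mult_left_mono L2_set_mult_ineq)
  finally show ?thesis using w by (simp add: L2_set_def power_mult_distrib less_imp_le mult.assoc)
qed

context guide
begin

interpretation H1: semi_inner_space "H1 \<Omega>" H1_inner
  rewrites "semi_inner_space.nrm H1_inner = H1_norm \<Omega>"
  by (rule semi_inner_space_H1 nrm_H1)+

abbreviation X where "X \<equiv> Hhalf d xm xp"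
abbreviation nX where "nX \<equiv> Hhalf_norm d xm xp"

definition wt :: "nat \<Rightarrow> real" where "wt n = 1 + ky n"

lemma wt_pos: "wt n > 0" using ky_pos[of n] kxy_0 by (cases "n = 0") (auto simp: wt_def)

lemma trace_set_nonempty:
  assumes "g \<in> X s" shows "{p \<in> H1 \<Omega>. is_trace s p g} \<noteq> {}"
  using assms by (auto simp: Hhalf_def)

lemma nX_nonneg: "g \<in> X s \<Longrightarrow> 0 \<le> nX s g"
  unfolding Hhalf_norm_def using trace_set_nonempty by (intro cINF_greatest) (auto simp: H1_norm_nonneg)

lemma nX_le: "p \<in> H1 \<Omega> \<Longrightarrow> is_trace s p g \<Longrightarrow> nX s g \<le> H1_norm \<Omega> p"
  unfolding Hhalf_norm_def by (intro cINF_lower) (auto simp: bdd_below_def intro: H1_norm_nonneg)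

lemma X_I: "p \<in> H1 \<Omega> \<Longrightarrow> is_trace s p g \<Longrightarrow> g \<in> X s" by (auto simp: Hhalf_def)

lemma X_scale:
  assumes g: "g \<in> X s" and c: "c \<noteq> 0"
  shows "(\<lambda>x. c * g x) \<in> X s \<and> nX s (\<lambda>x. c * g x) \<le> cmod c * nX s g"
proof
  show "(\<lambda>x. c * g x) \<in> X s" using g H1_scale(1) is_trace_scale by (fastforce simp: Hhalf_def)
  have "nX s (\<lambda>x. c * g x) / cmod c \<le> nX s g"
    unfolding Hhalf_norm_def[of _ _ _ _ g]
  proof (rule cINF_greatest[OF trace_set_nonempty[OF g]])
    fix p assume p: "p \<in> {p \<in> H1 \<Omega>. is_trace s p g}"
    then have "nX s (\<lambda>x. c * g x) \<le> H1_norm \<Omega> (\<lambda>x. c * p x)" by (intro nX_le H1_scale is_trace_scale) auto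
    also have "\<dots> = cmod c * H1_norm \<Omega> p" using p by (intro H1.nrm_scale) auto
    finally show "nX s (\<lambda>x. c * g x) / cmod c \<le> H1_norm \<Omega> p" using c by (simp add: field_simps)
  qed
  then show "nX s (\<lambda>x. c * g x) \<le> cmod c * nX s g" using c by (simp add: field_simps)
qed

lemma X_add: "g \<in> X s \<Longrightarrow> h \<in> X s \<Longrightarrow> (\<lambda>x. g x + h x) \<in> X s"
  unfolding Hhalf_def using H1_add(1) is_trace_add by blast

lemma X_L2: "g \<in> X s \<Longrightarrow> g \<in> L2 J" by (auto simp: Hhalf_def is_edge_trace_def)

lemma X_zero: assumes "s \<in> {xm, xp}" shows "(\<lambda>x. 0) \<in> X s \<and> nX s (\<lambda>x. 0) \<le> 1"
proof
  have t: "is_trace s (\<lambda>x. 0) (\<lambda>y. 0)" using is_trace_smooth[OF smooth_zero] .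
  show "(\<lambda>x. 0) \<in> X s" by (rule X_I[OF H1.zero_mem t])
  have "H1_norm \<Omega> (\<lambda>x. 0) = 0" using H1_norm_diff_self[OF H1.zero_mem] by simp
  then show "nX s (\<lambda>x. 0) \<le> 1" using nX_le[OF H1.zero_mem t] by simp
qed

lemma gc_add: "g \<in> X s \<Longrightarrow> h \<in> X s \<Longrightarrow> gc (\<lambda>y. g y + h y) n = gc g n + gc h n"
  by (simp add: gc_def L2.ip_add_left phi_L2 X_L2)

lemma gc_scale: "g \<in> X s \<Longrightarrow> gc (\<lambda>y. c * g y) n = c * gc g n"
  by (simp add: gc_def L2.ip_scale_left phi_L2 X_L2)

text \<open>The coefficients are the same for every extension p of g, so the bound for H^1 functions
  passes to the infimum over extensions.\<close>

lemma gc_bound: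
  assumes s: "s \<in> {xm, xp}" and g: "g \<in> X s"
  shows "sqrt (\<Sum>n<N. wt n * (cmod (gc g n))\<^sup>2) \<le> sqrt Kt * nX s g"
proof -
  have "sqrt (\<Sum>n<N. wt n * (cmod (gc g n))\<^sup>2) / sqrt Kt \<le> nX s g"
    unfolding Hhalf_norm_def
  proof (rule cINF_greatest[OF trace_set_nonempty[OF g]])
    fix p assume "p \<in> {p \<in> H1 \<Omega>. is_trace s p g}"
    then have p: "p \<in> H1 \<Omega>" "is_trace s p g" by auto
    have "sqrt (\<Sum>n<N. wt n * (cmod (gc g n))\<^sup>2) \<le> sqrt (Kt * (H1_norm \<Omega> p)\<^sup>2)"
      using tc_bound[OF s p(1), of N] is_trace_gc[OF p s] by (simp add: wt_def)
    also have "\<dots> = sqrt Kt * H1_norm \<Omega> p" by (simp add: real_sqrt_mult H1_norm_nonneg)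
    finally show "sqrt (\<Sum>n<N. wt n * (cmod (gc g n))\<^sup>2) / sqrt Kt \<le> H1_norm \<Omega> p"
      using Kt_pos by (simp add: field_simps)
  qed
  then show ?thesis using Kt_pos by (simp add: field_simps)
qed

lemma gc_summable:
  assumes s: "s \<in> {xm, xp}" and g: "g \<in> X s"
  shows "summable (\<lambda>n. wt n * (cmod (gc g n))\<^sup>2)"
proof (rule bounded_imp_summable)
  show "0 \<le> wt n * (cmod (gc g n))\<^sup>2" for n using wt_pos[of n] by simp
  show "(\<Sum>k\<le>n. wt k * (cmod (gc g k))\<^sup>2) \<le> (sqrt Kt * nX s g)\<^sup>2" for n
    using sqrt_le_D[OF gc_bound[OF s g, of "Suc n"]] by (simp add: lessThan_Suc_atMost)
qed

context
  fixes s \<kappa> :: real and c :: "nat \<Rightarrow> complex"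
  assumes s: "s \<in> {xm, xp}" and \<kappa>: "\<kappa> \<ge> 0" and c: "\<And>n. cmod (c n) \<le> \<kappa> * wt n"
begin

text \<open>The tail of the weighted coefficients of \<psi> is kept as a factor that does not
  involve g; this is what makes the series converge in the dual norm and not only pointwise.\<close>

lemma modal_partial_bound:
  assumes \<psi>: "\<psi> \<in> X s" and g: "g \<in> X s"
  shows "(\<Sum>n\<in>{N..<M}. cmod (c n * gc \<psi> n * cnj (gc g n))) \<le> \<kappa> * sqrt (\<Sum>n. wt (n + N) * (cmod (gc \<psi> (n + N)))\<^sup>2) * (sqrt Kt * nX s g)"
proof -
  have nn: "0 \<le> wt n * (cmod z)\<^sup>2" for n z using wt_pos[of n] by simp
  have "(\<Sum>n\<in>{N..<M}. cmod (c n * gc \<psi> n * cnj (gc g n))) \<le>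
     \<kappa> * sqrt (\<Sum>n\<in>{N..<M}. wt n * (cmod (gc \<psi> n))\<^sup>2) * sqrt (\<Sum>n\<in>{N..<M}. wt n * (cmod (gc g n))\<^sup>2)"
    by (rule sum_weighted_Cauchy_Schwarz[OF wt_pos c \<kappa>])
  also have "\<dots> \<le> \<kappa> * sqrt (\<Sum>n. wt (n + N) * (cmod (gc \<psi> (n + N)))\<^sup>2) * (sqrt Kt * nX s g)"
  proof (intro mult_mono mult_left_mono \<kappa>)
    have sm: "summable (\<lambda>n. wt (n + N) * (cmod (gc \<psi> (n + N)))\<^sup>2)"
      using summable_ignore_initial_segment[OF gc_summable[OF s \<psi>]] .
    have "(\<Sum>n\<in>{N..<M}. wt n * (cmod (gc \<psi> n))\<^sup>2) = (\<Sum>n\<in>{..<M-N}. wt (n + N) * (cmod (gc \<psi> (n + N)))\<^sup>2)"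
      by (cases "N \<le> M") (auto simp: sum.atLeastLessThan_shift_0 atLeast0LessThan add.commute)
    also have "\<dots> \<le> (\<Sum>n. wt (n + N) * (cmod (gc \<psi> (n + N)))\<^sup>2)" by (rule sum_le_suminf[OF sm]) (auto simp: nn)
    finally show "sqrt (\<Sum>n\<in>{N..<M}. wt n * (cmod (gc \<psi> n))\<^sup>2) \<le> sqrt (\<Sum>n. wt (n + N) * (cmod (gc \<psi> (n + N)))\<^sup>2)" by simp
    have "(\<Sum>n\<in>{N..<M}. wt n * (cmod (gc g n))\<^sup>2) \<le> (\<Sum>n<M. wt n * (cmod (gc g n))\<^sup>2)"
      by (rule sum_mono2) (auto simp: nn)
    then show "sqrt (\<Sum>n\<in>{N..<M}. wt n * (cmod (gc g n))\<^sup>2) \<le> sqrt Kt * nX s g"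
      using gc_bound[OF s g, of M] real_sqrt_le_mono order_trans by blast
    show "0 \<le> \<kappa> * sqrt (\<Sum>n. wt (n + N) * (cmod (gc \<psi> (n + N)))\<^sup>2)"
      using \<kappa> suminf_nonneg[OF sm] nn by simp
  qed (auto simp: nn sum_nonneg)
  finally show ?thesis .
qed

lemma modal_summable:
  assumes \<psi>: "\<psi> \<in> X s" and g: "g \<in> X s"
  shows "summable (\<lambda>n. cmod (c n * gc \<psi> n * cnj (gc g n)))"
proof (rule bounded_imp_summable)
  show "(\<Sum>k\<le>n. cmod (c k * gc \<psi> k * cnj (gc g k))) \<le> \<kappa> * sqrt (\<Sum>n. wt (n + 0) * (cmod (gc \<psi> (n + 0)))\<^sup>2) * (sqrt Kt * nX s g)" for n
    using modal_partial_bound[OF assms, of 0 "Suc n"] by (simp add: atLeast0LessThan lessThan_Suc_atMost)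
qed simp

lemma modal_tail:
  assumes \<psi>: "\<psi> \<in> X s" and g: "g \<in> X s"
  shows "cmod ((\<Sum>n. c n * gc \<psi> n * cnj (gc g n)) - (\<Sum>n<N. c n * gc \<psi> n * cnj (gc g n)))
    \<le> \<kappa> * sqrt (\<Sum>n. wt (n + N) * (cmod (gc \<psi> (n + N)))\<^sup>2) * (sqrt Kt * nX s g)"
proof -
  let ?f = "\<lambda>n. c n * gc \<psi> n * cnj (gc g n)"
  have sm: "summable (\<lambda>n. cmod (?f n))" by (rule modal_summable[OF assms])
  have "suminf ?f - (\<Sum>n<N. ?f n) = (\<Sum>n. ?f (n + N))"
    using suminf_minus_initial_segment[OF summable_norm_cancel[OF sm], of N] by simp
  also have "cmod \<dots> \<le> (\<Sum>n. cmod (?f (n + N)))"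
    by (rule summable_norm[OF summable_ignore_initial_segment[OF sm]])
  also have "\<dots> \<le> \<kappa> * sqrt (\<Sum>n. wt (n + N) * (cmod (gc \<psi> (n + N)))\<^sup>2) * (sqrt Kt * nX s g)"
  proof (rule suminf_le_const[OF summable_ignore_initial_segment[OF sm]])
    fix m
    have "(\<Sum>n<m. cmod (?f (n + N))) = (\<Sum>n\<in>{N..<m+N}. cmod (?f n))"
      by (simp add: sum.atLeastLessThan_shift_0[of _ N] atLeast0LessThan add.commute)
    then show "(\<Sum>n<m. cmod (?f (n + N))) \<le> \<kappa> * sqrt (\<Sum>n. wt (n + N) * (cmod (gc \<psi> (n + N)))\<^sup>2) * (sqrt Kt * nX s g)"
      using modal_partial_bound[OF assms, of N "m + N"] by simp
  qed
  finally show ?thesis .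
qed

text \<open>\<open>THE\<close> asks for existence and uniqueness. The tail bound shows that the
  pointwise sum is the limit in the dual norm; any other limit agrees with it on the trace space by
  \<open>dual_norm_ge\<close>, and elsewhere by extensionality.\<close>

theorem modal_operator_eq:
  assumes \<psi>: "\<psi> \<in> X s" and g: "g \<in> X s"
  shows "modal_operator d xm xp s c \<psi> g = (\<Sum>n. c n * gc \<psi> n * cnj (gc g n))"
proof -
  define l where "l = restrict (\<lambda>g. \<Sum>n. c n * gc \<psi> n * cnj (gc g n)) (X s)"
  have lX: "l g = (\<Sum>n. c n * gc \<psi> n * cnj (gc g n))" if "g \<in> X s" for g using that by (simp add: l_def)
  define S where "S N g = (\<Sum>n<N. c n * L2_inner J \<psi> (phi d n) * L2_inner J (phi d n) g)" for N g
  have SX: "S N g = (\<Sum>n<N. c n * gc \<psi> n * cnj (gc g n))" if "g \<in> X s" for N g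
    using X_L2[OF that] by (simp add: S_def gc_def L2.ip_cnj phi_L2)
  have sm: "summable (\<lambda>n. c n * gc \<psi> n * cnj (gc g n))" if "g \<in> X s" for g
    by (rule summable_norm_cancel[OF modal_summable[OF \<psi> that]])
  define B where "B N = \<kappa> * sqrt (\<Sum>n. wt (n + N) * (cmod (gc \<psi> (n + N)))\<^sup>2) * sqrt Kt" for N
  have B0: "B N \<ge> 0" for N
  proof -
    have "0 \<le> (\<Sum>n. wt (n + N) * (cmod (gc \<psi> (n + N)))\<^sup>2)"
      using wt_pos by (intro suminf_nonneg summable_ignore_initial_segment[OF gc_summable[OF s \<psi>]]) (simp add: less_imp_le)
    then show ?thesis using \<kappa> Kt_pos by (simp add: B_def)
  qed
  have "(\<lambda>N. \<Sum>n. wt (n + N) * (cmod (gc \<psi> (n + N)))\<^sup>2) \<longlonglongrightarrow> 0"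
    using suminf_exist_split2[OF gc_summable[OF s \<psi>]] .
  then have "B \<longlonglongrightarrow> \<kappa> * sqrt 0 * sqrt Kt" unfolding B_def by (intro tendsto_intros)
  then have Blim: "B \<longlonglongrightarrow> 0" by simp
  have tail: "cmod (l g - S N g) \<le> B N * nX s g" if "g \<in> X s" for g N
    using modal_tail[OF \<psi> that, of N] lX[OF that] SX[OF that] by (simp add: B_def mult.assoc)
  have l_add: "l (\<lambda>x. p x + q x) = l p + l q" if "p \<in> X s" "q \<in> X s" for p q
    using sm[OF that(1)] sm[OF that(2)] that
    by (simp add: lX X_add gc_add[of p s] suminf_add algebra_simps)
  have l_scale: "l (\<lambda>x. a * p x) = cnj a * l p" if p: "p \<in> X s" for a p
  proof -
    have aX: "(\<lambda>x. a * p x) \<in> X s" using X_scale[OF p, of a] X_zero[OF s] by (cases "a = 0") auto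
    show ?thesis using suminf_mult[OF sm[OF p], of "cnj a"]
      by (simp add: lX[OF aX] lX[OF p] gc_scale[OF p] mult_ac)
  qed
  have l_bound: "cmod (l p) \<le> B 0 * nX s p" if "p \<in> X s" for p
    using tail[OF that, of 0] by (simp add: S_def)
  have l_dual: "l \<in> antidual (X s) (nX s)"
    unfolding antidual_def
  proof (intro CollectI conjI ballI allI)
    show "l \<in> extensional (X s)" by (simp add: l_def)
    show "l (\<lambda>x. p x + q x) = l p + l q" if "p \<in> X s" "q \<in> X s" for p q by (rule l_add[OF that])
    show "l (\<lambda>x. a * p x) = cnj a * l p" if p: "p \<in> X s" for a p
    proof (cases "a = 0")
      case True
      have "l (\<lambda>x. 0) = 0" using l_scale[OF p, of 0] by simp
      then show ?thesis using True by simp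
    next
      case False
      then show ?thesis using l_scale[OF p] by simp
    qed
    show "\<exists>C. \<forall>p\<in>X s. cmod (l p) \<le> C * nX s p" using l_bound by blast
  qed
  have S_add: "S N (\<lambda>x. a * p x) = cnj a * S N p" if p: "p \<in> X s" "a \<noteq> 0" for N a p
    using X_scale[OF p] by (simp add: SX p(1) gc_scale[OF p(1)] sum_distrib_left mult_ac)
  have lim: "(\<lambda>N. dual_norm (X s) (nX s) (\<lambda>g. l g - S N g)) \<longlonglongrightarrow> 0"
  proof (rule tendsto_sandwich[OF _ _ tendsto_const Blim])
    have "dual_norm (X s) (nX s) (\<lambda>g. l g - S N g) \<le> B N" for N
      by (rule dual_norm_le[where z = "\<lambda>x. 0"]) (use X_zero[OF s] tail B0 in auto)
    then show "\<forall>\<^sub>F N in sequentially. dual_norm (X s) (nX s) (\<lambda>g. l g - S N g) \<le> B N" by simp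
    have "0 \<le> dual_norm (X s) (nX s) (\<lambda>g. l g - S N g)" for N
    proof -
      have "bdd_above ((\<lambda>g. cmod (l g - S N g)) ` {q \<in> X s. nX s q \<le> 1})"
      proof (rule bdd_aboveI2)
        fix q assume "q \<in> {q \<in> X s. nX s q \<le> 1}"
        then have "cmod (l q - S N q) \<le> B N * nX s q" "B N * nX s q \<le> B N * 1"
          using tail B0[of N] by (auto intro!: mult_left_mono simp del: mult_1_right)
        then show "cmod (l q - S N q) \<le> B N" by simp
      qed
      from cSUP_upper[OF _ this, of "\<lambda>x. 0"] X_zero[OF s] show ?thesis
        unfolding dual_norm_def by (auto intro: order_trans[OF norm_ge_zero])
    qed
    then show "\<forall>\<^sub>F N in sequentially. 0 \<le> dual_norm (X s) (nX s) (\<lambda>g. l g - S N g)" by simp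
  qed
  have "modal_operator d xm xp s c \<psi> = l"
    unfolding modal_operator_def S_def[symmetric]
  proof (rule the_equality)
    show "l \<in> antidual (X s) (nX s) \<and> (\<lambda>N. dual_norm (X s) (nX s) (\<lambda>g. l g - S N g)) \<longlonglongrightarrow> 0"
      using l_dual lim by blast
    fix l' assume l': "l' \<in> antidual (X s) (nX s) \<and> (\<lambda>N. dual_norm (X s) (nX s) (\<lambda>g. l' g - S N g)) \<longlonglongrightarrow> 0"
    then obtain C where C: "\<forall>p\<in>X s. cmod (l' p) \<le> C * nX s p" by (auto simp: antidual_def)
    from l' C have l'a: "\<And>a p. p \<in> X s \<Longrightarrow> l' (\<lambda>x. a * p x) = cnj a * l' p" "\<And>p. p \<in> X s \<Longrightarrow> cmod (l' p) \<le> C * nX s p"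
      and l'e: "l' \<in> extensional (X s)" by (auto simp: antidual_def)
    show "l' = l"
    proof (rule extensionalityI[OF l'e])
      show "l \<in> extensional (X s)" by (simp add: l_def)
      fix g assume g: "g \<in> X s"
      let ?D' = "\<lambda>N. dual_norm (X s) (nX s) (\<lambda>g. l' g - S N g)"
      \<comment> \<open>The bound that \<open>dual_norm_ge\<close> requires adds those of l', of l
        and of the tail.\<close>
      have 1: "cmod (l' g - S N g) \<le> ?D' N * nX s g" for N
      proof (rule dual_norm_ge[where C = "C + (B 0 + B N)"])
        fix q assume q: "q \<in> X s"
        have "cmod (l' q - S N q) \<le> cmod (l' q) + (cmod (l q) + cmod (l q - S N q))"
          using norm_triangle_ineq4[of "l' q" "S N q"] norm_triangle_ineq4[of "l q" "l q - S N q"] by simp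
        then show "cmod (l' q - S N q) \<le> (C + (B 0 + B N)) * nX s q"
          using l'a(2)[OF q] l_bound[OF q] tail[OF q, of N] by (simp add: distrib_right)
        fix a :: complex assume a: "a \<noteq> 0"
        have "l' (\<lambda>x. a * q x) - S N (\<lambda>x. a * q x) = cnj a * (l' q - S N q)"
          using l'a(1)[OF q] S_add[OF q a] by (simp add: algebra_simps)
        then show "(\<lambda>x. a * q x) \<in> X s \<and> cmod (l' (\<lambda>x. a * q x) - S N (\<lambda>x. a * q x)) = cmod a * cmod (l' q - S N q)
           \<and> nX s (\<lambda>x. a * q x) \<le> cmod a * nX s q"
          using X_scale[OF q a] by (simp add: norm_mult)
      qed (use nX_nonneg g in auto)
      have "cmod (l' g - l g) \<le> ?D' N * nX s g + B N * nX s g" for N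
        using norm_triangle_ineq4[of "l' g - S N g" "l g - S N g"] 1[of N] tail[OF g, of N] by simp
      moreover have "(\<lambda>N. ?D' N * nX s g + B N * nX s g) \<longlonglongrightarrow> 0 * nX s g + 0 * nX s g"
        using l' by (intro tendsto_add tendsto_mult_right Blim) auto
      ultimately have "cmod (l' g - l g) \<le> 0 * nX s g + 0 * nX s g" by (intro LIMSEQ_le_const) auto
      then show "l' g = l g" by simp
    qed
  qed
  then show ?thesis using lX[OF g] by simp
qed

end

lemma tc_X: "u \<in> H1 \<Omega> \<Longrightarrow> s \<in> {xm, xp} \<Longrightarrow> edge_trace d xm xp s u \<in> X s"
  using X_I edge_trace_is_trace by blast

section \<open>Boundary forms given by coefficient sequences\<close>

definition bform :: "(nat \<Rightarrow> complex) \<Rightarrow> real \<Rightarrow> (real \<times> real \<Rightarrow> complex) \<Rightarrow> (real \<times> real \<Rightarrow> complex) \<Rightarrow> complex" where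
  "bform c s p q = (\<Sum>n. c n * tc s p n * cnj (tc s q n))"

text \<open>Growth of order one, matched to the weight in the H^{1/2} trace bound: it makes the
  boundary form bounded on H^1.\<close>

definition admissible :: "(nat \<Rightarrow> complex) \<Rightarrow> real \<Rightarrow> bool" where
  "admissible c \<kappa> \<longleftrightarrow> \<kappa> \<ge> 0 \<and> (\<forall>n. cmod (c n) \<le> \<kappa> * wt n)"

lemma modal_operator_bform:
  assumes "admissible c \<kappa>" "s \<in> {xm, xp}" "p \<in> H1 \<Omega>" "q \<in> H1 \<Omega>"
  shows "modal_operator d xm xp s c (edge_trace d xm xp s p) (edge_trace d xm xp s q) = bform c s p q"
  unfolding bform_def tc_def
  by (rule modal_operator_eq[OF assms(2), of \<kappa>]) (use assms in \<open>auto simp: admissible_def intro!: tc_X\<close>)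

lemma bform_summable:
  assumes "admissible c \<kappa>" "s \<in> {xm, xp}" "p \<in> H1 \<Omega>" "q \<in> H1 \<Omega>"
  shows "summable (\<lambda>n. c n * tc s p n * cnj (tc s q n))"
  unfolding tc_def
  by (rule summable_norm_cancel, rule modal_summable[OF assms(2), of \<kappa>])
    (use assms in \<open>auto simp: admissible_def intro!: tc_X\<close>)

lemma bform_bound:
  assumes a: "admissible c \<kappa>" and s: "s \<in> {xm, xp}" and p: "p \<in> H1 \<Omega>" and q: "q \<in> H1 \<Omega>"
  shows "cmod (bform c s p q) \<le> \<kappa> * Kt * H1_norm \<Omega> p * H1_norm \<Omega> q"
proof -
  have sm: "summable (\<lambda>n. cmod (c n * tc s p n * cnj (tc s q n)))"
    unfolding tc_def
    by (rule modal_summable[OF s, of \<kappa>]) (use a p q s in \<open>auto simp: admissible_def intro!: tc_X\<close>)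
  have "cmod (bform c s p q) \<le> (\<Sum>n. cmod (c n * tc s p n * cnj (tc s q n)))"
    unfolding bform_def by (rule summable_norm[OF sm])
  also have "\<dots> \<le> \<kappa> * Kt * H1_norm \<Omega> p * H1_norm \<Omega> q"
  proof (rule suminf_le_const[OF sm])
    fix N
    have t: "sqrt (\<Sum>n<N. wt n * (cmod (tc s u n))\<^sup>2) \<le> sqrt Kt * H1_norm \<Omega> u" if "u \<in> H1 \<Omega>" for u
      using real_sqrt_le_mono[OF tc_bound[OF s that, of N]] by (simp add: wt_def real_sqrt_mult H1_norm_nonneg)
    have "(\<Sum>n<N. cmod (c n * tc s p n * cnj (tc s q n))) \<le> \<kappa> * sqrt (\<Sum>n<N. wt n * (cmod (tc s p n))\<^sup>2) * sqrt (\<Sum>n<N. wt n * (cmod (tc s q n))\<^sup>2)"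
      using a by (intro sum_weighted_Cauchy_Schwarz wt_pos) (auto simp: admissible_def)
    also have "\<dots> \<le> \<kappa> * (sqrt Kt * H1_norm \<Omega> p) * (sqrt Kt * H1_norm \<Omega> q)"
      using a wt_pos Kt_pos by (intro mult_mono mult_left_mono t p q mult_nonneg_nonneg real_sqrt_ge_zero sum_nonneg H1_norm_nonneg)
        (auto simp: admissible_def less_imp_le)
    also have "\<dots> = \<kappa> * (sqrt Kt * sqrt Kt) * H1_norm \<Omega> p * H1_norm \<Omega> q" by (simp only: mult_ac)
    also have "sqrt Kt * sqrt Kt = Kt" using Kt_pos by simp
    finally show "(\<Sum>n<N. cmod (c n * tc s p n * cnj (tc s q n))) \<le> \<kappa> * Kt * H1_norm \<Omega> p * H1_norm \<Omega> q" .
  qed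
  finally show ?thesis .
qed

lemma bform_linear:
  assumes a: "admissible c \<kappa>" and s: "s \<in> {xm, xp}" and p: "p \<in> H1 \<Omega>" "p' \<in> H1 \<Omega>" and q: "q \<in> H1 \<Omega>"
  shows "bform c s (\<lambda>x. p x + p' x) q = bform c s p q + bform c s p' q"
    and "bform c s (\<lambda>x. z * p x) q = z * bform c s p q"
    and "bform c s q (\<lambda>x. p x + p' x) = bform c s q p + bform c s q p'"
    and "bform c s q (\<lambda>x. z * p x) = cnj z * bform c s q p"
proof -
  note sm = bform_summable[OF a s]
  show "bform c s (\<lambda>x. p x + p' x) q = bform c s p q + bform c s p' q"
    unfolding bform_def suminf_add[OF sm[OF p(1) q] sm[OF p(2) q]] by (simp add: tc_add[OF p s] algebra_simps)
  show "bform c s q (\<lambda>x. p x + p' x) = bform c s q p + bform c s q p'"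
    unfolding bform_def suminf_add[OF sm[OF q p(1)] sm[OF q p(2)]] by (simp add: tc_add[OF p s] algebra_simps)
  show "bform c s (\<lambda>x. z * p x) q = z * bform c s p q"
    unfolding bform_def suminf_mult[OF sm[OF p(1) q], symmetric] by (simp add: tc_scale[OF p(1) s] mult_ac)
  show "bform c s q (\<lambda>x. z * p x) = cnj z * bform c s q p"
    unfolding bform_def suminf_mult[OF sm[OF q p(1)], symmetric] by (simp add: tc_scale[OF p(1) s] mult_ac)
qed

end

section \<open>The sesquilinear form on a single mode\<close>

text \<open>A + B = X - Y is integration by parts. Half of the convective term is rewritten by it,
  which symmetrises that term and shifts the boundary coefficients by \<i> K, with opposite signs at
  the two ends.\<close>

lemma gauge_algebra:
  fixes g K :: complex
  assumes "A + B = X - Y"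
  shows "g * P + (l2 - k2) * C - 2 * \<i> * (g * K) * A + g * (b1 * X + b2 * Y)
    = g * (P + \<i> * K * B - \<i> * K * A + K2 * C) - (k2 - l2 + g * K2) * C + g * ((b1 - \<i> * K) * X + (b2 + \<i> * K) * Y)"
proof -
  have X: "X = A + B + Y" by (simp add: assms)
  show ?thesis unfolding X by (simp add: algebra_simps)
qed

context guide
begin

interpretation H1: semi_inner_space "H1 \<Omega>" H1_inner
  rewrites "semi_inner_space.nrm H1_inner = H1_norm \<Omega>"
  by (rule semi_inner_space_H1 nrm_H1)+

text \<open>Under inner products the arbitrarily chosen weak derivative of a differentiable function
  may be replaced by the classical one.\<close>

lemma D_classical_inner:
  assumes u: "partial u ux uy" "continuous_on UNIV ux" "continuous_on UNIV uy" and g: "g \<in> L2 \<Omega>"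
  shows "L2_inner \<Omega> (D1 u) g = L2_inner \<Omega> ux g" "L2_inner \<Omega> (D2 u) g = L2_inner \<Omega> uy g"
    "L2_inner \<Omega> g (D1 u) = L2_inner \<Omega> g ux" "L2_inner \<Omega> g (D2 u) = L2_inner \<Omega> g uy"
proof -
  note * = D_classical[OF u]
  note L = continuous_in_L2[OF u(2)] continuous_in_L2[OF u(3)]
  show 1: "L2_inner \<Omega> (D1 u) g = L2_inner \<Omega> ux g" by (rule L2.ip_cong_null[OF H1D(2)[OF *(1)] L(1) g *(2)])
  show 2: "L2_inner \<Omega> (D2 u) g = L2_inner \<Omega> uy g" by (rule L2.ip_cong_null[OF H1D(3)[OF *(1)] L(2) g *(3)])
  show "L2_inner \<Omega> g (D1 u) = L2_inner \<Omega> g ux"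
    using arg_cong[OF 1, of cnj] by (simp add: L2.ip_cnj H1D(2)[OF *(1)] L g)
  show "L2_inner \<Omega> g (D2 u) = L2_inner \<Omega> g uy"
    using arg_cong[OF 2, of cnj] by (simp add: L2.ip_cnj H1D(3)[OF *(1)] L g)
qed

definition ip1 :: "(real \<Rightarrow> complex) \<Rightarrow> (real \<Rightarrow> complex) \<Rightarrow> complex" where
  "ip1 w z = integral {xm..xp} (\<lambda>x. w x * cnj (z x))"

definition ten :: "(real \<Rightarrow> complex) \<Rightarrow> nat \<Rightarrow> real \<times> real \<Rightarrow> complex" where
  "ten w n p = w (fst p) * phi d n (snd p)"

definition dphi :: "nat \<Rightarrow> real \<Rightarrow> complex" where
  "dphi n y = of_real (- ky n * (ny n * sy n y))"

lemma phi_deriv: "(phi d n has_vector_derivative dphi n y) (at y)"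
proof -
  have "((\<lambda>y. ny n * cy n y) has_vector_derivative ny n * (- ky n * sy n y)) (at y)"
    by (intro has_vector_derivative_mult_right trig_deriv)
  from bounded_linear.has_vector_derivative[OF bounded_linear_of_real this]
  show ?thesis by (simp add: phi_eq[abs_def] dphi_def mult_ac)
qed

lemma dphi_continuous: "continuous_on S (dphi n)"
  unfolding dphi_def[abs_def] by (intro continuous_intros cont_trig)

lemma smooth1_phi: "smooth1 (phi d n)"
  unfolding phi_eq[abs_def] by (intro smooth1_of_real smooth1_mult smooth1_const smooth1_trig)

lemma smooth_ten: "smooth1 w \<Longrightarrow> smooth (ten w n)"
  unfolding ten_def[abs_def] by (rule smooth_tensor[OF _ smooth1_phi])

lemma ten_H1: "smooth1 w \<Longrightarrow> ten w n \<in> H1 \<Omega>" by (intro smooth_in_H1 smooth_ten)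

lemma continuous_tensor:
  assumes "continuous_on UNIV f" "continuous_on UNIV g"
  shows "continuous_on UNIV (\<lambda>p::real \<times> real. f (fst p) * g (snd p) :: complex)"
  by (intro continuous_intros continuous_on_compose2[OF assms(1)] continuous_on_compose2[OF assms(2)]) auto

lemma continuous_ten: "continuous_on UNIV w \<Longrightarrow> continuous_on UNIV (ten w n)"
  unfolding ten_def[abs_def] by (rule continuous_tensor[OF _ phi_continuous])

lemma L2_inner_tensor:
  assumes "continuous_on UNIV w" "continuous_on UNIV z" "continuous_on UNIV f" "continuous_on UNIV g"
  shows "L2_inner \<Omega> (\<lambda>p. w (fst p) * f (snd p)) (\<lambda>p. z (fst p) * g (snd p)) = ip1 w z * integral {0..d} (\<lambda>y. f y * cnj (g y))"
proof -
  have "L2_inner \<Omega> (\<lambda>p. w (fst p) * f (snd p)) (\<lambda>p. z (fst p) * g (snd p))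
    = (LINT p|lebesgue_on \<Omega>. (\<lambda>x. w x * cnj (z x)) (fst p) * (\<lambda>y. f y * cnj (g y)) (snd p))"
    by (simp add: L2_inner_def mult_ac)
  also have "\<dots> = ip1 w z * integral {0..d} (\<lambda>y. f y * cnj (g y))"
    unfolding ip1_def by (rule LINT_Omega_tensor) (intro continuous_intros assms)+
  finally show ?thesis .
qed

lemma dphi_orthogonal: "integral {0..d} (\<lambda>y. dphi n y * cnj (dphi m y)) = (if n = m then of_real ((ky n)\<^sup>2) else 0)"
proof -
  have "((\<lambda>y. of_real ((ky n * ky m) * (ny n * sy n y * (ny m * sy m y))) :: complex) has_integral
      of_real ((ky n * ky m) * (if n = m \<and> n \<noteq> 0 then 1 else 0))) {0..d}"
    by (intro has_integral_of_real has_integral_mult_right sy_orthonormal)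
  then have "integral {0..d} (\<lambda>y. of_real ((ky n * ky m) * (ny n * sy n y * (ny m * sy m y))) :: complex) = of_real ((ky n * ky m) * (if n = m \<and> n \<noteq> 0 then 1 else 0))"
    by (rule integral_unique)
  moreover have "(\<lambda>y. dphi n y * cnj (dphi m y)) = (\<lambda>y. of_real ((ky n * ky m) * (ny n * sy n y * (ny m * sy m y))))"
    by (simp add: dphi_def fun_eq_iff mult_ac)
  ultimately show ?thesis by (cases "n = m"; cases "m = 0") (auto simp: kxy_0 power2_eq_square)
qed

lemma L2_inner_ten:
  assumes "continuous_on UNIV w" "continuous_on UNIV z"
  shows "L2_inner \<Omega> (ten w n) (ten z m) = (if n = m then ip1 w z else 0)"
    "L2_inner \<Omega> (\<lambda>p. w (fst p) * dphi n (snd p)) (\<lambda>p. z (fst p) * dphi m (snd p)) = (if n = m then of_real ((ky n)\<^sup>2) * ip1 w z else 0)"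
proof -
  show "L2_inner \<Omega> (ten w n) (ten z m) = (if n = m then ip1 w z else 0)"
    unfolding ten_def[abs_def] L2_inner_tensor[OF assms phi_continuous phi_continuous] L2_inner_J[OF phi_continuous phi_continuous, symmetric]
    by (simp add: phi_orthonormal)
  show "L2_inner \<Omega> (\<lambda>p. w (fst p) * dphi n (snd p)) (\<lambda>p. z (fst p) * dphi m (snd p)) = (if n = m then of_real ((ky n)\<^sup>2) * ip1 w z else 0)"
    unfolding L2_inner_tensor[OF assms dphi_continuous dphi_continuous] dphi_orthogonal by simp
qed

lemma partial_ten:
  assumes "\<And>x. (w has_vector_derivative w' x) (at x)"
  shows "partial (ten w n) (ten w' n) (\<lambda>p. w (fst p) * dphi n (snd p))"
  unfolding ten_def[abs_def] by (rule partial_tensor[OF assms phi_deriv])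

lemma tc_ten: "smooth1 w \<Longrightarrow> s \<in> {xm, xp} \<Longrightarrow> tc s (ten w n) m = (if n = m then w s else 0)"
  by (subst tc_smooth[OF smooth_ten])
    (auto simp: gc_def ten_def L2.ip_scale_left[OF phi_L2 phi_L2] phi_orthonormal)

lemma bform_ten:
  assumes "smooth1 w" "smooth1 z" "s \<in> {xm, xp}"
  shows "bform c s (ten w n) (ten z m) = (if n = m then c n * w s * cnj (z s) else 0)"
proof -
  have "bform c s (ten w n) (ten z m) = (\<Sum>j. if j = n then (if n = m then c n * w s * cnj (z s) else 0) else 0)"
    unfolding bform_def by (intro suminf_cong) (auto simp: tc_ten[OF assms(1,3)] tc_ten[OF assms(2,3)])
  also have "\<dots> = (if n = m then c n * w s * cnj (z s) else 0)"
    by (subst suminf_finite[of "{n}"]) auto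
  finally show ?thesis .
qed

lemma trigpoly_ten:
  "trigpoly ({..N} \<times> K) a = (\<lambda>p. \<Sum>n\<in>K. ten (\<lambda>x. \<Sum>m\<le>N. a (m, n) * of_real (nx m * cx m x)) n p)"
proof
  fix p :: "real \<times> real"
  show "trigpoly ({..N} \<times> K) a p = (\<Sum>n\<in>K. ten (\<lambda>x. \<Sum>m\<le>N. a (m, n) * of_real (nx m * cx m x)) n p)"
    using trigpoly_column[of N K a "fst p" "snd p"] by (simp add: ten_def)
qed

end

section \<open>The form of the convected Helmholtz equation\<close>

locale flow = guide +
  fixes M k :: real
  assumes M: "0 \<le> M" "M < 1" and k_pos: "0 < k"
    and nonresonant: "\<And>n :: nat. k \<noteq> sqrt (1 - M\<^sup>2) * (real n * pi / d)"
begin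

interpretation H1: semi_inner_space "H1 \<Omega>" H1_inner
  rewrites "semi_inner_space.nrm H1_inner = H1_norm \<Omega>"
  by (rule semi_inner_space_H1 nrm_H1)+

definition \<gamma> :: real where "\<gamma> = 1 - M\<^sup>2"
text \<open>The real shift common to all modes: each \<open>beta\<close> is - \<open>kap\<close>
  plus or minus the root \<open>mu n\<close>.\<close>

definition kap :: real where "kap = k * M / \<gamma>"

lemma \<gamma>: "0 < \<gamma>" "\<gamma> \<le> 1"
  using M by (auto simp: \<gamma>_def abs_square_less_1)

lemma kap_nonneg: "0 \<le> kap" using M \<gamma> k_pos by (simp add: kap_def)

definition F :: "(nat \<Rightarrow> complex) \<Rightarrow> (nat \<Rightarrow> complex) \<Rightarrow> (real \<times> real \<Rightarrow> complex) \<Rightarrow> (real \<times> real \<Rightarrow> complex) \<Rightarrow> complex" where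
  "F c1 c2 p q = of_real \<gamma> * L2_inner \<Omega> (D1 p) (D1 q) + L2_inner \<Omega> (D2 p) (D2 q)
     - of_real (k\<^sup>2) * L2_inner \<Omega> p q - 2 * \<i> * of_real (k * M) * L2_inner \<Omega> (D1 p) q
     + of_real \<gamma> * (bform c1 xp p q + bform c2 xm p q)"

text \<open>From here on the boundary operators enter only through the sequences c1 and c2, so that
  the exact and the truncated conditions become members of one family of forms.\<close>

lemma waveguide_form_F:
  assumes a: "admissible c1 \<kappa>" "admissible c2 \<kappa>" and p: "p \<in> H1 \<Omega>" and q: "q \<in> H1 \<Omega>"
  shows "waveguide_form d M k xm xp (modal_operator d xm xp xp c1) (modal_operator d xm xp xm c2) p q = F c1 c2 p q"
proof -
  have i: "integrable (lebesgue_on \<Omega>) (\<lambda>x. D1 p x * cnj (D1 q x))" "integrable (lebesgue_on \<Omega>) (\<lambda>x. D2 p x * cnj (D2 q x))"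
    by (intro L2_inner_integrable H1D p q)+
  have "(LINT x|lebesgue_on \<Omega>. of_real (1 - M\<^sup>2) * D1 p x * cnj (D1 q x) + D2 p x * cnj (D2 q x))
     = (LINT x|lebesgue_on \<Omega>. of_real (1 - M\<^sup>2) * (D1 p x * cnj (D1 q x))) + (LINT x|lebesgue_on \<Omega>. D2 p x * cnj (D2 q x))"
    using Bochner_Integration.integral_add[OF integrable_mult_right[OF i(1), of "of_real (1 - M\<^sup>2)"] i(2)] by (simp add: mult.assoc)
  also have "\<dots> = of_real \<gamma> * L2_inner \<Omega> (D1 p) (D1 q) + L2_inner \<Omega> (D2 p) (D2 q)"
    by (simp add: L2_inner_def \<gamma>_def)
  finally show ?thesis
    unfolding waveguide_form_def Let_def F_def
    using modal_operator_bform[OF a(1) _ p q, of xp] modal_operator_bform[OF a(2) _ p q, of xm]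
    by (simp add: L2_inner_def \<gamma>_def)
qed

definition FB :: "real \<Rightarrow> real" where "FB K = 2 + k\<^sup>2 + 2 * (k * M) + 2 * (K * Kt)"

text \<open>The squared axial wave number, negative for evanescent modes.\<close>

definition mu2 :: "nat \<Rightarrow> real" where "mu2 n = (k\<^sup>2 - (ky n)\<^sup>2 * \<gamma>) / \<gamma>\<^sup>2"

context
  fixes c1 c2 :: "nat \<Rightarrow> complex" and \<kappa> :: real
  assumes a1: "admissible c1 \<kappa>" and a2: "admissible c2 \<kappa>"
begin

lemma F_linear:
  assumes p: "p \<in> H1 \<Omega>" "p' \<in> H1 \<Omega>" and q: "q \<in> H1 \<Omega>"
  shows "F c1 c2 (\<lambda>x. p x + p' x) q = F c1 c2 p q + F c1 c2 p' q"
    and "F c1 c2 (\<lambda>x. z * p x) q = z * F c1 c2 p q"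
    and "F c1 c2 q (\<lambda>x. p x + p' x) = F c1 c2 q p + F c1 c2 q p'"
    and "F c1 c2 q (\<lambda>x. z * p x) = cnj z * F c1 c2 q p"
proof -
  have s: "xp \<in> {xm, xp}" "xm \<in> {xm, xp}" by auto
  have r: "L2_inner \<Omega> g (D1 (\<lambda>x. p x + p' x)) = L2_inner \<Omega> g (D1 p) + L2_inner \<Omega> g (D1 p')"
    "L2_inner \<Omega> g (D2 (\<lambda>x. p x + p' x)) = L2_inner \<Omega> g (D2 p) + L2_inner \<Omega> g (D2 p')"
    "L2_inner \<Omega> g (D1 (\<lambda>x. z * p x)) = cnj z * L2_inner \<Omega> g (D1 p)"
    "L2_inner \<Omega> g (D2 (\<lambda>x. z * p x)) = cnj z * L2_inner \<Omega> g (D2 p)"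
    if g: "g \<in> L2 \<Omega>" for g
    using D_add_inner[OF p g, THEN arg_cong[where f = cnj]] D_scale_inner[OF p(1) g, of z, THEN arg_cong[where f = cnj]]
    by (simp_all add: L2.ip_cnj H1D p g H1_add(1) H1_scale(1))
  note b = bform_linear[OF a1 s(1) p q] bform_linear[OF a2 s(2) p q]
  show "F c1 c2 (\<lambda>x. p x + p' x) q = F c1 c2 p q + F c1 c2 p' q"
    unfolding F_def b by (simp add: D_add_inner[OF p] H1D q L2.ip_add_left p algebra_simps)
  show "F c1 c2 (\<lambda>x. z * p x) q = z * F c1 c2 p q"
    unfolding F_def b by (simp add: D_scale_inner[OF p(1)] H1D q L2.ip_scale_left p algebra_simps)
  show "F c1 c2 q (\<lambda>x. p x + p' x) = F c1 c2 q p + F c1 c2 q p'"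
    unfolding F_def b by (simp add: r H1D q L2.ip_add_right p algebra_simps)
  show "F c1 c2 q (\<lambda>x. z * p x) = cnj z * F c1 c2 q p"
    unfolding F_def b by (simp add: r H1D q L2.ip_scale_right p algebra_simps)
qed

lemma F_bound:
  assumes p: "p \<in> H1 \<Omega>" and q: "q \<in> H1 \<Omega>"
  shows "cmod (F c1 c2 p q) \<le> FB \<kappa> * H1_norm \<Omega> p * H1_norm \<Omega> q"
proof -
  define P where "P = H1_norm \<Omega> p * H1_norm \<Omega> q"
  have P0: "0 \<le> P" by (simp add: P_def H1_norm_nonneg)
  have CS: "cmod (L2_inner \<Omega> u v) \<le> P" if "u \<in> L2 \<Omega>" "v \<in> L2 \<Omega>" "L2_norm \<Omega> u \<le> H1_norm \<Omega> p" "L2_norm \<Omega> v \<le> H1_norm \<Omega> q" for u v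
    unfolding P_def using L2.Cauchy_Schwarz[OF that(1,2)] mult_mono[OF that(3,4) H1_norm_nonneg L2_norm_nonneg] by linarith
  have 1: "cmod (of_real \<gamma> * L2_inner \<Omega> (D1 p) (D1 q)) \<le> 1 * P"
    unfolding norm_mult using \<gamma> by (intro mult_mono CS H1D p q L2_norms_le_H1) auto
  have 2: "cmod (L2_inner \<Omega> (D2 p) (D2 q)) \<le> P" by (intro CS H1D p q L2_norms_le_H1)
  have 3: "cmod (of_real (k\<^sup>2) * L2_inner \<Omega> p q) \<le> k\<^sup>2 * P"
    unfolding norm_mult by (intro mult_mono CS H1D p q L2_norms_le_H1) (auto simp: norm_power)
  have 4: "cmod (2 * \<i> * of_real (k * M) * L2_inner \<Omega> (D1 p) q) \<le> (2 * (k * M)) * P"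
  proof -
    have "cmod (2 * \<i> * of_real (k * M)) = 2 * (k * M)" using M k_pos by (simp add: norm_mult)
    then show ?thesis unfolding norm_mult[of "2 * \<i> * of_real (k * M)"]
      using M k_pos by (intro mult_mono CS H1D p q L2_norms_le_H1) auto
  qed
  have "cmod (bform c1 xp p q + bform c2 xm p q) \<le> \<kappa> * Kt * H1_norm \<Omega> p * H1_norm \<Omega> q + \<kappa> * Kt * H1_norm \<Omega> p * H1_norm \<Omega> q"
    by (intro norm_triangle_mono bform_bound a1 a2 p q) auto
  then have b: "cmod (bform c1 xp p q + bform c2 xm p q) \<le> 2 * (\<kappa> * Kt) * P" by (simp add: P_def mult_ac)
  have 5: "cmod (of_real \<gamma> * (bform c1 xp p q + bform c2 xm p q)) \<le> 2 * (\<kappa> * Kt) * P"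
  proof -
    have "cmod (of_real \<gamma> * (bform c1 xp p q + bform c2 xm p q)) \<le> 1 * cmod (bform c1 xp p q + bform c2 xm p q)"
      unfolding norm_mult using \<gamma> by (intro mult_right_mono) auto
    then show ?thesis using b by linarith
  qed
  have tri: "cmod (x + y - z - w + v) \<le> cmod x + cmod y + cmod z + cmod w + cmod v" for x y z w v
    using norm_triangle_ineq[of "x + y - z - w" v] norm_triangle_ineq4[of "x + y - z" w] norm_triangle_ineq4[of "x + y" z] norm_triangle_ineq[of x y] by linarith
  have "cmod (F c1 c2 p q) \<le> 1 * P + P + k\<^sup>2 * P + (2 * (k * M)) * P + 2 * (\<kappa> * Kt) * P"
    unfolding F_def using tri[of "of_real \<gamma> * L2_inner \<Omega> (D1 p) (D1 q)"] 1 2 3 4 5 by (meson add_mono order_trans)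
  also have "\<dots> = FB \<kappa> * P" by (simp add: FB_def algebra_simps)
  finally show ?thesis by (simp add: P_def mult.assoc)
qed

lemma F_zero: "q \<in> H1 \<Omega> \<Longrightarrow> F c1 c2 (\<lambda>x. 0) q = 0" "q \<in> H1 \<Omega> \<Longrightarrow> F c1 c2 q (\<lambda>x. 0) = 0"
  using F_linear(2)[OF H1.zero_mem H1.zero_mem, of q 0] F_linear(4)[OF H1.zero_mem H1.zero_mem, of q 0] by auto

lemma F_sum:
  assumes q: "q \<in> H1 \<Omega>"
  shows "finite I \<Longrightarrow> (\<And>i. i \<in> I \<Longrightarrow> f i \<in> H1 \<Omega>) \<Longrightarrow> F c1 c2 (\<lambda>x. \<Sum>i\<in>I. f i x) q = (\<Sum>i\<in>I. F c1 c2 (f i) q)"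
    and "finite I \<Longrightarrow> (\<And>i. i \<in> I \<Longrightarrow> f i \<in> H1 \<Omega>) \<Longrightarrow> F c1 c2 q (\<lambda>x. \<Sum>i\<in>I. f i x) = (\<Sum>i\<in>I. F c1 c2 q (f i))"
  by (induction I rule: finite_induct) (auto simp: F_zero q F_linear(1,3) H1.sum_mem)

lemma F_tendsto:
  assumes u: "\<And>n. u n \<in> H1 \<Omega>" "p \<in> H1 \<Omega>" "(\<lambda>n. H1_norm \<Omega> (\<lambda>x. u n x - p x)) \<longlonglongrightarrow> 0"
    and v: "\<And>n. v n \<in> H1 \<Omega>" "q \<in> H1 \<Omega>" "(\<lambda>n. H1_norm \<Omega> (\<lambda>x. v n x - q x)) \<longlonglongrightarrow> 0"
  shows "(\<lambda>n. F c1 c2 (u n) (v n)) \<longlonglongrightarrow> F c1 c2 p q"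
proof (rule LIM_zero_cancel, rule tendsto_norm_zero_cancel, rule tendsto_sandwich[OF _ _ tendsto_const])
  let ?b = "\<lambda>n. FB \<kappa> * H1_norm \<Omega> (\<lambda>x. u n x - p x) * H1_norm \<Omega> (v n) + FB \<kappa> * H1_norm \<Omega> p * H1_norm \<Omega> (\<lambda>x. v n x - q x)"
  have "?b \<longlonglongrightarrow> FB \<kappa> * 0 * H1_norm \<Omega> q + FB \<kappa> * H1_norm \<Omega> p * 0"
    by (intro tendsto_add tendsto_mult tendsto_const u v H1.nrm_tendsto)
  then show "?b \<longlonglongrightarrow> 0" by simp
  have "cmod (F c1 c2 (u n) (v n) - F c1 c2 p q) \<le> ?b n" for n
  proof -
    have d1: "F c1 c2 (\<lambda>x. u n x - p x) (v n) = F c1 c2 (u n) (v n) - F c1 c2 p (v n)"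
      using F_linear(1)[OF u(1)[of n] H1_scale(1)[OF u(2), of "-1"] v(1)[of n]] F_linear(2)[OF u(2) u(2) v(1)[of n], of "-1"] by simp
    have d2: "F c1 c2 p (\<lambda>x. v n x - q x) = F c1 c2 p (v n) - F c1 c2 p q"
      using F_linear(3)[OF v(1)[of n] H1_scale(1)[OF v(2), of "-1"] u(2)] F_linear(4)[OF v(2) v(2) u(2), of "-1"] by simp
    have "F c1 c2 (u n) (v n) - F c1 c2 p q = F c1 c2 (\<lambda>x. u n x - p x) (v n) + F c1 c2 p (\<lambda>x. v n x - q x)"
      unfolding d1 d2 by simp
    also have "cmod \<dots> \<le> ?b n"
      by (intro norm_triangle_mono F_bound H1.diff_mem u v)
    finally show ?thesis .
  qed
  then show "\<forall>\<^sub>F n in sequentially. cmod (F c1 c2 (u n) (v n) - F c1 c2 p q) \<le> ?b n" by simp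
qed simp

text \<open>With the covariant derivative \<open>w' + \<i> kap w\<close> the first-order term of the form disappears; its
  boundary contribution is moved into the boundary coefficients.\<close>

lemma F_ten:
  assumes w: "smooth1 w" "\<And>x. (w has_vector_derivative w' x) (at x)"
    and z: "smooth1 z" "\<And>x. (z has_vector_derivative z' x) (at x)"
  shows "F c1 c2 (ten w n) (ten z m) = (if n = m then of_real \<gamma> *
     (ip1 (\<lambda>x. w' x + \<i> * of_real kap * w x) (\<lambda>x. z' x + \<i> * of_real kap * z x) - of_real (mu2 n) * ip1 w z
      + (c1 n - \<i> * of_real kap) * w xp * cnj (z xp) + (c2 n + \<i> * of_real kap) * w xm * cnj (z xm)) else 0)"
proof -
  have sm: "smooth1 w'" "smooth1 z'" using smooth1_derivative w z by blast+
  have c: "continuous_on S w" "continuous_on S w'" "continuous_on S z" "continuous_on S z'" for S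
    using sm w(1) z(1) smooth1_continuous by blast+
  note P = partial_ten[OF w(2), of n] and R = partial_ten[OF z(2), of m]
  note cP = continuous_ten[OF c(2)] continuous_tensor[OF c(1) dphi_continuous]
  note cR = continuous_ten[OF c(4)] continuous_tensor[OF c(3) dphi_continuous]
  have L: "ten w' n \<in> L2 \<Omega>" "(\<lambda>p. w (fst p) * dphi n (snd p)) \<in> L2 \<Omega>" "ten z m \<in> L2 \<Omega>"
    by (intro continuous_in_L2 cP continuous_ten c)+
  have T: "ten z m \<in> H1 \<Omega>" by (rule ten_H1[OF z(1)])
  have e: "L2_inner \<Omega> (D1 (ten w n)) (D1 (ten z m)) = (if n = m then ip1 w' z' else 0)"
    "L2_inner \<Omega> (D2 (ten w n)) (D2 (ten z m)) = (if n = m then of_real ((ky n)\<^sup>2) * ip1 w z else 0)"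
    "L2_inner \<Omega> (ten w n) (ten z m) = (if n = m then ip1 w z else 0)"
    "L2_inner \<Omega> (D1 (ten w n)) (ten z m) = (if n = m then ip1 w' z else 0)"
    using D_classical_inner(1)[OF P cP H1D(2)[OF T]] D_classical_inner(3)[OF R cR L(1)]
      D_classical_inner(2)[OF P cP H1D(3)[OF T]] D_classical_inner(4)[OF R cR L(2)]
      D_classical_inner(1)[OF P cP L(3)]
      L2_inner_ten[OF c(1) c(3), of n m] L2_inner_ten[OF c(2) c(4), of n m] L2_inner_ten[OF c(2) c(3), of n m]
    by simp_all
  have b: "bform c1 xp (ten w n) (ten z m) = (if n = m then c1 n * w xp * cnj (z xp) else 0)"
    "bform c2 xm (ten w n) (ten z m) = (if n = m then c2 n * w xm * cnj (z xm) else 0)"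
    using bform_ten[OF w(1) z(1)] by auto
  have ic: "(\<lambda>x. f x * cnj (g x)) integrable_on {xm..xp}" if "continuous_on {xm..xp} f" "continuous_on {xm..xp} g" for f g
    by (intro integrable_continuous_real continuous_intros that)
  have ftc: "ip1 w' z + ip1 w z' = w xp * cnj (z xp) - w xm * cnj (z xm)"
  proof -
    have "((\<lambda>x. w x * cnj (z' x) + w' x * cnj (z x)) has_integral w xp * cnj (z xp) - w xm * cnj (z xm)) {xm..xp}"
      by (rule fundamental_theorem_of_calculus)
        (use xm_less_xp w(2) z(2) in \<open>auto intro!: has_vector_derivative_mult has_vector_derivative_cnj intro: has_vector_derivative_at_within\<close>)
    then have "integral {xm..xp} (\<lambda>x. w x * cnj (z' x) + w' x * cnj (z x)) = w xp * cnj (z xp) - w xm * cnj (z xm)" by (rule integral_unique)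
    moreover have "integral {xm..xp} (\<lambda>x. w x * cnj (z' x) + w' x * cnj (z x)) = ip1 w z' + ip1 w' z"
      unfolding ip1_def by (intro Henstock_Kurzweil_Integration.integral_add ic c)
    ultimately show ?thesis by (simp add: add.commute)
  qed
  have exp: "ip1 (\<lambda>x. w' x + \<i> * of_real kap * w x) (\<lambda>x. z' x + \<i> * of_real kap * z x)
     = ip1 w' z' + \<i> * of_real kap * ip1 w z' - \<i> * of_real kap * ip1 w' z + of_real (kap\<^sup>2) * ip1 w z"
  proof -
    have "(\<lambda>x. (w' x + \<i> * of_real kap * w x) * cnj (z' x + \<i> * of_real kap * z x))
      = (\<lambda>x. w' x * cnj (z' x) + (\<i> * of_real kap) * (w x * cnj (z' x)) + (- \<i> * of_real kap) * (w' x * cnj (z x)) + of_real (kap\<^sup>2) * (w x * cnj (z x)))"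
      by (simp add: fun_eq_iff algebra_simps power2_eq_square)
    then show ?thesis unfolding ip1_def
      by (simp only:) (subst Henstock_Kurzweil_Integration.integral_add | (intro integrable_add integrable_on_mult_right ic c) | simp)+
  qed
  show ?thesis
  proof (cases "n = m")
    case True
    have g0: "\<gamma> \<noteq> 0" using \<gamma> by simp
    have 1: "of_real \<gamma> * of_real kap = (of_real (k * M) :: complex)" using g0 by (simp add: kap_def)
    \<comment> \<open>Completing the square by the gauge adds \<gamma> \<open>kap\<^sup>2\<close> to
      \<open>k\<^sup>2 - (ky n)\<^sup>2\<close>; with \<open>M\<^sup>2\<close> = 1 - \<gamma> the
      sum is \<open>k\<^sup>2\<close> / \<gamma> - \<open>(ky n)\<^sup>2\<close>.\<close>
    have "\<gamma> * mu2 n = k\<^sup>2 - (ky n)\<^sup>2 + \<gamma> * kap\<^sup>2"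
    proof -
      have g: "M\<^sup>2 = 1 - \<gamma>" by (simp add: \<gamma>_def)
      have "\<gamma> * mu2 n = (k\<^sup>2 - (ky n)\<^sup>2 * \<gamma>) / \<gamma>" using g0 by (simp add: mu2_def power2_eq_square)
      then have "\<gamma> * mu2 n = k\<^sup>2 / \<gamma> - (ky n)\<^sup>2" using g0 by (simp add: diff_divide_distrib)
      moreover have "\<gamma> * kap\<^sup>2 = k\<^sup>2 * M\<^sup>2 / \<gamma>" using g0 by (simp add: kap_def power2_eq_square)
      then have "\<gamma> * kap\<^sup>2 = k\<^sup>2 / \<gamma> - k\<^sup>2" unfolding g using g0 by (simp add: right_diff_distrib diff_divide_distrib)
      ultimately show ?thesis by simp
    qed
    then have 2: "of_real \<gamma> * of_real (mu2 n) = (of_real (k\<^sup>2) - of_real ((ky n)\<^sup>2) + of_real \<gamma> * of_real (kap\<^sup>2) :: complex)"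
      by (metis of_real_add of_real_diff of_real_mult)
    have "F c1 c2 (ten w n) (ten z m) = of_real \<gamma> * ip1 w' z' + (of_real ((ky n)\<^sup>2) - of_real (k\<^sup>2)) * ip1 w z - 2 * \<i> * of_real (k * M) * ip1 w' z
       + of_real \<gamma> * (c1 n * w xp * cnj (z xp) + c2 n * w xm * cnj (z xm))"
      unfolding F_def e b using True by (simp add: algebra_simps)
    also have "\<dots> = of_real \<gamma> *
     (ip1 w' z' + \<i> * of_real kap * ip1 w z' - \<i> * of_real kap * ip1 w' z + of_real (kap\<^sup>2) * ip1 w z) - of_real \<gamma> * of_real (mu2 n) * ip1 w z
      + of_real \<gamma> * ((c1 n - \<i> * of_real kap) * w xp * cnj (z xp) + (c2 n + \<i> * of_real kap) * w xm * cnj (z xm))"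
      unfolding 2 1[symmetric]
      using gauge_algebra[OF ftc, of "of_real \<gamma>" "ip1 w' z'" "of_real ((ky n)\<^sup>2)" "of_real (k\<^sup>2)" "ip1 w z" "of_real kap" "c1 n" "c2 n" "of_real (kap\<^sup>2)"]
      by (simp only: mult.assoc)
    finally show ?thesis unfolding exp using True by (simp add: algebra_simps)
  qed (simp add: F_def e b)
qed

end

end

section \<open>A Garding inequality\<close>

lemma mult_lower_bound:
  fixes b :: real
  assumes "- b \<le> x" "y \<le> e" "0 \<le> y" "0 \<le> b"
  shows "- (b * e) \<le> x * y"
proof -
  have "- b * y \<le> x * y" using assms by (intro mult_right_mono)
  moreover have "b * y \<le> b * e" using assms by (intro mult_left_mono)
  ultimately show ?thesis by simp
qed

lemma sum_lower_bound:
  fixes b :: real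
  shows "- (b * e) \<le> x \<Longrightarrow> - (b * e) \<le> y \<Longrightarrow> g - 2 * b * e \<le> g + x + y"
  by (simp add: mult.assoc)

lemma absorb_bound: "(C + 1) * a - s \<le> b / 8 \<Longrightarrow> a + b / 8 \<le> b / 4 - C * a + (s::real)"
  by (simp add: distrib_right)

lemma quarter_bound: "2 * y + g < z \<Longrightarrow> 0 \<le> y \<Longrightarrow> 0 < g \<Longrightarrow> g / 4 + z / 4 \<le> z - (y::real)"
  by simp

text \<open>The Cayley transform maps the unit disc to the right half plane: the numerator of its
  real part is 1 - |E|^2. The modulus is largest where E is closest to 1.\<close>

lemma cayley_bounds:
  fixes E :: complex
  assumes E: "cmod E \<le> r" and r: "r < 1"
  shows "0 \<le> Re ((1 + E) / (1 - E))" "cmod ((1 + E) / (1 - E)) \<le> (1 + r) / (1 - r)" "1 - E \<noteq> 0"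
proof -
  have lo: "1 - r \<le> cmod (1 - E)" using E norm_triangle_ineq2[of 1 E] by simp
  then show ne: "1 - E \<noteq> 0" using r by auto
  have "cmod (1 + E) \<le> 1 + r" using E norm_triangle_ineq[of 1 E] by simp
  moreover have "0 \<le> 1 + r" using E norm_ge_zero[of E] by linarith
  ultimately show "cmod ((1 + E) / (1 - E)) \<le> (1 + r) / (1 - r)"
    unfolding norm_divide using lo r by (intro frac_le) auto
  have "(cmod E)\<^sup>2 \<le> 1" using E r by (intro power_le_one) auto
  then have "(Re E)\<^sup>2 + (Im E)\<^sup>2 \<le> 1" by (simp add: cmod_power2)
  then have "0 \<le> (1 + Re E) * (1 - Re E) + Im E * (- Im E)"
    by (simp add: power2_eq_square algebra_simps)
  then show "0 \<le> Re ((1 + E) / (1 - E))" by (simp add: Re_divide)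
qed

context flow
begin

interpretation H1: semi_inner_space "H1 \<Omega>" H1_inner
  rewrites "semi_inner_space.nrm H1_inner = H1_norm \<Omega>"
  by (rule semi_inner_space_H1 nrm_H1)+

definition mm :: "nat \<Rightarrow> real" where "mm n = sqrt \<bar>mu2 n\<bar>"
text \<open>The square root of \<open>mu2 n\<close> on the branch for which exp(\<i> mu x) travels,
  respectively decays, in the direction of increasing x.\<close>

definition mu :: "nat \<Rightarrow> complex" where "mu n = (if mu2 n > 0 then of_real (mm n) else \<i> * of_real (mm n))"

lemma mu2_nonzero: "mu2 n \<noteq> 0"
proof
  assume "mu2 n = 0"
  then have e: "k\<^sup>2 = (ky n)\<^sup>2 * \<gamma>" using \<gamma> by (auto simp: mu2_def)
  have "k = sqrt (k\<^sup>2)" using k_pos by simp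
  also have "\<dots> = sqrt \<gamma> * ky n" unfolding e
    using ky_pos[of n] kxy_0 by (cases "n = 0") (auto simp: real_sqrt_mult)
  also have "\<dots> = sqrt (1 - M\<^sup>2) * (real n * pi / d)" by (simp add: \<gamma>_def ky_def)
  finally show False using nonresonant by blast
qed

lemma propagating_ky: "mu2 n > 0 \<Longrightarrow> (ky n)\<^sup>2 \<le> k\<^sup>2 / \<gamma>"
proof -
  assume "mu2 n > 0"
  then have "0 < k\<^sup>2 - (ky n)\<^sup>2 * \<gamma>" using \<gamma> by (simp add: mu2_def zero_less_divide_iff)
  then show ?thesis using \<gamma> by (simp add: pos_le_divide_eq)
qed

lemma mm_pos: "mm n > 0" using mu2_nonzero by (simp add: mm_def)

lemma mm_square: "(mm n)\<^sup>2 = \<bar>mu2 n\<bar>" by (simp add: mm_def)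

text \<open>\<open>E1\<close> and \<open>E2\<close> are the reflection coefficients at \<open>xp\<close> and \<open>xm\<close>.\<close>

definition good :: "real \<Rightarrow> real \<Rightarrow> (nat \<Rightarrow> complex) \<Rightarrow> (nat \<Rightarrow> complex) \<Rightarrow> bool" where
  "good r \<kappa> c1 c2 \<longleftrightarrow> admissible c1 \<kappa> \<and> admissible c2 \<kappa> \<and> (\<forall>n. \<exists>E1 E2. cmod E1 \<le> r \<and> cmod E2 \<le> r \<and>
     c1 n - \<i> * of_real kap = - \<i> * mu n * ((1 + E1) / (1 - E1)) \<and> c2 n + \<i> * of_real kap = - \<i> * mu n * ((1 + E2) / (1 - E2)))"

lemma ky_finite: "finite {n. (ky n)\<^sup>2 \<le> K}"
proof (rule finite_subset)
  show "{n. (ky n)\<^sup>2 \<le> K} \<subseteq> {..nat \<lceil>sqrt K * d / pi\<rceil>}"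
  proof
    fix n assume "n \<in> {n. (ky n)\<^sup>2 \<le> K}"
    then have "ky n \<le> sqrt K" by (simp add: real_le_rsqrt)
    then have "real n \<le> sqrt K * d / pi" using d_pos by (simp add: ky_def field_simps)
    then show "n \<in> {..nat \<lceil>sqrt K * d / pi\<rceil>}" by (simp add: le_nat_iff) linarith
  qed
qed simp

text \<open>Only finitely many modes have small \<open>ky n\<close>, and none of them is at cutoff,
  so a minimum serves there; beyond them |mu2| grows like the square of \<open>ky n\<close>.\<close>

lemma mu2_lower: "\<exists>e>0. \<forall>n. e * (1 + (ky n)\<^sup>2) \<le> \<bar>mu2 n\<bar>"
proof -
  \<comment> \<open>Outside S the product of \<open>(ky n)\<^sup>2\<close> and \<gamma> exceeds 2
    \<open>k\<^sup>2\<close> + \<gamma>, so that subtracting \<open>k\<^sup>2\<close> leaves at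
    least a quarter of \<gamma> (1 + \<open>(ky n)\<^sup>2\<close>).\<close>
  define S where "S = {n. (ky n)\<^sup>2 \<le> 2 * k\<^sup>2 / \<gamma> + 1}"
  have S: "finite S" unfolding S_def by (rule ky_finite)
  define e where "e = Min (insert (1 / 4) ((\<lambda>n. \<bar>mu2 n\<bar> / (1 + (ky n)\<^sup>2)) ` S))"
  have p: "1 + (ky n)\<^sup>2 > 0" for n by (simp add: add_pos_nonneg)
  have "e > 0" unfolding e_def using S mu2_nonzero p by (subst Min_gr_iff) auto
  moreover have "e * (1 + (ky n)\<^sup>2) \<le> \<bar>mu2 n\<bar>" for n
  proof (cases "n \<in> S")
    case True
    then have "e \<le> \<bar>mu2 n\<bar> / (1 + (ky n)\<^sup>2)" unfolding e_def using S by (intro Min_le) auto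
    then show ?thesis using p[of n] by (simp add: pos_le_divide_eq)
  next
    case False
    then have K: "2 * k\<^sup>2 / \<gamma> + 1 < (ky n)\<^sup>2" by (simp add: S_def)
    define x where "x = (ky n)\<^sup>2"
    have K': "2 * k\<^sup>2 + \<gamma> < x * \<gamma>" using K \<gamma> by (simp add: x_def field_simps)
    have "\<gamma> / 4 * (1 + x) = \<gamma> / 4 + x * \<gamma> / 4" by (simp add: distrib_left mult.commute)
    also have "\<dots> \<le> x * \<gamma> - k\<^sup>2" using quarter_bound[OF K' zero_le_power2 \<gamma>(1)] .
    also have "x * \<gamma> - k\<^sup>2 = - mu2 n * \<gamma>\<^sup>2" using \<gamma> by (simp add: mu2_def x_def)
    also have "\<dots> \<le> \<bar>mu2 n\<bar> * \<gamma>\<^sup>2" by (intro mult_right_mono) auto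
    also have "\<dots> \<le> \<bar>mu2 n\<bar> * \<gamma>"
      using \<gamma> by (intro mult_left_mono) (auto simp: power2_eq_square mult_left_le)
    finally have "1 / 4 * (1 + x) \<le> \<bar>mu2 n\<bar>" using \<gamma> by (simp add: mult.commute[of _ \<gamma>] mult.assoc)
    moreover have "e \<le> 1 / 4" unfolding e_def using S by (intro Min_le) auto
    then have "e * (1 + x) \<le> 1 / 4 * (1 + x)" using p[of n] unfolding x_def by (intro mult_right_mono) auto
    ultimately show ?thesis by (simp add: x_def)
  qed
  ultimately show ?thesis by blast
qed

text \<open>One-dimensional facts about w, read off from the two-dimensional ones for
  \<open>ten w n\<close>; as \<open>phi d n\<close> is normalised, no factor appears.\<close>

lemma ten_facts:
  assumes w: "smooth1 w" "\<And>x. (w has_vector_derivative w' x) (at x)"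
  defines "g \<equiv> \<lambda>x. w' x + \<i> * of_real kap * w x"
  shows "ip1 w w = of_real ((L2_norm \<Omega> (ten w n))\<^sup>2)" "ip1 g g = of_real ((L2_norm \<Omega> (ten g n))\<^sup>2)"
    "L2_norm \<Omega> (ten w' n) \<le> L2_norm \<Omega> (ten g n) + kap * L2_norm \<Omega> (ten w n)"
    "s \<in> {xm, xp} \<Longrightarrow> (cmod (w s))\<^sup>2 \<le> (1 / len) * (L2_norm \<Omega> (ten w n))\<^sup>2 + 2 * L2_norm \<Omega> (ten w n) * L2_norm \<Omega> (ten w' n)"
proof -
  have sm: "smooth1 w'" using smooth1_derivative[OF w] .
  have c: "continuous_on S w" "continuous_on S w'" for S using sm w(1) smooth1_continuous by blast+
  have cg: "continuous_on S g" for S unfolding g_def by (intro continuous_intros c)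
  have self: "ip1 f f = of_real ((L2_norm \<Omega> (ten f n))\<^sup>2)" if "continuous_on UNIV f" for f
    using L2_inner_ten(1)[OF that that, of n n] L2_inner_self[of \<Omega> "ten f n"] by simp
  show "ip1 w w = of_real ((L2_norm \<Omega> (ten w n))\<^sup>2)" "ip1 g g = of_real ((L2_norm \<Omega> (ten g n))\<^sup>2)"
    by (intro self c cg)+
  have L: "ten f n \<in> L2 \<Omega>" if "continuous_on UNIV f" for f by (intro continuous_in_L2 continuous_ten that)
  have "ten w' n = (\<lambda>p. ten g n p - (\<i> * of_real kap) * ten w n p)" by (simp add: ten_def g_def fun_eq_iff algebra_simps)
  then have "L2_norm \<Omega> (ten w' n) \<le> L2_norm \<Omega> (ten g n) + L2_norm \<Omega> (\<lambda>p. - (\<i> * of_real kap) * ten w n p)"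
    using L2.nrm_triangle[OF L[OF cg] L2_scale[OF L[OF c(1)]], of "- (\<i> * of_real kap)"] by simp
  also have "L2_norm \<Omega> (\<lambda>p. - (\<i> * of_real kap) * ten w n p) = kap * L2_norm \<Omega> (ten w n)"
    using L2.nrm_scale[OF L[OF c(1)], of "- (\<i> * of_real kap)"] kap_nonneg by (simp add: norm_mult)
  finally show "L2_norm \<Omega> (ten w' n) \<le> L2_norm \<Omega> (ten g n) + kap * L2_norm \<Omega> (ten w n)" .
  show "(cmod (w s))\<^sup>2 \<le> (1 / len) * (L2_norm \<Omega> (ten w n))\<^sup>2 + 2 * L2_norm \<Omega> (ten w n) * L2_norm \<Omega> (ten w' n)" if s: "s \<in> {xm, xp}"
  proof -
    have "L2_inner J (\<lambda>y. ten w n (s, y)) (\<lambda>y. ten w n (s, y)) = w s * cnj (w s)"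
      by (simp add: ten_def L2.ip_scale_left L2.ip_scale_right L2_scale phi_L2 phi_orthonormal)
    then have 1: "(L2_norm J (\<lambda>y. ten w n (s, y)))\<^sup>2 = (cmod (w s))\<^sup>2"
      by (metis L2_inner_self complex_norm_square of_real_eq_iff)
    note P = partial_ten[OF w(2), of n]
    note cP = continuous_ten[OF c(2), of n] continuous_tensor[OF c(1) dphi_continuous, of n]
    have 2: "L2_norm \<Omega> (D1 (ten w n)) = L2_norm \<Omega> (ten w' n)"
      by (rule L2.nrm_cong_null[OF H1D(2)[OF D_classical(1)[OF P cP]] L[OF c(2)] D_classical(2)[OF P cP]])
    show ?thesis using edge_bound[OF smooth_ten[OF w(1)] s, of n] unfolding 1 2 .
  qed
qed

context
  fixes r \<kappa> :: real and c1 c2 :: "nat \<Rightarrow> complex"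
  assumes r: "0 \<le> r" "r < 1" and good: "good r \<kappa> c1 c2"
begin

lemma adm: "admissible c1 \<kappa>" "admissible c2 \<kappa>" using good by (auto simp: good_def)

lemma F_ten_self:
  assumes w: "smooth1 w" "\<And>x. (w has_vector_derivative w' x) (at x)"
  shows "Re (F c1 c2 (ten w n) (ten w n)) = \<gamma> * ((L2_norm \<Omega> (ten (\<lambda>x. w' x + \<i> * of_real kap * w x) n))\<^sup>2 - mu2 n * (L2_norm \<Omega> (ten w n))\<^sup>2
     + Re (c1 n - \<i> * of_real kap) * (cmod (w xp))\<^sup>2 + Re (c2 n + \<i> * of_real kap) * (cmod (w xm))\<^sup>2)"
proof -
  have q: "Re (z * v * cnj v) = Re z * (cmod v)\<^sup>2" for z v
    by (simp add: mult.assoc complex_norm_square[symmetric] del: of_real_power)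
  show ?thesis
    unfolding F_ten[OF adm w w] ten_facts(1,2)[OF w, of n]
    by (simp add: q[of "c1 n - \<i> * of_real kap" "w xp", simplified] q[of "c2 n + \<i> * of_real kap" "w xm", simplified] del: of_real_power)
qed

lemma F_evanescent:
  assumes w: "smooth1 w" "\<And>x. (w has_vector_derivative w' x) (at x)" and n: "mu2 n < 0"
  shows "Re (F c1 c2 (ten w n) (ten w n)) \<ge> \<gamma> * ((L2_norm \<Omega> (ten (\<lambda>x. w' x + \<i> * of_real kap * w x) n))\<^sup>2 + \<bar>mu2 n\<bar> * (L2_norm \<Omega> (ten w n))\<^sup>2)"
proof -
  obtain E1 E2 where E: "cmod E1 \<le> r" "cmod E2 \<le> r"
     "c1 n - \<i> * of_real kap = - \<i> * mu n * ((1 + E1) / (1 - E1))" "c2 n + \<i> * of_real kap = - \<i> * mu n * ((1 + E2) / (1 - E2))"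
    using good unfolding good_def by blast
  have m: "- \<i> * mu n = of_real (mm n)" using n by (simp add: mu_def)
  have "0 \<le> Re (c1 n - \<i> * of_real kap)" "0 \<le> Re (c2 n + \<i> * of_real kap)"
  proof -
    have R: "0 \<le> Re (of_real (mm n) * z)" if "0 \<le> Re z" for z using that mm_pos[of n] by simp
    show "0 \<le> Re (c1 n - \<i> * of_real kap)" "0 \<le> Re (c2 n + \<i> * of_real kap)"
      unfolding E(3,4) m by (intro R cayley_bounds(1)[OF E(1) r(2)] cayley_bounds(1)[OF E(2) r(2)])+
  qed
  from mult_nonneg_nonneg[OF this(1) zero_le_power2] mult_nonneg_nonneg[OF this(2) zero_le_power2]
  have "0 \<le> Re (c1 n - \<i> * of_real kap) * (cmod (w xp))\<^sup>2" "0 \<le> Re (c2 n + \<i> * of_real kap) * (cmod (w xm))\<^sup>2"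
    by blast+
  then show ?thesis unfolding F_ten_self[OF w] using n \<gamma> by (intro mult_left_mono) auto
qed

text \<open>Here - \<i> \<open>mu n\<close> is imaginary, and the real part of an impedance with
  nonzero reflection has no definite sign; it is estimated by the modulus and the boundary values by
  the edge bound.\<close>

lemma F_propagating:
  assumes w: "smooth1 w" "\<And>x. (w has_vector_derivative w' x) (at x)" and n: "mu2 n > 0"
  defines "A \<equiv> L2_norm \<Omega> (ten w n)" and "B \<equiv> L2_norm \<Omega> (ten w' n)"
  shows "Re (F c1 c2 (ten w n) (ten w n)) \<ge> \<gamma> * ((L2_norm \<Omega> (ten (\<lambda>x. w' x + \<i> * of_real kap * w x) n))\<^sup>2 - mu2 n * A\<^sup>2
     - 2 * (mm n * ((1 + r) / (1 - r))) * ((1 / len) * A\<^sup>2 + 2 * A * B))"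
proof -
  obtain E1 E2 where E: "cmod E1 \<le> r" "cmod E2 \<le> r"
     "c1 n - \<i> * of_real kap = - \<i> * mu n * ((1 + E1) / (1 - E1))" "c2 n + \<i> * of_real kap = - \<i> * mu n * ((1 + E2) / (1 - E2))"
    using good unfolding good_def by blast
  have m: "cmod (- \<i> * mu n) = mm n" using n mm_pos[of n] by (simp add: mu_def norm_mult)
  let ?b = "mm n * ((1 + r) / (1 - r))"
  have "cmod (c1 n - \<i> * of_real kap) \<le> ?b"
    unfolding E(3) norm_mult[of "- \<i> * mu n"] m
    by (rule mult_left_mono[OF cayley_bounds(2)[OF E(1) r(2)]]) (use mm_pos[of n] in simp)
  moreover have "cmod (c2 n + \<i> * of_real kap) \<le> ?b"
    unfolding E(4) norm_mult[of "- \<i> * mu n"] m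
    by (rule mult_left_mono[OF cayley_bounds(2)[OF E(2) r(2)]]) (use mm_pos[of n] in simp)
  ultimately have b: "- ?b \<le> Re (c1 n - \<i> * of_real kap)" "- ?b \<le> Re (c2 n + \<i> * of_real kap)"
    using abs_Re_le_cmod[of "c1 n - \<i> * of_real kap"] abs_Re_le_cmod[of "c2 n + \<i> * of_real kap"] by linarith+
  have b0: "0 \<le> ?b" using r mm_pos[of n] by (intro mult_nonneg_nonneg) auto
  let ?e = "(1 / len) * A\<^sup>2 + 2 * A * B"
  have e: "(cmod (w xp))\<^sup>2 \<le> ?e" "(cmod (w xm))\<^sup>2 \<le> ?e"
    using ten_facts(4)[OF w, of xp n] ten_facts(4)[OF w, of xm n] unfolding A_def B_def by auto
  note lb = sum_lower_bound[OF mult_lower_bound[OF b(1) e(1) zero_le_power2 b0] mult_lower_bound[OF b(2) e(2) zero_le_power2 b0]]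
  show ?thesis unfolding F_ten_self[OF w] A_def[symmetric] by (rule mult_left_mono[OF lb less_imp_le[OF \<gamma>(1)]])
qed

end

lemma young: "2 * (b::real) * x * y \<le> x\<^sup>2 / 2 + 2 * b\<^sup>2 * y\<^sup>2"
proof -
  have "0 \<le> (x - 2 * b * y)\<^sup>2" by simp
  then show ?thesis by (simp add: power2_diff power_mult_distrib algebra_simps)
qed

text \<open>The covariant derivative controls the plain one up to \<open>kap\<close> times the
  function; the term with |mu2|, at least of size 1 + \<open>(ky n)\<^sup>2\<close>, pays for
  that.\<close>

lemma mode_coercive_evanescent:
  assumes "0 \<le> r" "r < 1"
  shows "\<exists>c>0. \<forall>\<kappa> c1 c2 w w' n. good r \<kappa> c1 c2 \<longrightarrow> smooth1 w \<longrightarrow> (\<forall>x. (w has_vector_derivative w' x) (at x)) \<longrightarrow> mu2 n < 0 \<longrightarrow>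
     c * ((1 + (ky n)\<^sup>2) * (L2_norm \<Omega> (ten w n))\<^sup>2 + (L2_norm \<Omega> (ten w' n))\<^sup>2) \<le> Re (F c1 c2 (ten w n) (ten w n))"
proof -
  obtain e where e: "e > 0" "\<And>n. e * (1 + (ky n)\<^sup>2) \<le> \<bar>mu2 n\<bar>" using mu2_lower by blast
  \<comment> \<open>The share of the covariant term traded for the plain derivative: its cost, t
    times \<open>kap\<^sup>2\<close>, stays below half of the lower bound e.\<close>
  define t where "t = min 1 (e / (2 * (kap\<^sup>2 + 1)))"
  have k1: "kap\<^sup>2 + 1 > 0" by (simp add: add_nonneg_pos)
  have t: "t > 0" "t \<le> 1" using e k1 by (auto simp: t_def)
  have tk: "t * kap\<^sup>2 \<le> e / 2"
  proof -
    have "t * kap\<^sup>2 \<le> e / (2 * (kap\<^sup>2 + 1)) * (kap\<^sup>2 + 1)" using t e k1 by (intro mult_mono) (auto simp: t_def)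
    also have "\<dots> = e / 2" using k1 by (simp add: field_simps)
    finally show ?thesis .
  qed
  define c where "c = \<gamma> * min (t / 2) (e / 2)"
  have "c > 0" using \<gamma> t e by (simp add: c_def)
  moreover have "c * ((1 + (ky n)\<^sup>2) * (L2_norm \<Omega> (ten w n))\<^sup>2 + (L2_norm \<Omega> (ten w' n))\<^sup>2) \<le> Re (F c1 c2 (ten w n) (ten w n))"
    if g: "good r \<kappa> c1 c2" and w: "smooth1 w" "\<And>x. (w has_vector_derivative w' x) (at x)" and n: "mu2 n < 0" for \<kappa> c1 c2 w w' n
  proof -
    define A where "A = L2_norm \<Omega> (ten w n)"
    define B where "B = L2_norm \<Omega> (ten w' n)"
    define G where "G = L2_norm \<Omega> (ten (\<lambda>x. w' x + \<i> * of_real kap * w x) n)"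
    have "B \<le> G + kap * A" using ten_facts(3)[OF w] by (simp add: A_def B_def G_def)
    then have "B\<^sup>2 \<le> (G + kap * A)\<^sup>2" by (intro power_mono) (auto simp: B_def L2_norm_nonneg)
    also have "\<dots> \<le> 2 * G\<^sup>2 + 2 * kap\<^sup>2 * A\<^sup>2"
      using sum_squares_bound[of G "kap * A"] by (simp add: power2_sum power_mult_distrib algebra_simps)
    finally have GB: "B\<^sup>2 / 2 - kap\<^sup>2 * A\<^sup>2 \<le> G\<^sup>2" by simp
    have "t * (B\<^sup>2 / 2 - kap\<^sup>2 * A\<^sup>2) \<le> t * G\<^sup>2" using GB t by (intro mult_left_mono) auto
    also have "\<dots> \<le> G\<^sup>2" using t by (simp add: mult_left_le_one_le)
    finally have 1: "t / 2 * B\<^sup>2 - t * kap\<^sup>2 * A\<^sup>2 \<le> G\<^sup>2" by (simp add: algebra_simps)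
    have 2: "t * kap\<^sup>2 * A\<^sup>2 \<le> e / 2 * ((1 + (ky n)\<^sup>2) * A\<^sup>2)"
    proof -
      have "t * kap\<^sup>2 * A\<^sup>2 \<le> e / 2 * A\<^sup>2" using tk by (intro mult_right_mono) auto
      also have "\<dots> \<le> e / 2 * ((1 + (ky n)\<^sup>2) * A\<^sup>2)" using e by (intro mult_left_mono) (auto simp: distrib_right)
      finally show ?thesis .
    qed
    have 3: "e * ((1 + (ky n)\<^sup>2) * A\<^sup>2) \<le> \<bar>mu2 n\<bar> * A\<^sup>2"
      using mult_right_mono[OF e(2)[of n], of "A\<^sup>2"] by (simp add: mult.assoc)
    have X: "0 \<le> (1 + (ky n)\<^sup>2) * A\<^sup>2" by (intro mult_nonneg_nonneg) auto
    have "min (t / 2) (e / 2) * ((1 + (ky n)\<^sup>2) * A\<^sup>2 + B\<^sup>2) \<le> e / 2 * ((1 + (ky n)\<^sup>2) * A\<^sup>2) + t / 2 * B\<^sup>2"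
      unfolding distrib_left[of "min (t / 2) (e / 2)"] using X by (intro add_mono mult_right_mono) auto
    also have "\<dots> \<le> G\<^sup>2 + \<bar>mu2 n\<bar> * A\<^sup>2" using 1 2 3 by linarith
    finally have "c * ((1 + (ky n)\<^sup>2) * A\<^sup>2 + B\<^sup>2) \<le> \<gamma> * (G\<^sup>2 + \<bar>mu2 n\<bar> * A\<^sup>2)"
      unfolding c_def mult.assoc using \<gamma> by (intro mult_left_mono) auto
    also have "\<dots> \<le> Re (F c1 c2 (ten w n) (ten w n))"
      using F_evanescent[OF assms g w n] by (simp add: G_def A_def)
    finally show ?thesis by (simp add: A_def B_def)
  qed
  ultimately show ?thesis by blast
qed

text \<open>Propagating modes satisfy \<open>mu2 n\<close> \<le> \<open>k\<^sup>2\<close> /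
  \<open>\<gamma>\<^sup>2\<close>, so one constant C serves all of them. By Young's inequality the
  boundary terms use up half of the squared covariant derivative, besides multiples of the squared
  function.\<close>

lemma mode_garding_propagating:
  assumes r: "0 \<le> r" "r < 1"
  shows "\<exists>C\<ge>0. \<forall>\<kappa> c1 c2 w w' n. good r \<kappa> c1 c2 \<longrightarrow> smooth1 w \<longrightarrow> (\<forall>x. (w has_vector_derivative w' x) (at x)) \<longrightarrow> mu2 n > 0 \<longrightarrow>
     \<gamma> * ((L2_norm \<Omega> (ten w' n))\<^sup>2 / 4 - C * (L2_norm \<Omega> (ten w n))\<^sup>2) \<le> Re (F c1 c2 (ten w n) (ten w n))"
proof -
  define m2 where "m2 = k\<^sup>2 / \<gamma>\<^sup>2"
  define b where "b = sqrt m2 * ((1 + r) / (1 - r))"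
  have m2: "m2 \<ge> 0" by (simp add: m2_def)
  have b: "b \<ge> 0" using r m2 by (simp add: b_def)
  \<comment> \<open>In this order: the term with \<open>mu2 n\<close>, the value part of the edge
    bound, Young's inequality, and two costs of passing between the plain and the covariant
    derivative.\<close>
  define C where "C = m2 + 2 * b / len + 8 * b\<^sup>2 + 4 * b * kap + kap\<^sup>2"
  have C: "C \<ge> 0" unfolding C_def using m2 b kap_nonneg len_pos by (intro add_nonneg_nonneg mult_nonneg_nonneg divide_nonneg_nonneg) auto
  have "\<gamma> * ((L2_norm \<Omega> (ten w' n))\<^sup>2 / 4 - C * (L2_norm \<Omega> (ten w n))\<^sup>2) \<le> Re (F c1 c2 (ten w n) (ten w n))"
    if g: "good r \<kappa> c1 c2" and w: "smooth1 w" "\<And>x. (w has_vector_derivative w' x) (at x)" and n: "mu2 n > 0" for \<kappa> c1 c2 w w' n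
  proof -
    define A where "A = L2_norm \<Omega> (ten w n)"
    define B where "B = L2_norm \<Omega> (ten w' n)"
    define G where "G = L2_norm \<Omega> (ten (\<lambda>x. w' x + \<i> * of_real kap * w x) n)"
    have AB: "A \<ge> 0" "B \<ge> 0" by (simp_all add: A_def B_def L2_norm_nonneg)
    have BG: "B \<le> G + kap * A" using ten_facts(3)[OF w] by (simp add: A_def B_def G_def)
    then have "B\<^sup>2 \<le> (G + kap * A)\<^sup>2" by (intro power_mono) (auto simp: B_def L2_norm_nonneg)
    also have "\<dots> \<le> 2 * G\<^sup>2 + 2 * kap\<^sup>2 * A\<^sup>2"
      using sum_squares_bound[of G "kap * A"] by (simp add: power2_sum power_mult_distrib algebra_simps)
    finally have GB: "B\<^sup>2 / 4 - kap\<^sup>2 * A\<^sup>2 / 2 \<le> G\<^sup>2 / 2" by simp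
    have m: "mu2 n \<le> m2" unfolding mu2_def m2_def using \<gamma> by (intro divide_right_mono) auto
    have mb: "mm n * ((1 + r) / (1 - r)) \<le> b"
      unfolding b_def mm_def using m n r by (intro mult_right_mono) auto
    let ?e = "(1 / len) * A\<^sup>2 + 2 * A * B"
    have e0: "?e \<ge> 0" using AB len_pos by simp
    have "2 * (mm n * ((1 + r) / (1 - r))) * ?e \<le> 2 * b * ?e" using mb e0 by (intro mult_right_mono) auto
    also have "\<dots> = 2 * b / len * A\<^sup>2 + 4 * b * A * B" by (simp add: algebra_simps)
    also have "4 * b * A * B \<le> 4 * b * A * (G + kap * A)" using BG b AB by (intro mult_left_mono) auto
    also have "\<dots> = 2 * (2 * b) * G * A + 4 * b * kap * A\<^sup>2" by (simp add: algebra_simps power2_eq_square)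
    also have "2 * (2 * b) * G * A \<le> G\<^sup>2 / 2 + 2 * (2 * b)\<^sup>2 * A\<^sup>2" by (rule young)
    finally have 1: "2 * (mm n * ((1 + r) / (1 - r))) * ?e \<le> 2 * b / len * A\<^sup>2 + (G\<^sup>2 / 2 + 2 * (2 * b)\<^sup>2 * A\<^sup>2 + 4 * b * kap * A\<^sup>2)" by simp
    have 2: "mu2 n * A\<^sup>2 \<le> m2 * A\<^sup>2" using m by (intro mult_right_mono) auto
    have Ceq: "C * A\<^sup>2 = m2 * A\<^sup>2 + 2 * b / len * A\<^sup>2 + 2 * (2 * b)\<^sup>2 * A\<^sup>2 + 4 * b * kap * A\<^sup>2 + kap\<^sup>2 * A\<^sup>2"
      by (simp add: C_def algebra_simps power_mult_distrib)
    have k0: "0 \<le> kap\<^sup>2 * A\<^sup>2" by simp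
    have "B\<^sup>2 / 4 - C * A\<^sup>2 \<le> G\<^sup>2 - mu2 n * A\<^sup>2 - 2 * (mm n * ((1 + r) / (1 - r))) * ?e"
      using 1 2 GB k0 unfolding Ceq by linarith
    then have "\<gamma> * (B\<^sup>2 / 4 - C * A\<^sup>2) \<le> \<gamma> * (G\<^sup>2 - mu2 n * A\<^sup>2 - 2 * (mm n * ((1 + r) / (1 - r))) * ?e)"
      using \<gamma> by (intro mult_left_mono) auto
    also have "\<dots> \<le> Re (F c1 c2 (ten w n) (ten w n))"
      using F_propagating[OF r g w n] unfolding A_def B_def G_def .
    finally show ?thesis by (simp add: A_def B_def)
  qed
  then show ?thesis using C by blast
qed

section \<open>From single modes to all of H^1\<close>

lemma hat_add: "p \<in> H1 \<Omega> \<Longrightarrow> q \<in> H1 \<Omega> \<Longrightarrow> hat (\<lambda>x. p x + q x) i = hat p i + hat q i"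
  and hat_scale: "p \<in> H1 \<Omega> \<Longrightarrow> hat (\<lambda>x. z * p x) i = z * hat p i"
  by (simp_all add: hat_def L2.ip_add_left L2.ip_scale_left E_L2 H1D)

lemma hat_bound: "p \<in> H1 \<Omega> \<Longrightarrow> cmod (hat p i) \<le> H1_norm \<Omega> p"
proof -
  assume p: "p \<in> H1 \<Omega>"
  have "(L2_norm \<Omega> (E i))\<^sup>2 = 1" using L2_inner_self[of \<Omega> "E i"] by (simp add: E_orthonormal) (metis of_real_1 of_real_eq_iff of_real_power)
  then have "L2_norm \<Omega> (E i) = 1" using L2_norm_nonneg[of \<Omega> "E i"] by (simp add: power2_eq_1_iff)
  then have "cmod (hat p i) \<le> L2_norm \<Omega> p" using L2.Cauchy_Schwarz[OF H1D(1)[OF p] E_L2(1), of i] by (simp add: hat_def)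
  then show ?thesis using L2_norms_le_H1(1)[of p] by linarith
qed

lemma hat_tendsto:
  assumes u: "\<And>n. u n \<in> H1 \<Omega>" "p \<in> H1 \<Omega>" "(\<lambda>n. H1_norm \<Omega> (\<lambda>x. u n x - p x)) \<longlonglongrightarrow> 0"
  shows "(\<lambda>n. hat (u n) i) \<longlonglongrightarrow> hat p i"
proof (rule LIM_zero_cancel, rule tendsto_norm_zero_cancel, rule tendsto_sandwich[OF _ _ tendsto_const u(3)])
  have "cmod (hat (u n) i - hat p i) \<le> H1_norm \<Omega> (\<lambda>x. u n x - p x)" for n
    using hat_bound[OF H1.diff_mem[OF u(1)[of n] u(2)], of i] hat_add[OF u(1)[of n] H1_scale(1)[OF u(2), of "-1"], of i]
      hat_scale[OF u(2), of "-1" i] by simp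
  then show "\<forall>\<^sub>F n in sequentially. cmod (hat (u n) i - hat p i) \<le> H1_norm \<Omega> (\<lambda>x. u n x - p x)" by simp
qed simp

lemma hat_trigpoly: "finite I \<Longrightarrow> hat (trigpoly I a) i = (if i \<in> I then a i else 0)"
proof -
  assume I: "finite I"
  have "hat (trigpoly I a) i = (\<Sum>j\<in>I. a j * L2_inner \<Omega> (E j) (E i))"
    unfolding hat_def trigpoly_def[abs_def] L2.ip_sum_left[OF I L2_scale[OF E_L2(1)] E_L2(1)] L2.ip_scale_left[OF E_L2(1) E_L2(1)] ..
  also have "\<dots> = (\<Sum>j\<in>I. if j = i then a i else 0)" by (intro sum.cong) (auto simp: E_orthonormal)
  finally show ?thesis using I by simp
qed

definition col :: "nat \<Rightarrow> (nat \<times> nat \<Rightarrow> complex) \<Rightarrow> nat \<Rightarrow> real \<Rightarrow> complex" where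
  "col N a n x = (\<Sum>m\<le>N. a (m, n) * of_real (nx m * cx m x))"
definition dcol :: "nat \<Rightarrow> (nat \<times> nat \<Rightarrow> complex) \<Rightarrow> nat \<Rightarrow> real \<Rightarrow> complex" where
  "dcol N a n x = (\<Sum>m\<le>N. a (m, n) * of_real (nx m * (- kx m * sx m x)))"

lemma col_deriv: "(col N a n has_vector_derivative dcol N a n x) (at x)"
  unfolding col_def[abs_def] dcol_def
  by (intro has_vector_derivative_sum has_vector_derivative_mult_right bounded_linear.has_vector_derivative[OF bounded_linear_of_real] trig_deriv)

lemma smooth1_col: "smooth1 (col N a n)"
  unfolding col_def[abs_def] by (intro smooth1_sum smooth1_mult smooth1_const smooth1_of_real smooth1_trig)

lemma trigpoly_col: "trigpoly (Q N) a = (\<lambda>p. \<Sum>n\<le>N. ten (col N a n) n p)"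
  unfolding Q_def trigpoly_ten col_def[abs_def] ..

lemma ten_col: "ten (col N a n) n = trigpoly ({..N} \<times> {n}) a"
  unfolding trigpoly_ten col_def[abs_def] by simp

lemma col_norms:
  "(L2_norm \<Omega> (ten (col N a n) n))\<^sup>2 = (\<Sum>m\<le>N. (cmod (a (m, n)))\<^sup>2)"
  "(L2_norm \<Omega> (ten (dcol N a n) n))\<^sup>2 = (\<Sum>m\<le>N. (kx m)\<^sup>2 * (cmod (a (m, n)))\<^sup>2)"
proof -
  show "(L2_norm \<Omega> (ten (col N a n) n))\<^sup>2 = (\<Sum>m\<le>N. (cmod (a (m, n)))\<^sup>2)"
    unfolding ten_col by (subst trigpoly_norms) (auto simp: sum.cartesian_product')
  have c: "continuous_on UNIV (col N a n)" "continuous_on UNIV (dcol N a n)"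
    using smooth1_continuous[OF smooth1_col] smooth1_continuous[OF smooth1_derivative[OF smooth1_col col_deriv]] by blast+
  note P = partial_ten[OF col_deriv[of N a n], of n]
  note cP = continuous_ten[OF c(2), of n] continuous_tensor[OF c(1) dphi_continuous, of n]
  have "L2_norm \<Omega> (D1 (ten (col N a n) n)) = L2_norm \<Omega> (ten (dcol N a n) n)"
    by (rule L2.nrm_cong_null[OF H1D(2)[OF D_classical(1)[OF P cP]] continuous_in_L2[OF cP(1)] D_classical(2)[OF P cP]])
  then have "(L2_norm \<Omega> (ten (dcol N a n) n))\<^sup>2 = (L2_norm \<Omega> (D1 (trigpoly ({..N} \<times> {n}) a)))\<^sup>2"
    unfolding ten_col by simp
  also have "\<dots> = (\<Sum>m\<le>N. (kx m)\<^sup>2 * (cmod (a (m, n)))\<^sup>2)"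
    by (subst trigpoly_norms) (auto simp: sum.cartesian_product')
  finally show "(L2_norm \<Omega> (ten (dcol N a n) n))\<^sup>2 = (\<Sum>m\<le>N. (kx m)\<^sup>2 * (cmod (a (m, n)))\<^sup>2)" .
qed

lemma kx_mono: "m \<le> m' \<Longrightarrow> kx m \<le> kx m'"
  using len_pos by (simp add: kx_def divide_right_mono)

lemma kx_nonneg: "0 \<le> kx m" using len_pos by (simp add: kx_def)

text \<open>Within a propagating mode, frequencies above \<open>m0\<close> in the first variable
  have derivatives large enough to absorb C times their L2 mass. The finitely many lower ones are
  left over and form the compensating sum, to which evanescent modes contribute nothing. Density
  extends the estimate from trigonometric polynomials.\<close>

theorem garding:
  assumes r: "0 \<le> r" "r < 1"
  shows "\<exists>c>0. \<exists>\<Lambda>\<ge>0. \<exists>m0. \<forall>\<kappa> c1 c2 p. good r \<kappa> c1 c2 \<longrightarrow> p \<in> H1 \<Omega> \<longrightarrow>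
     c * (H1_norm \<Omega> p)\<^sup>2 \<le> Re (F c1 c2 p p) + \<Lambda> * (\<Sum>i\<in>{..m0} \<times> {n. mu2 n > 0}. (cmod (hat p i))\<^sup>2)"
proof -
  obtain ce where ce: "ce > 0" "\<And>\<kappa> c1 c2 w w' n. good r \<kappa> c1 c2 \<Longrightarrow> smooth1 w \<Longrightarrow> (\<forall>x. (w has_vector_derivative w' x) (at x)) \<Longrightarrow> mu2 n < 0 \<Longrightarrow>
     ce * ((1 + (ky n)\<^sup>2) * (L2_norm \<Omega> (ten w n))\<^sup>2 + (L2_norm \<Omega> (ten w' n))\<^sup>2) \<le> Re (F c1 c2 (ten w n) (ten w n))"
    using mode_coercive_evanescent[OF r] by blast
  obtain C where C: "C \<ge> 0" "\<And>\<kappa> c1 c2 w w' n. good r \<kappa> c1 c2 \<Longrightarrow> smooth1 w \<Longrightarrow> (\<forall>x. (w has_vector_derivative w' x) (at x)) \<Longrightarrow> mu2 n > 0 \<Longrightarrow>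
     \<gamma> * ((L2_norm \<Omega> (ten w' n))\<^sup>2 / 4 - C * (L2_norm \<Omega> (ten w n))\<^sup>2) \<le> Re (F c1 c2 (ten w n) (ten w n))"
    using mode_garding_propagating[OF r] by blast
  \<comment> \<open>With this \<open>m0\<close>, half of the available B^2 / 4 dominates C + 1 times
    the high-frequency mass; the 1 in C + 1 leaves A^2 over for the norm.\<close>
  have "\<exists>m0. 8 * (C + 1) \<le> (kx (Suc m0))\<^sup>2"
  proof -
    obtain j :: nat where j: "sqrt (8 * (C + 1)) * len / pi \<le> real j" using real_arch_simple by blast
    have "sqrt (8 * (C + 1)) \<le> kx (Suc j)"
    proof -
      have "sqrt (8 * (C + 1)) * len / pi \<le> real (Suc j)" using j by simp
      then show ?thesis using len_pos by (simp add: kx_def pos_le_divide_eq pos_divide_le_eq)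
    qed
    then have "(sqrt (8 * (C + 1)))\<^sup>2 \<le> (kx (Suc j))\<^sup>2" using C by (intro power_mono) auto
    then show ?thesis using C by auto
  qed
  then obtain m0 where m0: "8 * (C + 1) \<le> (kx (Suc m0))\<^sup>2" by blast
  define \<Lambda> where "\<Lambda> = \<gamma> * (C + 1)"
  \<comment> \<open>Bounds 1 + \<open>(ky n)\<^sup>2\<close> on the propagating modes.\<close>
  define K3 where "K3 = 1 + k\<^sup>2 / \<gamma>"
  have K3: "K3 \<ge> 1" using \<gamma> by (simp add: K3_def)
  define c where "c = min ce (\<gamma> * (1 / (8 * K3)))"
  have c: "c > 0" using ce \<gamma> K3 by (simp add: c_def)
  define Pr where "Pr = {n. mu2 n > 0}"
  have Pr: "finite Pr"
  proof (rule finite_subset[OF _ ky_finite[of "k\<^sup>2 / \<gamma>"]])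
    show "Pr \<subseteq> {n. (ky n)\<^sup>2 \<le> k\<^sup>2 / \<gamma>}" using propagating_ky by (auto simp: Pr_def)
  qed
  have poly: "c * (H1_norm \<Omega> (trigpoly (Q N) a))\<^sup>2 \<le> Re (F c1 c2 (trigpoly (Q N) a) (trigpoly (Q N) a)) + \<Lambda> * (\<Sum>i\<in>{..m0} \<times> Pr. (cmod (hat (trigpoly (Q N) a) i))\<^sup>2)"
    if g: "good r \<kappa> c1 c2" for \<kappa> c1 c2 N a
  proof -
    have ad: "admissible c1 \<kappa>" "admissible c2 \<kappa>" using g by (auto simp: good_def)
    define A where "A n = L2_norm \<Omega> (ten (col N a n) n)" for n
    define B where "B n = L2_norm \<Omega> (ten (dcol N a n) n)" for n
    \<comment> \<open>The low-frequency mass of column n; the condition m \<le> N covers polynomials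
      of degree below \<open>m0\<close>, whose further coefficients vanish.\<close>
    define S where "S n = (\<Sum>m\<le>m0. if m \<le> N then (cmod (a (m, n)))\<^sup>2 else 0)" for n
    have S0: "S n \<ge> 0" for n unfolding S_def by (intro sum_nonneg) auto
    have tH: "ten (col N a n) n \<in> H1 \<Omega>" for n by (rule ten_H1[OF smooth1_col])
    have diag: "F c1 c2 (ten (col N a n) n) (ten (col N a m) m) = 0" if "n \<noteq> m" for n m
      using F_ten[OF ad smooth1_col col_deriv smooth1_col col_deriv] that by simp
    have "F c1 c2 (trigpoly (Q N) a) (trigpoly (Q N) a) = (\<Sum>n\<le>N. \<Sum>m\<le>N. F c1 c2 (ten (col N a n) n) (ten (col N a m) m))"
      unfolding trigpoly_col by (simp add: F_sum[OF ad] tH H1.sum_mem)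
    also have "\<dots> = (\<Sum>n\<le>N. \<Sum>m\<le>N. if n = m then F c1 c2 (ten (col N a n) n) (ten (col N a n) n) else 0)"
      by (intro sum.cong) (auto simp: diag)
    finally have FT: "F c1 c2 (trigpoly (Q N) a) (trigpoly (Q N) a) = (\<Sum>n\<le>N. F c1 c2 (ten (col N a n) n) (ten (col N a n) n))" by simp
    have HT: "(H1_norm \<Omega> (trigpoly (Q N) a))\<^sup>2 = (\<Sum>n\<le>N. (1 + (ky n)\<^sup>2) * (A n)\<^sup>2 + (B n)\<^sup>2)"
    proof -
      have "(H1_norm \<Omega> (trigpoly (Q N) a))\<^sup>2 = (\<Sum>m\<le>N. \<Sum>n\<le>N. (1 + (kx m)\<^sup>2 + (ky n)\<^sup>2) * (cmod (a (m, n)))\<^sup>2)"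
        unfolding H1_norm_trigpoly[OF Q_finite] unfolding Q_def sum.cartesian_product' by simp
      also have "\<dots> = (\<Sum>n\<le>N. \<Sum>m\<le>N. (1 + (kx m)\<^sup>2 + (ky n)\<^sup>2) * (cmod (a (m, n)))\<^sup>2)" by (rule sum.swap)
      finally show ?thesis by (simp add: A_def B_def col_norms sum_distrib_left sum.distrib distrib_right)
    qed
    have hT: "(\<Sum>i\<in>{..m0} \<times> Pr. (cmod (hat (trigpoly (Q N) a) i))\<^sup>2) = (\<Sum>n\<in>Pr. if n \<le> N then S n else 0)"
    proof -
      have "(\<Sum>i\<in>{..m0} \<times> Pr. (cmod (hat (trigpoly (Q N) a) i))\<^sup>2) = (\<Sum>m\<le>m0. \<Sum>n\<in>Pr. (cmod (hat (trigpoly (Q N) a) (m, n)))\<^sup>2)"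
        unfolding sum.cartesian_product' ..
      also have "\<dots> = (\<Sum>n\<in>Pr. \<Sum>m\<le>m0. (cmod (hat (trigpoly (Q N) a) (m, n)))\<^sup>2)" by (rule sum.swap)
      also have "\<dots> = (\<Sum>n\<in>Pr. if n \<le> N then S n else 0)"
      proof (intro sum.cong refl)
        fix n
        have "(cmod (hat (trigpoly (Q N) a) (m, n)))\<^sup>2 = (if m \<le> N \<and> n \<le> N then (cmod (a (m, n)))\<^sup>2 else 0)" for m
          unfolding hat_trigpoly[OF Q_finite] by (simp add: Q_def)
        then show "(\<Sum>m\<le>m0. (cmod (hat (trigpoly (Q N) a) (m, n)))\<^sup>2) = (if n \<le> N then S n else 0)"
          by (simp add: S_def)
      qed
      finally show ?thesis .
    qed
    have hT2: "(\<Sum>n\<in>Pr. if n \<le> N then S n else 0) = (\<Sum>n\<le>N. if n \<in> Pr then S n else 0)"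
    proof -
      have "(\<Sum>n\<in>Pr. if n \<le> N then S n else 0) = (\<Sum>n\<in>Pr \<inter> {..N}. S n)" using Pr by (simp add: sum.inter_restrict)
      also have "\<dots> = (\<Sum>n\<in>{..N} \<inter> Pr. S n)" by (simp add: Int_commute)
      also have "\<dots> = (\<Sum>n\<le>N. if n \<in> Pr then S n else 0)" by (simp add: sum.inter_restrict)
      finally show ?thesis .
    qed
    have mode: "c * ((1 + (ky n)\<^sup>2) * (A n)\<^sup>2 + (B n)\<^sup>2) \<le> Re (F c1 c2 (ten (col N a n) n) (ten (col N a n) n)) + \<Lambda> * (if n \<in> Pr then S n else 0)" for n
    proof (cases "n \<in> Pr")
      case False
      then have neg: "mu2 n < 0" using mu2_nonzero[of n] by (simp add: Pr_def)
      have "c * ((1 + (ky n)\<^sup>2) * (A n)\<^sup>2 + (B n)\<^sup>2) \<le> ce * ((1 + (ky n)\<^sup>2) * (A n)\<^sup>2 + (B n)\<^sup>2)"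
        by (intro mult_right_mono add_nonneg_nonneg mult_nonneg_nonneg) (auto simp: c_def)
      also have "\<dots> \<le> Re (F c1 c2 (ten (col N a n) n) (ten (col N a n) n))"
        unfolding A_def B_def using ce(2)[OF g smooth1_col _ neg] col_deriv by blast
      finally show ?thesis using False by simp
    next
      case True
      then have pos: "mu2 n > 0" by (simp add: Pr_def)
      define R where "R = (kx (Suc m0))\<^sup>2"
      have mR: "8 * (C + 1) \<le> R" using m0 by (simp add: R_def)
      moreover have "0 < 8 * (C + 1)" using C(1) by simp
      ultimately have Rpos: "R > 0" by (rule less_le_trans[rotated])
      have "R * ((A n)\<^sup>2 - S n) \<le> (B n)\<^sup>2"
      proof -
        have "S n = (\<Sum>m\<in>{..m0} \<inter> {..N}. (cmod (a (m, n)))\<^sup>2)" unfolding S_def sum.inter_restrict[OF finite_atMost] by (intro sum.cong) auto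
        also have "\<dots> = (\<Sum>m\<le>N. if m \<le> m0 then (cmod (a (m, n)))\<^sup>2 else 0)" unfolding Int_commute[of "{..m0}"] sum.inter_restrict[OF finite_atMost] by (intro sum.cong) auto
        finally have "R * ((A n)\<^sup>2 - S n) = (\<Sum>m\<le>N. R * ((cmod (a (m, n)))\<^sup>2 - (if m \<le> m0 then (cmod (a (m, n)))\<^sup>2 else 0)))"
          by (simp add: A_def col_norms sum_distrib_left sum_subtractf right_diff_distrib)
        also have "\<dots> \<le> (\<Sum>m\<le>N. (kx m)\<^sup>2 * (cmod (a (m, n)))\<^sup>2)"
        proof (rule sum_mono)
          fix m
          show "R * ((cmod (a (m, n)))\<^sup>2 - (if m \<le> m0 then (cmod (a (m, n)))\<^sup>2 else 0)) \<le> (kx m)\<^sup>2 * (cmod (a (m, n)))\<^sup>2"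
          proof (cases "m \<le> m0")
            case False
            then have "R \<le> (kx m)\<^sup>2" unfolding R_def by (intro power_mono kx_mono kx_nonneg) auto
            then show ?thesis using False by (simp add: mult_right_mono)
          qed simp
        qed
        finally show ?thesis by (simp add: B_def col_norms)
      qed
      then have AS: "(A n)\<^sup>2 - S n \<le> (B n)\<^sup>2 / R" using Rpos by (simp add: field_simps)
      have "(C + 1) * ((B n)\<^sup>2 / R) \<le> (B n)\<^sup>2 / 8"
      proof -
        have "(C + 1) / R \<le> 1 / 8" using mR Rpos by (simp add: pos_divide_le_eq)
        from mult_right_mono[OF this zero_le_power2[of "B n"]] show ?thesis by simp
      qed
      moreover have "(C + 1) * ((A n)\<^sup>2 - S n) \<le> (C + 1) * ((B n)\<^sup>2 / R)" using AS C by (intro mult_left_mono) auto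
      ultimately have "(C + 1) * ((A n)\<^sup>2 - S n) \<le> (B n)\<^sup>2 / 8" by (rule order_trans[rotated])
      then have "(C + 1) * (A n)\<^sup>2 - (C + 1) * S n \<le> (B n)\<^sup>2 / 8" unfolding right_diff_distrib .
      then have "(A n)\<^sup>2 + (B n)\<^sup>2 / 8 \<le> (B n)\<^sup>2 / 4 - C * (A n)\<^sup>2 + (C + 1) * S n" by (rule absorb_bound)
      moreover have "(1 / (8 * K3)) * ((1 + (ky n)\<^sup>2) * (A n)\<^sup>2 + (B n)\<^sup>2) \<le> (A n)\<^sup>2 + (B n)\<^sup>2 / 8"
      proof -
        have "(ky n)\<^sup>2 \<le> k\<^sup>2 / \<gamma>" by (rule propagating_ky[OF pos])
        then have "(1 + (ky n)\<^sup>2) * (A n)\<^sup>2 \<le> K3 * (A n)\<^sup>2" by (intro mult_right_mono) (auto simp: K3_def)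
        moreover have "(B n)\<^sup>2 \<le> K3 * (B n)\<^sup>2" using K3 by (simp add: mult_right_mono[of 1 K3, simplified])
        ultimately have "(1 + (ky n)\<^sup>2) * (A n)\<^sup>2 + (B n)\<^sup>2 \<le> K3 * ((A n)\<^sup>2 + (B n)\<^sup>2)" by (simp add: distrib_left)
        then have "(1 / (8 * K3)) * ((1 + (ky n)\<^sup>2) * (A n)\<^sup>2 + (B n)\<^sup>2) \<le> (1 / (8 * K3)) * (K3 * ((A n)\<^sup>2 + (B n)\<^sup>2))"
          using K3 by (intro mult_left_mono) auto
        also have "\<dots> = ((A n)\<^sup>2 + (B n)\<^sup>2) / 8" using K3 by simp
        also have "\<dots> \<le> (A n)\<^sup>2 + (B n)\<^sup>2 / 8" by simp
        finally show ?thesis .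
      qed
      ultimately have "\<gamma> * ((1 / (8 * K3)) * ((1 + (ky n)\<^sup>2) * (A n)\<^sup>2 + (B n)\<^sup>2)) \<le> \<gamma> * ((B n)\<^sup>2 / 4 - C * (A n)\<^sup>2 + (C + 1) * S n)"
        using \<gamma> by (intro mult_left_mono) auto
      also have "\<dots> = \<gamma> * ((B n)\<^sup>2 / 4 - C * (A n)\<^sup>2) + \<Lambda> * S n" by (simp add: \<Lambda>_def algebra_simps)
      also have "\<gamma> * ((B n)\<^sup>2 / 4 - C * (A n)\<^sup>2) \<le> Re (F c1 c2 (ten (col N a n) n) (ten (col N a n) n))"
        unfolding A_def B_def using C(2)[OF g smooth1_col _ pos] col_deriv by blast
      finally have "\<gamma> * (1 / (8 * K3)) * ((1 + (ky n)\<^sup>2) * (A n)\<^sup>2 + (B n)\<^sup>2) \<le> Re (F c1 c2 (ten (col N a n) n) (ten (col N a n) n)) + \<Lambda> * S n"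
        by simp
      moreover have "c * ((1 + (ky n)\<^sup>2) * (A n)\<^sup>2 + (B n)\<^sup>2) \<le> \<gamma> * (1 / (8 * K3)) * ((1 + (ky n)\<^sup>2) * (A n)\<^sup>2 + (B n)\<^sup>2)"
        by (intro mult_right_mono add_nonneg_nonneg mult_nonneg_nonneg) (auto simp: c_def)
      ultimately show ?thesis using True by simp
    qed
    have "c * (H1_norm \<Omega> (trigpoly (Q N) a))\<^sup>2 = (\<Sum>n\<le>N. c * ((1 + (ky n)\<^sup>2) * (A n)\<^sup>2 + (B n)\<^sup>2))"
      unfolding HT sum_distrib_left ..
    also have "\<dots> \<le> (\<Sum>n\<le>N. Re (F c1 c2 (ten (col N a n) n) (ten (col N a n) n)) + \<Lambda> * (if n \<in> Pr then S n else 0))"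
      by (rule sum_mono) (rule mode)
    also have "\<dots> = Re (F c1 c2 (trigpoly (Q N) a) (trigpoly (Q N) a)) + \<Lambda> * (\<Sum>i\<in>{..m0} \<times> Pr. (cmod (hat (trigpoly (Q N) a) i))\<^sup>2)"
      unfolding FT hT hT2 sum.distrib sum_distrib_left Re_sum ..
    finally show ?thesis .
  qed
  have "c * (H1_norm \<Omega> p)\<^sup>2 \<le> Re (F c1 c2 p p) + \<Lambda> * (\<Sum>i\<in>{..m0} \<times> Pr. (cmod (hat p i))\<^sup>2)"
    if g: "good r \<kappa> c1 c2" and p: "p \<in> H1 \<Omega>" for \<kappa> c1 c2 p
  proof -
    have ad: "admissible c1 \<kappa>" "admissible c2 \<kappa>" using g by (auto simp: good_def)
    note dense = D_trigpoly(1) p trigpoly_dense[OF p]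
    have "(\<lambda>N. c * (H1_norm \<Omega> (trigpoly (Q N) (hat p)))\<^sup>2) \<longlonglongrightarrow> c * (H1_norm \<Omega> p)\<^sup>2"
      by (intro tendsto_mult_left tendsto_power H1.nrm_tendsto dense)
    moreover have "(\<lambda>N. Re (F c1 c2 (trigpoly (Q N) (hat p)) (trigpoly (Q N) (hat p))) + \<Lambda> * (\<Sum>i\<in>{..m0} \<times> Pr. (cmod (hat (trigpoly (Q N) (hat p)) i))\<^sup>2))
       \<longlonglongrightarrow> Re (F c1 c2 p p) + \<Lambda> * (\<Sum>i\<in>{..m0} \<times> Pr. (cmod (hat p i))\<^sup>2)"
      by (intro tendsto_add tendsto_mult_left tendsto_sum tendsto_power tendsto_norm tendsto_Re hat_tendsto F_tendsto[OF ad] dense)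
    ultimately show ?thesis by (rule LIMSEQ_le) (use poly[OF g] in blast)
  qed
  then show ?thesis using c C \<gamma> unfolding Pr_def
    by (intro exI[of _ c] conjI exI[of _ \<Lambda>] exI[of _ m0]) (auto simp: \<Lambda>_def)
qed

end

section \<open>Representers of Fourier coefficients\<close>

definition ex :: "complex \<Rightarrow> real \<Rightarrow> complex" where "ex c x = exp (c * of_real x)"

lemma smooth1_ex: "smooth1 (ex c)" unfolding ex_def[abs_def] by (rule smooth1_exp)

lemma ex_deriv: "(ex c has_vector_derivative c * ex c x) (at x)"
  unfolding ex_def[abs_def]
  by (auto intro!: derivative_eq_intros has_vector_derivative_real_field simp: mult.commute)

lemma ex_simps: "ex a x * ex b x = ex (a + b) x" "ex 0 x = 1" "cnj (ex c x) = ex (cnj c) x" "ex c x \<noteq> 0"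
  by (simp_all add: ex_def exp_add distrib_right exp_cnj)

lemma cmod_ex: "cmod (ex (\<i> * of_real a) x) = 1"
  by (simp add: ex_def)

section \<open>The driven oscillator between impedance conditions\<close>

definition oscillation :: "real \<Rightarrow> (real \<Rightarrow> complex) \<Rightarrow> (real \<Rightarrow> complex) \<Rightarrow> (real \<Rightarrow> complex) \<Rightarrow> bool" where
  "oscillation \<mu> h Y Y' \<longleftrightarrow> smooth1 Y \<and> (\<forall>x. (Y has_vector_derivative Y' x) (at x) \<and>
     (Y' has_vector_derivative - (of_real (\<mu>\<^sup>2) * Y x + h x)) (at x))"

lemma oscillation_add:
  "oscillation \<mu> h Y Y' \<Longrightarrow> oscillation \<mu> g Z Z' \<Longrightarrow> oscillation \<mu> (\<lambda>x. h x + g x) (\<lambda>x. Y x + Z x) (\<lambda>x. Y' x + Z' x)"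
  unfolding oscillation_def
  by (auto intro!: smooth1_add has_vector_derivative_add has_vector_derivative_eq_rhs[OF has_vector_derivative_add] simp: algebra_simps)

lemma oscillation_scale:
  "oscillation \<mu> h Y Y' \<Longrightarrow> oscillation \<mu> (\<lambda>x. c * h x) (\<lambda>x. c * Y x) (\<lambda>x. c * Y' x)"
  unfolding oscillation_def
  by (auto intro!: smooth1_mult has_vector_derivative_mult_right has_vector_derivative_eq_rhs[OF has_vector_derivative_mult_right] simp: algebra_simps)

lemma oscillation_homogeneous:
  assumes "c\<^sup>2 = - of_real (\<mu>\<^sup>2)"
  shows "oscillation \<mu> (\<lambda>x. 0) (ex c) (\<lambda>x. c * ex c x)"
  unfolding oscillation_def
proof (intro conjI allI smooth1_ex ex_deriv)
  fix x
  have e: "c * (c * z) = - (of_real (\<mu>\<^sup>2) * z)" for z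
    using assms by (simp add: mult.assoc[symmetric] power2_eq_square[symmetric])
  show "((\<lambda>x. c * ex c x) has_vector_derivative - (of_real (\<mu>\<^sup>2) * ex c x + 0)) (at x)"
    using has_vector_derivative_mult_right[OF ex_deriv[of c x], of c] unfolding e by simp
qed

text \<open>A multiple of the exponential solves the equation unless the exponential is itself a
  free wave; then x times the exponential provides a solution. This resonance has to be covered,
  since the frequency of a cosine, shifted by the gauge, may coincide with a propagating wave
  number.\<close>

lemma oscillation_ex:
  assumes \<mu>: "\<mu> \<noteq> 0"
  shows "\<exists>Y Y'. oscillation \<mu> (ex c) Y Y'"
proof (cases "c\<^sup>2 + of_real (\<mu>\<^sup>2) = 0")
  case False
  define b where "b = - 1 / (c\<^sup>2 + of_real (\<mu>\<^sup>2))"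
  have 1: "b * (c\<^sup>2 + of_real (\<mu>\<^sup>2)) = - 1" unfolding b_def using False by simp
  have "b * c\<^sup>2 = b * (c\<^sup>2 + of_real (\<mu>\<^sup>2)) - of_real (\<mu>\<^sup>2) * b" by (simp add: algebra_simps)
  then have b: "b * c\<^sup>2 = - (of_real (\<mu>\<^sup>2) * b + 1)" unfolding 1 by simp
  have e: "b * (c * (c * z)) = - (of_real (\<mu>\<^sup>2) * (b * z) + z)" for z
  proof -
    have "b * (c * (c * z)) = (b * c\<^sup>2) * z" by (simp add: power2_eq_square)
    then show ?thesis unfolding b by (simp add: algebra_simps)
  qed
  have "oscillation \<mu> (ex c) (\<lambda>x. b * ex c x) (\<lambda>x. b * (c * ex c x))"
    unfolding oscillation_def
  proof (intro conjI allI smooth1_mult smooth1_const smooth1_ex has_vector_derivative_mult_right ex_deriv)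
    fix x
    show "((\<lambda>x. b * (c * ex c x)) has_vector_derivative - (of_real (\<mu>\<^sup>2) * (b * ex c x) + ex c x)) (at x)"
      using has_vector_derivative_mult_right[OF has_vector_derivative_mult_right[OF ex_deriv[of c x], of c], of b] unfolding e .
  qed
  then show ?thesis by blast
next
  case True
  then have c2: "c * c = - of_real (\<mu>\<^sup>2)" by (simp add: power2_eq_square add_eq_0_iff)
  then have c: "c \<noteq> 0" using \<mu> by auto
  define b where "b = - 1 / (2 * c)"
  have b: "b * c = - 1 / 2" using c by (simp add: b_def)
  have e: "b * (c * ex c x + (c * ex c x + c * (of_real x * (c * ex c x)))) = - (of_real (\<mu>\<^sup>2) * (b * (of_real x * ex c x)) + ex c x)" for x
  proof -
    have "b * (c * ex c x + (c * ex c x + c * (of_real x * (c * ex c x)))) = (b * c) * (2 * ex c x) + b * (c * c) * (of_real x * ex c x)"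
      by (simp add: algebra_simps)
    then show ?thesis unfolding b c2 by simp
  qed
  have x: "((\<lambda>x. complex_of_real x) has_vector_derivative 1) (at x)" for x :: real
    using bounded_linear.has_vector_derivative[OF bounded_linear_of_real has_vector_derivative_id] by simp
  have p: "((\<lambda>x. of_real x * ex c x) has_vector_derivative (ex c x + c * (of_real x * ex c x))) (at x)" for x
    using has_vector_derivative_mult[OF x ex_deriv[of c x]] by (simp add: algebra_simps)
  have sx: "smooth1 (\<lambda>x. complex_of_real x)" by (rule smooth1_antideriv[OF x smooth1_const])
  have "oscillation \<mu> (ex c) (\<lambda>x. b * (of_real x * ex c x)) (\<lambda>x. b * (ex c x + c * (of_real x * ex c x)))"
    unfolding oscillation_def
  proof (intro conjI allI smooth1_mult smooth1_const smooth1_ex has_vector_derivative_mult_right p sx)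
    fix x
    have "((\<lambda>x. b * (ex c x + c * (of_real x * ex c x))) has_vector_derivative b * (c * ex c x + c * (ex c x + c * (of_real x * ex c x)))) (at x)"
      by (intro has_vector_derivative_mult_right has_vector_derivative_add ex_deriv p)
    then show "((\<lambda>x. b * (ex c x + c * (of_real x * ex c x))) has_vector_derivative - (of_real (\<mu>\<^sup>2) * (b * (of_real x * ex c x)) + ex c x)) (at x)"
      unfolding e[symmetric] by (simp add: algebra_simps)
  qed
  then show ?thesis by blast
qed

text \<open>With reflection coefficients of modulus at most \<open>r < 1\<close> at both ends, the amplitudes of the two
  travelling waves solve a linear system whose determinant is at least \<open>1 - r\<^sup>2\<close>.\<close>

lemma reflected_amplitudes:
  fixes E1 E2 e a a' b b' :: complex
  assumes r: "0 \<le> r" "r < 1" and E: "cmod E1 \<le> r" "cmod E2 \<le> r" and e: "cmod e = 1"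
    and R: "cmod a \<le> R" "cmod a' \<le> R" "cmod b \<le> R" "cmod b' \<le> R"
  shows "\<exists>\<alpha> \<beta>. cmod \<alpha> \<le> 4 * R / (1 - r\<^sup>2) \<and> cmod \<beta> \<le> 4 * R / (1 - r\<^sup>2) + 2 * R \<and>
    b' + \<beta> / e = E1 * (b + \<alpha> * e) \<and> a + \<alpha> = E2 * (a' + \<beta>)"
proof -
  \<comment> \<open>The first equation, multiplied by e, reads \<beta> = E1 e^2 \<alpha> + r2;
    inserted into the second it leaves one equation for \<alpha>, with the determinant as
    coefficient.\<close>
  define r1 where "r1 = E2 * a' - a"
  define r2 where "r2 = e * (E1 * b - b')"
  define \<alpha> where "\<alpha> = (r1 + E2 * r2) / (1 - E1 * E2 * e\<^sup>2)"
  define \<beta> where "\<beta> = E1 * e\<^sup>2 * \<alpha> + r2"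
  have R0: "0 \<le> R" using R(1) norm_ge_zero order_trans by blast
  have m1: "cmod (F * z) \<le> R" if "cmod F \<le> r" "cmod z \<le> R" for F z
    using mult_mono[OF order_trans[OF that(1) less_imp_le[OF r(2)]] that(2)] by (simp add: norm_mult)
  have "cmod r1 \<le> R + R" unfolding r1_def using norm_triangle_ineq4[of "E2 * a'" a] m1[OF E(2) R(2)] R(1) by linarith
  then have 1: "cmod r1 \<le> 2 * R" by simp
  have "cmod (E1 * b - b') \<le> R + R" using norm_triangle_ineq4[of "E1 * b" b'] m1[OF E(1) R(3)] R(4) by linarith
  then have 2: "cmod r2 \<le> 2 * R" unfolding r2_def norm_mult e by simp
  have "cmod (E2 * r2) \<le> 1 * (2 * R)" unfolding norm_mult using E(2) r 2 by (intro mult_mono) auto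
  then have n: "cmod (r1 + E2 * r2) \<le> 4 * R" using norm_triangle_ineq[of r1 "E2 * r2"] 1 by linarith
  have "cmod (E1 * E2 * e\<^sup>2) \<le> r * r" unfolding norm_mult norm_power e using E r by (simp add: mult_mono)
  then have d: "1 - r\<^sup>2 \<le> cmod (1 - E1 * E2 * e\<^sup>2)" using norm_triangle_ineq2[of 1 "E1 * E2 * e\<^sup>2"] by (simp add: power2_eq_square)
  have r2p: "0 < 1 - r\<^sup>2" using r by (simp add: abs_square_less_1)
  have \<alpha>: "cmod \<alpha> \<le> 4 * R / (1 - r\<^sup>2)" unfolding \<alpha>_def norm_divide using n d r2p R0 by (intro frac_le) auto
  have "cmod (E1 * e\<^sup>2 * \<alpha>) \<le> 1 * cmod \<alpha>" unfolding norm_mult norm_power e using E r by (intro mult_mono) auto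
  then have \<beta>: "cmod \<beta> \<le> 4 * R / (1 - r\<^sup>2) + 2 * R" unfolding \<beta>_def using norm_triangle_ineq[of "E1 * e\<^sup>2 * \<alpha>" r2] 2 \<alpha> by linarith
  have e0: "e \<noteq> 0" using e by auto
  have "1 - E1 * E2 * e\<^sup>2 \<noteq> 0" using d r2p by auto
  then have "\<alpha> * (1 - E1 * E2 * e\<^sup>2) = r1 + E2 * r2" by (simp add: \<alpha>_def)
  then have "\<alpha> = r1 + E2 * \<beta>" unfolding \<beta>_def by (simp add: algebra_simps)
  then have 3: "a + \<alpha> = E2 * (a' + \<beta>)" unfolding r1_def by (simp add: algebra_simps)
  have "\<beta> / e = E1 * e * \<alpha> + (E1 * b - b')" using e0 unfolding \<beta>_def r2_def by (simp add: add_divide_distrib power2_eq_square)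
  then have 4: "b' + \<beta> / e = E1 * (b + \<alpha> * e)" by (simp add: algebra_simps)
  show ?thesis using \<alpha> \<beta> 3 4 by blast
qed

text \<open>For an outward derivative D, D + \<i> \<mu> u isolates the outgoing wave and D - \<i>
  \<mu> u the returning one. The reflection law with ratio E becomes an impedance on solving for
  D.\<close>

lemma impedance_condition:
  assumes "E \<noteq> (1::complex)" "D - \<i> * \<mu> * u = E * (D + \<i> * \<mu> * u)"
  shows "D + - \<i> * \<mu> * ((1 + E) / (1 - E)) * u = 0"
proof -
  have "(1 - E) \<noteq> 0" using assms(1) by simp
  then have "(D + - \<i> * \<mu> * ((1 + E) / (1 - E)) * u) * (1 - E) = D * (1 - E) - \<i> * \<mu> * (1 + E) * u"
    by (simp add: algebra_simps diff_divide_distrib add_divide_distrib) (simp add: field_simps)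
  also have "\<dots> = 0" using assms(2) by (simp add: algebra_simps)
  finally show ?thesis using assms(1) by simp
qed

text \<open>Two free waves are added to a fixed particular solution Y. Their amplitudes solve the
  reflection system with boundary values of Y as data, so the constant involves E1 and E2 only
  through r.\<close>

lemma impedance_problem:
  assumes r: "0 \<le> r" "r < 1" and \<mu>: "\<mu> > 0" and Y: "oscillation \<mu> h Y Y'"
  shows "\<exists>K. \<forall>E1 E2. cmod E1 \<le> r \<longrightarrow> cmod E2 \<le> r \<longrightarrow> (\<exists>A B. cmod A \<le> K \<and> cmod B \<le> K \<and>
    (\<exists>\<Psi> \<Psi>'. \<Psi> = (\<lambda>x. Y x + A * ex (\<i> * of_real \<mu>) x + B * ex (- (\<i> * of_real \<mu>)) x) \<and> oscillation \<mu> h \<Psi> \<Psi>' \<and>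
      \<Psi>' b + - \<i> * of_real \<mu> * ((1 + E1) / (1 - E1)) * \<Psi> b = 0 \<and>
      - \<Psi>' a + - \<i> * of_real \<mu> * ((1 + E2) / (1 - E2)) * \<Psi> a = 0))"
proof -
  define w where "w = \<i> * complex_of_real \<mu>"
  have w0: "w \<noteq> 0" using \<mu> by (simp add: w_def)
  have cw: "cmod (2 * w) = 2 * \<mu>" using \<mu> by (simp add: w_def norm_mult)
  \<comment> \<open>Up to a constant factor, the right-going part of Y for s = 1 and the left-going
    part for s = -1.\<close>
  define Z where "Z = (\<lambda>s x. Y' x + s * w * Y x)"
  define R where "R = cmod (Z 1 a) + cmod (Z (-1) a) + cmod (Z 1 b) + cmod (Z (-1) b)"
  define K where "K = (4 * R / (1 - r\<^sup>2) + 2 * R) / (2 * \<mu>)"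
  have R0: "0 \<le> R" by (simp add: R_def)
  have e1: "cmod (ex (w) x) = 1" "cmod (ex (- w) x) = 1" for x
    using cmod_ex[of \<mu> x] cmod_ex[of "- \<mu>" x] by (simp_all add: w_def)
  have "\<exists>A B. cmod A \<le> K \<and> cmod B \<le> K \<and>
    (\<exists>\<Psi> \<Psi>'. \<Psi> = (\<lambda>x. Y x + A * ex w x + B * ex (- w) x) \<and> oscillation \<mu> h \<Psi> \<Psi>' \<and>
      \<Psi>' b + - w * ((1 + E1) / (1 - E1)) * \<Psi> b = 0 \<and>
      - \<Psi>' a + - w * ((1 + E2) / (1 - E2)) * \<Psi> a = 0)"
    if E: "cmod E1 \<le> r" "cmod E2 \<le> r" for E1 E2
  proof -
    have ne: "E1 \<noteq> 1" "E2 \<noteq> 1" using E r by auto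
    have ee: "cmod (ex w b / ex w a) = 1" by (simp add: norm_divide e1)
    obtain \<alpha> \<beta> where \<alpha>: "cmod \<alpha> \<le> 4 * R / (1 - r\<^sup>2)" and \<beta>: "cmod \<beta> \<le> 4 * R / (1 - r\<^sup>2) + 2 * R"
      and eqs: "Z (-1) b + \<beta> / (ex w b / ex w a) = E1 * (Z 1 b + \<alpha> * (ex w b / ex w a))" "Z 1 a + \<alpha> = E2 * (Z (-1) a + \<beta>)"
      using reflected_amplitudes[OF r E ee, of "Z 1 a" R "Z (-1) a" "Z 1 b" "Z (-1) b"] unfolding R_def by auto
    \<comment> \<open>The scaling makes \<alpha> and \<beta> the contributions of the free waves to
      the right-going and left-going parts at a; at b they carry the propagation factor and its
      inverse.\<close>
    define A where "A = \<alpha> / (2 * w * ex w a)"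
    define B where "B = - \<beta> / (2 * w * ex (- w) a)"
    define \<Psi> where "\<Psi> = (\<lambda>x. Y x + A * ex w x + B * ex (- w) x)"
    define \<Psi>' where "\<Psi>' = (\<lambda>x. Y' x + A * (w * ex w x) + B * (- w * ex (- w) x))"
    have KA: "cmod A \<le> K" "cmod B \<le> K"
      unfolding A_def B_def K_def norm_divide norm_mult[of "2 * w"] cw e1 using \<alpha> \<beta> R0 \<mu> by (auto intro!: divide_right_mono)
    have w2: "w\<^sup>2 = - of_real (\<mu>\<^sup>2)" by (simp add: w_def power_mult_distrib)
    have "oscillation \<mu> (\<lambda>x. h x + A * 0 + B * 0) \<Psi> \<Psi>'"
      unfolding \<Psi>_def \<Psi>'_def
      by (intro oscillation_add oscillation_scale Y oscillation_homogeneous) (simp_all add: w2)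
    then have osc: "oscillation \<mu> h \<Psi> \<Psi>'" by simp
    have pl: "\<Psi>' x + w * \<Psi> x = Z 1 x + A * (2 * w * ex w x)" and mi: "\<Psi>' x - w * \<Psi> x = Z (-1) x - B * (2 * w * ex (- w) x)" for x
      by (simp_all add: \<Psi>_def \<Psi>'_def Z_def algebra_simps)
    have inv: "ex (- w) x = 1 / ex w x" for x
      using ex_simps(1)[of "- w" x w] ex_simps(2)[of x] ex_simps(4)[of w x] by (simp add: field_simps)
    have 1: "A * (2 * w * ex w a) = \<alpha>" "A * (2 * w * ex w b) = \<alpha> * (ex w b / ex w a)" "- (B * (2 * w * ex (- w) a)) = \<beta>"
      "- (B * (2 * w * ex (- w) b)) = \<beta> / (ex w b / ex w a)"
      using w0 ex_simps(4)[of w] unfolding A_def B_def inv by (simp_all add: field_simps)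
    have 2: "\<Psi>' b - w * \<Psi> b = E1 * (\<Psi>' b + w * \<Psi> b)"
      using eqs(1) unfolding pl mi 1(2,4)[symmetric] by simp
    have 3: "\<Psi>' a + w * \<Psi> a = E2 * (\<Psi>' a - w * \<Psi> a)"
      using eqs(2) unfolding pl mi 1(1,3)[symmetric] by simp
    have "\<Psi>' b + - w * ((1 + E1) / (1 - E1)) * \<Psi> b = 0"
      using impedance_condition[OF ne(1), of "\<Psi>' b" "of_real \<mu>" "\<Psi> b"] 2 by (simp add: w_def mult.assoc)
    moreover have "- \<Psi>' a + - w * ((1 + E2) / (1 - E2)) * \<Psi> a = 0"
    proof -
      have "- \<Psi>' a - \<i> * of_real \<mu> * \<Psi> a = E2 * (- \<Psi>' a + \<i> * of_real \<mu> * \<Psi> a)"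
        using arg_cong[OF 3, of uminus] by (simp add: w_def algebra_simps)
      from impedance_condition[OF ne(2) this] show ?thesis by (simp add: w_def mult.assoc)
    qed
    ultimately show ?thesis using KA osc unfolding \<Psi>_def by blast
  qed
  then show ?thesis unfolding w_def by (intro exI[of _ K]) (auto simp: mult.assoc)
qed

section \<open>From the two-point problem to the form\<close>

context flow
begin

interpretation H1: semi_inner_space "H1 \<Omega>" H1_inner
  rewrites "semi_inner_space.nrm H1_inner = H1_norm \<Omega>"
  by (rule semi_inner_space_H1 nrm_H1)+

text \<open>Annihilated by the covariant derivative, so that factoring it out turns covariant
  derivatives into plain ones.\<close>

definition gauge :: "real \<Rightarrow> complex" where "gauge = ex (- (\<i> * of_real kap))"

lemma gauge_facts: "smooth1 gauge" "(gauge has_vector_derivative - (\<i> * of_real kap) * gauge x) (at x)"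
  "gauge x * cnj (gauge x) = 1" "cnj (gauge x) * gauge x = 1"
  by (simp_all add: gauge_def smooth1_ex ex_simps)
    (use ex_deriv[of "- (\<i> * of_real kap)" x] in simp)

text \<open>With the conjugate of g in the second argument the expression is bilinear and symmetric
  in f and g, so the same two-point problem provides representers for either argument.\<close>

lemma F_gauge:
  assumes a: "admissible c1 \<kappa>" "admissible c2 \<kappa>"
    and f: "smooth1 f" "\<And>x. (f has_vector_derivative f' x) (at x)"
    and g: "smooth1 g" "\<And>x. (g has_vector_derivative g' x) (at x)"
  shows "F c1 c2 (ten (\<lambda>x. gauge x * f x) n) (ten (\<lambda>x. gauge x * cnj (g x)) n)
    = of_real \<gamma> * (integral {xm..xp} (\<lambda>x. f' x * g' x) - of_real (mu2 n) * integral {xm..xp} (\<lambda>x. f x * g x)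
       + (c1 n - \<i> * of_real kap) * f xp * g xp + (c2 n + \<i> * of_real kap) * f xm * g xm)"
proof -
  have gc: "smooth1 (\<lambda>x. cnj (g x))" by (rule smooth1_cnj[OF g(1)])
  have gd: "((\<lambda>x. cnj (g x)) has_vector_derivative cnj (g' x)) (at x)" for x by (rule has_vector_derivative_cnj[OF g(2)])
  have d: "((\<lambda>x. gauge x * u x) has_vector_derivative (gauge x * u' x + - (\<i> * of_real kap) * gauge x * u x)) (at x)"
    if "\<And>x. (u has_vector_derivative u' x) (at x)" for u u' x
    by (rule has_vector_derivative_mult[OF gauge_facts(2) that])
  have c: "(gauge x * u) * cnj (gauge x * cnj v) = u * v" for x u v
    using gauge_facts(3)[of x] by (metis complex_cnj_cnj complex_cnj_mult mult.assoc mult.commute mult.left_neutral)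
  have c': "(gauge x * u + - (\<i> * of_real kap) * gauge x * f x + \<i> * of_real kap * (gauge x * f x)) *
      cnj (gauge x * cnj v + - (\<i> * of_real kap) * gauge x * cnj (g x) + \<i> * of_real kap * (gauge x * cnj (g x))) = u * v" for x u v
    using c[of x u v] by simp
  have b: "b * (gauge x * u) * cnj (gauge x * cnj v) = b * u * v" for b x u v
    using c[of x u v] by (simp only: mult.assoc)
  show ?thesis
    unfolding F_ten[OF a smooth1_mult[OF gauge_facts(1) f(1)] d[OF f(2)] smooth1_mult[OF gauge_facts(1) gc] d[OF gd]] ip1_def c c' b
    by simp
qed

text \<open>The weak form of the two-point problem: the boundary conditions on \<Psi> cancel what
  partial integration leaves at the ends. The sign of h in \<open>oscillation\<close> is chosen for
  this formula.\<close>

lemma integrate_by_parts: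
  assumes \<Psi>: "oscillation (mm n) h \<Psi> \<Psi>'" and h: "continuous_on UNIV h" and n: "mu2 n > 0"
    and g: "smooth1 g" "\<And>x. (g has_vector_derivative g' x) (at x)"
    and bc: "\<Psi>' xp + b1 * \<Psi> xp = 0" "- \<Psi>' xm + b2 * \<Psi> xm = 0"
  shows "integral {xm..xp} (\<lambda>x. \<Psi>' x * g' x) - of_real (mu2 n) * integral {xm..xp} (\<lambda>x. \<Psi> x * g x)
       + b1 * \<Psi> xp * g xp + b2 * \<Psi> xm * g xm = integral {xm..xp} (\<lambda>x. h x * g x)"
proof -
  have D: "smooth1 \<Psi>" "\<And>x. (\<Psi> has_vector_derivative \<Psi>' x) (at x)" "\<And>x. (\<Psi>' has_vector_derivative - (of_real (mu2 n) * \<Psi> x + h x)) (at x)"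
    using \<Psi> n unfolding oscillation_def by (auto simp: mm_square)
  have c: "continuous_on S \<Psi>" "continuous_on S g" "continuous_on S g'" for S
    using smooth1_continuous D(1) g(1) smooth1_derivative[OF g] by blast+
  have c': "continuous_on S \<Psi>'" "continuous_on S h" for S
    using smooth1_continuous[OF smooth1_derivative[OF D(1,2)]] continuous_on_subset[OF h] by auto
  have "((\<lambda>x. \<Psi>' x * g' x + - (of_real (mu2 n) * \<Psi> x + h x) * g x) has_integral \<Psi>' xp * g xp - \<Psi>' xm * g xm) {xm..xp}"
    by (rule fundamental_theorem_of_calculus)
      (use xm_less_xp D(3) g(2) in \<open>auto intro!: has_vector_derivative_mult intro: has_vector_derivative_at_within\<close>)
  then have "\<Psi>' xp * g xp - \<Psi>' xm * g xm = integral {xm..xp} (\<lambda>x. \<Psi>' x * g' x + - (of_real (mu2 n) * \<Psi> x + h x) * g x)"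
    by (rule integral_unique[symmetric])
  also have "\<dots> = integral {xm..xp} (\<lambda>x. \<Psi>' x * g' x - (of_real (mu2 n) * (\<Psi> x * g x) + h x * g x))"
    by (intro arg_cong[where f = "integral {xm..xp}"]) (simp add: fun_eq_iff algebra_simps)
  also have "\<dots> = integral {xm..xp} (\<lambda>x. \<Psi>' x * g' x) - (of_real (mu2 n) * integral {xm..xp} (\<lambda>x. \<Psi> x * g x) + integral {xm..xp} (\<lambda>x. h x * g x))"
  proof -
    have "integral {xm..xp} (\<lambda>x. of_real (mu2 n) * (\<Psi> x * g x) + h x * g x) = of_real (mu2 n) * integral {xm..xp} (\<lambda>x. \<Psi> x * g x) + integral {xm..xp} (\<lambda>x. h x * g x)"
      by (subst Henstock_Kurzweil_Integration.integral_add) (auto intro!: integrable_continuous_interval continuous_intros c c')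
    then show ?thesis
      by (subst Henstock_Kurzweil_Integration.integral_diff) (auto intro!: integrable_continuous_interval continuous_intros c c')
  qed
  finally have "\<Psi>' xp * g xp - \<Psi>' xm * g xm = \<dots>" .
  moreover have "b1 * \<Psi> xp * g xp = - \<Psi>' xp * g xp" "b2 * \<Psi> xm * g xm = \<Psi>' xm * g xm"
    using bc[THEN arg_cong[where f = "\<lambda>z. z * g xp"]] bc[THEN arg_cong[where f = "\<lambda>z. z * g xm"]]
    by (simp_all add: algebra_simps add_eq_0_iff)
  ultimately show ?thesis by (simp add: algebra_simps)
qed

lemma E_ten: "E (m, n) = ten (\<lambda>x. of_real (nx m * cx m x)) n"
  by (simp add: E_def ten_def fun_eq_iff phi_eq)

lemma hat_ten: "continuous_on UNIV w \<Longrightarrow> hat (ten w n') (m, n) = (if n' = n then integral {xm..xp} (\<lambda>x. w x * of_real (nx m * cx m x)) else 0)"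
  unfolding hat_def E_ten
  by (subst L2_inner_ten) (auto simp: ip1_def intro!: smooth1_continuous smooth1_of_real smooth1_mult smooth1_const smooth1_trig)

text \<open>A cosine times an exponential is a sum of two exponentials, each with a particular
  solution. The parameter s stands for \<open>kap\<close> or its negative.\<close>

lemma oscillation_cx:
  assumes "mu2 n > 0"
  shows "\<exists>Y Y'. oscillation (mm n) (\<lambda>x. of_real (nx m / \<gamma>) * (ex (\<i> * of_real s) x * of_real (cx m x))) Y Y'"
proof -
  let ?a = "exp (- (\<i> * of_real (kx m * xm)))" and ?b = "exp (\<i> * of_real (kx m * xm))"
  have c: "of_real (cx m x) = (1 / 2) * (?a * ex (\<i> * of_real (kx m)) x + ?b * ex (- (\<i> * of_real (kx m))) x)" for x
  proof -
    have "of_real (cx m x) = cos (complex_of_real (kx m * (x - xm)))" by (simp add: cx_alt cos_of_real[symmetric] right_diff_distrib)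
    then have "2 * of_real (cx m x) = ?a * ex (\<i> * of_real (kx m)) x + ?b * ex (- (\<i> * of_real (kx m))) x"
      by (simp add: cos_exp_eq ex_def exp_add[symmetric] algebra_simps)
    moreover have "z = (1 / 2) * w" if "2 * z = w" for z w :: complex using that by auto
    ultimately show ?thesis by blast
  qed
  obtain Y1 Y1' Y2 Y2' where Y: "oscillation (mm n) (ex (\<i> * of_real s + \<i> * of_real (kx m))) Y1 Y1'" "oscillation (mm n) (ex (\<i> * of_real s - \<i> * of_real (kx m))) Y2 Y2'"
    using oscillation_ex mm_pos[of n] by (metis less_irrefl)
  have "(\<lambda>x. of_real (nx m / \<gamma>) * (ex (\<i> * of_real s) x * of_real (cx m x)))
    = (\<lambda>x. (of_real (nx m / \<gamma>) * (1 / 2) * ?a) * ex (\<i> * of_real s + \<i> * of_real (kx m)) x + (of_real (nx m / \<gamma>) * (1 / 2) * ?b) * ex (\<i> * of_real s - \<i> * of_real (kx m)) x)"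
    unfolding c diff_conv_add_uminus ex_simps(1)[symmetric] by (simp add: algebra_simps)
  moreover note oscillation_add[OF oscillation_scale[OF Y(1), of "of_real (nx m / \<gamma>) * (1 / 2) * ?a"] oscillation_scale[OF Y(2), of "of_real (nx m / \<gamma>) * (1 / 2) * ?b"]]
  ultimately show ?thesis by (auto simp only: intro!: exI)
qed

text \<open>Trigonometric polynomials are finite sums of tensor products and dense in H^1, and both
  sides are continuous in q.\<close>

lemma F_trigpoly_extend:
  assumes a: "admissible c1 \<kappa>" "admissible c2 \<kappa>" and \<psi>: "\<psi> \<in> H1 \<Omega>" and q: "q \<in> H1 \<Omega>"
  shows "(\<And>w n'. smooth1 w \<Longrightarrow> F c1 c2 \<psi> (ten w n') = cnj (hat (ten w n') i)) \<Longrightarrow> F c1 c2 \<psi> q = cnj (hat q i)"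
    and "(\<And>w n'. smooth1 w \<Longrightarrow> F c1 c2 (ten w n') \<psi> = hat (ten w n') i) \<Longrightarrow> F c1 c2 q \<psi> = hat q i"
proof -
  let ?T = "\<lambda>N. trigpoly (Q N) (hat q)"
  have T: "?T N = (\<lambda>p. \<Sum>n\<le>N. ten (col N (hat q) n) n p)" for N by (rule trigpoly_col)
  have h: "ten (col N (hat q) n) n \<in> H1 \<Omega>" for N n by (rule ten_H1[OF smooth1_col])
  have s: "hat (?T N) i = (\<Sum>n\<le>N. hat (ten (col N (hat q) n) n) i)" for N
    unfolding T hat_def[of _ i] by (rule L2.ip_sum_left) (simp_all add: E_L2 H1D(1)[OF h])
  note dense = D_trigpoly(1) q trigpoly_dense[OF q]
  have 0: "(\<lambda>n. H1_norm \<Omega> (\<lambda>x. \<psi> x - \<psi> x)) \<longlonglongrightarrow> 0"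
    using H1.nrm_scale[OF \<psi>, of 0] by simp
  {
    assume *: "\<And>w n'. smooth1 w \<Longrightarrow> F c1 c2 \<psi> (ten w n') = cnj (hat (ten w n') i)"
    have "F c1 c2 \<psi> (?T N) = (\<Sum>n\<le>N. F c1 c2 \<psi> (ten (col N (hat q) n) n))" for N
      unfolding T by (rule F_sum(2)[OF a \<psi> finite_atMost h])
    then have "F c1 c2 \<psi> (?T N) = cnj (hat (?T N) i)" for N
      unfolding s by (simp add: *[OF smooth1_col])
    moreover have "(\<lambda>N. F c1 c2 \<psi> (?T N)) \<longlonglongrightarrow> F c1 c2 \<psi> q" by (rule F_tendsto[OF a \<psi> \<psi> 0 dense])
    moreover have "(\<lambda>N. cnj (hat (?T N) i)) \<longlonglongrightarrow> cnj (hat q i)" by (intro tendsto_cnj hat_tendsto dense)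
    ultimately show "F c1 c2 \<psi> q = cnj (hat q i)" using LIMSEQ_unique by simp
  }
  {
    assume *: "\<And>w n'. smooth1 w \<Longrightarrow> F c1 c2 (ten w n') \<psi> = hat (ten w n') i"
    have "F c1 c2 (?T N) \<psi> = (\<Sum>n\<le>N. F c1 c2 (ten (col N (hat q) n) n) \<psi>)" for N
      unfolding T by (rule F_sum(1)[OF a \<psi> finite_atMost h])
    then have "F c1 c2 (?T N) \<psi> = hat (?T N) i" for N
      unfolding s by (simp add: *[OF smooth1_col])
    moreover have "(\<lambda>N. F c1 c2 (?T N) \<psi>) \<longlonglongrightarrow> F c1 c2 q \<psi>" by (rule F_tendsto[OF a dense \<psi> \<psi> 0])
    moreover have "(\<lambda>N. hat (?T N) i) \<longlonglongrightarrow> hat q i" by (intro hat_tendsto dense)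
    ultimately show "F c1 c2 q \<psi> = hat q i" using LIMSEQ_unique by simp
  }
qed

text \<open>Both \<Psi> and its conjugate are bounded, because a left representer is built from the
  function and a right one from the conjugate. K is quantified before the coefficients and so is
  uniform in the layers.\<close>

lemma impedance_gauge:
  assumes r: "0 \<le> r" "r < 1" and n: "mu2 n > 0"
  shows "\<exists>K. \<forall>\<kappa> c1 c2. good r \<kappa> c1 c2 \<longrightarrow> (\<exists>\<Psi> \<Psi>'.
     oscillation (mm n) (\<lambda>x. of_real (nx m / \<gamma>) * (ex (\<i> * of_real s) x * of_real (cx m x))) \<Psi> \<Psi>' \<and>
     \<Psi>' xp + (c1 n - \<i> * of_real kap) * \<Psi> xp = 0 \<and> - \<Psi>' xm + (c2 n + \<i> * of_real kap) * \<Psi> xm = 0 \<and>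
     H1_norm \<Omega> (ten (\<lambda>x. gauge x * \<Psi> x) n) \<le> K \<and> H1_norm \<Omega> (ten (\<lambda>x. gauge x * cnj (\<Psi> x)) n) \<le> K)"
proof -
  let ?h = "\<lambda>x. of_real (nx m / \<gamma>) * (ex (\<i> * of_real s) x * of_real (cx m x))"
  obtain Y Y' where Y: "oscillation (mm n) ?h Y Y'" using oscillation_cx[OF n] by blast
  then have sY: "smooth1 Y" by (simp add: oscillation_def)
  let ?u = "ex (\<i> * of_real (mm n))" and ?v = "ex (- (\<i> * of_real (mm n)))"
  obtain K0 where K0: "\<And>E1 E2. cmod E1 \<le> r \<Longrightarrow> cmod E2 \<le> r \<Longrightarrow> \<exists>A B. cmod A \<le> K0 \<and> cmod B \<le> K0 \<and>
    (\<exists>\<Psi> \<Psi>'. \<Psi> = (\<lambda>x. Y x + A * ?u x + B * ?v x) \<and> oscillation (mm n) ?h \<Psi> \<Psi>' \<and>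
      \<Psi>' xp + - \<i> * of_real (mm n) * ((1 + E1) / (1 - E1)) * \<Psi> xp = 0 \<and>
      - \<Psi>' xm + - \<i> * of_real (mm n) * ((1 + E2) / (1 - E2)) * \<Psi> xm = 0)"
    using impedance_problem[OF r mm_pos[of n] Y, of xp xm] by blast
  let ?t = "\<lambda>f. ten (\<lambda>x. gauge x * f x) n"
  have tH: "?t f \<in> H1 \<Omega>" if "smooth1 f" for f by (intro ten_H1 smooth1_mult gauge_facts(1) that)
  define K where "K = (H1_norm \<Omega> (?t Y) + K0 * H1_norm \<Omega> (?t ?u) + K0 * H1_norm \<Omega> (?t ?v))
     + (H1_norm \<Omega> (?t (\<lambda>x. cnj (Y x))) + K0 * H1_norm \<Omega> (?t ?v) + K0 * H1_norm \<Omega> (?t ?u))"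
  have tri: "H1_norm \<Omega> (?t (\<lambda>x. f x + A * g x + B * h x)) \<le> H1_norm \<Omega> (?t f) + K0 * H1_norm \<Omega> (?t g) + K0 * H1_norm \<Omega> (?t h)"
    if s: "smooth1 f" "smooth1 g" "smooth1 h" and A: "cmod A \<le> K0" "cmod B \<le> K0" for f g h A B
  proof -
    have e: "?t (\<lambda>x. f x + A * g x + B * h x) = (\<lambda>p. (?t f p + A * ?t g p) + B * ?t h p)"
      by (simp add: ten_def fun_eq_iff algebra_simps)
    have m: "(\<lambda>p. A * ?t g p) \<in> H1 \<Omega>" "(\<lambda>p. B * ?t h p) \<in> H1 \<Omega>" by (intro H1.scale_mem tH s)+
    have "H1_norm \<Omega> (\<lambda>p. (?t f p + A * ?t g p) + B * ?t h p) \<le> (H1_norm \<Omega> (?t f) + cmod A * H1_norm \<Omega> (?t g)) + cmod B * H1_norm \<Omega> (?t h)"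
      using H1.nrm_triangle[OF H1.add_mem[OF tH[OF s(1)] m(1)] m(2)] H1.nrm_triangle[OF tH[OF s(1)] m(1)]
        H1.nrm_scale[OF tH[OF s(2)], of A] H1.nrm_scale[OF tH[OF s(3)], of B] by linarith
    also have "\<dots> \<le> (H1_norm \<Omega> (?t f) + K0 * H1_norm \<Omega> (?t g)) + K0 * H1_norm \<Omega> (?t h)"
      by (intro add_mono mult_right_mono A H1_norm_nonneg order_refl)
    finally show ?thesis unfolding e .
  qed
  have "\<exists>\<Psi> \<Psi>'. oscillation (mm n) ?h \<Psi> \<Psi>' \<and>
     \<Psi>' xp + (c1 n - \<i> * of_real kap) * \<Psi> xp = 0 \<and> - \<Psi>' xm + (c2 n + \<i> * of_real kap) * \<Psi> xm = 0 \<and>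
     H1_norm \<Omega> (?t \<Psi>) \<le> K \<and> H1_norm \<Omega> (?t (\<lambda>x. cnj (\<Psi> x))) \<le> K" if g: "good r \<kappa> c1 c2" for \<kappa> c1 c2
  proof -
    obtain E1 E2 where E: "cmod E1 \<le> r" "cmod E2 \<le> r"
       "c1 n - \<i> * of_real kap = - \<i> * mu n * ((1 + E1) / (1 - E1))" "c2 n + \<i> * of_real kap = - \<i> * mu n * ((1 + E2) / (1 - E2))"
      using g unfolding good_def by blast
    have mun: "mu n = of_real (mm n)" using n by (simp add: mu_def)
    obtain A B \<Psi> \<Psi>' where AB: "cmod A \<le> K0" "cmod B \<le> K0" and \<Psi>: "\<Psi> = (\<lambda>x. Y x + A * ?u x + B * ?v x)" and sol: "oscillation (mm n) ?h \<Psi> \<Psi>'"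
      "\<Psi>' xp + - \<i> * of_real (mm n) * ((1 + E1) / (1 - E1)) * \<Psi> xp = 0" "- \<Psi>' xm + - \<i> * of_real (mm n) * ((1 + E2) / (1 - E2)) * \<Psi> xm = 0"
      using K0[OF E(1,2)] by blast
    have K0p: "0 \<le> K0" using AB(1) norm_ge_zero order_trans by blast
    have 1: "H1_norm \<Omega> (?t \<Psi>) \<le> H1_norm \<Omega> (?t Y) + K0 * H1_norm \<Omega> (?t ?u) + K0 * H1_norm \<Omega> (?t ?v)"
      unfolding \<Psi> by (intro tri sY smooth1_ex AB)
    have c: "cnj (\<Psi> x) = cnj (Y x) + cnj A * ?v x + cnj B * ?u x" for x by (simp add: \<Psi> ex_simps)
    have 2: "H1_norm \<Omega> (?t (\<lambda>x. cnj (\<Psi> x))) \<le> H1_norm \<Omega> (?t (\<lambda>x. cnj (Y x))) + K0 * H1_norm \<Omega> (?t ?v) + K0 * H1_norm \<Omega> (?t ?u)"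
      unfolding c by (intro tri smooth1_cnj sY smooth1_ex) (simp_all add: AB)
    have p: "0 \<le> H1_norm \<Omega> (?t f)" "0 \<le> K0 * H1_norm \<Omega> (?t f)" for f using K0p H1_norm_nonneg by (auto intro: mult_nonneg_nonneg)
    have "H1_norm \<Omega> (?t \<Psi>) \<le> K" "H1_norm \<Omega> (?t (\<lambda>x. cnj (\<Psi> x))) \<le> K"
      unfolding K_def using 1 2 p[of Y] p[of ?u] p[of ?v] p[of "\<lambda>x. cnj (Y x)"] by linarith+
    then show ?thesis using sol unfolding E(3,4) mun by blast
  qed
  then show ?thesis by blast
qed

text \<open>The sources of the two problems differ in the sign of \<open>kap\<close>, because the
  gauge factor enters the first argument plainly and the second through its conjugate. \<psi> serves
  to correct an approximate solution; v, with its uniform bound, serves to read off a coefficient of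
  a solution.\<close>

lemma representers:
  assumes r: "0 \<le> r" "r < 1" and n: "mu2 n > 0"
  shows "\<exists>K. \<forall>\<kappa> c1 c2. good r \<kappa> c1 c2 \<longrightarrow> (\<exists>\<psi>\<in>H1 \<Omega>. \<exists>v\<in>H1 \<Omega>. H1_norm \<Omega> v \<le> K \<and>
     (\<forall>q\<in>H1 \<Omega>. F c1 c2 \<psi> q = cnj (hat q (m, n)) \<and> F c1 c2 q v = hat q (m, n)))"
proof -
  let ?h = "\<lambda>s x. of_real (nx m / \<gamma>) * (ex (\<i> * of_real s) x * of_real (cx m x))"
  obtain K1 where K1: "\<And>\<kappa> c1 c2. good r \<kappa> c1 c2 \<Longrightarrow> \<exists>\<Psi> \<Psi>'. oscillation (mm n) (?h kap) \<Psi> \<Psi>' \<and>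
     \<Psi>' xp + (c1 n - \<i> * of_real kap) * \<Psi> xp = 0 \<and> - \<Psi>' xm + (c2 n + \<i> * of_real kap) * \<Psi> xm = 0 \<and>
     H1_norm \<Omega> (ten (\<lambda>x. gauge x * \<Psi> x) n) \<le> K1 \<and> H1_norm \<Omega> (ten (\<lambda>x. gauge x * cnj (\<Psi> x)) n) \<le> K1"
    using impedance_gauge[OF r n, of m kap] by blast
  obtain K2 where K2: "\<And>\<kappa> c1 c2. good r \<kappa> c1 c2 \<Longrightarrow> \<exists>\<Psi> \<Psi>'. oscillation (mm n) (?h (- kap)) \<Psi> \<Psi>' \<and>
     \<Psi>' xp + (c1 n - \<i> * of_real kap) * \<Psi> xp = 0 \<and> - \<Psi>' xm + (c2 n + \<i> * of_real kap) * \<Psi> xm = 0 \<and>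
     H1_norm \<Omega> (ten (\<lambda>x. gauge x * \<Psi> x) n) \<le> K2 \<and> H1_norm \<Omega> (ten (\<lambda>x. gauge x * cnj (\<Psi> x)) n) \<le> K2"
    using impedance_gauge[OF r n, of m "- kap"] by blast
  have hc: "continuous_on UNIV (?h s)" for s
    by (intro smooth1_continuous smooth1_mult smooth1_const smooth1_ex smooth1_of_real smooth1_trig)
  have g0: "\<gamma> \<noteq> 0" using \<gamma> by simp
  have ge: "ex (\<i> * of_real kap) x = cnj (gauge x)" "ex (\<i> * of_real (- kap)) x = gauge x" for x
    by (simp_all add: gauge_def ex_simps)
  have "\<exists>\<psi>\<in>H1 \<Omega>. \<exists>v\<in>H1 \<Omega>. H1_norm \<Omega> v \<le> K2 \<and>
     (\<forall>q\<in>H1 \<Omega>. F c1 c2 \<psi> q = cnj (hat q (m, n)) \<and> F c1 c2 q v = hat q (m, n))"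
    if g: "good r \<kappa> c1 c2" for \<kappa> c1 c2
  proof -
    have a: "admissible c1 \<kappa>" "admissible c2 \<kappa>" using g by (auto simp: good_def)
    obtain \<Psi> \<Psi>' where \<Psi>: "oscillation (mm n) (?h kap) \<Psi> \<Psi>'"
      "\<Psi>' xp + (c1 n - \<i> * of_real kap) * \<Psi> xp = 0" "- \<Psi>' xm + (c2 n + \<i> * of_real kap) * \<Psi> xm = 0"
      using K1[OF g] by blast
    obtain \<Phi> \<Phi>' where \<Phi>: "oscillation (mm n) (?h (- kap)) \<Phi> \<Phi>'"
      "\<Phi>' xp + (c1 n - \<i> * of_real kap) * \<Phi> xp = 0" "- \<Phi>' xm + (c2 n + \<i> * of_real kap) * \<Phi> xm = 0"
      "H1_norm \<Omega> (ten (\<lambda>x. gauge x * cnj (\<Phi> x)) n) \<le> K2"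
      using K2[OF g] by blast
    define \<psi> where "\<psi> = ten (\<lambda>x. gauge x * \<Psi> x) n"
    define v where "v = ten (\<lambda>x. gauge x * cnj (\<Phi> x)) n"
    have D: "smooth1 \<Psi>" "\<And>x. (\<Psi> has_vector_derivative \<Psi>' x) (at x)" "smooth1 \<Phi>" "\<And>x. (\<Phi> has_vector_derivative \<Phi>' x) (at x)"
      using \<Psi>(1) \<Phi>(1) by (auto simp: oscillation_def)
    have sm: "smooth1 (\<lambda>x. gauge x * \<Psi> x)" "smooth1 (\<lambda>x. gauge x * cnj (\<Phi> x))"
      by (intro smooth1_mult gauge_facts(1) smooth1_cnj D)+
    have H: "\<psi> \<in> H1 \<Omega>" "v \<in> H1 \<Omega>" unfolding \<psi>_def v_def by (intro ten_H1 sm)+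
    have other: "F c1 c2 (ten w i) (ten z j) = 0" if "i \<noteq> j" "smooth1 w" "smooth1 z" for w z i j
    proof -
      note wz = that
      obtain w' where "smooth1 w'" and w': "\<And>x. (w has_vector_derivative w' x) (at x)" by (rule smooth1_deriv[OF wz(2)]) (rule that)
      obtain z' where "smooth1 z'" and z': "\<And>x. (z has_vector_derivative z' x) (at x)" by (rule smooth1_deriv[OF wz(3)]) (rule that)
      show ?thesis using F_ten[OF a wz(2) w' wz(3) z'] wz(1) by simp
    qed
    have 1: "F c1 c2 \<psi> (ten w n') = cnj (hat (ten w n') (m, n))" if w: "smooth1 w" for w n'
    proof (cases "n' = n")
      case True
      \<comment> \<open>With this g the test function w is the gauge times the conjugate of g, the
        shape that \<open>F_gauge\<close> expects. The factor 1 / \<gamma> in the source cancels the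
        \<gamma> in front of the form.\<close>
      define g where "g = (\<lambda>x. gauge x * cnj (w x))"
      have gs: "smooth1 g" unfolding g_def by (intro smooth1_mult smooth1_cnj gauge_facts(1) w)
      obtain g' where g': "\<And>x. (g has_vector_derivative g' x) (at x)" using smooth1_deriv[OF gs] by metis
      have we: "gauge x * cnj (g x) = w x" for x using gauge_facts(3)[of x] by (simp add: g_def mult.assoc[symmetric])
      have he: "?h kap x * g x = of_real (1 / \<gamma>) * cnj (w x * of_real (nx m * cx m x))" for x
      proof -
        have "?h kap x * g x = (cnj (gauge x) * gauge x) * (of_real (1 / \<gamma>) * cnj (w x * of_real (nx m * cx m x)))"
          unfolding g_def ge by (simp add: mult_ac)
        then show ?thesis unfolding gauge_facts by simp
      qed
      have "F c1 c2 \<psi> (ten w n) = of_real \<gamma> * (integral {xm..xp} (\<lambda>x. ?h kap x * g x))"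
        using F_gauge[OF a D(1,2) gs g', of n] integrate_by_parts[OF \<Psi>(1) hc n gs g' \<Psi>(2,3)] unfolding \<psi>_def we by simp
      also have "\<dots> = integral {xm..xp} (\<lambda>x. cnj (w x * of_real (nx m * cx m x)))"
        unfolding he integral_mult_right using g0 by simp
      also have "\<dots> = cnj (hat (ten w n) (m, n))"
        using Henstock_Kurzweil_Integration.integral_cnj[of "{xm..xp}" "\<lambda>x. w x * of_real (nx m * cx m x)"]
        by (simp add: hat_ten[OF smooth1_continuous[OF w]])
      finally show ?thesis using True by simp
    next
      case False
      then show ?thesis using other[OF _ sm(1) w] by (simp add: \<psi>_def hat_ten[OF smooth1_continuous[OF w]])
    qed
    have 2: "F c1 c2 (ten w n') v = hat (ten w n') (m, n)" if w: "smooth1 w" for w n'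
    proof (cases "n' = n")
      case True
      define f where "f = (\<lambda>x. cnj (gauge x) * w x)"
      have fs: "smooth1 f" unfolding f_def by (intro smooth1_mult smooth1_cnj gauge_facts(1) w)
      obtain f' where f': "\<And>x. (f has_vector_derivative f' x) (at x)" using smooth1_deriv[OF fs] by metis
      have we: "gauge x * f x = w x" for x using gauge_facts(3)[of x] by (simp add: f_def mult.assoc[symmetric])
      have he: "?h (- kap) x * f x = of_real (1 / \<gamma>) * (w x * of_real (nx m * cx m x))" for x
      proof -
        have "?h (- kap) x * f x = (cnj (gauge x) * gauge x) * (of_real (1 / \<gamma>) * (w x * of_real (nx m * cx m x)))"
          unfolding f_def ge by (simp add: mult_ac)
        then show ?thesis unfolding gauge_facts by simp
      qed
      have "F c1 c2 (ten w n) v = of_real \<gamma> * (integral {xm..xp} (\<lambda>x. ?h (- kap) x * f x))"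
        using F_gauge[OF a fs f' D(3,4), of n] integrate_by_parts[OF \<Phi>(1) hc n fs f' \<Phi>(2,3)] unfolding v_def we by (simp add: mult_ac)
      also have "\<dots> = integral {xm..xp} (\<lambda>x. w x * of_real (nx m * cx m x))"
        unfolding he integral_mult_right using g0 by simp
      also have "\<dots> = hat (ten w n) (m, n)"
        unfolding hat_ten[OF smooth1_continuous[OF w]] by simp
      finally show ?thesis using True by simp
    next
      case False
      then show ?thesis using other[OF False w sm(2)] by (simp add: v_def hat_ten[OF smooth1_continuous[OF w]])
    qed
    show ?thesis using F_trigpoly_extend(1)[OF a H(1) _ 1] F_trigpoly_extend(2)[OF a H(2) _ 2] H \<Phi>(4) unfolding v_def by blast
  qed
  then show ?thesis by blast
qed

end

section \<open>Uniform stability\<close>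

text \<open>Young's inequality splits D N into c N^2 / 2 and D^2 / (2 c).\<close>

lemma quadratic_absorb:
  fixes N D c S :: real
  assumes "c > 0" "N \<ge> 0" "D \<ge> 0" "S \<ge> 0" "c * N\<^sup>2 \<le> D * N + S * D\<^sup>2"
  shows "N \<le> sqrt ((2 / c) * (1 / (2 * c) + S)) * D"
proof -
  have "0 \<le> (c * N - D)\<^sup>2" by simp
  then have "0 \<le> c * (c * N\<^sup>2 - 2 * (D * N)) + D\<^sup>2" by (simp add: power2_diff power_mult_distrib algebra_simps power2_eq_square)
  then have "0 \<le> (c * (c * N\<^sup>2 - 2 * (D * N)) + D\<^sup>2) / c" using assms(1) by simp
  also have "\<dots> = c * N\<^sup>2 - 2 * (D * N) + D\<^sup>2 / c" using assms(1) by (simp add: add_divide_distrib)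
  finally have "c * N\<^sup>2 \<le> D\<^sup>2 / c + 2 * (S * D\<^sup>2)" using assms(5) by linarith
  also have "\<dots> = c * ((2 / c) * (1 / (2 * c) + S) * D\<^sup>2)" using assms(1) by (simp add: field_simps power2_eq_square)
  finally have "N\<^sup>2 \<le> (2 / c) * (1 / (2 * c) + S) * D\<^sup>2" by (rule mult_left_le_imp_le) (rule assms(1))
  then have "sqrt (N\<^sup>2) \<le> sqrt ((2 / c) * (1 / (2 * c) + S) * D\<^sup>2)" by (rule real_sqrt_le_mono)
  then show ?thesis using assms(2,3) by (simp only: real_sqrt_mult real_sqrt_abs abs_of_nonneg)
qed

context flow
begin

interpretation H1: complete_semi_inner_space "H1 \<Omega>" H1_inner
  rewrites "semi_inner_space.nrm H1_inner = H1_norm \<Omega>"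
  by (rule complete_H1 nrm_H1)+

lemma propagating_finite: "finite {n. mu2 n > 0}"
  by (rule finite_subset[OF _ ky_finite[of "k\<^sup>2 / \<gamma>"]]) (auto intro: propagating_ky)

text \<open>Testing with the right representer of a low-frequency coefficient bounds that
  coefficient by a multiple of D, so the compensating sum in the Garding inequality is at most a
  multiple of D^2. All constants involve the coefficient sequences only through r.\<close>

theorem stability:
  assumes r: "0 \<le> r" "r < 1"
  shows "\<exists>C\<ge>0. \<forall>\<kappa> c1 c2 p D. good r \<kappa> c1 c2 \<longrightarrow> p \<in> H1 \<Omega> \<longrightarrow> D \<ge> 0 \<longrightarrow>
    (\<forall>q\<in>H1 \<Omega>. cmod (F c1 c2 p q) \<le> D * H1_norm \<Omega> q) \<longrightarrow> H1_norm \<Omega> p \<le> C * D"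
proof -
  obtain c \<Lambda> m0 where c: "c > 0" and \<Lambda>: "\<Lambda> \<ge> 0" and garding: "\<And>\<kappa> c1 c2 p. good r \<kappa> c1 c2 \<Longrightarrow> p \<in> H1 \<Omega> \<Longrightarrow>
     c * (H1_norm \<Omega> p)\<^sup>2 \<le> Re (F c1 c2 p p) + \<Lambda> * (\<Sum>i\<in>{..m0} \<times> {n. mu2 n > 0}. (cmod (hat p i))\<^sup>2)"
    using garding[OF r] by blast
  define I where "I = {..m0} \<times> {n. mu2 n > 0}"
  have "\<forall>i\<in>I. \<exists>K. \<forall>\<kappa> c1 c2. good r \<kappa> c1 c2 \<longrightarrow> (\<exists>v\<in>H1 \<Omega>. H1_norm \<Omega> v \<le> K \<and> (\<forall>q\<in>H1 \<Omega>. F c1 c2 q v = hat q i))"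
  proof
    fix i assume "i \<in> I"
    then have "mu2 (snd i) > 0" by (auto simp: I_def)
    from representers[OF r this, of "fst i"] show "\<exists>K. \<forall>\<kappa> c1 c2. good r \<kappa> c1 c2 \<longrightarrow> (\<exists>v\<in>H1 \<Omega>. H1_norm \<Omega> v \<le> K \<and> (\<forall>q\<in>H1 \<Omega>. F c1 c2 q v = hat q i))"
      unfolding prod.collapse by blast
  qed
  then obtain K where K: "\<And>i \<kappa> c1 c2. i \<in> I \<Longrightarrow> good r \<kappa> c1 c2 \<Longrightarrow> \<exists>v\<in>H1 \<Omega>. H1_norm \<Omega> v \<le> K i \<and> (\<forall>q\<in>H1 \<Omega>. F c1 c2 q v = hat q i)"
    by metis
  define S where "S = \<Lambda> * (\<Sum>i\<in>I. (K i)\<^sup>2)"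
  have S: "0 \<le> S" unfolding S_def using \<Lambda> by (intro mult_nonneg_nonneg sum_nonneg) auto
  have "H1_norm \<Omega> p \<le> sqrt ((2 / c) * (1 / (2 * c) + S)) * D"
    if g: "good r \<kappa> c1 c2" and p: "p \<in> H1 \<Omega>" and D: "D \<ge> 0" and b: "\<And>q. q \<in> H1 \<Omega> \<Longrightarrow> cmod (F c1 c2 p q) \<le> D * H1_norm \<Omega> q" for \<kappa> c1 c2 p D
  proof (rule quadratic_absorb[OF c H1_norm_nonneg D S])
    have "(cmod (hat p i))\<^sup>2 \<le> (K i)\<^sup>2 * D\<^sup>2" if i: "i \<in> I" for i
    proof -
      obtain v where v: "v \<in> H1 \<Omega>" "H1_norm \<Omega> v \<le> K i" "F c1 c2 p v = hat p i" using K[OF i g] p by blast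
      have "cmod (hat p i) \<le> D * K i" using b[OF v(1)] mult_left_mono[OF v(2) D] unfolding v(3) by linarith
      then have "(cmod (hat p i))\<^sup>2 \<le> (D * K i)\<^sup>2" by (intro power_mono) auto
      then show ?thesis by (simp add: power_mult_distrib mult.commute)
    qed
    then have "\<Lambda> * (\<Sum>i\<in>I. (cmod (hat p i))\<^sup>2) \<le> \<Lambda> * (\<Sum>i\<in>I. (K i)\<^sup>2 * D\<^sup>2)"
      using \<Lambda> by (intro mult_left_mono sum_mono)
    also have "\<dots> = S * D\<^sup>2" by (simp add: S_def sum_distrib_right)
    finally have 1: "\<Lambda> * (\<Sum>i\<in>I. (cmod (hat p i))\<^sup>2) \<le> S * D\<^sup>2" .
    have "Re (F c1 c2 p p) \<le> D * H1_norm \<Omega> p" using b[OF p] complex_Re_le_cmod order_trans by blast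
    then show "c * (H1_norm \<Omega> p)\<^sup>2 \<le> D * H1_norm \<Omega> p + S * D\<^sup>2"
      using garding[OF g p] 1 unfolding I_def by linarith
  qed
  moreover have "0 \<le> sqrt ((2 / c) * (1 / (2 * c) + S))" using c S by simp
  ultimately show ?thesis by blast
qed

text \<open>The compensated form t is coercive, so Lax--Milgram applies to it. Adding the left
  representers with weights \<Lambda> \<open>hat p i\<close> to the solution p reproduces the
  compensating sum, so F at the corrected function equals t at p.\<close>

theorem solvability:
  assumes r: "0 \<le> r" "r < 1" and g: "good r \<kappa> c1 c2" and l: "H1.bounded_antilinear l"
  shows "\<exists>p\<in>H1 \<Omega>. \<forall>q\<in>H1 \<Omega>. F c1 c2 p q = l q"
proof -
  obtain c \<Lambda> m0 where c: "c > 0" and \<Lambda>: "\<Lambda> \<ge> 0" and garding: "\<And>\<kappa> c1 c2 p. good r \<kappa> c1 c2 \<Longrightarrow> p \<in> H1 \<Omega> \<Longrightarrow>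
     c * (H1_norm \<Omega> p)\<^sup>2 \<le> Re (F c1 c2 p p) + \<Lambda> * (\<Sum>i\<in>{..m0} \<times> {n. mu2 n > 0}. (cmod (hat p i))\<^sup>2)"
    using garding[OF r] by blast
  define I where "I = {..m0} \<times> {n. mu2 n > 0}"
  have I: "finite I" using propagating_finite by (simp add: I_def)
  have a: "admissible c1 \<kappa>" "admissible c2 \<kappa>" using g by (auto simp: good_def)
  define t where "t = (\<lambda>p q. F c1 c2 p q + of_real \<Lambda> * (\<Sum>i\<in>I. hat p i * cnj (hat q i)))"
  have tb: "cmod (t p q) \<le> (FB \<kappa> + \<Lambda> * card I) * H1_norm \<Omega> p * H1_norm \<Omega> q" if p: "p \<in> H1 \<Omega>" and q: "q \<in> H1 \<Omega>" for p q
  proof -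
    have "cmod (\<Sum>i\<in>I. hat p i * cnj (hat q i)) \<le> card I * (H1_norm \<Omega> p * H1_norm \<Omega> q)"
      by (rule sum_norm_bound) (auto simp: norm_mult intro!: mult_mono hat_bound p q H1_norm_nonneg)
    then have "cmod (of_real \<Lambda> * (\<Sum>i\<in>I. hat p i * cnj (hat q i))) \<le> \<Lambda> * (card I * (H1_norm \<Omega> p * H1_norm \<Omega> q))"
      using \<Lambda> by (simp add: norm_mult mult_left_mono)
    then show ?thesis unfolding t_def using F_bound[OF a p q]
        norm_triangle_ineq[of "F c1 c2 p q" "of_real \<Lambda> * (\<Sum>i\<in>I. hat p i * cnj (hat q i))"]
      by (simp add: distrib_right mult.assoc)
  qed
  have t: "H1.bounded_antilinear (t p)" if p: "p \<in> H1 \<Omega>" for p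
    unfolding H1.bounded_antilinear_def
  proof (intro conjI ballI allI exI[of _ "(FB \<kappa> + \<Lambda> * card I) * H1_norm \<Omega> p"])
    fix q q' assume q: "q \<in> H1 \<Omega>" "q' \<in> H1 \<Omega>"
    show "t p (\<lambda>x. q x + q' x) = t p q + t p q'"
      unfolding t_def F_linear(3)[OF a q p] by (simp add: hat_add q sum.distrib algebra_simps)
  next
    fix z q assume q: "q \<in> H1 \<Omega>"
    show "t p (\<lambda>x. z * q x) = cnj z * t p q"
      unfolding t_def F_linear(4)[OF a q q p] by (simp add: hat_scale q sum_distrib_left algebra_simps)
  qed (rule tb[OF p])
  obtain p where p: "p \<in> H1 \<Omega>" "\<And>q. q \<in> H1 \<Omega> \<Longrightarrow> t p q = l q"
  proof (rule H1.Lax_Milgram[of t "FB \<kappa> + \<Lambda> * card I" c l])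
    fix p p' q z assume h: "p \<in> H1 \<Omega>" "q \<in> H1 \<Omega>"
    show "t (\<lambda>x. z * p x) q = z * t p q"
      unfolding t_def F_linear(2)[OF a h(1) h(1) h(2)] by (simp add: hat_scale h sum_distrib_left algebra_simps)
    assume "p' \<in> H1 \<Omega>"
    then show "t (\<lambda>x. p x + p' x) q = t p q + t p' q"
      unfolding t_def F_linear(1)[OF a h(1) \<open>p' \<in> H1 \<Omega>\<close> h(2)] by (simp add: hat_add h sum.distrib algebra_simps)
  next
    fix p assume "p \<in> H1 \<Omega>"
    then show "c * (H1_norm \<Omega> p)\<^sup>2 \<le> Re (t p p)"
      using garding[OF g] by (simp add: t_def I_def complex_norm_square[symmetric] flip: of_real_sum)
  qed (use t tb c l in auto)
  have "\<forall>i\<in>I. \<exists>\<psi>\<in>H1 \<Omega>. \<forall>q\<in>H1 \<Omega>. F c1 c2 \<psi> q = cnj (hat q i)"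
  proof
    fix i assume "i \<in> I"
    then have "mu2 (snd i) > 0" by (auto simp: I_def)
    from representers[OF r this, of "fst i"] show "\<exists>\<psi>\<in>H1 \<Omega>. \<forall>q\<in>H1 \<Omega>. F c1 c2 \<psi> q = cnj (hat q i)"
      unfolding prod.collapse using g by blast
  qed
  then obtain \<psi> where \<psi>: "\<And>i. i \<in> I \<Longrightarrow> \<psi> i \<in> H1 \<Omega>" "\<And>i q. i \<in> I \<Longrightarrow> q \<in> H1 \<Omega> \<Longrightarrow> F c1 c2 (\<psi> i) q = cnj (hat q i)"
    by metis
  have m: "(\<lambda>x. (of_real \<Lambda> * hat p i) * \<psi> i x) \<in> H1 \<Omega>" if "i \<in> I" for i by (intro H1.scale_mem \<psi> that)
  have s: "(\<lambda>x. \<Sum>i\<in>I. (of_real \<Lambda> * hat p i) * \<psi> i x) \<in> H1 \<Omega>" by (intro H1.sum_mem I m)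
  have "F c1 c2 (\<lambda>x. p x + (\<Sum>i\<in>I. (of_real \<Lambda> * hat p i) * \<psi> i x)) q = l q" if q: "q \<in> H1 \<Omega>" for q
  proof -
    have "F c1 c2 (\<lambda>x. p x + (\<Sum>i\<in>I. (of_real \<Lambda> * hat p i) * \<psi> i x)) q = F c1 c2 p q + (\<Sum>i\<in>I. F c1 c2 (\<lambda>x. (of_real \<Lambda> * hat p i) * \<psi> i x) q)"
      unfolding F_linear(1)[OF a p(1) s q] by (rule arg_cong[OF F_sum(1)[OF a q I m]])
    also have "(\<Sum>i\<in>I. F c1 c2 (\<lambda>x. (of_real \<Lambda> * hat p i) * \<psi> i x) q) = (\<Sum>i\<in>I. of_real \<Lambda> * hat p i * cnj (hat q i))"
      by (intro sum.cong refl) (simp add: F_linear(2)[OF a \<psi>(1) \<psi>(1) q] \<psi>(2) q)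
    also have "F c1 c2 p q + \<dots> = t p q" by (simp add: t_def sum_distrib_left mult.assoc)
    finally show ?thesis using p(2)[OF q] by simp
  qed
  then show ?thesis using H1.add_mem[OF p(1) s] by blast
qed

end

section \<open>Reflection coefficients of the absorbing layers\<close>

text \<open>The truncated integrand lies below both 1 and h / w, so a single number bounds the
  thickness of a layer and its absorption from below. Continuity and positivity of h at 1 make it
  positive already for L = 1.\<close>

lemma truncated_integral:
  fixes h :: "real \<Rightarrow> real"
  assumes h: "continuous_on UNIV h" "\<And>s. 0 \<le> s \<Longrightarrow> 0 \<le> h s" and w: "w > 0"
  defines "I \<equiv> \<lambda>L. integral {0..L} (\<lambda>s. min 1 (h s / w))"
  shows "0 \<le> L \<Longrightarrow> I L \<le> L" "I L \<le> integral {0..L} h / w" "1 \<le> L \<Longrightarrow> I 1 \<le> I L" "0 < h 1 \<Longrightarrow> 0 < I 1"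
proof -
  have c: "continuous_on S h" for S using h(1) continuous_on_subset by blast
  have c': "continuous_on S (\<lambda>s. min 1 (h s / w))" for S using w by (intro continuous_intros c) auto
  have i: "(\<lambda>s. min 1 (h s / w)) integrable_on {0..L}" "h integrable_on {0..L}" for L
    by (intro integrable_continuous_interval c c')+
  have "I L \<le> integral {0..L} (\<lambda>s. 1)" unfolding I_def by (intro integral_le i) auto
  then show "0 \<le> L \<Longrightarrow> I L \<le> L" by simp
  have "I L \<le> integral {0..L} (\<lambda>s. h s / w)"
    unfolding I_def by (intro integral_le i) (auto simp: divide_inverse intro!: integrable_on_mult_left i)
  then show "I L \<le> integral {0..L} h / w" by simp
  have n: "0 \<le> min 1 (h s / w)" if "0 \<le> s" for s using h(2)[OF that] w by simp
  show "I 1 \<le> I L" if "1 \<le> L" unfolding I_def using that n by (intro integral_subset_le i) auto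
  show "0 < I 1" if h1: "0 < h 1"
  proof -
    have "I 1 \<noteq> 0"
    proof
      assume "I 1 = 0"
      then have "min 1 (h 1 / w) = 0" unfolding I_def by (subst (asm) integral_eq_0_iff[OF c']) (use n in auto)
      moreover have "0 < h 1 / w" using h1 w by simp
      ultimately show False by (auto simp: min_def split: if_splits)
    qed
    moreover have "0 \<le> I 1" unfolding I_def using n by (intro Henstock_Kurzweil_Integration.integral_nonneg i) auto
    ultimately show ?thesis by simp
  qed
qed

lemma reflection_algebra:
  fixes \<mu> E X :: complex
  assumes "E = exp X" "E \<noteq> 1"
  shows "2 * \<mu> / (1 - exp (- X)) = - (2 * \<mu> * E / (1 - E))"
proof -
  have "E \<noteq> 0" "exp (- X) = 1 / E" using assms by (auto simp: exp_minus field_simps)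
  moreover have "1 - E \<noteq> 0" "E - 1 \<noteq> 0" using assms by auto
  ultimately show ?thesis unfolding \<open>exp (- X) = 1 / E\<close> by (simp add: divide_simps) (simp add: algebra_simps)
qed

lemma cayley_diff: "1 - E \<noteq> (0::complex) \<Longrightarrow> (1 + E) / (1 - E) - 1 = 2 * E / (1 - E)"
  by (simp add: field_simps)

context flow
begin

interpretation H1: complete_semi_inner_space "H1 \<Omega>" H1_inner
  rewrites "semi_inner_space.nrm H1_inner = H1_norm \<Omega>"
  by (rule complete_H1 nrm_H1)+

lemma mu2_sq: "k\<^sup>2 - (real n)\<^sup>2 * pi\<^sup>2 / d\<^sup>2 * (1 - M\<^sup>2) = mu2 n * \<gamma>\<^sup>2"
  using \<gamma> by (simp add: mu2_def ky_def \<gamma>_def power_mult_distrib power_divide)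

text \<open>The floor admits equality, that is a mode at cutoff, which \<open>mu2_nonzero\<close>
  excludes; hence the strict inequality.\<close>

lemma propagating_iff: "int n \<le> N0 d M k \<longleftrightarrow> mu2 n > 0"
proof -
  have s: "0 < sqrt \<gamma>" using \<gamma> by simp
  have "int n \<le> N0 d M k \<longleftrightarrow> real n \<le> k * d / (pi * sqrt \<gamma>)" by (simp add: N0_def \<gamma>_def le_floor_iff)
  also have "\<dots> \<longleftrightarrow> ky n * sqrt \<gamma> \<le> k" using s d_pos by (simp add: ky_def field_simps)
  also have "\<dots> \<longleftrightarrow> (ky n * sqrt \<gamma>)\<^sup>2 \<le> k\<^sup>2"
  proof -
    have "0 \<le> ky n * sqrt \<gamma>" using s ky_pos[of n] kxy_0 by (cases "n = 0") auto
    then show ?thesis using k_pos by (simp add: power_mono_iff)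
  qed
  also have "\<dots> \<longleftrightarrow> 0 \<le> mu2 n" using \<gamma> by (simp add: mu2_def power_mult_distrib zero_le_divide_iff)
  also have "\<dots> \<longleftrightarrow> 0 < mu2 n" using mu2_nonzero[of n] by auto
  finally show ?thesis .
qed

text \<open>The denominator \<gamma> is taken under the root, where \<open>k\<^sup>2\<close> -
  \<open>(ky n)\<^sup>2\<close> \<gamma> is \<open>mu2 n\<close> times
  \<open>\<gamma>\<^sup>2\<close>.\<close>

lemma beta_mu: "beta d M k sg n = - of_real kap + of_real sg * mu n"
proof -
  have g: "\<gamma> \<noteq> 0" "0 \<le> \<gamma>" using \<gamma> by auto
  have e: "(real n)\<^sup>2 * pi\<^sup>2 / d\<^sup>2 * (1 - M\<^sup>2) - k\<^sup>2 = - mu2 n * \<gamma>\<^sup>2" using mu2_sq[of n] by simp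
  have s: "sqrt (mu2 n * \<gamma>\<^sup>2) = mm n * \<gamma>" if "mu2 n > 0" using that g by (simp add: mm_def real_sqrt_mult)
  have s': "sqrt (- (mu2 n * \<gamma>\<^sup>2)) = mm n * \<gamma>" if "\<not> mu2 n > 0"
  proof -
    have "- (mu2 n * \<gamma>\<^sup>2) = (mm n * \<gamma>)\<^sup>2" using that by (simp add: power_mult_distrib mm_square)
    then show ?thesis using mm_pos[of n] g by simp
  qed
  show ?thesis
    unfolding beta_def propagating_iff mu2_sq e unfolding \<gamma>_def[symmetric] kap_def mu_def
    using g by (auto simp: s s' add_divide_distrib diff_divide_distrib)
qed

definition edge :: "real \<Rightarrow> real" where "edge sg = (if sg = 1 then xp else xm)"

text \<open>The factor that mode n collects on a round trip through the layer, measured in the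
  complex coordinate with derivative 1 / \<alpha>.\<close>

definition reflection :: "real \<Rightarrow> (real \<Rightarrow> real) \<Rightarrow> real \<Rightarrow> real \<Rightarrow> nat \<Rightarrow> complex" where
  "reflection \<omega> \<sigma> L sg n = exp (\<i> * (2 * mu n) * integral {0..L} (\<lambda>s. 1 / pml_alpha \<omega> \<sigma> (edge sg + sg * s)))"

text \<open>One formula for both boundary conditions: e = 0 gives the exact one, the round-trip
  factors of the layer give the truncated one.\<close>

definition coeff :: "real \<Rightarrow> (nat \<Rightarrow> complex) \<Rightarrow> nat \<Rightarrow> complex" where
  "coeff sg e n = of_real sg * (\<i> * of_real kap) - \<i> * mu n * ((1 + e n) / (1 - e n))"

lemma coeff_DtN: "sg \<in> {1, -1} \<Longrightarrow> (\<lambda>n. - of_real sg * (\<i> * beta d M k sg n)) = coeff sg (\<lambda>n. 0)"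
  by (auto simp: beta_mu coeff_def fun_eq_iff algebra_simps)

lemma coeff_DtN_pml:
  assumes sg: "sg \<in> {1, -1}" and ne: "\<And>n. reflection \<omega> \<sigma> L sg n \<noteq> 1"
  shows "(\<lambda>n. - of_real sg * (\<i> * nu d M k \<omega> \<sigma> L sg (edge sg) n)) = coeff sg (reflection \<omega> \<sigma> L sg)"
proof
  fix n
  let ?E = "reflection \<omega> \<sigma> L sg n" and ?I = "integral {0..L} (\<lambda>s. 1 / pml_alpha \<omega> \<sigma> (edge sg + sg * s))"
  have \<delta>: "beta d M k 1 n - beta d M k (-1) n = 2 * mu n" by (simp add: beta_mu)
  have X: "- \<i> * (2 * mu n) * ?I = - (\<i> * (2 * mu n) * ?I)" by simp
  have R: "2 * mu n / (1 - exp (- (\<i> * (2 * mu n) * ?I))) = - (2 * mu n * ?E / (1 - ?E))"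
    by (rule reflection_algebra[OF reflection_def ne])
  have nz: "1 - ?E \<noteq> 0" using ne[of n] by simp
  have cd: "(1 + ?E) / (1 - ?E) = 1 + 2 * ?E / (1 - ?E)" using cayley_diff[OF nz] by (simp add: algebra_simps)
  have nu: "nu d M k \<omega> \<sigma> L sg (edge sg) n = - of_real kap + of_real sg * mu n + of_real sg * (2 * mu n * ?E / (1 - ?E))"
    unfolding nu_def Let_def \<delta> X R unfolding beta_mu by simp
  show "- of_real sg * (\<i> * nu d M k \<omega> \<sigma> L sg (edge sg) n) = coeff sg (reflection \<omega> \<sigma> L sg) n"
    unfolding nu coeff_def cd using sg by (auto simp: algebra_simps)
qed

definition Cm :: real where "Cm = (k + 1) / \<gamma>"

lemma Cm_pos: "Cm > 0" using k_pos \<gamma> by (simp add: Cm_def)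

text \<open>The wave numbers grow with order one, as \<open>admissible\<close> permits.\<close>

lemma mm_upper: "mm n \<le> Cm * wt n"
proof -
  have ky: "0 \<le> ky n" using ky_pos[of n] kxy_0 by (cases "n = 0") auto
  have "\<bar>k\<^sup>2 - (ky n)\<^sup>2 * \<gamma>\<bar> \<le> k\<^sup>2 + (ky n)\<^sup>2 * \<gamma>" using \<gamma> by (simp add: abs_if)
  also have "\<dots> \<le> k\<^sup>2 + (ky n)\<^sup>2" using \<gamma> by (simp add: mult_left_le)
  also have "\<dots> \<le> (k + ky n)\<^sup>2" using k_pos ky by (simp add: power2_sum)
  also have "\<dots> \<le> ((k + 1) * wt n)\<^sup>2" using k_pos ky by (intro power_mono) (auto simp: wt_def algebra_simps)
  finally have "\<bar>mu2 n\<bar> \<le> ((k + 1) * wt n)\<^sup>2 / \<gamma>\<^sup>2" by (simp add: mu2_def divide_right_mono)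
  then have "\<bar>mu2 n\<bar> \<le> (Cm * wt n)\<^sup>2" by (simp add: Cm_def power_mult_distrib power_divide)
  moreover have "0 \<le> Cm * wt n" using Cm_pos wt_pos[of n] by simp
  ultimately show ?thesis unfolding mm_def by (rule real_le_lsqrt[rotated])
qed

lemma mm_lower: "\<exists>e>0. \<forall>n. e \<le> mm n"
proof -
  obtain e where e: "e > 0" "\<And>n. e * (1 + (ky n)\<^sup>2) \<le> \<bar>mu2 n\<bar>" using mu2_lower by blast
  have "sqrt e \<le> mm n" for n
  proof -
    have "e * 1 \<le> e * (1 + (ky n)\<^sup>2)" using e(1) by (intro mult_left_mono) auto
    then show ?thesis unfolding mm_def using e(2)[of n] by (intro real_sqrt_le_mono) simp
  qed
  then show ?thesis using e(1) by (intro exI[of _ "sqrt e"]) auto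
qed

lemma cmod_mu: "cmod (mu n) = mm n"
  using mm_pos[of n] by (simp add: mu_def norm_mult)

lemma wt_ge_1: "1 \<le> wt n"
  using ky_pos[of n] kxy_0 by (cases "n = 0") (auto simp: wt_def)

definition coeff_bound :: "real \<Rightarrow> real" where "coeff_bound r = kap + Cm * ((1 + r) / (1 - r))"

lemma coeff_good:
  assumes r: "0 \<le> r" "r < 1" and e: "\<And>n. cmod (e1 n) \<le> r" "\<And>n. cmod (e2 n) \<le> r"
  shows "good r (coeff_bound r) (coeff 1 e1) (coeff (-1) e2)"
proof -
  have R: "0 \<le> (1 + r) / (1 - r)" using r by simp
  have b: "cmod (coeff sg e n) \<le> coeff_bound r * wt n" if "cmod (e n) \<le> r" "\<bar>sg\<bar> = 1" for sg e n
  proof -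
    have "cmod (\<i> * mu n * ((1 + e n) / (1 - e n))) = mm n * cmod ((1 + e n) / (1 - e n))"
      unfolding norm_mult cmod_mu by simp
    also have "\<dots> \<le> Cm * wt n * ((1 + r) / (1 - r))"
      using mm_pos[of n] mm_upper[of n] by (intro mult_mono cayley_bounds(2)[OF that(1) r(2)]) auto
    finally have 1: "cmod (\<i> * mu n * ((1 + e n) / (1 - e n))) \<le> Cm * ((1 + r) / (1 - r)) * wt n" by (simp only: mult_ac)
    have "cmod (of_real sg * (\<i> * of_real kap)) = kap" using that(2) kap_nonneg by (simp add: norm_mult)
    also have "\<dots> \<le> kap * wt n" using kap_nonneg wt_ge_1[of n] by (simp add: mult_le_cancel_left1)
    finally show ?thesis unfolding coeff_def coeff_bound_def distrib_right
      using 1 norm_triangle_ineq4[of "of_real sg * (\<i> * of_real kap)" "\<i> * mu n * ((1 + e n) / (1 - e n))"] by linarith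
  qed
  have "0 \<le> coeff_bound r" unfolding coeff_bound_def using kap_nonneg Cm_pos R by (intro add_nonneg_nonneg mult_nonneg_nonneg) auto
  moreover have "coeff 1 e1 n - \<i> * of_real kap = - \<i> * mu n * ((1 + e1 n) / (1 - e1 n))"
    "coeff (-1) e2 n + \<i> * of_real kap = - \<i> * mu n * ((1 + e2 n) / (1 - e2 n))" for n
    by (simp_all add: coeff_def)
  ultimately show ?thesis unfolding good_def admissible_def
    using b[OF e(1), of 1] b[OF e(2), of "-1"] e by (intro conjI allI exI) simp_all
qed

text \<open>The Cayley transforms of E and of 0 differ by 2 E / (1 - E); multiplied by
  \<open>mu n\<close> this is a sequence of order one times the size x of the reflection.\<close>

lemma coeff_diff_admissible:
  assumes r: "r < 1" and e: "\<And>n. cmod (e n) \<le> r" "\<And>n. cmod (e n) \<le> x"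
  shows "admissible (\<lambda>n. coeff sg e n - coeff sg (\<lambda>n. 0) n) (2 * Cm / (1 - r) * x)"
proof -
  have x: "0 \<le> x" using e(2)[of 0] norm_ge_zero order_trans by blast
  have "cmod (coeff sg e n - coeff sg (\<lambda>n. 0) n) \<le> 2 * Cm / (1 - r) * x * wt n" for n
  proof -
    have nz: "1 - e n \<noteq> 0" by (rule cayley_bounds(3)[OF e(1) r])
    have "coeff sg e n - coeff sg (\<lambda>n. 0) n = - (\<i> * mu n * ((1 + e n) / (1 - e n) - 1))" by (simp add: coeff_def algebra_simps)
    then have "cmod (coeff sg e n - coeff sg (\<lambda>n. 0) n) = mm n * (2 * cmod (e n) / cmod (1 - e n))"
      unfolding cayley_diff[OF nz] norm_minus_cancel norm_mult[of "\<i> * mu n"] by (simp add: norm_mult norm_divide cmod_mu)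
    also have "\<dots> \<le> (Cm * wt n) * (2 * x / (1 - r))"
    proof (intro mult_mono frac_le mm_upper)
      show "1 - r \<le> cmod (1 - e n)" using e(1)[of n] norm_triangle_ineq2[of 1 "e n"] by simp
    qed (use r e(2)[of n] x Cm_pos wt_pos[of n] in auto)
    also have "\<dots> = 2 * Cm / (1 - r) * x * wt n" by simp
    finally show ?thesis .
  qed
  moreover have "0 \<le> 2 * Cm / (1 - r) * x" using r Cm_pos x by simp
  ultimately show ?thesis by (simp add: admissible_def)
qed

text \<open>1 / \<alpha> = 1 + \<i> \<sigma> / \<omega>, so thickness and absorption become the real
  and the imaginary part. \<open>max L 0\<close> accounts for {0..L} being empty when L is
  negative.\<close>

lemma pml_integral:
  assumes \<omega>: "\<omega> > 0" and \<sigma>: "continuous_on UNIV \<sigma>"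
  shows "integral {0..L} (\<lambda>s. 1 / pml_alpha \<omega> \<sigma> (x0 + sg * s)) = of_real (max L 0) + \<i> * of_real (integral {0..L} (\<lambda>s. \<sigma> (x0 + sg * s)) / \<omega>)"
proof -
  have c: "continuous_on S (\<lambda>s. \<sigma> (x0 + sg * s))" for S
    by (rule continuous_on_compose2[OF \<sigma>]) (auto intro!: continuous_intros)
  have e: "1 / pml_alpha \<omega> \<sigma> x = of_real 1 + \<i> * (of_real (\<sigma> x / \<omega>))" for x
  proof -
    have nz: "- \<i> * complex_of_real \<omega> \<noteq> 0" using \<omega> by simp
    have "1 / pml_alpha \<omega> \<sigma> x = (- \<i> * of_real \<omega> + of_real (\<sigma> x)) / (- \<i> * of_real \<omega>)"
      unfolding pml_alpha_def by (simp only: divide_divide_eq_right mult_1_left)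
    also have "\<dots> = of_real 1 + \<i> * (of_real (\<sigma> x / \<omega>))"
      unfolding nonzero_divide_eq_eq[OF nz] using \<omega> by (simp add: distrib_right mult.left_commute[of \<i>])
    finally show ?thesis .
  qed
  have "((\<lambda>s. of_real 1 + \<i> * complex_of_real (\<sigma> (x0 + sg * s) / \<omega>)) has_integral of_real (max L 0) + \<i> * of_real (integral {0..L} (\<lambda>s. \<sigma> (x0 + sg * s)) / \<omega>)) {0..L}"
  proof (intro has_integral_add has_integral_mult_right has_integral_of_real)
    show "((\<lambda>s. 1) has_integral max L 0) {0..L}" using has_integral_const_real[of "1::real" 0 L] by (auto simp: max_def split: if_splits)
    show "((\<lambda>s. \<sigma> (x0 + sg * s) / \<omega>) has_integral integral {0..L} (\<lambda>s. \<sigma> (x0 + sg * s)) / \<omega>) {0..L}"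
      by (intro has_integral_divide integrable_integral integrable_continuous_interval c)
  qed
  then show ?thesis unfolding e by (rule integral_unique)
qed

text \<open>For real \<open>mu n\<close> the modulus of the round-trip factor sees only the
  absorption integral, for imaginary \<open>mu n\<close> only the thickness; T lies below
  both.\<close>

lemma reflection_cmod:
  assumes \<omega>: "\<omega> > 0" and \<sigma>: "continuous_on UNIV \<sigma>" and L: "0 \<le> L"
    and e: "\<And>n. e \<le> mm n" "0 < e" and T: "0 \<le> T" "T \<le> L" "T \<le> integral {0..L} (\<lambda>s. \<sigma> (edge sg + sg * s)) / \<omega>"
  shows "cmod (reflection \<omega> \<sigma> L sg n) \<le> exp (- (2 * e) * T)"
proof -
  let ?S = "integral {0..L} (\<lambda>s. \<sigma> (edge sg + sg * s)) / \<omega>"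
  have "cmod (reflection \<omega> \<sigma> L sg n) = exp (- (2 * mm n * (if mu2 n > 0 then ?S else L)))"
    unfolding reflection_def pml_integral[OF \<omega> \<sigma>] norm_exp_eq_Re mu_def using L by (simp add: max_def)
  also have "\<dots> \<le> exp (- (2 * e) * T)"
  proof -
    have "2 * e * T \<le> 2 * mm n * (if mu2 n > 0 then ?S else L)"
      using e(1)[of n] e(2) T by (intro mult_mono) auto
    then show ?thesis by simp
  qed
  finally show ?thesis .
qed

section \<open>The isomorphism and the error estimate\<close>

lemma antidual_bounded_antilinear:
  "l \<in> antidual (H1 \<Omega>) (H1_norm \<Omega>) \<Longrightarrow> H1.bounded_antilinear l"
  by (simp add: antidual_def H1.bounded_antilinear_def)

text \<open>Stability bounds the inverse and solvability gives surjectivity; extensionality turns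
  equality on H^1 into equality of functionals.\<close>

lemma F_isomorphism:
  assumes r: "0 \<le> r" "r < 1" and g: "good r \<kappa> c1 c2"
    and A: "\<And>p q. p \<in> H1 \<Omega> \<Longrightarrow> q \<in> H1 \<Omega> \<Longrightarrow> A p q = F c1 c2 p q"
    and ext: "\<And>p. p \<in> H1 \<Omega> \<Longrightarrow> A p \<in> extensional (H1 \<Omega>)"
  shows "isomorphism_onto_dual (H1 \<Omega>) (H1_norm \<Omega>) A"
proof -
  have a: "admissible c1 \<kappa>" "admissible c2 \<kappa>" using g by (auto simp: good_def)
  have b: "cmod (A p q) \<le> FB \<kappa> * H1_norm \<Omega> p * H1_norm \<Omega> q" if "p \<in> H1 \<Omega>" "q \<in> H1 \<Omega>" for p q
    using F_bound[OF a that] A[OF that] by simp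
  have FB: "0 \<le> FB \<kappa>" using a(1) Kt_pos k_pos M by (simp add: FB_def admissible_def)
  have z: "H1_norm \<Omega> (\<lambda>x. 0) = 0" using H1.nrm_scale[OF H1.zero_mem, of 0] by simp
  have scale: "(\<lambda>x. c * q x) \<in> H1 \<Omega> \<and> cmod (A p (\<lambda>x. c * q x)) = cmod c * cmod (A p q) \<and> H1_norm \<Omega> (\<lambda>x. c * q x) \<le> cmod c * H1_norm \<Omega> q"
    if "p \<in> H1 \<Omega>" "q \<in> H1 \<Omega>" for p q c
    using that by (simp add: A H1.scale_mem F_linear(4)[OF a that(2) that(2) that(1)] norm_mult H1.nrm_scale)
  have up: "cmod (A p q) \<le> dual_norm (H1 \<Omega>) (H1_norm \<Omega>) (A p) * H1_norm \<Omega> q" if "p \<in> H1 \<Omega>" "q \<in> H1 \<Omega>" for p q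
    by (rule dual_norm_ge[OF b[OF that(1)] scale[OF that(1)] H1_norm_nonneg that(2)])
  have pos: "0 \<le> dual_norm (H1 \<Omega>) (H1_norm \<Omega>) (A p)" if p: "p \<in> H1 \<Omega>" for p
  proof -
    have "bdd_above ((\<lambda>q. cmod (A p q)) ` {q \<in> H1 \<Omega>. H1_norm \<Omega> q \<le> 1})"
    proof (rule bdd_aboveI2)
      fix q assume q: "q \<in> {q \<in> H1 \<Omega>. H1_norm \<Omega> q \<le> 1}"
      then have "FB \<kappa> * H1_norm \<Omega> p * H1_norm \<Omega> q \<le> FB \<kappa> * H1_norm \<Omega> p" using FB H1_norm_nonneg by (intro mult_left_le) auto
      then show "cmod (A p q) \<le> FB \<kappa> * H1_norm \<Omega> p" using b[OF p, of q] q by auto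
    qed
    then have "cmod (A p (\<lambda>x. 0)) \<le> dual_norm (H1 \<Omega>) (H1_norm \<Omega>) (A p)"
      unfolding dual_norm_def by (rule cSUP_upper[rotated]) (simp add: z H1.zero_mem)
    then show ?thesis using norm_ge_zero order_trans by blast
  qed
  obtain C where C: "C \<ge> 0" "\<And>p D. p \<in> H1 \<Omega> \<Longrightarrow> D \<ge> 0 \<Longrightarrow> (\<forall>q\<in>H1 \<Omega>. cmod (F c1 c2 p q) \<le> D * H1_norm \<Omega> q) \<Longrightarrow> H1_norm \<Omega> p \<le> C * D"
    using stability[OF r] g by blast
  show ?thesis unfolding isomorphism_onto_dual_def
  proof (intro conjI ballI allI)
    fix p assume p: "p \<in> H1 \<Omega>"
    show "A p \<in> antidual (H1 \<Omega>) (H1_norm \<Omega>)"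
      unfolding antidual_def
    proof (intro CollectI conjI ballI allI ext[OF p] exI[of _ "FB \<kappa> * H1_norm \<Omega> p"])
      fix q q' assume "q \<in> H1 \<Omega>" "q' \<in> H1 \<Omega>"
      then show "A p (\<lambda>x. q x + q' x) = A p q + A p q'" using F_linear(3)[OF a _ _ p] by (simp add: A p H1.add_mem)
    next
      fix c q assume "q \<in> H1 \<Omega>"
      then show "A p (\<lambda>x. c * q x) = cnj c * A p q" using F_linear(4)[OF a _ _ p] by (simp add: A p H1.scale_mem)
    qed (rule b[OF p])
    { fix p' q assume "p' \<in> H1 \<Omega>" "q \<in> H1 \<Omega>"
      then show "A (\<lambda>x. p x + p' x) q = A p q + A p' q" using F_linear(1)[OF a p] by (simp add: A p H1.add_mem) }
    { fix c q assume "q \<in> H1 \<Omega>"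
      then show "A (\<lambda>x. c * p x) q = c * A p q" using F_linear(2)[OF a p p] by (simp add: A p H1.scale_mem) }
  next
    have "dual_norm (H1 \<Omega>) (H1_norm \<Omega>) (A p) \<le> FB \<kappa> * H1_norm \<Omega> p" if p: "p \<in> H1 \<Omega>" for p
      by (rule dual_norm_le[OF H1.zero_mem _ b[OF p]]) (use z FB H1_norm_nonneg in auto)
    then show "\<exists>C. \<forall>p\<in>H1 \<Omega>. dual_norm (H1 \<Omega>) (H1_norm \<Omega>) (A p) \<le> C * H1_norm \<Omega> p" by blast
  next
    fix l assume l: "l \<in> antidual (H1 \<Omega>) (H1_norm \<Omega>)"
    obtain p where p: "p \<in> H1 \<Omega>" "\<And>q. q \<in> H1 \<Omega> \<Longrightarrow> F c1 c2 p q = l q"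
      using solvability[OF r g antidual_bounded_antilinear[OF l]] by blast
    have "A p = l"
      by (rule extensionalityI[OF ext[OF p(1)]]) (use l p in \<open>auto simp: antidual_def A\<close>)
    then show "\<exists>p\<in>H1 \<Omega>. A p = l" using p(1) by blast
  next
    have "H1_norm \<Omega> p \<le> C * dual_norm (H1 \<Omega>) (H1_norm \<Omega>) (A p)" if p: "p \<in> H1 \<Omega>" for p
      by (rule C(2)[OF p pos[OF p]]) (use up[OF p] A[OF p] in auto)
    then show "\<exists>C. \<forall>p\<in>H1 \<Omega>. H1_norm \<Omega> p \<le> C * dual_norm (H1 \<Omega>) (H1_norm \<Omega>) (A p)" by blast
  qed
qed

lemma bform_diff:
  assumes "admissible c \<kappa>" "admissible c' \<kappa>'" "s \<in> {xm, xp}" "p \<in> H1 \<Omega>" "q \<in> H1 \<Omega>"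
  shows "bform c s p q - bform c' s p q = bform (\<lambda>n. c n - c' n) s p q"
  using suminf_diff[OF bform_summable[OF assms(1,3-5)] bform_summable[OF assms(2,3-5)]] by (simp add: bform_def left_diff_distrib)

text \<open>The volume terms of the two forms coincide, so only boundary forms with the difference
  of the coefficients remain.\<close>

lemma F_diff_bound:
  assumes c: "admissible c1 \<kappa>" "admissible c2 \<kappa>" "admissible c1' \<kappa>'" "admissible c2' \<kappa>'"
    and d: "admissible (\<lambda>n. c1 n - c1' n) x1" "admissible (\<lambda>n. c2 n - c2' n) x2"
    and p: "p \<in> H1 \<Omega>" and q: "q \<in> H1 \<Omega>"
  shows "cmod (F c1 c2 p q - F c1' c2' p q) \<le> Kt * (x1 + x2) * H1_norm \<Omega> p * H1_norm \<Omega> q"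
proof -
  let ?d = "bform (\<lambda>n. c1 n - c1' n) xp p q + bform (\<lambda>n. c2 n - c2' n) xm p q"
  have "F c1 c2 p q - F c1' c2' p q = of_real \<gamma> * ?d"
    using bform_diff[OF c(1,3) _ p q, of xp] bform_diff[OF c(2,4) _ p q, of xm] by (simp add: F_def algebra_simps)
  then have "cmod (F c1 c2 p q - F c1' c2' p q) = \<gamma> * cmod ?d" using \<gamma> by (simp add: norm_mult)
  also have "\<dots> \<le> 1 * cmod ?d" using \<gamma> by (intro mult_right_mono) auto
  also have "\<dots> \<le> x1 * Kt * H1_norm \<Omega> p * H1_norm \<Omega> q + x2 * Kt * H1_norm \<Omega> p * H1_norm \<Omega> q"
    using norm_triangle_ineq[of "bform (\<lambda>n. c1 n - c1' n) xp p q" "bform (\<lambda>n. c2 n - c2' n) xm p q"]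
      bform_bound[OF d(1) _ p q, of xp] bform_bound[OF d(2) _ p q, of xm] by simp
  finally show ?thesis by (simp add: algebra_simps)
qed

lemma a_form_F:
  assumes "p \<in> H1 \<Omega>" "q \<in> H1 \<Omega>"
  shows "a_form d M k xm xp p q = F (coeff 1 (\<lambda>n. 0)) (coeff (-1) (\<lambda>n. 0)) p q"
proof -
  have "good 0 (coeff_bound 0) (coeff 1 (\<lambda>n. 0)) (coeff (-1) (\<lambda>n. 0))" by (rule coeff_good) auto
  then have a: "admissible (coeff 1 (\<lambda>n. 0)) (coeff_bound 0)" "admissible (coeff (-1) (\<lambda>n. 0)) (coeff_bound 0)" by (auto simp: good_def)
  show ?thesis
    using waveguide_form_F[OF a assms] coeff_DtN[of 1] coeff_DtN[of "-1"]
    by (simp add: a_form_def DtN_def Let_def)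
qed

lemma aL_form_F:
  assumes r: "0 \<le> r" "r < 1" and E: "\<And>n. cmod (reflection \<omega> \<sigma> L 1 n) \<le> r" "\<And>n. cmod (reflection \<omega> \<sigma> L (-1) n) \<le> r"
    and pq: "p \<in> H1 \<Omega>" "q \<in> H1 \<Omega>"
  shows "aL_form d M k xm xp \<omega> \<sigma> L p q = F (coeff 1 (reflection \<omega> \<sigma> L 1)) (coeff (-1) (reflection \<omega> \<sigma> L (-1))) p q"
proof -
  have ne: "reflection \<omega> \<sigma> L 1 n \<noteq> 1" "reflection \<omega> \<sigma> L (-1) n \<noteq> 1" for n using E[of n] r by auto
  note a = coeff_good[OF r E, unfolded good_def]
  show ?thesis
    using waveguide_form_F[OF a[THEN conjunct1] a[THEN conjunct2, THEN conjunct1] pq] coeff_DtN_pml[of 1, OF _ ne(1)] coeff_DtN_pml[of "-1", OF _ ne(2)]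
    by (simp add: aL_form_def DtN_pml_def Let_def edge_def)
qed

text \<open>At distance 1 from the computational domain \<sigma> is positive, so a layer of
  thickness 1 already absorbs, and a thicker one absorbs no less.\<close>

lemma reflection_decay:
  assumes \<omega>: "\<omega> > 0" and \<sigma>: "continuous_on UNIV \<sigma>" "\<And>x. x \<in> {xm..xp} \<Longrightarrow> \<sigma> x = 0" "\<And>x. x \<notin> {xm..xp} \<Longrightarrow> \<sigma> x > 0"
    and e: "\<And>n. e \<le> mm n" "0 < e" and sg: "sg \<in> {1, -1}"
  defines "T \<equiv> \<lambda>L. integral {0..L} (\<lambda>s. sigma_tilde \<omega> \<sigma> (edge sg + sg * s))"
  shows "0 < T 1" "1 \<le> L \<Longrightarrow> T 1 \<le> T L" "1 \<le> L \<Longrightarrow> cmod (reflection \<omega> \<sigma> L sg n) \<le> exp (- (2 * e) * T L)"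
proof -
  let ?h = "\<lambda>s. \<sigma> (edge sg + sg * s)"
  have c: "continuous_on UNIV ?h"
    by (rule continuous_on_compose2[OF \<sigma>(1)]) (auto intro!: continuous_intros)
  have \<sigma>0: "0 \<le> \<sigma> x" for x using \<sigma>(2,3)[of x] by (cases "x \<in> {xm..xp}") auto
  have h1: "0 < ?h 1" using sg xm_less_xp by (intro \<sigma>(3)) (auto simp: edge_def)
  have T: "T = (\<lambda>L. integral {0..L} (\<lambda>s. min 1 (?h s / \<omega>)))" by (simp add: T_def sigma_tilde_def)
  note I = truncated_integral[OF c \<sigma>0 \<omega>]
  show 1: "0 < T 1" "1 \<le> L \<Longrightarrow> T 1 \<le> T L" unfolding T using I(4)[OF h1] I(3) by auto
  show "cmod (reflection \<omega> \<sigma> L sg n) \<le> exp (- (2 * e) * T L)" if L: "1 \<le> L"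
  proof (rule reflection_cmod[OF \<omega> \<sigma>(1) _ e])
    show "0 \<le> T L" using 1 L by linarith
    show "T L \<le> L" "T L \<le> integral {0..L} ?h / \<omega>" unfolding T using I(1)[of L] I(2)[of L] L by auto
  qed (use L in simp)
qed

end

theorem theorem3p6:
  fixes d M k \<omega> xm xp :: real and \<sigma> :: "real \<Rightarrow> real"
  assumes "d > 0" and "0 \<le> M" and "M < 1" and "k > 0" and "\<omega> > 0" and "xm < xp"
    and "\<sigma> C1_differentiable_on UNIV"
    and "\<And>x. x \<in> {xm..xp} \<Longrightarrow> \<sigma> x = 0"
    and "\<And>x. x \<notin> {xm..xp} \<Longrightarrow> \<sigma> x > 0"
    and "\<And>n :: nat. k \<noteq> sqrt (1 - M\<^sup>2) * (real n * pi / d)"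
  shows "\<exists>Lt > 0.
    (\<forall>L \<ge> Lt. isomorphism_onto_dual (H1 (Omega_b d xm xp)) (H1_norm (Omega_b d xm xp))
                 (AL_operator d M k xm xp \<omega> \<sigma> L)) \<and>
    (\<exists>C1 > 0. \<exists>C2 > 0. \<forall>L \<ge> Lt.
       \<forall>(f :: real \<times> real \<Rightarrow> complex) (P :: 'w measure) W \<T>.
         f \<in> L2 (Omega d) \<and> compact (ess_support (Omega d) f) \<and>
         ess_support (Omega d) f \<subseteq> Omega_b d xm xp \<and>
         mesh_of (ess_support (Omega d) f) \<T> \<and> white_noise P (Omega d) W \<longrightarrow>
         (\<forall>w \<in> space P. \<forall>ph pL.
            weak_solution (Omega_b d xm xp) (a_form d M k xm xp)
              (\<lambda>x. f x + discretized_noise W \<T> w x) ph \<and>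
            weak_solution (Omega_b d xm xp) (aL_form d M k xm xp \<omega> \<sigma> L)
              (\<lambda>x. f x + discretized_noise W \<T> w x) pL \<longrightarrow>
            H1_norm (Omega_b d xm xp) (\<lambda>x. ph x - pL x)
              \<le> C1 * (exp (- C2 * integral {0..L} (\<lambda>s. sigma_tilde \<omega> \<sigma> (xp + s)))
                     + exp (- C2 * integral {0..L} (\<lambda>s. sigma_tilde \<omega> \<sigma> (xm - s))))
                * H1_norm (Omega_b d xm xp) ph))"
proof -
  interpret flow d xm xp M k
    using assms by unfold_locales auto
  interpret H1: complete_semi_inner_space "H1 \<Omega>" H1_inner
    rewrites "semi_inner_space.nrm H1_inner = H1_norm \<Omega>"
    by (rule complete_H1 nrm_H1)+
  have \<sigma>c: "continuous_on UNIV \<sigma>" by (rule C1_differentiable_imp_continuous_on[OF assms(7)])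
  \<comment> \<open>e bounds the moduli of all \<open>mu n\<close> from below; the round trip
    doubles it, so the exponent in the end is 2 e.\<close>
  obtain e where e: "0 < e" "\<And>n. e \<le> mm n" using mm_lower by blast
  define T where "T = (\<lambda>sg L. integral {0..L} (\<lambda>s. sigma_tilde \<omega> \<sigma> (edge sg + sg * s)))"
  have decay: "0 < T sg 1" "1 \<le> L \<Longrightarrow> T sg 1 \<le> T sg L" "1 \<le> L \<Longrightarrow> cmod (reflection \<omega> \<sigma> L sg n) \<le> exp (- (2 * e) * T sg L)"
    if "sg \<in> {1, -1}" for sg L n
    unfolding T_def using reflection_decay[OF assms(5) \<sigma>c assms(8,9) e(2,1) that] by blast+
  have T: "T 1 L = integral {0..L} (\<lambda>s. sigma_tilde \<omega> \<sigma> (xp + s))" "T (-1) L = integral {0..L} (\<lambda>s. sigma_tilde \<omega> \<sigma> (xm - s))" for L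
    by (simp_all add: T_def edge_def)
  define x where "x = (\<lambda>sg L. exp (- (2 * e) * T sg L))"
  \<comment> \<open>The worse of the two reflection bounds at thickness 1; by monotonicity it holds
    for all L \<ge> 1, which makes 1 the threshold.\<close>
  define r where "r = max (x 1 1) (x (-1) 1)"
  have r: "0 \<le> r" "r < 1" using mult_pos_pos[OF e(1) decay(1)[of 1]] mult_pos_pos[OF e(1) decay(1)[of "-1"]]
    by (simp_all add: r_def x_def le_max_iff_disj)
  define cL where "cL = (\<lambda>sg L. coeff sg (reflection \<omega> \<sigma> L sg))"
  define c where "c = (\<lambda>sg. coeff sg (\<lambda>n. 0))"
  have rx: "cmod (reflection \<omega> \<sigma> L sg n) \<le> x sg L" if "1 \<le> L" "sg \<in> {1, -1}" for L sg n
    unfolding x_def using decay(3) that by blast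
  have xr: "x sg L \<le> r" if "1 \<le> L" "sg \<in> {1, -1}" for L sg
  proof -
    have "x sg L \<le> x sg 1" unfolding x_def using decay(2)[OF that(2,1)] e(1) by simp
    then show ?thesis using that(2) by (auto simp: r_def)
  qed
  have rr: "cmod (reflection \<omega> \<sigma> L 1 n) \<le> r" "cmod (reflection \<omega> \<sigma> L (-1) n) \<le> r" if "1 \<le> L" for L n
    using rx[OF that, of 1 n] xr[OF that, of 1] rx[OF that, of "-1" n] xr[OF that, of "-1"] by auto
  have gL: "good r (coeff_bound r) (cL 1 L) (cL (-1) L)" if "1 \<le> L" for L
    unfolding cL_def by (intro coeff_good r rr that)
  have g: "good r (coeff_bound r) (c 1) (c (-1))"
    unfolding c_def by (intro coeff_good r) (simp_all add: r)
  have aL: "aL_form d M k xm xp \<omega> \<sigma> L p q = F (cL 1 L) (cL (-1) L) p q" if "1 \<le> L" "p \<in> H1 \<Omega>" "q \<in> H1 \<Omega>" for L p q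
    unfolding cL_def by (rule aL_form_F[OF r rr[OF that(1)] that(2,3)])
  \<comment> \<open>Stability is used for this one r, so C is fixed before L.\<close>
  obtain C where C: "C \<ge> 0" "\<And>L p D. 1 \<le> L \<Longrightarrow> p \<in> H1 \<Omega> \<Longrightarrow> D \<ge> 0 \<Longrightarrow>
      (\<forall>q\<in>H1 \<Omega>. cmod (F (cL 1 L) (cL (-1) L) p q) \<le> D * H1_norm \<Omega> q) \<Longrightarrow> H1_norm \<Omega> p \<le> C * D"
    using stability[OF r] gL by blast
  \<comment> \<open>The trace constant times the factor by which reflections enter the difference of
    the boundary coefficients.\<close>
  define B where "B = Kt * (2 * Cm / (1 - r))"
  have B: "0 \<le> B" using Kt_pos Cm_pos r by (simp add: B_def)
  \<comment> \<open>Only C * B \<ge> 0 is known, so 1 is added to obtain a positive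
    constant.\<close>
  have error: "H1_norm \<Omega> (\<lambda>z. ph z - pL z) \<le> (C * B + 1) * (x 1 L + x (-1) L) * H1_norm \<Omega> ph"
    if L: "1 \<le> L" and h: "weak_solution \<Omega> (a_form d M k xm xp) G ph" "weak_solution \<Omega> (aL_form d M k xm xp \<omega> \<sigma> L) G pL" for L G ph pL
  proof -
    have m: "ph \<in> H1 \<Omega>" "pL \<in> H1 \<Omega>" using h by (auto simp: weak_solution_def)
    have ad: "admissible (cL 1 L) (coeff_bound r)" "admissible (cL (-1) L) (coeff_bound r)" "admissible (c 1) (coeff_bound r)" "admissible (c (-1)) (coeff_bound r)"
      using gL[OF L] g by (auto simp: good_def)
    have dif: "admissible (\<lambda>n. cL sg L n - c sg n) (2 * Cm / (1 - r) * x sg L)" if "sg \<in> {1, -1}" for sg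
      unfolding cL_def c_def by (rule coeff_diff_admissible[OF r(2)]) (use rx[OF L that] xr[OF L that] in \<open>auto intro: order_trans\<close>)
    have bound: "cmod (F (cL 1 L) (cL (-1) L) (\<lambda>z. ph z - pL z) q) \<le> (B * (x 1 L + x (-1) L) * H1_norm \<Omega> ph) * H1_norm \<Omega> q" if q: "q \<in> H1 \<Omega>" for q
    proof -
      \<comment> \<open>Both solutions have the same data, so the exact form at \<open>ph\<close>
        replaces the truncated one at \<open>pL\<close>; the residual of the error is thus the
        difference of the two forms at \<open>ph\<close>.\<close>
      have "F (cL 1 L) (cL (-1) L) pL q = F (c 1) (c (-1)) ph q"
        using h q aL[OF L m(2) q] a_form_F[OF m(1) q] by (simp add: weak_solution_def c_def)
      then have "F (cL 1 L) (cL (-1) L) (\<lambda>z. ph z - pL z) q = F (cL 1 L) (cL (-1) L) ph q - F (c 1) (c (-1)) ph q"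
        using F_linear(1)[OF ad(1,2) m(1) H1.scale_mem[OF m(2), of "-1"] q] F_linear(2)[OF ad(1,2) m(2) m(2) q, of "-1"] by simp
      then show ?thesis using F_diff_bound[OF ad dif[of 1] dif[of "-1"] m(1) q] by (simp add: B_def distrib_left mult.assoc)
    qed
    have x0: "0 \<le> (x 1 L + x (-1) L) * H1_norm \<Omega> ph" by (simp add: x_def H1_norm_nonneg add_nonneg_nonneg)
    have "H1_norm \<Omega> (\<lambda>z. ph z - pL z) \<le> C * (B * (x 1 L + x (-1) L) * H1_norm \<Omega> ph)"
      using bound B x0 by (intro C(2)[OF L H1.diff_mem[OF m]]) (auto simp: mult.assoc)
    also have "\<dots> \<le> (C * B + 1) * (x 1 L + x (-1) L) * H1_norm \<Omega> ph"
      using x0 by (simp add: algebra_simps)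
    finally show ?thesis .
  qed
  have iso: "isomorphism_onto_dual (H1 \<Omega>) (H1_norm \<Omega>) (AL_operator d M k xm xp \<omega> \<sigma> L)" if L: "1 \<le> L" for L
    by (rule F_isomorphism[OF r gL[OF L]]) (simp_all add: AL_operator_def aL[OF L])
  have pos: "0 < C * B + 1" "0 < 2 * e" using C(1) B e(1) by (auto intro: add_nonneg_pos)
  show ?thesis
  proof (rule exI[of _ 1], intro conjI)
    show "\<exists>C1>0. \<exists>C2>0. \<forall>L\<ge>1. \<forall>(f :: real \<times> real \<Rightarrow> complex) (P :: 'w measure) W \<T>.
         f \<in> L2 (Omega d) \<and> compact (ess_support (Omega d) f) \<and>
         ess_support (Omega d) f \<subseteq> Omega_b d xm xp \<and>
         mesh_of (ess_support (Omega d) f) \<T> \<and> white_noise P (Omega d) W \<longrightarrow>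
         (\<forall>w \<in> space P. \<forall>ph pL.
            weak_solution (Omega_b d xm xp) (a_form d M k xm xp)
              (\<lambda>x. f x + discretized_noise W \<T> w x) ph \<and>
            weak_solution (Omega_b d xm xp) (aL_form d M k xm xp \<omega> \<sigma> L)
              (\<lambda>x. f x + discretized_noise W \<T> w x) pL \<longrightarrow>
            H1_norm (Omega_b d xm xp) (\<lambda>x. ph x - pL x)
              \<le> C1 * (exp (- C2 * integral {0..L} (\<lambda>s. sigma_tilde \<omega> \<sigma> (xp + s)))
                     + exp (- C2 * integral {0..L} (\<lambda>s. sigma_tilde \<omega> \<sigma> (xm - s))))
                * H1_norm (Omega_b d xm xp) ph)"
      by (rule exI[of _ "C * B + 1"], rule conjI[OF pos(1)], rule exI[of _ "2 * e"], rule conjI[OF pos(2)])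
        (use error in \<open>auto simp only: x_def T\<close>)
  qed (use iso in auto)
qed

end
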